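(* Let $\Lambda$ be a finite dimensional algebra over an algebraically closed field $k$ and let $\bar\Lambda$ denote its duplicated algebra. Then there is an isomorphism of posets $$\mathrm{s}\tau\text{-}\mathrm{tilt}\,\Lambda\;\cong\;\mathrm{tilt}\,\bar\Lambda .$$
   Context: For a finite dimensional $k$-algebra $A$, $\mathrm{mod}\,A$ is the category of finite dimensional right $A$-modules, $|M|$ is the number of pairwise nonisomorphic indecomposable summands of $M$, and $\mathrm{Fac}\,M$ is the class of all quotients of finite direct sums of copies of $M$. A module is basic if its indecomposable summands are pairwise nonisomorphic. $\tau_A$ is the Auslander-Reiten translation and $D=\mathrm{Hom}_k(-,k)$. Duplicated algebra: $\bar\Lambda=\begin{bmatrix}\Lambda&0\\ D\Lambda&\Lambda\end{bmatrix}$ (triangular matrix algebra with the bimodule $D\Lambda$ in the lower left corner). Tilting: a basic $M\in\mathrm{mod}\,A$ is tilting if $\mathrm{Ext}^1_A(M,M)=0$, $\mathrm{pd}_A M\le 1$ and $|M|=|A|$. $\mathrm{tilt}\,A$ is the set of isomorphism classes of tilting $A$-modules, partially ordered by $M\le M'$ iff $\mathrm{Fac}\,M\subseteq\mathrm{Fac}\,M'$. Support $\tau$-tilting: a pair $(M,P)$ of basic modules with $M\in\mathrm{mod}\,A$ and $P$ projective is support $\tau$-tilting if $\mathrm{Hom}_A(M,\tau_A M)=0$, $\mathrm{Hom}_A(P,M)=0$ and $|M\oplus P|=|A|$. $\mathrm{s}\tau\text{-}\mathrm{tilt}\,A$ is the set of such pairs up to isomorphism (componentwise), partially ordered by $(M,P)\le(M',P')$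 iff $\mathrm{Fac}\,M\subseteq\mathrm{Fac}\,M'$. *)

theory Defs
  imports
    "HOL-Algebra.Algebraic_Closure"
    "HOL-Algebra.Elementary_Groups"
    "HOL-Algebra.Order"
    "HOL-Library.Extended_Nat"
    "Jordan_Normal_Form.Missing_VectorSpace"
begin

section \<open>Finite dimensional algebras and their modules\<close>

text \<open>A \<open>K\<close>-algebra is a record of type \<open>module\<close>: the ring fields hold its ring structure, and
  \<open>smult\<close> is the action of \<open>K\<close>. The zero algebra is allowed.\<close>

definition fd_algebra ::
  "('k, 'x) ring_scheme \<Rightarrow> ('k, 'a, 'y) module_scheme \<Rightarrow> bool" where
  "fd_algebra K A \<longleftrightarrow>
     vectorspace K A \<and> vectorspace.fin_dim K A \<and> ring A \<and>
     (\<forall>c\<in>carrier K. \<forall>x\<in>carrier A. \<forall>y\<in>carrier A.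
        (c \<odot>\<^bsub>A\<^esub> x) \<otimes>\<^bsub>A\<^esub> y = c \<odot>\<^bsub>A\<^esub> (x \<otimes>\<^bsub>A\<^esub> y) \<and>
        x \<otimes>\<^bsub>A\<^esub> (c \<odot>\<^bsub>A\<^esub> y) = c \<odot>\<^bsub>A\<^esub> (x \<otimes>\<^bsub>A\<^esub> y))"

text \<open>Modules over a noncommutative ring also use the record type \<open>module\<close>, whose fields
  \<open>mult\<close> and \<open>one\<close> are then irrelevant. For a right module \<open>M\<close> the term \<open>a \<odot>\<^bsub>M\<^esub> x\<close> stands for
  \<open>x \<cdot> a\<close>; for a left module it stands for \<open>a \<cdot> x\<close>. The library's \<open>module_hom\<close> does not refer to
  the multiplication of the ring, hence it describes homomorphisms of left and of right modules.\<close>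

locale right_module = A?: ring A + M?: abelian_group M
    for A :: "('a, 'y) ring_scheme" and M :: "('a, 'm, 'z) module_scheme" +
  assumes ract_closed: "\<lbrakk>a \<in> carrier A; x \<in> carrier M\<rbrakk> \<Longrightarrow> a \<odot>\<^bsub>M\<^esub> x \<in> carrier M"
    and ract_add_ring: "\<lbrakk>a \<in> carrier A; b \<in> carrier A; x \<in> carrier M\<rbrakk> \<Longrightarrow>
      (a \<oplus>\<^bsub>A\<^esub> b) \<odot>\<^bsub>M\<^esub> x = a \<odot>\<^bsub>M\<^esub> x \<oplus>\<^bsub>M\<^esub> b \<odot>\<^bsub>M\<^esub> x"
    and ract_add: "\<lbrakk>a \<in> carrier A; x \<in> carrier M; y \<in> carrier M\<rbrakk> \<Longrightarrow>
      a \<odot>\<^bsub>M\<^esub> (x \<oplus>\<^bsub>M\<^esub> y) = a \<odot>\<^bsub>M\<^esub> x \<oplus>\<^bsub>M\<^esub> a \<odot>\<^bsub>M\<^esub> y"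
    and ract_mult: "\<lbrakk>a \<in> carrier A; b \<in> carrier A; x \<in> carrier M\<rbrakk> \<Longrightarrow>
      (a \<otimes>\<^bsub>A\<^esub> b) \<odot>\<^bsub>M\<^esub> x = b \<odot>\<^bsub>M\<^esub> (a \<odot>\<^bsub>M\<^esub> x)"
    and ract_one: "x \<in> carrier M \<Longrightarrow> \<one>\<^bsub>A\<^esub> \<odot>\<^bsub>M\<^esub> x = x"

text \<open>The \<open>K\<close>-vector space underlying a left or right \<open>A\<close>-module: \<open>c\<close> acts as \<open>c \<cdot> 1\<^sub>A\<close>.\<close>

definition underlying_space ::
  "('k, 'a, 'y) module_scheme \<Rightarrow> ('a, 'm, 'z) module_scheme \<Rightarrow> ('k, 'm) module" where
  "underlying_space A M =
     \<lparr>carrier = carrier M, monoid.mult = monoid.mult M, one = one M, zero = zero M, add = add M,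
      smult = (\<lambda>c x. (c \<odot>\<^bsub>A\<^esub> \<one>\<^bsub>A\<^esub>) \<odot>\<^bsub>M\<^esub> x)\<rparr>"

definition fd_right_module where
  "fd_right_module K A M \<longleftrightarrow>
     right_module A M \<and> vectorspace.fin_dim K (underlying_space A M)"

text \<open>Every finite dimensional module is isomorphic to one whose elements are coordinate vectors,
  that is, functions \<open>nat \<Rightarrow> 'k\<close>. The modules with elements of this type therefore form a
  category equivalent to \<open>mod A\<close>, in which the isomorphism classes are sets.\<close>

type_synonym ('k, 'a) rmod = "('a, nat \<Rightarrow> 'k) module"

definition mod_cat ::
  "('k, 'x) ring_scheme \<Rightarrow> ('k, 'a, 'y) module_scheme \<Rightarrow> ('k, 'a) rmod set" where
  "mod_cat K A = {M. fd_right_module K A M}"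

definition mod_iso where
  "mod_iso A M N \<longleftrightarrow> (\<exists>f \<in> module_hom A M N. bij_betw f (carrier M) (carrier N))"

definition iso_rel where
  "iso_rel K A = {(M, N). M \<in> mod_cat K A \<and> N \<in> mod_cat K A \<and> mod_iso A M N}"

definition zero_module where
  "zero_module M \<longleftrightarrow> carrier M = {\<zero>\<^bsub>M\<^esub>}"

definition regular_module :: "('a, 'y) ring_scheme \<Rightarrow> ('a, 'a) module" where
  "regular_module A =
     \<lparr>carrier = carrier A, monoid.mult = monoid.mult A, one = one A, zero = zero A, add = add A,
      smult = (\<lambda>a x. x \<otimes>\<^bsub>A\<^esub> a)\<rparr>"

text \<open>The direct sum of \<open>F 0\<close>, ..., \<open>F (n - 1)\<close>. (For two summands, \<open>direct_sum\<close> from the library is used.)\<close>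

definition family_sum :: "nat \<Rightarrow> (nat \<Rightarrow> ('a, 'm, 'z) module_scheme) \<Rightarrow> ('a, nat \<Rightarrow> 'm) module" where
  "family_sum n F =
     \<lparr>carrier = (\<Pi>\<^sub>E i\<in>{..<n}. carrier (F i)), monoid.mult = undefined, one = undefined,
      zero = (\<lambda>i\<in>{..<n}. \<zero>\<^bsub>F i\<^esub>),
      add = (\<lambda>x y. \<lambda>i\<in>{..<n}. x i \<oplus>\<^bsub>F i\<^esub> y i),
      smult = (\<lambda>a x. \<lambda>i\<in>{..<n}. a \<odot>\<^bsub>F i\<^esub> x i)\<rparr>"

definition quotient_module :: "('a, 'm, 'z) module_scheme \<Rightarrow> 'm set \<Rightarrow> ('a, 'm set) module" where
  "quotient_module M U =
     \<lparr>carrier = a_rcosets\<^bsub>M\<^esub> U, monoid.mult = undefined, one = undefined,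
      zero = U,
      add = (<+>\<^bsub>M\<^esub>),
      smult = (\<lambda>a C. \<Union>x\<in>C. U +>\<^bsub>M\<^esub> (a \<odot>\<^bsub>M\<^esub> x))\<rparr>"

definition right_submodule where
  "right_submodule A U M \<longleftrightarrow>
     additive_subgroup U M \<and> (\<forall>a\<in>carrier A. \<forall>u\<in>U. a \<odot>\<^bsub>M\<^esub> u \<in> U)"

definition Fac where
  "Fac K A M = {N \<in> mod_cat K A.
     \<exists>n. \<exists>f \<in> module_hom A (family_sum n (\<lambda>_. M)) N.
       f ` carrier (family_sum n (\<lambda>_. M)) = carrier N}"

text \<open>Homomorphisms are made \<open>undefined\<close> outside the domain, so that equal maps are equal functions.\<close>

definition Hom where
  "Hom A M N = module_hom A M N \<inter> extensional (carrier M)"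

definition Hom_zero where
  "Hom_zero A M N \<longleftrightarrow> Hom A M N = {\<lambda>x\<in>carrier M. \<zero>\<^bsub>N\<^esub>}"

definition Hom_group ::
  "('a, 'y) ring_scheme \<Rightarrow> ('a, 'm, 'z) module_scheme \<Rightarrow> ('a, 'n, 'w) module_scheme \<Rightarrow> ('m \<Rightarrow> 'n) ring" where
  "Hom_group A M N =
     \<lparr>carrier = Hom A M N, monoid.mult = undefined, one = undefined,
      zero = (\<lambda>x\<in>carrier M. \<zero>\<^bsub>N\<^esub>),
      add = (\<lambda>f g. \<lambda>x\<in>carrier M. f x \<oplus>\<^bsub>N\<^esub> g x)\<rparr>"


section \<open>Indecomposable summands\<close>

definition indecomposable where
  "indecomposable K A M \<longleftrightarrow>
     M \<in> mod_cat K A \<and> \<not> zero_module M \<and>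
     (\<forall>S \<in> mod_cat K A. \<forall>T \<in> mod_cat K A.
        mod_iso A M (direct_sum S T) \<longrightarrow> zero_module S \<or> zero_module T)"

definition indecomposable_summands where
  "indecomposable_summands K A M =
     {N. indecomposable K A N \<and> (\<exists>N' \<in> mod_cat K A. mod_iso A M (direct_sum N N'))}"

definition num_summands where
  "num_summands K A M = card (indecomposable_summands K A M // iso_rel K A)"

definition basic_module where
  "basic_module K A M \<longleftrightarrow>
     (\<forall>n F. (\<forall>i<n. indecomposable K A (F i)) \<and> mod_iso A M (family_sum n F) \<longrightarrow>
        (\<forall>i<n. \<forall>j<n. i \<noteq> j \<longrightarrow> \<not> mod_iso A (F i) (F j)))"


section \<open>Projective modules, projective dimension and Ext\<close>

definition projective where
  "projective K A P \<longleftrightarrow>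
     P \<in> mod_cat K A \<and>
     (\<forall>S \<in> mod_cat K A. \<forall>T \<in> mod_cat K A. \<forall>g \<in> module_hom A S T. \<forall>f \<in> module_hom A P T.
        g ` carrier S = carrier T \<longrightarrow>
        (\<exists>h \<in> module_hom A P S. \<forall>p \<in> carrier P. g (h p) = f p))"

text \<open>The exact sequence \<open>\<dots> \<rightarrow> P 2 \<rightarrow> P 1 \<rightarrow> P 0 \<rightarrow> M \<rightarrow> 0\<close> with differentials
  \<open>d n : P (n + 1) \<rightarrow> P n\<close> and augmentation \<open>e : P 0 \<rightarrow> M\<close>.\<close>

definition proj_resolution where
  "proj_resolution K A M P d e \<longleftrightarrow>
     (\<forall>n. projective K A (P n)) \<and>
     (\<forall>n. d n \<in> module_hom A (P (Suc n)) (P n)) \<and>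
     e \<in> module_hom A (P 0) M \<and>
     e ` carrier (P 0) = carrier M \<and>
     d 0 ` carrier (P 1) = a_kernel (P 0) M e \<and>
     (\<forall>n. d (Suc n) ` carrier (P (Suc (Suc n))) = a_kernel (P (Suc n)) (P n) (d n))"

definition proj_dim :: "_ \<Rightarrow> _ \<Rightarrow> _ \<Rightarrow> enat" where
  "proj_dim K A M =
     Inf {enat n | n. \<exists>P d e. proj_resolution K A M P d e \<and> (\<forall>i>n. zero_module (P i))}"

definition chosen_resolution where
  "chosen_resolution K A M = (SOME (P, d). \<exists>e. proj_resolution K A M P d e)"

definition cocycles where
  "cocycles A P d N n =
     {f \<in> Hom A (P n) N. \<forall>x \<in> carrier (P (Suc n)). f (d n x) = \<zero>\<^bsub>N\<^esub>}"

fun coboundaries where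
  "coboundaries A P d N 0 = {\<lambda>x\<in>carrier (P 0). \<zero>\<^bsub>N\<^esub>}"
| "coboundaries A P d N (Suc n) = (\<lambda>f. compose (carrier (P (Suc n))) f (d n)) ` Hom A (P n) N"

text \<open>The cohomology group \<open>H\<^sup>n(Hom(P\<^sub>\<bullet>, N))\<close>.\<close>

definition Ext where
  "Ext K A n M N =
     (case chosen_resolution K A M of (P, d) \<Rightarrow>
        (Hom_group A (P n) N)\<lparr>carrier := cocycles A P d N n\<rparr> A_Mod coboundaries A P d N n)"


section \<open>Duality and the Auslander-Reiten translation\<close>

text \<open>\<open>D L = Hom\<^sub>K(L, K)\<close> for a left \<open>A\<close>-module \<open>L\<close>, with the right action
  \<open>(\<phi> \<cdot> a)(x) = \<phi>(a \<cdot> x)\<close>.\<close>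

definition dual_module ::
  "('k, 'x) ring_scheme \<Rightarrow> ('k, 'a, 'y) module_scheme \<Rightarrow> ('a, 'm, 'z) module_scheme \<Rightarrow>
   ('a, 'm \<Rightarrow> 'k) module" where
  "dual_module K A L =
     (let V = underlying_space A L; H = Hom_group K V (regular_module K) in
     \<lparr>carrier = carrier H, monoid.mult = undefined, one = undefined, zero = zero H, add = add H,
      smult = (\<lambda>a \<phi>. \<lambda>x\<in>carrier L. \<phi> (a \<odot>\<^bsub>L\<^esub> x))\<rparr>)"

text \<open>The left \<open>A\<close>-module \<open>Hom\<^sub>A(P, A)\<close>, where \<open>(a \<cdot> \<phi>)(x) = a \<phi>(x)\<close>.\<close>

definition star_module ::
  "('a, 'y) ring_scheme \<Rightarrow> ('a, 'm, 'z) module_scheme \<Rightarrow> ('a, 'm \<Rightarrow> 'a) module" where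
  "star_module A P =
     (let H = Hom_group A P (regular_module A) in
     \<lparr>carrier = carrier H, monoid.mult = undefined, one = undefined, zero = zero H, add = add H,
      smult = (\<lambda>a \<phi>. \<lambda>x\<in>carrier P. a \<otimes>\<^bsub>A\<^esub> \<phi> x)\<rparr>)"

definition proj_cover_onto where
  "proj_cover_onto K A P M f U \<longleftrightarrow>
     projective K A P \<and> f \<in> module_hom A P M \<and> f ` carrier P = U \<and>
     (\<forall>V. right_submodule A V P \<and> V <+>\<^bsub>P\<^esub> a_kernel P M f = carrier P \<longrightarrow> V = carrier P)"

text \<open>\<open>P\<^sub>1 \<rightarrow> P\<^sub>0 \<rightarrow> M \<rightarrow> 0\<close> with maps \<open>f\<close> and \<open>g\<close> is a minimal projective presentation:
  \<open>g\<close> is a projective cover of \<open>M\<close>, and \<open>f\<close> is one of \<open>Ker g\<close>.\<close>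

definition min_proj_presentation where
  "min_proj_presentation K A M P1 P0 f g \<longleftrightarrow>
     proj_cover_onto K A P0 M g (carrier M) \<and>
     proj_cover_onto K A P1 P0 f (a_kernel P0 M g)"

text \<open>The cokernel of \<open>Hom\<^sub>A(f, A) : Hom\<^sub>A(P\<^sub>0, A) \<rightarrow> Hom\<^sub>A(P\<^sub>1, A)\<close>.\<close>

definition transpose_module ::
  "('a, 'y) ring_scheme \<Rightarrow> ('a, 'p, 'z) module_scheme \<Rightarrow> ('a, 'q, 'w) module_scheme \<Rightarrow>
   ('p \<Rightarrow> 'q) \<Rightarrow> ('a, ('p \<Rightarrow> 'a) set) module" where
  "transpose_module A P1 P0 f =
     quotient_module (star_module A P1)
       ((\<lambda>\<phi>. compose (carrier P1) \<phi> f) ` carrier (star_module A P0))"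

definition AR_translate where
  "AR_translate K A M =
     (case (SOME (P1, P0, f). \<exists>g. min_proj_presentation K A M P1 P0 f g) of
        (P1, P0, f) \<Rightarrow> dual_module K A (transpose_module A P1 P0 f))"


section \<open>The posets\<close>

definition tilting where
  "tilting K A M \<longleftrightarrow>
     M \<in> mod_cat K A \<and> basic_module K A M \<and>
     trivial_group (Ext K A 1 M M) \<and>
     proj_dim K A M \<le> 1 \<and>
     num_summands K A M = num_summands K A (regular_module A)"

definition tilt ::
  "('k, 'x) ring_scheme \<Rightarrow> ('k, 'a, 'y) module_scheme \<Rightarrow> ('k, 'a) rmod set gorder" where
  "tilt K A =
     \<lparr>carrier = {M. tilting K A M} // iso_rel K A,
      eq = (=),
      le = (\<lambda>S T. \<exists>M\<in>S. \<exists>M'\<in>T. Fac K A M \<subseteq> Fac K A M')\<rparr>"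

definition support_tau_tilting where
  "support_tau_tilting K A M P \<longleftrightarrow>
     M \<in> mod_cat K A \<and> basic_module K A M \<and>
     projective K A P \<and> basic_module K A P \<and>
     Hom_zero A M (AR_translate K A M) \<and>
     Hom_zero A P M \<and>
     num_summands K A (direct_sum M P) = num_summands K A (regular_module A)"

definition pair_iso_rel where
  "pair_iso_rel K A = {((M, P), (M', P')). (M, M') \<in> iso_rel K A \<and> (P, P') \<in> iso_rel K A}"

definition stau_tilt ::
  "('k, 'x) ring_scheme \<Rightarrow> ('k, 'a, 'y) module_scheme \<Rightarrow>
   (('k, 'a) rmod \<times> ('k, 'a) rmod) set gorder" where
  "stau_tilt K A =
     \<lparr>carrier = {(M, P). support_tau_tilting K A M P} // pair_iso_rel K A,
      eq = (=),
      le = (\<lambda>S T. \<exists>(M, P)\<in>S. \<exists>(M', P')\<in>T. Fac K A M \<subseteq> Fac K A M')\<rparr>"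

text \<open>The library's predicate \<open>isotone\<close> includes that both sides are partially ordered.\<close>

definition poset_isomorphic where
  "poset_isomorphic L L' \<longleftrightarrow>
     (\<exists>f. bij_betw f (carrier L) (carrier L') \<and>
          isotone L L' f \<and> isotone L' L (inv_into (carrier L) f))"


section \<open>The duplicated algebra\<close>

text \<open>The triple \<open>(a, \<phi>, b)\<close> is the lower triangular matrix with diagonal entries \<open>a\<close>, \<open>b\<close> and
  lower left entry \<open>\<phi> \<in> D A\<close>. The bimodule structure of \<open>D A\<close> is \<open>(\<phi> \<cdot> a)(x) = \<phi>(a x)\<close> and
  \<open>(b \<cdot> \<phi>)(x) = \<phi>(x b)\<close>, and the lower left entry of a product is \<open>\<phi> \<cdot> a' + b \<cdot> \<phi>'\<close>.\<close>

definition duplicated_algebra ::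
  "('k, 'x) ring_scheme \<Rightarrow> ('k, 'a, 'y) module_scheme \<Rightarrow> ('k, 'a \<times> ('a \<Rightarrow> 'k) \<times> 'a) module" where
  "duplicated_algebra K A =
     (let DA = Hom_group K A (regular_module K) in
     \<lparr>carrier = carrier A \<times> carrier DA \<times> carrier A,
      monoid.mult = (\<lambda>(a, \<phi>, b) (a', \<phi>', b').
        (a \<otimes>\<^bsub>A\<^esub> a', (\<lambda>x\<in>carrier A. \<phi> (a' \<otimes>\<^bsub>A\<^esub> x) \<oplus>\<^bsub>K\<^esub> \<phi>' (x \<otimes>\<^bsub>A\<^esub> b)), b \<otimes>\<^bsub>A\<^esub> b')),
      one = (\<one>\<^bsub>A\<^esub>, \<zero>\<^bsub>DA\<^esub>, \<one>\<^bsub>A\<^esub>),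
      zero = (\<zero>\<^bsub>A\<^esub>, \<zero>\<^bsub>DA\<^esub>, \<zero>\<^bsub>A\<^esub>),
      add = (\<lambda>(a, \<phi>, b) (a', \<phi>', b'). (a \<oplus>\<^bsub>A\<^esub> a', \<phi> \<oplus>\<^bsub>DA\<^esub> \<phi>', b \<oplus>\<^bsub>A\<^esub> b')),
      smult = (\<lambda>c (a, \<phi>, b). (c \<odot>\<^bsub>A\<^esub> a, (\<lambda>x\<in>carrier A. c \<otimes>\<^bsub>K\<^esub> \<phi> x), c \<odot>\<^bsub>A\<^esub> b))\<rparr>)"

end

theory Submission
imports Defs "HOL-Library.Function_Algebras"
begin

text \<open>The index of a projective presentation \<open>P1 \<rightarrow> P0\<close> of a module is the function
 \<open>Z \<mapsto> dim Hom(P0, Z) - dim Hom(P1, Z)\<close>. The indices of pairwise nonisomorphic indecomposable modules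
 \<open>U\<close> such that \<open>Hom(U, \<tau> U') = 0\<close> for all pairs are linearly independent, also together with the
 functions \<open>dim Hom(Q, -)\<close> of the indecomposable projective modules \<open>Q\<close> with \<open>Hom(Q, U) = 0\<close>. Hence a
 \<open>\<tau>\<close>-rigid pair has at most as many summands as the algebra, a pair attaining this bound is maximal,
 and therefore it is determined by its class \<open>Fac\<close>.

 Let \<open>E\<close> be the right ideal of the duplicated algebra generated by the idempotent \<open>e2\<close> of its second
 row. It is projective and injective, so every tilting module \<open>T\<close> generates it. The largest quotient of
 \<open>T\<close> that is a module over the given algebra belongs to a support \<open>\<tau>\<close>-tilting pair: this is a matter of
 counting, and the count follows by restricting indices to modules over the given algebra.
 Conversely, let \<open>f : P1 \<rightarrow> P0\<close> be a minimal presentation of a summand of \<open>M\<close>, or the map \<open>P1 \<rightarrow> 0\<close> for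
 a summand \<open>P1\<close> of \<open>P\<close>. An embedding of \<open>P1\<close> into a sum \<open>Q\<close> of copies of \<open>E\<close> completes \<open>f\<close> to an
 injection \<open>P1 \<rightarrow> P0 \<oplus> Q\<close>, and the cokernels of these injections together with \<open>E\<close> are the summands of a
 tilting module. Since the kernel of \<open>T \<rightarrow> T / T e2\<close> is generated by \<open>E\<close>, the inclusions between the
 classes \<open>Fac\<close> on both sides correspond to each other.\<close>

text \<open>The index of a presentation \<open>f\<close> of \<open>M\<close> at \<open>Z\<close>
  compares the dimensions of the two ends of \<open>Hom(f, Z)\<close>. The kernel of this map is
  \<open>Hom(M, Z)\<close>; for minimal \<open>f\<close> its cokernel is dual to
  \<open>Hom(Z, \<tau> M)\<close>. If both vanish the index is 0, if exactly one vanishes it is not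
  0. So independence needs, for each \<open>V\<close> in the family, a module \<open>Z\<close> at
  which exactly one of the two spaces vanishes for \<open>V\<close> and both vanish for all other
  members. A right almost split map to \<open>V\<close> inside the family supplies it. Neither
  direction of the theorem writes down an inverse: each produces compatible indecomposables and
  shows by counting that there are enough of them. The counts match because the indecomposable
  projectives over the duplicated algebra are those of the given algebra and the summands of
  \<open>E\<close>. On modules over the given algebra \<open>Hom(E, -)\<close> vanishes, and a
  completed presentation has the index of \<open>f\<close>; restriction thus loses exactly the
  contribution of \<open>E\<close>. Tilting modules and pairs are related when their
  \<open>Fac\<close> classes agree after reflection, and the bijection is read off from this
  relation.\<close>

text \<open>By the coercion, \<open>x \<in> M\<close> stands for \<open>x \<in> carrier M\<close>. The structure is written as a subscript,
 and \<open>a ._M x\<close> is the action of \<open>a\<close> on \<open>x\<close>.\<close>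

declare [[coercion carrier]]

notation (input) zero ("0'__" [1000] 1000) and one ("1'__" [1000] 1000) and a_inv ("-'__ _" [1000, 81] 80) and iff (infixr "<->" 25)
abbreviation (input) plus_in ("_ +'__ _" [65, 1000, 66] 65) where "x +_M y \<equiv> x \<oplus>\<^bsub>M\<^esub> y"
abbreviation (input) minus_in ("_ -'__ _" [65, 1000, 66] 65) where "x -_M y \<equiv> x \<ominus>\<^bsub>M\<^esub> y"
abbreviation (input) times_in ("_ *'__ _" [70, 1000, 71] 70) where "x *_M y \<equiv> x \<otimes>\<^bsub>M\<^esub> y"
abbreviation (input) act_in ("_ .'__ _" [70, 1000, 71] 70) where "a ._M x \<equiv> a \<odot>\<^bsub>M\<^esub> x"

section \<open>Finite dimensional vector spaces\<close>

definition fdvs where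
 "fdvs K V <-> vectorspace K V & vectorspace.fin_dim K V"

lemma subspaceI:
 assumes "vectorspace K V" "W <= carrier V" "0_V\<in>W"
  "!!x y. x\<in>W ==> y\<in>W ==> x +_V y\<in>W"
  "!!c x. c\<in>K ==> x\<in>W ==> c ._V x\<in>W"
 shows "subspace K W V"
 using assms unfolding subspace_def submodule_def vectorspace_def by auto

lemma subspaceD:
 assumes "subspace K W V"
 shows "vectorspace K V" "W <= carrier V" "0_V\<in>W"
  "!!x y. x\<in>W ==> y\<in>W ==> x +_V y\<in>W"
  "!!c x. c\<in>K ==> x\<in>W ==> c ._V x\<in>W"
  "vectorspace K (V(|carrier:=W|))"
proof -
 have s: "submodule K W V" and v: "vectorspace K V" using assms unfolding subspace_def by auto
 show "vectorspace K V" by fact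
 show "W <= carrier V" "0_V\<in>W"
  "!!x y. x\<in>W ==> y\<in>W ==> x +_V y\<in>W"
  "!!c x. c\<in>K ==> x\<in>W ==> c ._V x\<in>W"
  using s unfolding submodule_def by auto
 show "vectorspace K (V(|carrier:=W|))" by (rule vectorspace.subspace_is_vs[OF v assms])
qed

text \<open>Stated with subspaces instead of linear combinations, finite dimension takes the form of
  finite generation. \<open>fd_gen\<close> has the same shape with submodules, so the two notions
  can be compared directly.\<close>

lemma fin_dim_iff:
 assumes "vectorspace K V"
 shows "vectorspace.fin_dim K V <->
  (\<exists>S. finite S & S <= carrier V & (\<forall>W. subspace K W V --> S <= W --> carrier V <= W))"
proof -
 interpret vectorspace K V by fact
 show ?thesis
 proof
  assume "fin_dim"
  then obtain S where S: "finite S" "S <= carrier V" "gen_set S" unfolding fin_dim_def by auto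
  have "carrier V <= W" if "subspace K W V" "S <= W" for W
   using span_is_subset[OF that(2)] that(1) S(3) by (auto simp: subspace_def)
  thus "\<exists>S. finite S & S <= carrier V & (\<forall>W. subspace K W V --> S <= W --> carrier V <= W)"
   using S by blast
 next
  assume "\<exists>S. finite S & S <= carrier V & (\<forall>W. subspace K W V --> S <= W --> carrier V <= W)"
  then obtain S where S: "finite S" "S <= carrier V" "!!W. subspace K W V ==> S <= W ==> carrier V <= W"
   by blast
  have "carrier V <= span S"
   using S(3)[OF span_is_subspace[OF S(2)]] in_own_span[OF S(2)] by auto
  hence "gen_set S" using span_is_subset2[OF S(2)] by auto
  thus "fin_dim" unfolding fin_dim_def using S by blast
 qed
qed

lemma fdvsI:
 assumes "vectorspace K V" "finite S" "S <= carrier V"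
  "!!W. subspace K W V ==> S <= W ==> carrier V <= W"
 shows "fdvs K V"
 unfolding fdvs_def using assms fin_dim_iff by blast

lemma fdvs_subspace:
 assumes V: "fdvs K V" and W: "subspace K W V"
 shows "fdvs K (V(|carrier:=W|))"
  and "vectorspace.dim K (V(|carrier:=W|)) <= vectorspace.dim K V"
  and "vectorspace.dim K (V(|carrier:=W|)) = vectorspace.dim K V ==> W = carrier V"
proof -
 interpret vectorspace K V using V by (simp add: fdvs_def)
 have fd: fin_dim using V by (simp add: fdvs_def)
 note WD = subspaceD[OF W]
 have sm: "submodule K W V" using W by (simp add: subspace_def)
 interpret W: vectorspace K "V(|carrier:=W|)" by (rule WD(6))
 \<comment> \<open>Independent subsets of \<open>W\<close> have at most \<open>dim\<close> elements,
   so a maximal one exists; it is a basis of \<open>W\<close>.\<close>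
 have "\<exists>A. finite A & maximal A (%S. S <= W & W.lin_indpt S)"
 proof (rule maximal_exists[where N = dim and B = "{}"])
  show "!!A. A <= W & W.lin_indpt A ==> finite A & card A <= dim"
   using li_le_dim[OF fd] span_li_not_depend(2)[OF _ sm] WD(2) by (metis subset_trans)
  show "{} <= W & W.lin_indpt {}" by (auto simp: W.lin_dep_def)
 qed
 then obtain A where A: "finite A" "maximal A (%S. S <= W & W.lin_indpt S)" by auto
 hence b: "W.basis A" by (intro W.max_li_is_basis) auto
 hence AW: "A <= W" "W.lin_indpt A" "W.gen_set A" by (auto simp: W.basis_def)
 have fdW: "W.fin_dim" unfolding W.fin_dim_def using A(1) AW by auto
 thus "fdvs K (V(|carrier:=W|))" unfolding fdvs_def using WD(6) by auto
 have dW: "W.dim = card A" by (rule W.dim_basis[OF A(1) b])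
 have liA: "lin_indpt A" using AW span_li_not_depend(2)[OF AW(1) sm] by simp
 show "W.dim <= dim" using li_le_dim(2)[OF fd _ liA] AW(1) WD(2) dW by auto
 show "W = carrier V" if "W.dim = dim"
 proof -
  have "basis A" using dim_li_is_basis[OF fd A(1) _ liA] that dW AW(1) WD(2) by auto
  hence "span A = carrier V" by (simp add: basis_def)
  moreover have "span A = W" using AW(3) span_li_not_depend(1)[OF AW(1) sm] by simp
  ultimately show ?thesis by simp
 qed
qed

lemma linear_mapI:
 assumes "vectorspace K V" "vectorspace K W" "T\<in>module_hom K V W"
 shows "linear_map K V W T"
 using assms unfolding linear_map_def mod_hom_def mod_hom_axioms_def vectorspace_def by auto

definition lker where "lker V W T = {x\<in>V. T x = 0_W}"

lemma linear_map_facts: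
 assumes "vectorspace K V" "vectorspace K W" "T\<in>module_hom K V W"
 shows "subspace K (lker V W T) V" "subspace K (T ` V) W"
  "inj_on T V <-> lker V W T = {0_V}"
  "fdvs K V ==> vectorspace.dim K V =
    vectorspace.dim K (W(|carrier:=T ` V|)) + vectorspace.dim K (V(|carrier:=lker V W T|))"
  "fdvs K (V(|carrier:=lker V W T|)) ==> fdvs K W ==> fdvs K V"
  "fdvs K V ==> T ` V = carrier W ==> fdvs K W"
proof -
 interpret linear_map K V W T by (rule linear_mapI[OF assms])
 have k: "kerT = lker V W T" by (simp add: ker_def lker_def)
 have i: "imT = T ` V" by (simp add: im_def)
 show sk: "subspace K (lker V W T) V" using kerT_is_subspace k by simp
 show si: "subspace K (T ` V) W" using imT_is_subspace i by simp
 show "inj_on T V <-> lker V W T = {0_V}" using Ke0_iff_inj k by simp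
 show "fdvs K V ==> vectorspace.dim K V =
    vectorspace.dim K (W(|carrier:=T ` V|)) + vectorspace.dim K (V(|carrier:=lker V W T|))"
  using rank_nullity k i by (simp add: fdvs_def)
 show "fdvs K V ==> T ` V = carrier W ==> fdvs K W"
  using rank_nullity_main(2) assms by (simp add: fdvs_def)
 show "fdvs K V" if kf: "fdvs K (V(|carrier:=lker V W T|))" and Wf: "fdvs K W"
 proof -
  have imf: "fdvs K (W(|carrier:=T ` V|))" by (rule fdvs_subspace(1)[OF Wf si])
  obtain S where S: "finite S" "S <= lker V W T"
   "!!U. subspace K U (V(|carrier:=lker V W T|)) ==> S <= U ==> lker V W T <= U"
   using kf fin_dim_iff[of K "V(|carrier:=lker V W T|)"] by (auto simp: fdvs_def)
  obtain R where R: "finite R" "R <= T ` V"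
   "!!U. subspace K U (W(|carrier:=T ` V|)) ==> R <= U ==> T ` V <= U"
   using imf fin_dim_iff[of K "W(|carrier:=T ` V|)"] by (auto simp: fdvs_def)
  \<comment> \<open>Generators of the kernel together with preimages of generators of the image
    generate \<open>V\<close>.\<close>
  obtain R' where R': "R' <= carrier V" "finite R'" "R = T ` R'"
   using R(1,2) by (metis finite_subset_image)
  show ?thesis
  proof (rule fdvsI[where S = "S \<union> R'"])
   show "vectorspace K V" "finite (S \<union> R')" "S \<union> R' <= carrier V"
    using assms S R' by (auto simp: lker_def)
   fix U assume U: "subspace K U V" "S \<union> R' <= U"
   note UD = subspaceD[OF U(1)] and kD = subspaceD[OF sk]
   have "subspace K (U \<inter> lker V W T) (V(|carrier:=lker V W T|))"
    by (rule subspaceI) (use UD kD in auto)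
   from S(3)[OF this] U S have 1: "lker V W T <= U" by auto
   have "subspace K (T ` U) (W(|carrier:=T ` V|))"
   proof (rule subspaceI)
    show "vectorspace K (W(|carrier:=T ` V|))" using subspaceD(6)[OF si] .
    show "T ` U <= carrier (W(|carrier:=T ` V|))" using UD(2) by auto
    show "0_(W(|carrier:=T ` V|))\<in>T ` U" using imageI[OF UD(3), of T] T0_is_0 by simp
   next
    fix x y assume "x\<in>T ` U" "y\<in>T ` U"
    then obtain x' y' where "x'\<in>U" "y'\<in>U" "x = T x'" "y = T y'" by blast
    thus "x +_(W(|carrier:=T ` V|)) y\<in>T ` U"
     using subsetD[OF UD(2)] UD(4) T_add[of x' y'] by (auto intro!: image_eqI[of _ _ "x' +_V y'"])
   next
    fix c x assume "c\<in>K" "x\<in>T ` U"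
    then obtain x' where "x'\<in>U" "x = T x'" by blast
    thus "c ._(W(|carrier:=T ` V|)) x\<in>T ` U"
     using UD(2,5) T_smult[of c x'] \<open>c \<in> carrier K\<close> by (auto intro!: image_eqI[of _ _ "c ._V x'"])
   qed
   moreover have "R <= T ` U" using R'(3) U by auto
   ultimately have 2: "T ` V <= T ` U" by (rule R(3))
   show "carrier V <= U"
   proof
    fix x assume x: "x\<in>V"
    then obtain u where u: "u\<in>U" "T x = T u" using 2 by blast
    have uc: "u\<in>V" using u UD by auto
    have "x -_V u\<in>lker V W T" using x uc u(2) by (simp add: lker_def)
    hence "(x -_V u) +_V u\<in>U" using 1 UD(4) u(1) by blast
    thus "x\<in>U" using x uc by (simp add: V.module.M.minus_eq V.module.M.a_assoc V.module.M.l_neg)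
   qed
  qed
 qed
qed

lemma fdvs_zero:
 assumes "vectorspace K V" "carrier V = {0_V}"
 shows "fdvs K V" "vectorspace.dim K V = 0"
proof -
 interpret vectorspace K V by fact
 show "fdvs K V" by (rule fdvsI[where S = "{}"]) (use assms subspaceD(3) in auto)
 have "gen_set {}" using assms by (simp add: span_empty)
 thus "dim = 0" using gen_ge_dim[of "{}"] by auto
qed

lemma dim_0_iff:
 assumes "fdvs K V"
 shows "vectorspace.dim K V = 0 <-> carrier V = {0_V}"
proof -
 have v: "vectorspace K V" using assms by (simp add: fdvs_def)
 interpret vectorspace K V by fact
 have s: "subspace K {0_V} V" by (rule subspaceI[OF v]) auto
 have z: "vectorspace.dim K (V(|carrier:={0_V}|)) = 0"
  by (rule fdvs_zero(2)[OF subspaceD(6)[OF s]]) simp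
 show ?thesis
 proof
  assume "dim = 0" thus "carrier V = {0_V}" using fdvs_subspace(3)[OF assms s] z by simp
 next
  assume "carrier V = {0_V}" thus "dim = 0" by (rule fdvs_zero(2)[OF v])
 qed
qed

lemma fdvs_inj:
 assumes "vectorspace K V" "fdvs K W" "T\<in>module_hom K V W" "inj_on T V"
 shows "fdvs K V" "vectorspace.dim K V <= vectorspace.dim K W"
  "vectorspace.dim K V = vectorspace.dim K W <-> T ` V = carrier W"
proof -
 have W: "vectorspace K W" using assms by (simp add: fdvs_def)
 note lf = linear_map_facts[OF assms(1) W assms(3)]
 have z: "carrier (V(|carrier:=lker V W T|)) = {0_(V(|carrier:=lker V W T|))}" using lf(3) assms(4) by simp
 note kz = fdvs_zero[OF subspaceD(6)[OF lf(1)] z]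
 show V: "fdvs K V" by (rule lf(5)[OF kz(1) assms(2)])
 have d: "vectorspace.dim K V = vectorspace.dim K (W(|carrier:=T ` V|))" using lf(4)[OF V] kz(2) by simp
 thus "vectorspace.dim K V <= vectorspace.dim K W" using fdvs_subspace(2)[OF assms(2) lf(2)] by simp
 show "vectorspace.dim K V = vectorspace.dim K W <-> T ` V = carrier W"
  using fdvs_subspace(3)[OF assms(2) lf(2)] d by auto
qed

lemma fdvs_surj:
 assumes "fdvs K V" "vectorspace K W" "T\<in>module_hom K V W" "T ` V = carrier W"
 shows "fdvs K W"
  "vectorspace.dim K V = vectorspace.dim K W + vectorspace.dim K (V(|carrier:=lker V W T|))"
  "vectorspace.dim K V = vectorspace.dim K W <-> inj_on T V"
proof -
 have V: "vectorspace K V" using assms by (simp add: fdvs_def)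
 note lf = linear_map_facts[OF V assms(2,3)]
 show "fdvs K W" by (rule lf(6)[OF assms(1,4)])
 show d: "vectorspace.dim K V = vectorspace.dim K W + vectorspace.dim K (V(|carrier:=lker V W T|))"
  using lf(4)[OF assms(1)] assms(4) by simp
 show "vectorspace.dim K V = vectorspace.dim K W <-> inj_on T V"
  using d dim_0_iff[OF fdvs_subspace(1)[OF assms(1) lf(1)]] lf(3) by simp
qed

lemma vectorspace_regular:
 assumes "field K" shows "vectorspace K (regular_module K)"
proof -
 interpret field K by fact
 have "\<exists>n\<in>K. v +_K n = 0_K" if "v\<in>K" for v
  using that r_neg a_inv_closed by blast
 thus ?thesis
  by (intro vs_criteria[OF assms]) (auto simp: regular_module_def a_ac m_ac l_distr r_distr)
qed

abbreviation functional where
 "functional K V xi \<equiv> xi\<in>module_hom K V (regular_module K)"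

lemma functional_iff:
 assumes "field K"
 shows "functional K V xi <-> (\<forall>x\<in>V. xi x\<in>K) &
  (\<forall>x\<in>V. \<forall>y\<in>V. xi (x +_V y) = xi x +_K xi y) &
  (\<forall>c\<in>K. \<forall>x\<in>V. xi (c ._V x) = c *_K xi x)"
proof -
 interpret field K by fact
 show ?thesis by (auto simp: module_hom_def regular_module_def Pi_iff m_comm)
qed

lemma functional_zero:
 assumes "vectorspace K V" "functional K V xi"
 shows "xi 0_V = 0_K"
proof -
 have "field K" using assms(1) by (simp add: vectorspace_def)
 then interpret linear_map K V "regular_module K" xi
  by (intro linear_mapI assms vectorspace_regular)
 show ?thesis using T0_is_0 by (simp add: regular_module_def)
qed

lemma functional_finsum:
 assumes "vectorspace K V" "functional K V ph" "finite B" "g\<in>B \<rightarrow> carrier V"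
 shows "ph (\<Oplus>\<^bsub>V\<^esub>b\<in>B. g b) = (\<Oplus>\<^bsub>K\<^esub>b\<in>B. ph (g b))"
proof -
 interpret vectorspace K V by fact
 have fK: "field K" by unfold_locales
 show ?thesis using assms(3,4)
 proof (induction rule: finite_induct)
  case empty
  thus ?case using functional_zero[OF assms(1,2)] by simp
 next
  case (insert b B)
  note ph = assms(2)[unfolded functional_iff[OF fK]]
  have "(\<Oplus>\<^bsub>V\<^esub>b\<in>B. g b)\<in>V" using insert.prems by (intro module.M.finsum_closed) auto
  thus ?case using insert ph by (simp add: module.M.finsum_insert R.finsum_insert Pi_iff)
 qed
qed

text \<open>Uniqueness of the coefficients makes them linear in the vector, so they form the dual
  basis.\<close>

lemma coordinates:
 assumes V: "vectorspace K V" and B: "finite B" "vectorspace.basis K V B"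
 obtains c where "!!b. b\<in>B ==> functional K V (c b)"
  "!!v. v\<in>V ==> v = (\<Oplus>\<^bsub>V\<^esub>b\<in>B. c b v ._V b)"
  "!!b b'. b\<in>B ==> b'\<in>B ==> c b b' = (if b = b' then 1_K else 0_K)"
proof -
 interpret vectorspace K V by fact
 have fK: "field K" by unfold_locales
 have Bc: "B <= carrier V" using B(2) by (simp add: basis_def)
 have ex: "\<exists>!a. a\<in>B \<rightarrow>\<^sub>E carrier K & lincomb a B = v" if "v\<in>V" for v
  using basis_criterion[OF B(1) Bc] B(2) that by blast
 define a where "a v = (THE a. a\<in>B \<rightarrow>\<^sub>E carrier K & lincomb a B = v)" for v
 have a: "a v\<in>B \<rightarrow>\<^sub>E carrier K" "lincomb (a v) B = v" if "v\<in>V" for v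
  using theI'[OF ex[OF that]] by (simp_all add: a_def)
 have u: "a (lincomb f B) b = f b" if f: "f\<in>B \<rightarrow> carrier K" and b: "b\<in>B" for f b
 proof -
  have "lincomb (restrict f B) B = lincomb f B"
   unfolding lincomb_def using f Bc by (intro module.M.finsum_cong') auto
  moreover have v: "lincomb f B\<in>V" using f Bc by simp
  ultimately have "a (lincomb f B) = restrict f B" using ex[OF v] a[OF v] f by (metis restrict_PiE_iff PiE_restrict Pi_iff restrict_PiE)
  thus ?thesis using b by simp
 qed
 have aK: "a v b\<in>K" if "v\<in>V" "b\<in>B" for v b using a(1)[OF that(1)] that(2) by auto
 show ?thesis
 proof (rule that[of "%b v. a v b"])
  show "functional K V (%v. a v b)" if b: "b\<in>B" for b
   unfolding functional_iff[OF fK]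
  proof (intro conjI ballI)
   fix v assume v: "v\<in>V"
   show "a v b\<in>K" by (rule aK[OF v b])
   show "a (c ._V v) b = c *_K a v b" if c: "c\<in>K" for c
    using u[of "%w. c *_K a v w" b] lincomb_smult[OF Bc, of "a v" c] a(2)[OF v] aK[OF v] c b by simp
   fix w assume w: "w\<in>V"
   show "a (v +_V w) b = a v b +_K a w b"
    using u[of "%x. a v x +_K a w x" b] lincomb_sum[OF B(1) Bc, of "a v" "a w"] a(2)[OF v] a(2)[OF w] aK[OF v] aK[OF w] b by simp
  qed
  show "v = (\<Oplus>\<^bsub>V\<^esub>b\<in>B. a v b ._V b)" if "v\<in>V" for v using a(2)[OF that] by (simp add: lincomb_def)
  show "a b' b = (if b = b' then 1_K else 0_K)" if b: "b\<in>B" "b'\<in>B" for b b'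
  proof -
   have "lincomb (%x. if x = b' then 1_K else 0_K) B = (\<Oplus>\<^bsub>V\<^esub>x\<in>B. if b' = x then x else 0_V)"
    unfolding lincomb_def using Bc by (intro module.M.finsum_cong') auto
   also have "\<dots> = b'" using module.M.finsum_singleton[OF b(2) B(1), of "%x. x"] Bc by auto
   finally show ?thesis using u[of "%x. if x = b' then 1_K else 0_K" b] b by simp
  qed
 qed
qed

text \<open>A basis of \<open>S\<close> together with \<open>x\<close> is completed to a basis of
  \<open>V\<close> by the exchange lemma; \<open>xi\<close> is the coordinate at
  \<open>x\<close>.\<close>

lemma functional_separate:
 assumes V: "fdvs K V" and S: "subspace K S V" and x: "x\<in>V" "x \<notin> S"
 obtains xi where "functional K V xi" "!!s. s\<in>S ==> xi s = 0_K" "xi x = 1_K"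
proof -
 have v: "vectorspace K V" and fd: "vectorspace.fin_dim K V" using V by (simp_all add: fdvs_def)
 interpret vectorspace K V by fact
 have fK: "field K" by unfold_locales
 interpret W: vectorspace K "V(|carrier:=S|)" by (rule subspaceD(6)[OF S])
 have sm: "submodule K S V" using S by (simp add: subspace_def)
 obtain A where A: "finite A" "W.basis A" using W.finite_basis_exists fdvs_subspace(1)[OF V S] by (auto simp: fdvs_def)
 hence AS: "A <= S" by (simp add: W.basis_def)
 hence AV: "A <= carrier V" using subspaceD(2)[OF S] by blast
 have li: "lin_indpt A" "span A = S" using A(2) span_li_not_depend[OF AS sm] by (simp_all add: W.basis_def)
 have "lin_indpt (A \<union> {x})" using lin_dep_iff_in_span[OF AV li(1) x(1)] x(2) AS li(2) by blast
 moreover obtain C where C: "finite C" "basis C" using finite_basis_exists[OF fd] by blast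
 moreover have "span C = carrier V" "C <= carrier V" using C(2) by (simp_all add: basis_def)
 ultimately obtain D where D: "finite D" "D <= carrier V" "int (card D) <= int (card C) - int (card (A \<union> {x}))" "span (A \<union> {x} \<union> D) = carrier V"
  using replacement[of "A \<union> {x}" C] A(1) AV x(1) by auto
 have "card (A \<union> {x} \<union> D) <= dim" using card_Un_le[of "A \<union> {x}" D] D(3) dim_basis[OF C] by simp
 hence b: "basis (A \<union> {x} \<union> D)" using dim_gen_is_basis[of "A \<union> {x} \<union> D"] A(1) D AV x(1) by simp
 obtain c where c: "!!b. b\<in>A \<union> {x} \<union> D ==> functional K V (c b)"
  "!!b b'. b\<in>A \<union> {x} \<union> D ==> b'\<in>A \<union> {x} \<union> D ==> c b b' = (if b = b' then 1_K else 0_K)"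
  by (rule coordinates[OF v _ b]) (use A(1) D(1) in auto)
 have k: "subspace K (lker V (regular_module K) (c x)) V"
  by (rule linear_map_facts(1)[OF v vectorspace_regular[OF fK] c(1)]) simp
 have "A <= lker V (regular_module K) (c x)" using c(2)[of x] AV AS x(2) by (auto simp: lker_def regular_module_def)
 from span_is_subset[OF this] have "S <= lker V (regular_module K) (c x)" using k li(2) by (simp add: subspace_def)
 hence "c x s = 0_K" if "s\<in>S" for s using that by (auto simp: lker_def regular_module_def)
 moreover have "c x x = 1_K" using c(2)[of x x] by simp
 ultimately show ?thesis using that[of "c x"] c(1)[of x] by simp
qed

text \<open>If \<open>f s = 1\<close>, a functional that vanishes on \<open>Ker f\<close> and is \<open>1\<close> at \<open>s\<close> extends \<open>f\<close>.\<close>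

lemma functional_extend:
 assumes V: "fdvs K V" and S: "subspace K S V" and f: "functional K (V(|carrier:=S|)) f"
 obtains g where "functional K V g" "!!s. s\<in>S ==> g s = f s"
proof -
 have v: "vectorspace K V" using V by (simp add: fdvs_def)
 interpret vectorspace K V by fact
 have fK: "field K" by unfold_locales
 note SD = subspaceD[OF S]
 have fD: "\<forall>x\<in>S. f x\<in>K" "\<forall>x\<in>S. \<forall>y\<in>S. f (x +_V y) = f x +_K f y"
  "\<forall>c\<in>K. \<forall>x\<in>S. f (c ._V x) = c *_K f x"
  using f unfolding functional_iff[OF fK] by auto
 show ?thesis
 proof (cases "\<forall>s\<in>S. f s = 0_K")
  case True
  thus ?thesis using that[of "%_. 0_K"] by (simp add: functional_iff[OF fK])
 next
  case False
  then obtain t where t: "t\<in>S" "f t ~= 0_K" by blast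
  define s where "s = inv\<^bsub>K\<^esub> f t ._V t"
  have "f t\<in>Units K" using t fD(1) by (simp add: field_Units)
  hence s: "s\<in>S" "f s = 1_K" using t SD(5) fD(3) by (simp_all add: s_def)
  have S': "subspace K {x\<in>S. f x = 0_K} V"
  proof (rule subspaceI[OF v])
   have "f (0_K ._V 0_V) = 0_K *_K f 0_V" using fD(3) SD(3) by blast
   thus "0_V\<in>{x\<in>S. f x = 0_K}" using fD(1) SD(3) by simp
  qed (use SD fD in auto)
  obtain g where g: "functional K V g" "!!x. x\<in>S ==> f x = 0_K ==> g x = 0_K" "g s = 1_K"
   by (rule functional_separate[OF V S', of s]) (use s SD(2) in auto)
  note gD = g(1)[unfolded functional_iff[OF fK]]
  have "g x = f x" if x: "x\<in>S" for x
  proof -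
   have c: "f x\<in>K" "x\<in>V" "s\<in>V" "(-_K f x) ._V s\<in>S" using fD(1) x SD(2,5) s(1) by auto
   have "f (x +_V (-_K f x) ._V s) = 0_K" using fD c x s by (simp add: R.r_neg)
   hence "g (x +_V (-_K f x) ._V s) = 0_K" using g(2) SD(4) x c(4) by blast
   hence "g x -_K f x = 0_K" using gD c g(3) by (simp add: R.minus_eq)
   thus ?thesis using gD c by simp
  qed
  thus ?thesis using that g(1) by blast
 qed
qed

text \<open>Expanding a functional in the dual basis \<open>d\<close> of a basis \<open>B\<close>
  shows that \<open>Th\<close> is evaluation at the sum of the vectors
  \<open>Th (d b) ._V b\<close>. This is how functionals on the component \<open>D A\<close> of the
  duplicated algebra are represented later.\<close>

lemma double_dual:
 assumes V: "fdvs K V"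
  and cl: "!!ph. ph\<in>Hom K V (regular_module K) ==> Th ph\<in>K"
  and add: "!!ph ps. ph\<in>Hom K V (regular_module K) ==> ps\<in>Hom K V (regular_module K) ==>
   Th (\<lambda>x\<in>V. ph x +_K ps x) = Th ph +_K Th ps"
  and sm: "!!c ph. c\<in>K ==> ph\<in>Hom K V (regular_module K) ==>
   Th (\<lambda>x\<in>V. c *_K ph x) = c *_K Th ph"
 shows "\<exists>b\<in>V. \<forall>ph\<in>Hom K V (regular_module K). Th ph = ph b"
proof -
 have v: "vectorspace K V" and fd: "vectorspace.fin_dim K V" using V by (simp_all add: fdvs_def)
 interpret vectorspace K V by fact
 have fK: "field K" by unfold_locales
 let ?D = "Hom K V (regular_module K)"
 have D: "ph\<in>?D <-> functional K V ph & ph\<in>extensional V" for ph by (simp add: Hom_def)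
 obtain B where B: "finite B" "basis B" using finite_basis_exists[OF fd] by blast
 hence Bc: "B <= carrier V" by (simp add: basis_def)
 obtain c where c: "!!b. b\<in>B ==> functional K V (c b)" "!!v. v\<in>V ==> v = (\<Oplus>\<^bsub>V\<^esub>b\<in>B. c b v ._V b)"
  by (rule coordinates[OF v B]) blast
 define d where "d b = restrict (c b) (carrier V)" for b
 have d: "d b\<in>?D" if "b\<in>B" for b using c(1)[OF that] unfolding D functional_iff[OF fK] by (simp add: d_def)
 have dK: "d b v\<in>K" if "b\<in>B" "v\<in>V" for b v using d[OF that(1)] that(2) unfolding D functional_iff[OF fK] by blast
 define b where "b = (\<Oplus>\<^bsub>V\<^esub>b\<in>B. Th (d b) ._V b)"
 have "Th ph = ph b" if p: "ph\<in>?D" for ph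
 proof -
  note ph = p[unfolded D, THEN conjunct1] and phD = p[unfolded D functional_iff[OF fK], THEN conjunct1]
  have phK: "ph x\<in>K" if "x\<in>B" for x using phD Bc that by blast
  \<comment> \<open>Partial sums of the expansion of \<open>ph\<close> in the dual basis; the
    additivity of \<open>Th\<close> is applied one term at a time.\<close>
  define E where "E F = (\<lambda>v\<in>V. \<Oplus>\<^bsub>K\<^esub>b\<in>F. ph b *_K d b v)" for F
  have main: "E F\<in>?D & Th (E F) = (\<Oplus>\<^bsub>K\<^esub>b\<in>F. ph b *_K Th (d b))" if "finite F" "F <= B" for F
   using that
  proof (induction rule: finite_induct)
   case empty
   have e: "(\<lambda>v\<in>V. 0_K *_K ph v) = E {}" using phD by (auto simp: E_def)
   have "E {}\<in>?D" unfolding D functional_iff[OF fK] by (simp add: E_def)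
   thus ?case using sm[OF R.zero_closed p, unfolded e] cl[OF p] by simp
  next
   case (insert x F)
   define ch where "ch = (\<lambda>v\<in>V. ph x *_K d x v)"
   have x: "x\<in>B" "F <= B" using insert(4) by auto
   note IH = insert.IH[OF x(2)]
   have ch: "ch\<in>?D" using d[OF x(1)] phK[OF x(1)] unfolding D functional_iff[OF fK] ch_def by (simp add: R.r_distr R.m_lcomm)
   have e: "E (insert x F) = (\<lambda>v\<in>V. ch v +_K E F v)"
    unfolding E_def ch_def using insert(1,2) x dK phK by (intro restrict_ext) (simp add: R.finsum_insert Pi_iff subset_iff)
   have "(\<lambda>v\<in>V. ch v +_K E F v)\<in>?D"
    using ch IH unfolding D functional_iff[OF fK] by (simp add: R.r_distr R.a_ac)
   moreover have "Th ch = ph x *_K Th (d x)" unfolding ch_def by (rule sm[OF phK[OF x(1)] d[OF x(1)]])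
   moreover have "(\<Oplus>\<^bsub>K\<^esub>b\<in>insert x F. ph b *_K Th (d b)) = ph x *_K Th (d x) +_K (\<Oplus>\<^bsub>K\<^esub>b\<in>F. ph b *_K Th (d b))"
    by (rule R.finsum_insert) (use insert(1,2) x cl[OF d] phK in auto)
   ultimately show ?case using add[OF ch conjunct1[OF IH]] IH unfolding e by (simp only: simp_thms)
  qed
  have "ph v = (\<Oplus>\<^bsub>K\<^esub>b\<in>B. ph b *_K d b v)" if v': "v\<in>V" for v
  proof -
   have "ph v = (\<Oplus>\<^bsub>K\<^esub>b\<in>B. ph (d b v ._V b))"
    using functional_finsum[OF v ph B(1), of "%b. d b v ._V b"] c(2)[OF v'] dK[OF _ v'] Bc v' by (auto simp: d_def cong: module.M.finsum_cong)
   also have "\<dots> = (\<Oplus>\<^bsub>K\<^esub>b\<in>B. ph b *_K d b v)"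
    using phD Bc dK[OF _ v'] phK by (intro R.finsum_cong') (auto simp: R.m_comm)
   finally show ?thesis .
  qed
  hence "ph = E B" using p unfolding D E_def by (auto intro!: extensionalityI[of _ "carrier V"])
  hence "Th ph = (\<Oplus>\<^bsub>K\<^esub>b\<in>B. ph b *_K Th (d b))" using main[OF B(1)] by simp
  also have "\<dots> = (\<Oplus>\<^bsub>K\<^esub>b\<in>B. ph (Th (d b) ._V b))"
   using phD Bc cl[OF d] phK by (intro R.finsum_cong') (auto simp: R.m_comm subset_iff)
  also have "\<dots> = ph b" unfolding b_def using functional_finsum[OF v ph B(1)] Bc cl[OF d] by (simp add: Pi_iff subset_iff)
  finally show ?thesis .
 qed
 moreover have "b\<in>V" unfolding b_def using Bc cl[OF d] by (intro module.M.finsum_closed) auto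
 ultimately show ?thesis by blast
qed

section \<open>Modules over a finite dimensional algebra\<close>

text \<open>A vector is sent to chosen coefficients with respect to a finite generating set whose
  members are numbered. This moves finite dimensional modules of any element type into
  \<open>mod_cat\<close>.\<close>

lemma fdvs_inj_into_functions:
 fixes K :: "('k, 'x) ring_scheme"
 assumes "fdvs K V"
 obtains r :: "'v \<Rightarrow> nat \<Rightarrow> 'k" where "inj_on r (carrier (V :: ('k, 'v, 'z) module_scheme))"
proof -
 interpret vectorspace K V using assms by (simp add: fdvs_def)
 obtain S where S: "finite S" "S <= carrier V" "gen_set S"
  using assms by (auto simp: fdvs_def fin_dim_def)
 obtain e :: "'v \<Rightarrow> nat" where e: "inj_on e S" using S(1) finite_imp_inj_to_nat_seg by metis
 have "\<exists>a. a\<in>S \<rightarrow> carrier K & v = lincomb a S" if "v\<in>V" for v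
 proof -
  have "v\<in>span S" using that S(3) by simp
  thus ?thesis unfolding finite_span[OF S(1,2)] by blast
 qed
 then obtain a where a: "!!v. v\<in>V ==> a v\<in>S \<rightarrow> carrier K & v = lincomb (a v) S" by metis
 define r where "r v n = a v (inv_into S e n)" for v n
 have "v = lincomb (%s. r v (e s)) S" if "v\<in>V" for v
 proof -
  have "lincomb (%s. r v (e s)) S = lincomb (a v) S"
   unfolding lincomb_def using a[OF that] S(2) e by (intro module.M.finsum_cong') (auto simp: r_def)
  thus ?thesis using a[OF that] by simp
 qed
 hence "inj_on r V" by (intro inj_onI) metis
 thus ?thesis by (rule that)
qed

lemma right_moduleI:
 assumes "ring A" "abelian_group M"
  "!!a x. a\<in>A ==> x\<in>M ==> a ._M x\<in>M"
  "!!a b x. a\<in>A ==> b\<in>A ==> x\<in>M ==>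
   (a +_A b) ._M x = a ._M x +_M b ._M x"
  "!!a x y. a\<in>A ==> x\<in>M ==> y\<in>M ==>
   a ._M (x +_M y) = a ._M x +_M a ._M y"
  "!!a b x. a\<in>A ==> b\<in>A ==> x\<in>M ==>
   (a *_A b) ._M x = b ._M (a ._M x)"
  "!!x. x\<in>M ==> 1_A ._M x = x"
 shows "right_module A M"
 unfolding right_module_def right_module_axioms_def using assms by blast

context right_module begin

lemma ract_zero [simp]: "a\<in>A ==> a ._M 0_M = 0_M"
 using ract_add[of a "0_M" "0_M"] ract_closed[of a "0_M"] by simp

lemma ract_zero_ring [simp]: "x\<in>M ==> 0_A ._M x = 0_M"
 using ract_add_ring[of "0_A" "0_A" x] ract_closed[of "0_A" x] by simp

lemma ract_minus: "a\<in>A ==> x\<in>M ==> a ._M (-_M x) = -_M (a ._M x)"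
 using ract_add[of a "-_M x" x] ract_closed M.minus_equality M.l_neg by simp

lemma ract_minus_ring: "a\<in>A ==> x\<in>M ==> (-_A a) ._M x = -_M (a ._M x)"
 using ract_add_ring[of "-_A a" a x] ract_closed M.minus_equality A.l_neg by simp

lemma right_submoduleI:
 assumes "U <= carrier M" "0_M\<in>U"
  "!!x y. x\<in>U ==> y\<in>U ==> x +_M y\<in>U"
  "!!a x. a\<in>A ==> x\<in>U ==> a ._M x\<in>U"
 shows "right_submodule A U M"
proof -
 have n: "-_M x\<in>U" if "x\<in>U" for x
 proof -
  have "(-_A 1_A) ._M x\<in>U" using assms(4) that by simp
  moreover have "x\<in>M" using assms(1) that by auto
  ultimately show ?thesis by (simp add: ract_minus_ring ract_one)
 qed
 have "additive_subgroup U M"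
  by (rule additive_subgroup.intro, rule subgroup.intro)
   (use assms n in \<open>auto simp flip: a_inv_def\<close>)
 thus ?thesis using assms(4) by (simp add: right_submodule_def)
qed

lemma right_submoduleD:
 assumes "right_submodule A U M"
 shows "U <= carrier M" "0_M\<in>U"
  "!!x y. x\<in>U ==> y\<in>U ==> x +_M y\<in>U"
  "!!a x. a\<in>A ==> x\<in>U ==> a ._M x\<in>U"
  "!!x. x\<in>U ==> -_M x\<in>U"
  "!!x y. x\<in>U ==> y\<in>U ==> x -_M y\<in>U"
proof -
 interpret U: additive_subgroup U M using assms by (simp add: right_submodule_def)
 show "U <= carrier M" "0_M\<in>U" "!!x y. x\<in>U ==> y\<in>U ==> x +_M y\<in>U"
  using U.a_subset by auto
 show "!!a x. a\<in>A ==> x\<in>U ==> a ._M x\<in>U"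
  using assms by (simp add: right_submodule_def)
 show n: "!!x. x\<in>U ==> -_M x\<in>U"
  using subgroup.m_inv_closed[OF U.a_subgroup] by (simp add: a_inv_def)
 show "!!x y. x\<in>U ==> y\<in>U ==> x -_M y\<in>U"
  using n by (simp add: M.minus_eq)
qed

lemma right_module_submodule:
 assumes "right_submodule A U M"
 shows "right_module A (M(|carrier:=U|))"
proof (rule right_moduleI)
 note D = right_submoduleD[OF assms]
 have c: "x\<in>M" if "x\<in>U" for x using D(1) that by auto
 show "abelian_group (M(|carrier:=U|))"
 proof (rule abelian_groupI)
  fix x assume "x\<in>carrier (M(|carrier:=U|))"
  thus "\<exists>y\<in>carrier (M(|carrier:=U|)). y +_(M(|carrier:=U|)) x = 0_(M(|carrier:=U|))"
   using D(5) c by (intro bexI[of _ "-_M x"]) (auto simp: M.l_neg)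
 qed (use D c in \<open>auto simp: M.a_ac\<close>)
 show "ring A" by unfold_locales
qed (use right_submoduleD[OF assms] in \<open>auto simp: ract_add ract_add_ring ract_mult ract_one subsetD\<close>)

end

lemma homI:
 assumes "!!x. x\<in>carrier M ==> f x\<in>carrier N"
  "!!x y. x\<in>carrier M ==> y\<in>carrier M ==> f (x +_M y) = f x +_N f y"
  "!!a x. a\<in>carrier A ==> x\<in>carrier M ==> f (a ._M x) = a ._N f x"
 shows "f\<in>module_hom A M N"
 using assms by (auto simp: module_hom_def)

lemma homD:
 assumes "f\<in>module_hom A M N"
 shows "!!x. x\<in>M ==> f x\<in>N"
  "!!x y. x\<in>M ==> y\<in>M ==> f (x +_M y) = f x +_N f y"
  "!!a x. a\<in>A ==> x\<in>M ==> f (a ._M x) = a ._N f x"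
 using assms by (auto simp: module_hom_def)

lemma hom_cong:
 assumes "f\<in>module_hom A M N" "right_module A M" "!!x. x\<in>M ==> f x = g x"
 shows "g\<in>module_hom A M N"
proof -
 interpret right_module A M by fact
 show ?thesis using assms(1,3) ract_closed unfolding module_hom_def by (auto simp: Pi_iff)
qed

lemma hom_more:
 assumes "f\<in>module_hom A M N" "right_module A M" "right_module A N"
 shows "f 0_M = 0_N"
  "!!x. x\<in>M ==> f (-_M x) = -_N f x"
  "!!x y. x\<in>M ==> y\<in>M ==> f (x -_M y) = f x -_N f y"
  "right_submodule A {x\<in>M. f x = 0_N} M"
  "!!U. right_submodule A U M ==> right_submodule A (f ` U) N"
  "!!U. right_submodule A U N ==> right_submodule A {x\<in>M. f x\<in>U} M"
  "inj_on f M <-> (\<forall>x\<in>M. f x = 0_N --> x = 0_M)"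
proof -
 interpret M: right_module A M by fact
 interpret N: right_module A N by fact
 note D = homD[OF assms(1)]
 show z: "f 0_M = 0_N" using D(2)[of "0_M" "0_M"] D(1)[of "0_M"] by simp
 show n: "f (-_M x) = -_N f x" if "x\<in>M" for x
  using D(2)[of "-_M x" x] D(1) that z by (simp add: M.M.l_neg N.M.minus_equality)
 show m: "f (x -_M y) = f x -_N f y" if "x\<in>M" "y\<in>M" for x y
  using D(2)[of x "-_M y"] n that by (simp add: M.M.minus_eq N.M.minus_eq)
 show "right_submodule A {x\<in>M. f x = 0_N} M"
  by (rule M.right_submoduleI) (auto simp: z D M.ract_closed)
 show "right_submodule A (f ` U) N" if "right_submodule A U M" for U
 proof (rule N.right_submoduleI)
  note U = M.right_submoduleD[OF that]
  have c: "x\<in>M" if "x\<in>U" for x using U(1) that by auto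
  show "f ` U <= carrier N" using c D(1) by auto
  show "0_N\<in>f ` U" using z U(2) by (metis imageI)
  show "x +_N y\<in>f ` U" if "x\<in>f ` U" "y\<in>f ` U" for x y
   using that U(3) c D(2) by (smt (verit) imageE imageI)
  show "a ._N x\<in>f ` U" if "a\<in>A" "x\<in>f ` U" for a x
   using that U(4) c D(3) by (smt (verit) imageE imageI)
 qed
 show "right_submodule A {x\<in>M. f x\<in>U} M" if "right_submodule A U N" for U
  by (rule M.right_submoduleI) (use N.right_submoduleD[OF that] in \<open>auto simp: z D M.ract_closed\<close>)
 show "inj_on f M <-> (\<forall>x\<in>M. f x = 0_N --> x = 0_M)"
 proof
  assume "inj_on f M"
  thus "\<forall>x\<in>M. f x = 0_N --> x = 0_M" using z by (metis M.M.zero_closed inj_onD)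
 next
  assume k: "\<forall>x\<in>M. f x = 0_N --> x = 0_M"
  show "inj_on f M"
  proof (rule inj_onI)
   fix x y assume xy: "x\<in>M" "y\<in>M" "f x = f y"
   hence "f (x -_M y) = 0_N" using m D(1) by simp
   hence "x -_M y = 0_M" using k xy by simp
   thus "x = y" using xy by simp
  qed
 qed
qed

lemma hom_comp:
 assumes "f\<in>module_hom A M N" "g\<in>module_hom A N L"
 shows "(%x. g (f x))\<in>module_hom A M L"
 using homD[OF assms(1)] homD[OF assms(2)] by (intro homI) auto

lemma hom_id: "(%x. x)\<in>module_hom A M M"
 by (intro homI) auto

lemma hom_add:
 assumes "f\<in>module_hom A M N" "g\<in>module_hom A M N" "right_module A N"
 shows "(%x. f x +_N g x)\<in>module_hom A M N"
proof -
 interpret right_module A N by fact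
 note f = homD[OF assms(1)] and g = homD[OF assms(2)]
 show ?thesis
  by (intro homI) (auto simp: f g ract_add M.a_ac)
qed

lemma hom_diff:
 assumes "f\<in>module_hom A M N" "g\<in>module_hom A M N" "right_module A N"
 shows "(%x. f x -_N g x)\<in>module_hom A M N"
proof -
 interpret right_module A N by fact
 note f = homD[OF assms(1)] and g = homD[OF assms(2)]
 show ?thesis
  by (intro homI) (auto simp: f g ract_add M.a_ac M.minus_eq M.minus_add ract_minus)
qed

lemma hom_0:
 assumes "right_module A N"
 shows "(%x. 0_N)\<in>module_hom A M N"
proof -
 interpret right_module A N by fact
 show ?thesis by (intro homI) auto
qed

lemma module_hom_incl:
 assumes "right_module A M" "right_submodule A U M"
 shows "(%x. x)\<in>module_hom A (M(|carrier:=U|)) M"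
 using right_module.right_submoduleD(1)[OF assms] by (intro homI) auto

lemma module_hom_codom:
 assumes "f\<in>module_hom A M N" "!!x. x\<in>M ==> f x\<in>U"
 shows "f\<in>module_hom A M (N(|carrier:=U|))"
 using homD[OF assms(1)] assms(2) by (intro homI) auto

lemma module_hom_dom:
 assumes "f\<in>module_hom A M N" "U <= carrier M"
 shows "f\<in>module_hom A (M(|carrier:=U|)) N"
 using homD[OF assms(1)] assms(2) by (intro homI) (auto simp: subsetD)

lemma hom_inv:
 assumes "f\<in>module_hom A M N" "bij_betw f (carrier M) (carrier N)" "right_module A M"
 shows "inv_into (carrier M) f\<in>module_hom A N M"
  "bij_betw (inv_into (carrier M) f) (carrier N) (carrier M)"
  "!!x. x\<in>M ==> inv_into (carrier M) f (f x) = x"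
  "!!y. y\<in>N ==> f (inv_into (carrier M) f y) = y"
proof -
 interpret right_module A M by fact
 note D = homD[OF assms(1)]
 let ?g = "inv_into (carrier M) f"
 show b: "bij_betw ?g (carrier N) (carrier M)" by (rule bij_betw_inv_into[OF assms(2)])
 show l: "!!x. x\<in>M ==> ?g (f x) = x" by (rule bij_betw_inv_into_left[OF assms(2)])
 show r: "!!y. y\<in>N ==> f (?g y) = y" by (rule bij_betw_inv_into_right[OF assms(2)])
 have c: "?g y\<in>M" if "y\<in>N" for y using b that by (auto simp: bij_betw_def)
 show "?g\<in>module_hom A N M"
 proof (rule homI)
  show "!!y. y\<in>N ==> ?g y\<in>M" by (rule c)
  show "?g (x +_N y) = ?g x +_M ?g y" if "x\<in>N" "y\<in>N" for x y
   using D(2)[of "?g x" "?g y"] l[of "?g x +_M ?g y"] c r that by simp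
  show "?g (a ._N x) = a ._M ?g x" if "a\<in>A" "x\<in>N" for a x
   using D(3)[of a "?g x"] l[of "a ._M ?g x"] c r that ract_closed by simp
 qed
qed

lemma mod_iso_trans:
 assumes "mod_iso A M N" "mod_iso A N L"
 shows "mod_iso A M L"
proof -
 obtain f g where f: "f\<in>module_hom A M N" "bij_betw f (carrier M) (carrier N)"
  and g: "g\<in>module_hom A N L" "bij_betw g (carrier N) (carrier L)"
  using assms unfolding mod_iso_def by blast
 have "bij_betw (%x. g (f x)) (carrier M) (carrier L)"
  using bij_betw_trans[OF f(2) g(2)] by (simp add: comp_def)
 thus ?thesis unfolding mod_iso_def using hom_comp[OF f(1) g(1)] by blast
qed

lemma mod_iso_sym: "mod_iso A M N ==> right_module A M ==> mod_iso A N M"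
 unfolding mod_iso_def using hom_inv(1,2) by blast

lemma mod_iso_refl: "mod_iso A M M"
 unfolding mod_iso_def using hom_id[of A M] by (intro bexI[of _ "%x. x"]) (auto simp: bij_betw_def)

text \<open>Transport of the module structure along an injection, and quotients by a congruence, are
 instances of this construction.\<close>

definition img_mod :: "('m \<Rightarrow> 'n) \<Rightarrow> ('a, 'm, 'z) module_scheme \<Rightarrow> ('a, 'n) module" where
 "img_mod r M = (|carrier = r ` M, monoid.mult = undefined, one = undefined,
   zero = r 0_M,
   add = (%u v. r (inv_into (carrier M) r u +_M inv_into (carrier M) r v)),
   smult = (%a u. r (a ._M inv_into (carrier M) r u))|)"

lemma img_mod:
 assumes "right_module A M"
  and c1: "!!x x' y y'. x\<in>M ==> x'\<in>M ==> y\<in>M ==> y'\<in>M ==>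
   r x = r x' ==> r y = r y' ==> r (x +_M y) = r (x' +_M y')"
  and c2: "!!a x x'. a\<in>A ==> x\<in>M ==> x'\<in>M ==>
   r x = r x' ==> r (a ._M x) = r (a ._M x')"
 shows "right_module A (img_mod r M)" "r\<in>module_hom A M (img_mod r M)"
  "carrier (img_mod r M) = r ` M" "0_(img_mod r M) = r 0_M"
proof -
 interpret right_module A M by fact
 show C: "carrier (img_mod r M) = r ` M" and Z: "0_(img_mod r M) = r 0_M"
  by (simp_all add: img_mod_def)
 let ?i = "inv_into (carrier M) r"
 have ri: "r (?i (r x)) = r x" "?i (r x)\<in>M" if "x\<in>M" for x
  using that by (auto intro: f_inv_into_f inv_into_into)
 have a: "r x +_(img_mod r M) r y = r (x +_M y)" if "x\<in>M" "y\<in>M" for x y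
  using c1[of "?i (r x)" x "?i (r y)" y] ri that by (simp add: img_mod_def)
 have s: "d ._(img_mod r M) r x = r (d ._M x)" if "d\<in>A" "x\<in>M" for d x
  using c2[of d "?i (r x)" x] ri that by (simp add: img_mod_def)
 show "r\<in>module_hom A M (img_mod r M)"
  by (rule homI) (auto simp: C a s)
 show "right_module A (img_mod r M)"
 proof (rule right_moduleI)
  show "ring A" by unfold_locales
  show "abelian_group (img_mod r M)"
  proof (rule abelian_groupI, unfold C Z)
   fix x assume "x\<in>r ` M"
   then obtain y where y: "y\<in>M" "x = r y" by auto
   thus "\<exists>y\<in>r ` M. y +_(img_mod r M) x = r 0_M"
    by (intro bexI[of _ "r (-_M y)"]) (auto simp: a M.l_neg)
  qed (auto simp: a M.a_ac)
 qed (auto simp: C a s ract_closed ract_add ract_add_ring ract_mult ract_one)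
qed

section \<open>Direct sums of coordinate modules\<close>

definition pr1 :: "(nat \<Rightarrow> 'k) \<Rightarrow> nat \<Rightarrow> 'k" where "pr1 z = (%n. z (2 * n))"

definition pr2 :: "(nat \<Rightarrow> 'k) \<Rightarrow> nat \<Rightarrow> 'k" where "pr2 z = (%n. z (2 * n + 1))"

text \<open>Interleaving even and odd positions identifies pairs of coordinate vectors with
  coordinate vectors, so that a direct sum of modules in \<open>mod_cat\<close> has elements of the
  same type again.\<close>

definition jn :: "(nat \<Rightarrow> 'k) \<Rightarrow> (nat \<Rightarrow> 'k) \<Rightarrow> nat \<Rightarrow> 'k" where
 "jn x y = (%n. if even n then x (n div 2) else y (n div 2))"

lemma pr_jn [simp]: "pr1 (jn x y) = x" "pr2 (jn x y) = y" "jn (pr1 z) (pr2 z) = z"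
 by (auto simp: pr1_def pr2_def jn_def fun_eq_iff)

lemma jn_eq [simp]: "jn x y = jn x' y' <-> x = x' & y = y'"
 by (metis pr_jn(1,2))

lemma pr_eq: "z = w <-> pr1 z = pr1 w & pr2 z = pr2 w"
 by (metis pr_jn(3))

definition bsum :: "('a, nat \<Rightarrow> 'k) module \<Rightarrow> ('a, nat \<Rightarrow> 'k) module \<Rightarrow> ('a, nat \<Rightarrow> 'k) module" (infixl "[+]" 65)
 where "M [+] N = (|carrier = {z. pr1 z\<in>M & pr2 z\<in>N},
   monoid.mult = undefined, one = undefined, zero = jn 0_M 0_N,
   add = (%z w. jn (pr1 z +_M pr1 w) (pr2 z +_N pr2 w)),
   smult = (%a z. jn (a ._M pr1 z) (a ._N pr2 z))|)"

lemma bsum_simps [simp]: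
 "z\<in>(M [+] N) <-> pr1 z\<in>M & pr2 z\<in>N"
 "0_(M [+] N) = jn 0_M 0_N"
 "z +_(M [+] N) w = jn (pr1 z +_M pr1 w) (pr2 z +_N pr2 w)"
 "a ._(M [+] N) z = jn (a ._M pr1 z) (a ._N pr2 z)"
 by (auto simp: bsum_def)

lemma right_module_bsum:
 assumes "right_module A M" "right_module A N"
 shows "right_module A (M [+] N)"
proof -
 interpret M: right_module A M by fact
 interpret N: right_module A N by fact
 show ?thesis
 proof (rule right_moduleI)
  show "ring A" by (rule M.A.ring_axioms)
  show "abelian_group (M [+] N)"
  proof (rule abelian_groupI)
   fix x assume "x\<in>(M [+] N)"
   thus "\<exists>y\<in>(M [+] N). y +_(M [+] N) x = 0_(M [+] N)"
    by (intro bexI[of _ "jn (-_M pr1 x) (-_N pr2 x)"]) (auto simp: M.M.l_neg N.M.l_neg)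
  qed (auto simp: M.M.a_ac N.M.a_ac)
 qed (auto simp: M.ract_closed N.ract_closed M.ract_add N.ract_add M.ract_add_ring N.ract_add_ring
   M.ract_mult N.ract_mult M.ract_one N.ract_one)
qed

lemma bsum_homs:
 assumes "right_module A M" "right_module A N"
 shows "pr1\<in>module_hom A (M [+] N) M" "pr2\<in>module_hom A (M [+] N) N"
  "(%x. jn x 0_N)\<in>module_hom A M (M [+] N)" "(%y. jn 0_M y)\<in>module_hom A N (M [+] N)"
proof -
 interpret M: right_module A M by fact
 interpret N: right_module A N by fact
 show "pr1\<in>module_hom A (M [+] N) M" "pr2\<in>module_hom A (M [+] N) N"
  "(%x. jn x 0_N)\<in>module_hom A M (M [+] N)" "(%y. jn 0_M y)\<in>module_hom A N (M [+] N)"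
  by (auto intro!: homI)
qed

lemma bsum_pair:
 assumes "f\<in>module_hom A L M" "g\<in>module_hom A L N"
 shows "(%x. jn (f x) (g x))\<in>module_hom A L (M [+] N)"
 using homD[OF assms(1)] homD[OF assms(2)] by (auto intro!: homI)

lemma bsum_copair:
 assumes "f\<in>module_hom A M L" "g\<in>module_hom A N L" "right_module A L"
 shows "(%z. f (pr1 z) +_L g (pr2 z))\<in>module_hom A (M [+] N) L"
proof -
 interpret right_module A L by fact
 note f = homD[OF assms(1)] and g = homD[OF assms(2)]
 show ?thesis by (intro homI) (auto simp: f g ract_add M.a_ac)
qed

definition zmod :: "('a, nat \<Rightarrow> 'k) module" where
 "zmod = (|carrier = {%_. undefined}, monoid.mult = undefined, one = undefined, zero = (%_. undefined),
   add = (%_ _ _. undefined), smult = (%_ _ _. undefined)|)"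

lemma zmod_simps [simp]:
 "carrier zmod = {%_. undefined}" "0_zmod = (%_. undefined)"
 "x +_zmod y = (%_. undefined)" "a ._zmod x = (%_. undefined)"
 by (simp_all add: zmod_def)

lemma right_module_zmod: "ring A ==> right_module A zmod"
 by (intro right_moduleI abelian_groupI) auto

section \<open>Modules over a fixed finite dimensional algebra\<close>

locale fdalg =
 fixes K :: "'k ring" and A :: "('k, 'a) module"
 assumes field_K: "field K" and fd_A: "fd_algebra K A"
begin

abbreviation "MC \<equiv> mod_cat K A"

abbreviation "mh \<equiv> module_hom A"

abbreviation "rm \<equiv> right_module A"

abbreviation "us \<equiv> underlying_space A"

abbreviation "sbm U M \<equiv> right_submodule A U M"

lemma vs_A: "vectorspace K A" and fdvs_A: "fdvs K A" and ring_A: "ring A"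
 using fd_A by (auto simp: fd_algebra_def fdvs_def)

lemma alg_smult:
 "c\<in>K ==> x\<in>A ==> y\<in>A ==> (c ._A x) *_A y = c ._A (x *_A y)"
 "c\<in>K ==> x\<in>A ==> y\<in>A ==> x *_A (c ._A y) = c ._A (x *_A y)"
 using fd_A by (auto simp: fd_algebra_def)

text \<open>The structure map from \<open>K\<close> to the algebra. Its image is central, which is
  why spaces of homomorphisms are vector spaces over \<open>K\<close>.\<close>

definition sc where "sc c = c ._A 1_A"

lemma sc_facts:
 "c\<in>K ==> sc c\<in>A"
 "c\<in>K ==> d\<in>K ==> sc (c +_K d) = sc c +_A sc d"
 "c\<in>K ==> d\<in>K ==> sc (c *_K d) = sc c *_A sc d"
 "sc 1_K = 1_A"
 "c\<in>K ==> a\<in>A ==> a *_A sc c = c ._A a"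
 "c\<in>K ==> a\<in>A ==> sc c *_A a = c ._A a"
proof -
 interpret V: vectorspace K A by (rule vs_A)
 interpret R: ring A by (rule ring_A)
 show "c\<in>K ==> sc c\<in>A" for c by (simp add: sc_def)
 show "c\<in>K ==> d\<in>K ==> sc (c +_K d) = sc c +_A sc d" for c d
  by (simp add: sc_def V.smult_l_distr)
 show "c\<in>K ==> d\<in>K ==> sc (c *_K d) = sc c *_A sc d" for c d
  by (simp add: sc_def alg_smult flip: V.smult_assoc1) (simp add: V.R.m_comm)
 show "sc 1_K = 1_A" by (simp add: sc_def)
 show "c\<in>K ==> a\<in>A ==> a *_A sc c = c ._A a" for c a
  by (simp add: sc_def alg_smult)
 show "c\<in>K ==> a\<in>A ==> sc c *_A a = c ._A a" for c a
  by (simp add: sc_def alg_smult)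
qed

lemma us_simps [simp]:
 "carrier (us M) = carrier M" "0_(us M) = 0_M" "x +_(us M) y = x +_M y"
 "c ._(us M) x = sc c ._M x" "us (M(|carrier:=U|)) = (us M)(|carrier:=U|)"
 by (simp_all add: underlying_space_def sc_def)

lemma vs_us:
 assumes "rm M" shows "vectorspace K (us M)"
proof -
 interpret right_module A M by fact
 interpret field K by (rule field_K)
 have n: "\<exists>y\<in>M. x +_M y = 0_M" if "x\<in>M" for x
  using that M.r_neg M.a_inv_closed by blast
 have c: "sc (a *_K b) ._M v = sc a ._M (sc b ._M v)"
  if "a\<in>K" "b\<in>K" "v\<in>M" for a b v
  using that ract_mult[of "sc b" "sc a" v] sc_facts(3)[of b a] by (simp add: sc_facts(1) m_comm)
 show ?thesis
  by (rule vs_criteria[OF field_K])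
   (use n c in \<open>auto simp: sc_facts ract_closed ract_add ract_add_ring ract_one M.a_ac\<close>)
qed

lemma subspace_us: "rm M ==> sbm U M ==> subspace K U (us M)"
 using right_module.right_submoduleD[of A M U] by (intro subspaceI vs_us) (auto simp: sc_facts)

lemma hom_us: "f\<in>mh M N ==> f\<in>module_hom K (us M) (us N)"
 using homD[of f A M N] by (intro homI) (auto simp: sc_facts)

lemma fd_iff: "fd_right_module K A M <-> rm M & fdvs K (us M)"
 using vs_us by (auto simp: fd_right_module_def fdvs_def)

lemma MC_iff: "M\<in>MC <-> rm M & fdvs K (us M)"
 by (simp add: mod_cat_def fd_iff)

text \<open>Finite dimension over \<open>K\<close> is the same as finite generation over the
  algebra: module generators multiplied by generators of \<open>A\<close> generate the vector
  space.\<close>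

lemma fd_gen:
 assumes "rm M"
 shows "fdvs K (us M) <-> (\<exists>S. finite S & S <= carrier M & (\<forall>U. sbm U M --> S <= U --> carrier M <= U))"
proof
 assume "fdvs K (us M)"
 then obtain S where S: "finite S" "S <= carrier M"
  "!!W. subspace K W (us M) ==> S <= W ==> carrier M <= W"
  using fin_dim_iff[OF vs_us[OF assms]] by (auto simp: fdvs_def)
 thus "\<exists>S. finite S & S <= carrier M & (\<forall>U. sbm U M --> S <= U --> carrier M <= U)"
  using subspace_us[OF assms] by (intro exI[of _ S]) blast
next
 assume "\<exists>S. finite S & S <= carrier M & (\<forall>U. sbm U M --> S <= U --> carrier M <= U)"
 then obtain S where S: "finite S" "S <= carrier M" "!!U. sbm U M ==> S <= U ==> carrier M <= U"
  by blast
 obtain B where B: "finite B" "B <= carrier A" "!!W. subspace K W A ==> B <= W ==> carrier A <= W"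
  using fdvs_A fin_dim_iff[OF vs_A] by (auto simp: fdvs_def)
 interpret right_module A M by fact
 interpret V: vectorspace K A by (rule vs_A)
 have Sc: "s\<in>M" if "s\<in>S" for s using that S(2) by auto
 let ?T = "(%(s, b). b ._M s) ` (S \<times> B)"
 show "fdvs K (us M)"
 proof (rule fdvsI[OF vs_us[OF assms]])
  show "finite ?T" using S(1) B(1) by simp
  show "?T <= carrier (us M)" using S(2) B(2) ract_closed by auto
  fix W assume W: "subspace K W (us M)" and TW: "?T <= W"
  note WD = subspaceD[OF W, simplified]
  have gen: "a ._M s\<in>W" if "s\<in>S" "a\<in>A" for s a
  proof -
   have "subspace K {a\<in>A. a ._M s\<in>W} A"
   proof (rule subspaceI[OF vs_A])
    show "0_A\<in>{a\<in>A. a ._M s\<in>W}" using WD(3) Sc[OF that(1)] by simp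
    fix c x assume c: "c\<in>K" and x: "x\<in>{a\<in>A. a ._M s\<in>W}"
    have "(c ._A x) ._M s = sc c ._M (x ._M s)"
     using ract_mult[of x "sc c" s] sc_facts c x Sc[OF that(1)] by simp
    thus "c ._A x\<in>{a\<in>A. a ._M s\<in>W}" using WD(5) c x by simp
   qed (use WD(4) Sc[OF that(1)] ract_add_ring in auto)
   hence "carrier A <= {a\<in>A. a ._M s\<in>W}"
    by (rule B(3)) (use B(2) TW that(1) in auto)
   thus ?thesis using that by auto
  qed
  \<comment> \<open>The elements whose whole orbit stays in the subspace \<open>W\<close> form the
    largest submodule inside \<open>W\<close>; it contains the generators.\<close>
  have "sbm {x\<in>M. \<forall>a\<in>A. a ._M x\<in>W} M"
   by (rule right_submoduleI) (use WD in \<open>auto simp: ract_add ract_closed simp flip: ract_mult\<close>)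
  hence "carrier M <= {x\<in>M. \<forall>a\<in>A. a ._M x\<in>W}"
   by (rule S(3)) (use gen Sc in auto)
  thus "carrier (us M) <= W" using ract_one by force
 qed
qed

lemma MC_rm [simp]: "M\<in>MC ==> rm M" by (simp add: MC_iff)

lemma fd_surj:
 assumes "rm M" "fdvs K (us M)" "rm N" "f\<in>mh M N" "f ` M = carrier N"
 shows "fdvs K (us N)"
 using fdvs_surj(1)[OF assms(2) vs_us[OF assms(3)] hom_us[OF assms(4)]] assms(5) by simp

lemma MC_sub: "M\<in>MC ==> sbm U M ==> M(|carrier:=U|)\<in>MC"
 unfolding MC_iff using right_module.right_module_submodule fdvs_subspace(1) subspace_us by fastforce

lemma MC_zmod: "zmod\<in>MC"
 unfolding MC_iff using right_module_zmod[OF ring_A] fdvs_zero(1)[OF vs_us] by fastforce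

lemma MC_bsum [simp]:
 assumes M: "M\<in>MC" and N: "N\<in>MC"
 shows "M [+] N\<in>MC"
proof -
 have r: "rm M" "rm N" "rm (M [+] N)" using M N right_module_bsum[of A M N] by simp_all
 note h = bsum_homs[OF r(1,2)]
 interpret M: right_module A M by (rule r)
 interpret N: right_module A N by (rule r)
 obtain S where S: "finite S" "S <= carrier M" "!!U. sbm U M ==> S <= U ==> carrier M <= U"
  using M fd_gen[OF r(1)] by (auto simp: MC_iff)
 obtain T where T: "finite T" "T <= carrier N" "!!U. sbm U N ==> T <= U ==> carrier N <= U"
  using N fd_gen[OF r(2)] by (auto simp: MC_iff)
 have "fdvs K (us (M [+] N))" unfolding fd_gen[OF r(3)]
 proof (intro exI[of _ "(%x. jn x 0_N) ` S \<union> (%y. jn 0_M y) ` T"] conjI allI impI)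
  fix U assume U: "sbm U (M [+] N)" "(%x. jn x 0_N) ` S \<union> (%y. jn 0_M y) ` T <= U"
  have 1: "carrier M <= {x\<in>M. jn x 0_N\<in>U}"
   by (rule S(3), rule hom_more(6)[OF h(3) r(1,3) U(1)]) (use S U in auto)
  have 2: "carrier N <= {y\<in>N. jn 0_M y\<in>U}"
   by (rule T(3), rule hom_more(6)[OF h(4) r(2,3) U(1)]) (use T U in auto)
  show "carrier (M [+] N) <= U"
  proof
   fix z assume z: "z\<in>(M [+] N)"
   hence "jn (pr1 z) 0_N +_(M [+] N) jn 0_M (pr2 z)\<in>U"
    using 1 2 by (intro right_module.right_submoduleD(3)[OF r(3) U(1)]) auto
   thus "z\<in>U" using z by simp
  qed
 qed (use S T in auto)
 thus ?thesis using r(3) by (simp add: MC_iff)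
qed

lemma fd_realize:
 assumes "rm M" "fdvs K (us M)"
 obtains Y f where "Y\<in>MC" "f\<in>mh M Y" "bij_betw f (carrier M) (carrier Y)"
proof -
 interpret right_module A M by fact
 obtain r :: "_ \<Rightarrow> nat \<Rightarrow> 'k" where r: "inj_on r M"
  using fdvs_inj_into_functions[OF assms(2)] by auto
 have c1: "r (x +_M y) = r (x' +_M y')"
  if "x\<in>M" "x'\<in>M" "y\<in>M" "y'\<in>M" "r x = r x'" "r y = r y'"
  for x x' y y' using that r by (metis inj_onD)
 have c2: "r (a ._M x) = r (a ._M x')"
  if "a\<in>A" "x\<in>M" "x'\<in>M" "r x = r x'" for a x x' using that r by (metis inj_onD)
 have i: "rm (img_mod r M)" "r\<in>mh M (img_mod r M)" "carrier (img_mod r M) = r ` M"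
  "0_(img_mod r M) = r 0_M"
  by (rule img_mod[OF assms(1)]; (rule c1 c2; assumption))+
 have "img_mod r M\<in>MC"
  unfolding MC_iff using i(1) fd_surj[OF assms i(1,2) i(3)[symmetric]] by blast
 moreover have "bij_betw r (carrier M) (carrier (img_mod r M))" unfolding i(3) using r by (rule inj_on_imp_bij_betw)
 ultimately show ?thesis using that i(2) by blast
qed

text \<open>The quotient lives on chosen coset representatives instead of cosets, so that it has the
  element type of \<open>M\<close>; \<open>r\<close> picks the representative.\<close>

lemma quotient_exists:
 assumes "M\<in>MC" "sbm U M"
 obtains Q q where "Q\<in>MC" "q\<in>mh M Q" "q ` M = carrier Q"
  "!!x. x\<in>M ==> q x = 0_Q <-> x\<in>U"
proof -
 have rm: "rm M" using assms by simp
 interpret right_module A M by (rule rm)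
 note U = right_submoduleD[OF assms(2)]
 have Uc: "x\<in>M" if "x\<in>U" for x using U(1) that by auto
 define r where "r x = (SOME y. y\<in>M & y -_M x\<in>U)" for x
 have cls: "x -_M z\<in>U" if "x\<in>M" "y\<in>M" "z\<in>M" "x -_M y\<in>U" "y -_M z\<in>U" for x y z
 proof -
  have "x -_M z = (x -_M y) +_M (y -_M z)"
   using that(1-3) by (simp add: M.minus_eq M.a_assoc M.r_neg1)
  thus ?thesis using U(3) that by simp
 qed
 have sym: "y -_M x\<in>U" if "x\<in>M" "y\<in>M" "x -_M y\<in>U" for x y
  using U(5)[OF that(3)] that(1,2) by (simp add: M.minus_eq M.minus_add M.a_comm)
 have rr: "r x\<in>M" "r x -_M x\<in>U" if "x\<in>M" for x
  using someI[of "%y. y\<in>M & y -_M x\<in>U" x] that U(2)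
  by (auto simp: r_def M.minus_eq M.r_neg)
 have re: "r x = r y <-> x -_M y\<in>U" if "x\<in>M" "y\<in>M" for x y
 proof
  assume "r x = r y"
  thus "x -_M y\<in>U" using cls[OF that(1) rr(1)[OF that(1)] that(2)] sym rr that by metis
 next
  assume u: "x -_M y\<in>U"
  have "(z\<in>M & z -_M x\<in>U) = (z\<in>M & z -_M y\<in>U)" for z
   using cls[of z x y] cls[of z y x] u sym[OF that u] that by blast
  thus "r x = r y" by (simp add: r_def)
 qed
 have c1: "r (x +_M y) = r (x' +_M y')"
  if "x\<in>M" "x'\<in>M" "y\<in>M" "y'\<in>M" "r x = r x'" "r y = r y'"
  for x x' y y'
 proof -
  have "(x +_M y) -_M (x' +_M y') = (x -_M x') +_M (y -_M y')"
   using that(1-4) by (simp add: M.minus_eq M.minus_add M.a_ac)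
  thus ?thesis using that U(3) by (simp add: re)
 qed
 have c2: "r (a ._M x) = r (a ._M x')"
  if "a\<in>A" "x\<in>M" "x'\<in>M" "r x = r x'" for a x x'
 proof -
  have "(a ._M x) -_M (a ._M x') = a ._M (x -_M x')"
   using that(1-3) by (simp add: M.minus_eq ract_add ract_minus)
  thus ?thesis using that U(4) by (simp add: re ract_closed)
 qed
 have i: "rm (img_mod r M)" "r\<in>mh M (img_mod r M)" "carrier (img_mod r M) = r ` M"
  "0_(img_mod r M) = r 0_M"
  by (rule img_mod[OF rm]; (rule c1 c2; assumption))+
 have "fdvs K (us M)" using assms(1) by (simp add: MC_iff)
 hence "img_mod r M\<in>MC"
  unfolding MC_iff using i(1) fd_surj[OF rm _ i(1,2) i(3)[symmetric]] by blast
 have mz: "x -_M 0_M = x" if "x\<in>M" for x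
 proof -
  have "-_M 0_M = 0_M" by (rule M.minus_equality) auto
  thus ?thesis unfolding M.minus_eq using that by simp
 qed
 have "r x = 0_(img_mod r M) <-> x\<in>U" if "x\<in>M" for x
  unfolding i(4) re[OF that M.zero_closed] using that mz by simp
 thus ?thesis using \<open>img_mod r M \<in> MC\<close> that i(2) i(3)[symmetric] by blast
qed

lemma factor_surj:
 assumes "rm M" "rm Q" "rm N" "q\<in>mh M Q" "q ` M = carrier Q" "f\<in>mh M N"
  "!!x. x\<in>M ==> q x = 0_Q ==> f x = 0_N"
 obtains h where "h\<in>mh Q N" "!!x. x\<in>M ==> h (q x) = f x"
proof -
 interpret M: right_module A M by fact
 interpret Q: right_module A Q by fact
 interpret N: right_module A N by fact
 note qD = homD[OF assms(4)] and fD = homD[OF assms(6)]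
 define h where "h y = f (inv_into (carrier M) q y)" for y
 have hq: "h (q x) = f x" if x: "x\<in>M" for x
 proof -
  define x' where "x' = inv_into (carrier M) q (q x)"
  have x': "x'\<in>M" "q x' = q x" using x by (auto simp: x'_def f_inv_into_f inv_into_into)
  hence "q (x' -_M x) = 0_Q" using x hom_more(3)[OF assms(4,1,2)] qD(1) by simp
  hence "f (x' -_M x) = 0_N" using assms(7) x x' by simp
  hence "f x' = f x" using x x' hom_more(3)[OF assms(6,1,3)] fD(1) by simp
  thus ?thesis by (simp add: h_def x'_def)
 qed
 have "h\<in>mh Q N"
 proof (rule homI)
  fix y assume "y\<in>Q"
  then obtain x where x: "x\<in>M" "y = q x" using assms(5) by auto
  show "h y\<in>N" using x hq fD by simp
  show "h (a ._Q y) = a ._N h y" if "a\<in>A" for a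
   using x hq[of x] hq[of "a ._M x"] fD qD that M.ract_closed by simp
  fix z assume "z\<in>Q"
  then obtain w where w: "w\<in>M" "z = q w" using assms(5) by auto
  show "h (y +_Q z) = h y +_N h z"
   using x w hq[of x] hq[of w] hq[of "x +_M w"] fD qD by simp
 qed
 thus ?thesis using that hq by blast
qed

lemma regular_simps [simp]:
 "carrier (regular_module A) = carrier A" "0_(regular_module A) = 0_A"
 "x +_(regular_module A) y = x +_A y" "a ._(regular_module A) x = x *_A a"
 by (simp_all add: regular_module_def)

lemma rm_regular: "rm (regular_module A)"
proof -
 interpret ring A by (rule ring_A)
 show ?thesis
 proof (rule right_moduleI)
  show "abelian_group (regular_module A)"
  proof (rule abelian_groupI)
   fix x assume "x\<in>carrier (regular_module A)"
   thus "\<exists>y\<in>carrier (regular_module A). y +_(regular_module A) x = 0_(regular_module A)"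
    by (intro bexI[of _ "-_A x"]) (auto simp: l_neg)
  qed (auto simp: a_ac)
 qed (auto simp: ring_A l_distr r_distr m_assoc)
qed

lemma fd_regular: "fdvs K (us (regular_module A))"
proof -
 interpret R: ring A by (rule ring_A)
 show ?thesis unfolding fd_gen[OF rm_regular]
 proof (intro exI[of _ "{1_A}"] conjI allI impI subsetI)
  fix U x assume "sbm U (regular_module A)" "{1_A} <= U" "x\<in>carrier (regular_module A)"
  thus "x\<in>U" using right_module.right_submoduleD(4)[OF rm_regular, of U x "1_A"] by simp
 qed auto
qed

text \<open>The elements of the regular module are those of the algebra; \<open>AA\<close> is a copy
  of it among the coordinate modules.\<close>

definition AA where "AA = (SOME Y. Y\<in>MC & mod_iso A (regular_module A) Y)"

lemma AA: "AA\<in>MC" "mod_iso A (regular_module A) AA"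
proof -
 have "\<exists>Y. Y\<in>MC & mod_iso A (regular_module A) Y"
  using fd_realize[OF rm_regular fd_regular] unfolding mod_iso_def by metis
 from someI_ex[OF this] show "AA\<in>MC" "mod_iso A (regular_module A) AA" by (auto simp: AA_def)
qed

text \<open>\<open>u\<close> corresponds to the unit of the algebra and is a free generator.\<close>

lemma AA_generator:
 obtains u where "u\<in>AA" "!!M x. M\<in>MC ==> x\<in>M ==> \<exists>h\<in>mh AA M. h u = x"
  "!!y. y\<in>AA ==> \<exists>a\<in>A. y = a ._AA u"
proof -
 interpret R: ring A by (rule ring_A)
 obtain f where f: "f\<in>mh (regular_module A) AA" "bij_betw f (carrier A) (carrier AA)"
  using AA(2) by (auto simp: mod_iso_def)
 note v = hom_inv[OF f(1) _ rm_regular, simplified, OF f(2)]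
 let ?u = "f 1_A"
 show ?thesis
 proof (rule that[of ?u])
  show "?u\<in>AA" using homD(1)[OF f(1)] by simp
 next
  fix M x assume M: "M\<in>MC" and x: "x\<in>M"
  interpret right_module A M by (rule MC_rm[OF M])
  have "(%a. a ._M x)\<in>mh (regular_module A) M"
   by (rule homI) (auto simp: ract_closed ract_add_ring ract_mult x)
  from hom_comp[OF v(1) this] show "\<exists>h\<in>mh AA M. h ?u = x"
   by (rule bexI[rotated]) (use v(3) x ract_one in simp)
 next
  fix y assume y: "y\<in>AA"
  let ?a = "inv_into (carrier A) f y"
  have a: "?a\<in>A" "f ?a = y" using v(4)[OF y] homD(1)[OF v(1) y] by auto
  hence "y = ?a ._AA ?u" using homD(3)[OF f(1), of ?a "1_A"] by simp
  thus "\<exists>a\<in>A. y = a ._AA ?u" using a(1) by blast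
 qed
qed

definition dm where "dm M = vectorspace.dim K (us M)"

lemma dm_sub:
 assumes "M\<in>MC" "sbm U M" "U ~= carrier M"
 shows "dm (M(|carrier:=U|)) < dm M"
proof -
 have r: "rm M" "fdvs K (us M)" using assms by (auto simp: MC_iff)
 note s = fdvs_subspace(2,3)[OF r(2) subspace_us[OF r(1) assms(2)]]
 show ?thesis using s assms(3) by (fastforce simp: dm_def)
qed

lemma dm_inj:
 assumes "M\<in>MC" "N\<in>MC" "f\<in>mh M N" "inj_on f M"
 shows "dm M <= dm N" "dm M = dm N <-> f ` M = carrier N"
 using fdvs_inj(2,3)[OF vs_us _ hom_us[OF assms(3)], simplified] assms by (auto simp: MC_iff dm_def)

lemma dm_surj:
 assumes "M\<in>MC" "N\<in>MC" "f\<in>mh M N" "f ` M = carrier N"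
 shows "dm N <= dm M" "dm M = dm N <-> inj_on f M"
 using fdvs_surj(2,3)[OF _ vs_us hom_us[OF assms(3)], simplified] assms by (auto simp: MC_iff dm_def)

lemma endo_inj_iff_surj:
 assumes "M\<in>MC" "f\<in>mh M M"
 shows "inj_on f M <-> f ` M = carrier M"
 using dm_inj(2)[OF assms(1,1,2)] dm_surj(2)[OF assms(1,1,2)] by auto

section \<open>Dimensions of spaces of homomorphisms\<close>

definition hs ::
 "('a, 'm, 'z) module_scheme \<Rightarrow> ('a, 'n, 'w) module_scheme \<Rightarrow> ('k, 'm \<Rightarrow> 'n) module" where
 "hs M N = (|carrier = Hom A M N, monoid.mult = undefined, one = undefined,
   zero = (\<lambda>x\<in>M. 0_N), add = (%f g. \<lambda>x\<in>M. f x +_N g x),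
   smult = (%c f. \<lambda>x\<in>M. sc c ._N f x)|)"

definition hd where "hd M N = vectorspace.dim K (hs M N)"

lemma Hom_iff: "f\<in>Hom A M N <-> f\<in>mh M N & f\<in>extensional M"
 by (simp add: Hom_def)

lemma restrict_Hom: "f\<in>mh M N ==> rm M ==> restrict f M\<in>Hom A M N"
 unfolding Hom_iff using hom_cong[of f A M N "restrict f M"] by simp

lemma Hom_ext: "f\<in>Hom A M N ==> g\<in>Hom A M N ==> (!!x. x\<in>M ==> f x = g x) ==> f = g"
 unfolding Hom_iff by (blast intro: extensionalityI)

lemma module_hom_scale:
 assumes "f\<in>mh M N" "rm N" "c\<in>K"
 shows "(%x. sc c ._N f x)\<in>mh M N"
proof -
 interpret right_module A N by fact
 note f = homD[OF assms(1)]
 interpret R: ring A by (rule ring_A)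
 have "a ._N (sc c ._N y) = sc c ._N (a ._N y)" if "a\<in>A" "y\<in>N" for a y
  using ract_mult[of a "sc c" y] ract_mult[of "sc c" a y] sc_facts assms(3) that by simp
 thus ?thesis
  by (intro homI) (auto simp: f ract_add ract_closed sc_facts(1)[OF assms(3)])
qed

lemma hs_simps [simp]:
 "carrier (hs M N) = Hom A M N" "0_(hs M N) = (\<lambda>x\<in>M. 0_N)"
 "f +_(hs M N) g = (\<lambda>x\<in>M. f x +_N g x)"
 "c ._(hs M N) f = (\<lambda>x\<in>M. sc c ._N f x)"
 by (simp_all add: hs_def)

lemma vs_hs:
 assumes "rm M" "rm N"
 shows "vectorspace K (hs M N)"
proof -
 interpret M: right_module A M by fact
 interpret N: right_module A N by fact
 interpret U: vectorspace K "us N" by (rule vs_us[OF assms(2)])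
 have c: "f x\<in>N" if "f\<in>Hom A M N" "x\<in>M" for f x
  using that by (auto simp: Hom_iff dest: homD(1))
 have e: "f x = undefined" if "f\<in>Hom A M N" "x \<notin> carrier M" for f x
  using that by (auto simp: Hom_iff extensional_def)
 note ub = U.smult_assoc1[simplified] U.smult_one[simplified] U.smult_l_distr[simplified]
  U.smult_r_distr[simplified] U.smult_closed[simplified]
 show ?thesis
 proof (rule vs_criteria[OF field_K], simp_all, goal_cases)
  case 1 show ?case by (rule restrict_Hom[OF hom_0[OF assms(2)] assms(1)])
 next
  case 2 show ?case using restrict_Hom[OF hom_add[OF _ _ assms(2)] assms(1)] by (auto simp: Hom_iff)
 next
  case 3
  show ?case
  proof
   fix v assume v: "v\<in>Hom A M N"
   have "(\<lambda>x\<in>M. 0_N -_N v x)\<in>Hom A M N"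
    by (rule restrict_Hom[OF hom_diff[OF hom_0[OF assms(2)] _ assms(2)] assms(1)])
     (use v in \<open>simp add: Hom_iff\<close>)
   thus "\<exists>g\<in>Hom A M N. (\<lambda>x\<in>M. v x +_N g x) = (\<lambda>x\<in>M. 0_N)"
    by (rule bexI[rotated]) (use c[OF v] in \<open>auto simp: fun_eq_iff N.M.minus_eq N.M.r_neg\<close>)
  qed
 next
  case 4 show ?case using restrict_Hom[OF module_hom_scale[OF _ assms(2)] assms(1)] by (auto simp: Hom_iff)
 next
  case 5 show ?case using c by (auto simp: fun_eq_iff N.M.a_comm)
 next
  case 6 show ?case using c by (auto simp: fun_eq_iff N.M.a_assoc)
 next
  case 7 show ?case using c by (auto simp: fun_eq_iff e)
 next
  case 8 show ?case using c ub by (auto simp: fun_eq_iff)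
 next
  case 9 show ?case using c ub by (auto simp: fun_eq_iff e)
 next
  case 10 show ?case using c ub by (auto simp: fun_eq_iff)
 next
  case 11 show ?case using c ub by (auto simp: fun_eq_iff)
 qed
qed

text \<open>A homomorphism is determined by its values on generators. The induction handles one
  generator at a time: evaluation at \<open>t\<close> has values in the finite dimensional
  \<open>N\<close>, and its kernel satisfies the hypothesis for the remaining generators.\<close>

lemma fdvs_hs:
 assumes M: "M\<in>MC" and N: "N\<in>MC"
 shows "fdvs K (hs M N)"
proof -
 have r: "rm M" "rm N" using M N by auto
 note v = vs_hs[OF r]
 obtain S where S: "finite S" "S <= carrier M" "!!U. sbm U M ==> S <= U ==> carrier M <= U"
  using M fd_gen[OF r(1)] by (auto simp: MC_iff)
 have "fdvs K ((hs M N)(|carrier:=W|))"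
  if "finite T" "T <= carrier M" "subspace K W (hs M N)"
   "!!f. f\<in>W ==> (\<forall>x\<in>T. f x = 0_N) ==> f = 0_(hs M N)" for T W
  using that
 proof (induction T arbitrary: W rule: finite_induct)
  case empty
  have "W = {0_(hs M N)}" using empty(3) subspaceD(3)[OF empty(2)] by blast
  thus ?case by (intro fdvs_zero(1)[OF subspaceD(6)[OF empty(2)]]) simp
 next
  case (insert t T)
  note WD = subspaceD[OF insert.prems(2)]
  let ?V = "(hs M N)(|carrier:=W|)"
  have h: "(%f. f t)\<in>module_hom K ?V (us N)"
  proof (rule homI)
   show "f t\<in>(us N)" if "f\<in>carrier ?V" for f
    using that WD(2) insert.prems(1) homD(1) by (force simp: Hom_iff)
  qed (use insert.prems(1) in auto)
  note lf = linear_map_facts[OF WD(6) vs_us[OF r(2)] h]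
  let ?L = "lker ?V (us N) (%f. f t)"
  note LD = subspaceD[OF lf(1)]
  have Ls: "subspace K ?L (hs M N)"
   by (rule subspaceI[OF v]) (use LD(2-5) WD(2) in auto)
  have "fdvs K ((hs M N)(|carrier:=?L|))"
   by (rule insert.IH[OF _ Ls]) (use insert.prems in \<open>auto simp: lker_def\<close>)
  thus ?case using lf(5) N by (simp add: MC_iff)
 qed
 note main = this[OF S(1,2)]
 have "fdvs K ((hs M N)(|carrier:=carrier (hs M N)|))"
 proof (rule main)
  interpret vectorspace K "hs M N" by (rule v)
  show "subspace K (carrier (hs M N)) (hs M N)"
   by (rule subspaceI[OF v]) (use module.M.zero_closed module.M.a_closed smult_closed in blast)+
  fix f assume f: "f\<in>carrier (hs M N)" "\<forall>x\<in>S. f x = 0_N"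
  hence fh: "f\<in>mh M N" by (simp add: Hom_iff)
  have "carrier M <= {x\<in>M. f x = 0_N}"
   by (rule S(3)[OF hom_more(4)[OF fh r]]) (use f(2) S(2) in auto)
  thus "f = 0_(hs M N)" using f(1) by (intro ext) (auto simp: Hom_iff extensional_def)
 qed
 thus ?thesis by (simp add: hs_def)
qed

text \<open>This is surjectivity of \<open>Hom(f, Z)\<close> from \<open>Hom(P0, Z)\<close> to
  \<open>Hom(P1, Z)\<close>, and \<open>N0\<close> below is its injectivity.\<close>

definition E0 where
 "E0 P1 P0 f Z <-> (\<forall>g\<in>mh P1 Z. \<exists>h\<in>mh P0 Z. \<forall>x\<in>P1. h (f x) = g x)"

definition N0 where
 "N0 P1 P0 f Z <-> (\<forall>h\<in>mh P0 Z. (\<forall>x\<in>P1. h (f x) = 0_Z) --> (\<forall>y\<in>P0. h y = 0_Z))"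

text \<open>\<open>Hom(f, Z)\<close> is linear, so whether it is onto or injective decides how the
  dimensions of its two ends compare. In this way vanishing of spaces of homomorphisms becomes
  information about indices.\<close>

lemma hd_compare:
 assumes "P1\<in>MC" "P0\<in>MC" "Z\<in>MC" "f\<in>mh P1 P0"
 shows "E0 P1 P0 f Z ==> N0 P1 P0 f Z ==> hd P0 Z = hd P1 Z"
  "E0 P1 P0 f Z ==> ~ N0 P1 P0 f Z ==> hd P0 Z > hd P1 Z"
  "~ E0 P1 P0 f Z ==> N0 P1 P0 f Z ==> hd P0 Z < hd P1 Z"
proof -
 have r: "rm P1" "rm P0" "rm Z" using assms by auto
 note v1 = vs_hs[OF r(1,3)] and v0 = vs_hs[OF r(2,3)]
 note d1 = fdvs_hs[OF assms(1,3)] and d0 = fdvs_hs[OF assms(2,3)]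
 note fD = homD[OF assms(4)]
 define T where "T h = (\<lambda>x\<in>P1. h (f x))" for h :: "(nat \<Rightarrow> 'k) \<Rightarrow> (nat \<Rightarrow> 'k)"
 have T: "T h\<in>Hom A P1 Z" if "h\<in>Hom A P0 Z" for h
  unfolding T_def using restrict_Hom[OF hom_comp[OF assms(4)] r(1)] that by (auto simp: Hom_iff)
 have lin: "T\<in>module_hom K (hs P0 Z) (hs P1 Z)"
 proof (rule homI)
  show "T x\<in>carrier (hs P1 Z)" if "x\<in>carrier (hs P0 Z)" for x using T that by simp
 qed (auto simp: T_def fD fun_eq_iff)
 have surj: "T ` Hom A P0 Z = Hom A P1 Z <-> E0 P1 P0 f Z"
 proof
  assume s: "T ` Hom A P0 Z = Hom A P1 Z"
  show "E0 P1 P0 f Z" unfolding E0_def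
  proof
   fix g assume "g\<in>mh P1 Z"
   hence "restrict g P1\<in>T ` Hom A P0 Z" unfolding s using r(1) by (rule restrict_Hom)
   then obtain h where h: "h\<in>Hom A P0 Z" "restrict g P1 = T h" by auto
   have "\<forall>x\<in>P1. h (f x) = g x"
    using fun_cong[OF h(2)] by (metis T_def restrict_apply')
   thus "\<exists>h\<in>mh P0 Z. \<forall>x\<in>P1. h (f x) = g x" using h by (auto simp: Hom_iff)
  qed
 next
  assume E: "E0 P1 P0 f Z"
  show "T ` Hom A P0 Z = Hom A P1 Z"
  proof (intro equalityI subsetI)
   fix g assume g: "g\<in>Hom A P1 Z"
   then obtain h where h: "h\<in>mh P0 Z" "\<forall>x\<in>P1. h (f x) = g x"
    using E by (auto simp: E0_def Hom_iff)
   have rh: "restrict h P0\<in>Hom A P0 Z" by (rule restrict_Hom[OF h(1) r(2)])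
   have "T (restrict h P0) = g"
    by (rule Hom_ext[OF T[OF rh] g]) (use h(2) fD in \<open>auto simp: T_def\<close>)
   thus "g\<in>T ` Hom A P0 Z" using rh by blast
  qed (use T in auto)
 qed
 have inj: "inj_on T (Hom A P0 Z) <-> N0 P1 P0 f Z"
 proof -
  have "inj_on T (carrier (hs P0 Z)) <-> lker (hs P0 Z) (hs P1 Z) T = {0_(hs P0 Z)}"
   by (rule linear_map_facts(3)[OF v0 v1 lin])
  also have "\<dots> <-> N0 P1 P0 f Z"
  proof
   assume l: "lker (hs P0 Z) (hs P1 Z) T = {0_(hs P0 Z)}"
   show "N0 P1 P0 f Z" unfolding N0_def
   proof (intro ballI impI)
    fix h y assume h: "h\<in>mh P0 Z" "\<forall>x\<in>P1. h (f x) = 0_Z" and y: "y\<in>P0"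
    have "restrict h P0\<in>lker (hs P0 Z) (hs P1 Z) T"
     using restrict_Hom[OF h(1) r(2)] h(2) fD by (auto simp: lker_def T_def fun_eq_iff)
    hence "restrict h P0 = (\<lambda>x\<in>P0. 0_Z)" using l by simp
    thus "h y = 0_Z" using y by (metis restrict_apply')
   qed
  next
   assume N: "N0 P1 P0 f Z"
   have "h = 0_(hs P0 Z)" if "h\<in>lker (hs P0 Z) (hs P1 Z) T" for h
   proof -
    have h: "h\<in>Hom A P0 Z" "T h = (\<lambda>x\<in>P1. 0_Z)" using that by (auto simp: lker_def)
    have "\<forall>x\<in>P1. h (f x) = 0_Z" using fun_cong[OF h(2)] by (metis T_def restrict_apply')
    hence "\<forall>y\<in>P0. h y = 0_Z" using N h(1) by (auto simp: N0_def Hom_iff)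
    thus ?thesis using h(1) by (intro ext) (auto simp: Hom_iff extensional_def)
   qed
   moreover have "0_(hs P0 Z)\<in>lker (hs P0 Z) (hs P1 Z) T"
    using subspaceD(3)[OF linear_map_facts(1)[OF v0 v1 lin]] .
   ultimately show "lker (hs P0 Z) (hs P1 Z) T = {0_(hs P0 Z)}" by blast
  qed
  finally show ?thesis by simp
 qed
 note i = fdvs_inj(2,3)[OF v0 d1 lin, simplified] and s = fdvs_surj(2,3)[OF d0 v1 lin, simplified]
 show "hd P0 Z = hd P1 Z" if "E0 P1 P0 f Z" "N0 P1 P0 f Z"
  using s(2) surj inj that unfolding hd_def by blast
 show "hd P0 Z > hd P1 Z" if "E0 P1 P0 f Z" "~ N0 P1 P0 f Z"
 proof -
  have "hd P0 Z ~= hd P1 Z" using s(2) surj inj that unfolding hd_def by blast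
  moreover have "hd P0 Z \<ge> hd P1 Z" using s(1) surj that unfolding hd_def by linarith
  ultimately show ?thesis by simp
 qed
 show "hd P0 Z < hd P1 Z" if "~ E0 P1 P0 f Z" "N0 P1 P0 f Z"
 proof -
  have "hd P0 Z ~= hd P1 Z" using i(2) surj inj that unfolding hd_def by blast
  moreover have "hd P0 Z <= hd P1 Z" using i(1) inj that unfolding hd_def by blast
  ultimately show ?thesis by simp
 qed
qed

lemma hd_iso:
 assumes "M\<in>MC" "N\<in>MC" "Z\<in>MC" "f\<in>mh M N" "bij_betw f (carrier M) (carrier N)"
 shows "hd M Z = hd N Z"
proof -
 note v = hom_inv[OF assms(4,5) MC_rm[OF assms(1)]]
 have "E0 M N f Z" unfolding E0_def
 proof
  fix g assume "g\<in>mh M Z"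
  from hom_comp[OF v(1) this] show "\<exists>h\<in>mh N Z. \<forall>x\<in>M. h (f x) = g x"
   by (rule bexI[rotated]) (use v(3) in auto)
 qed
 moreover have "N0 M N f Z" unfolding N0_def by (auto simp flip: bij_betw_imp_surj_on[OF assms(5)])
 ultimately show ?thesis using hd_compare(1)[OF assms(1-4)] by simp
qed

lemma hd_zero:
 assumes "M\<in>MC" "Z\<in>MC" "!!h x. h\<in>mh M Z ==> x\<in>M ==> h x = 0_Z"
 shows "hd M Z = 0"
proof -
 have v: "vectorspace K (hs M Z)" by (intro vs_hs MC_rm assms(1,2))
 have "f = (\<lambda>x\<in>M. 0_Z)" if "f\<in>Hom A M Z" for f
  using that assms(3) by (intro ext) (auto simp: Hom_iff extensional_def)
 moreover have "(\<lambda>x\<in>M. 0_Z)\<in>Hom A M Z"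
  by (intro restrict_Hom hom_0 MC_rm assms(1,2))
 ultimately have "carrier (hs M Z) = {0_(hs M Z)}" unfolding hs_simps by blast
 thus ?thesis unfolding hd_def by (rule fdvs_zero(2)[OF v])
qed

text \<open>Restriction to \<open>M\<close> is onto, and its kernel is isomorphic to
  \<open>Hom(N, Z)\<close>.\<close>

lemma hd_bsum:
 assumes M: "M\<in>MC" and N: "N\<in>MC" and Z: "Z\<in>MC"
 shows "hd (M [+] N) Z = hd M Z + hd N Z"
proof -
 have r: "rm M" "rm N" "rm Z" "rm (M [+] N)" using assms by auto
 interpret Z: right_module A Z by (rule r)
 interpret M: right_module A M by (rule r)
 interpret N: right_module A N by (rule r)
 note h = bsum_homs[OF r(1,2)]
 note vS = vs_hs[OF r(4,3)] and vM = vs_hs[OF r(1,3)] and vN = vs_hs[OF r(2,3)]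
 define T where "T g = (\<lambda>x\<in>M. g (jn x 0_N))" for g :: "(nat \<Rightarrow> 'k) \<Rightarrow> (nat \<Rightarrow> 'k)"
 have T: "T g\<in>Hom A M Z" if "g\<in>Hom A (M [+] N) Z" for g
  unfolding T_def using restrict_Hom[OF hom_comp[OF h(3)] r(1)] that by (auto simp: Hom_iff)
 have lin: "T\<in>module_hom K (hs (M [+] N) Z) (hs M Z)"
 proof (rule homI)
  show "T x\<in>carrier (hs M Z)" if "x\<in>carrier (hs (M [+] N) Z)" for x using T that by simp
 qed (auto simp: T_def fun_eq_iff)
 have surj: "T ` carrier (hs (M [+] N) Z) = carrier (hs M Z)"
 proof (intro equalityI subsetI)
  fix g assume g: "g\<in>carrier (hs M Z)"
  hence gm: "g\<in>mh M Z" by (simp add: Hom_iff)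
  let ?g = "restrict (%z. g (pr1 z)) (carrier (M [+] N))"
  have gg: "?g\<in>Hom A (M [+] N) Z" by (rule restrict_Hom[OF hom_comp[OF h(1) gm] r(4)])
  have "T ?g = g" by (rule Hom_ext[OF T[OF gg]]) (use g in \<open>auto simp: T_def\<close>)
  thus "g\<in>T ` carrier (hs (M [+] N) Z)" using gg by force
 qed (use T in auto)
 have dS: "fdvs K (hs (M [+] N) Z)" using fdvs_hs assms by simp
 have 1: "hd (M [+] N) Z = hd M Z + vectorspace.dim K ((hs (M [+] N) Z)(|carrier:=lker (hs (M [+] N) Z) (hs M Z) T|))"
  unfolding hd_def by (rule fdvs_surj(2)[OF dS vM lin surj])
 let ?L = "(hs (M [+] N) Z)(|carrier:=lker (hs (M [+] N) Z) (hs M Z) T|)"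
 have sub: "subspace K (lker (hs (M [+] N) Z) (hs M Z) T) (hs (M [+] N) Z)"
  by (rule linear_map_facts(1)[OF vS vM lin])
 have Lk: "g\<in>carrier ?L <-> g\<in>Hom A (M [+] N) Z & (\<forall>x\<in>M. g (jn x 0_N) = 0_Z)" for g
  by (auto simp: lker_def T_def fun_eq_iff)
 define R where "R g = (\<lambda>y\<in>N. g (jn 0_M y))" for g :: "(nat \<Rightarrow> 'k) \<Rightarrow> (nat \<Rightarrow> 'k)"
 have R: "R g\<in>Hom A N Z" if "g\<in>Hom A (M [+] N) Z" for g
  unfolding R_def using restrict_Hom[OF hom_comp[OF h(4)] r(2)] that by (auto simp: Hom_iff)
 have linR: "R\<in>module_hom K ?L (hs N Z)"
 proof (rule homI)
  show "R x\<in>carrier (hs N Z)" if "x\<in>carrier ?L" for x using R that Lk by simp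
 qed (auto simp: R_def fun_eq_iff)
 have inj: "inj_on R (carrier ?L)"
 proof (rule inj_onI)
  fix g g' assume g: "g\<in>carrier ?L" "g'\<in>carrier ?L" "R g = R g'"
  have gm: "g\<in>mh (M [+] N) Z" "g'\<in>mh (M [+] N) Z" using g Lk by (auto simp: Hom_iff)
  show "g = g'"
  proof (rule Hom_ext)
   show "g\<in>Hom A (M [+] N) Z" "g'\<in>Hom A (M [+] N) Z" using g Lk by auto
   fix z assume z: "z\<in>(M [+] N)"
   have e: "z = jn (pr1 z) 0_N +_(M [+] N) jn 0_M (pr2 z)" using z by simp
   have q: "k z = k (jn (pr1 z) 0_N) +_Z k (jn 0_M (pr2 z))" if "k\<in>mh (M [+] N) Z" for k
    by (subst e, rule homD(2)[OF that]) (use z in auto)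
   have "g (jn 0_M (pr2 z)) = g' (jn 0_M (pr2 z))"
    using fun_cong[OF g(3), of "pr2 z"] z by (simp add: R_def)
   thus "g z = g' z" using q[OF gm(1)] q[OF gm(2)] g Lk z by simp
  qed
 qed
 have surjR: "R ` carrier ?L = carrier (hs N Z)"
 proof (intro equalityI subsetI)
  fix g assume g: "g\<in>carrier (hs N Z)"
  hence gm: "g\<in>mh N Z" by (simp add: Hom_iff)
  let ?g = "restrict (%z. g (pr2 z)) (carrier (M [+] N))"
  have gg: "?g\<in>Hom A (M [+] N) Z" by (rule restrict_Hom[OF hom_comp[OF h(2) gm] r(4)])
  have gL: "?g\<in>carrier ?L" unfolding Lk using gg hom_more(1)[OF gm r(2,3)] by simp
  have "R ?g = g" by (rule Hom_ext[OF R[OF gg]]) (use g in \<open>auto simp: R_def\<close>)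
  thus "g\<in>R ` carrier ?L" using gL by force
 qed (use R Lk in auto)
 have "vectorspace.dim K ?L = hd N Z"
  unfolding hd_def using fdvs_inj(3)[OF subspaceD(6)[OF sub] fdvs_hs[OF N Z] linR inj] surjR by blast
 thus ?thesis using 1 by simp
qed

end

section \<open>Direct sum decompositions\<close>

context fdalg begin

abbreviation "ind \<equiv> indecomposable K A"

abbreviation "IS \<equiv> indecomposable_summands K A"

lemma MC_ag: "M\<in>MC ==> abelian_group M"
 using MC_rm by (simp add: right_module_def)

lemma MC_closed [simp]:
 assumes "M\<in>MC"
 shows "0_M\<in>M"
  "x\<in>M ==> y\<in>M ==> x +_M y\<in>M"
  "x\<in>M ==> y\<in>M ==> x -_M y\<in>M"
  "x\<in>M ==> x +_M 0_M = x" "x\<in>M ==> 0_M +_M x = x"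
  "x\<in>M ==> x -_M x = 0_M" "x\<in>M ==> x -_M 0_M = x"
  "x\<in>M ==> y\<in>M ==> x -_M y = 0_M <-> x = y"
  "x\<in>M ==> y\<in>M ==> (x -_M y) +_M y = x"
  "x\<in>M ==> y\<in>M ==> y +_M (x -_M y) = x"
  "x\<in>M ==> y\<in>M ==> (x +_M y) -_M y = x"
  "x\<in>M ==> y\<in>M ==> (x +_M y) -_M x = y"
proof -
 interpret abelian_group M by (rule MC_ag[OF assms])
 have z: "-_M 0_M = 0_M" by (rule minus_equality) auto
 show "0_M\<in>M"
  "x\<in>M ==> y\<in>M ==> x +_M y\<in>M"
  "x\<in>M ==> y\<in>M ==> x -_M y\<in>M"
  "x\<in>M ==> x +_M 0_M = x" "x\<in>M ==> 0_M +_M x = x"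
  "x\<in>M ==> x -_M x = 0_M" "x\<in>M ==> x -_M 0_M = x"
  "x\<in>M ==> y\<in>M ==> (x -_M y) +_M y = x"
  "x\<in>M ==> y\<in>M ==> y +_M (x -_M y) = x"
  "x\<in>M ==> y\<in>M ==> (x +_M y) -_M y = x"
  by (auto simp: minus_eq a_assoc l_neg r_neg z a_lcomm)
 show "x\<in>M ==> y\<in>M ==> x -_M y = 0_M <-> x = y" by simp
 assume c: "x\<in>M" "y\<in>M"
 hence "(x +_M y) -_M x = y +_M (x +_M -_M x)" by (simp add: minus_eq a_ac)
 thus "(x +_M y) -_M x = y" using c by (simp add: r_neg)
qed

lemma hom_closed: "f\<in>mh M N ==> x\<in>M ==> f x\<in>N" by (rule homD(1))

lemma hom_zero: "f\<in>mh M N ==> M\<in>MC ==> N\<in>MC ==> f 0_M = 0_N"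
 using hom_more(1)[OF _ MC_rm MC_rm] by blast

lemma hom_minus: "f\<in>mh M N ==> M\<in>MC ==> N\<in>MC ==> x\<in>M ==> y\<in>M ==>
  f (x -_M y) = f x -_N f y"
 using hom_more(3)[OF _ MC_rm MC_rm] by blast

lemma sbm_carrier: "M\<in>MC ==> sbm (carrier M) M"
 using right_module.right_submoduleI[of A M "carrier M"] right_module.ract_closed[of A M] by auto

lemma sbm_image: "f\<in>mh M N ==> M\<in>MC ==> N\<in>MC ==> sbm (f ` M) N"
 using hom_more(5)[OF _ MC_rm MC_rm sbm_carrier] by auto

lemma sbm_kernel: "f\<in>mh M N ==> M\<in>MC ==> N\<in>MC ==> sbm {x\<in>M. f x = 0_N} M"
 using hom_more(4)[OF _ MC_rm MC_rm] by blast

lemma sbmD: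
 assumes "sbm U M" "M\<in>MC"
 shows "!!x. x\<in>U ==> x\<in>M" "0_M\<in>U"
  "!!x y. x\<in>U ==> y\<in>U ==> x +_M y\<in>U" "!!x y. x\<in>U ==> y\<in>U ==> x -_M y\<in>U"
  "!!a x. a\<in>A ==> x\<in>U ==> a ._M x\<in>U"
  "M(|carrier:=U|)\<in>MC" "(%x. x)\<in>mh (M(|carrier:=U|)) M"
 using right_module.right_submoduleD[OF MC_rm[OF assms(2)] assms(1)] MC_sub[OF assms(2,1)]
  module_hom_incl[OF MC_rm[OF assms(2)] assms(1)] by auto

lemma hom_funpow: "a\<in>mh M M ==> (a ^^ n)\<in>mh M M"
proof (induction n)
 case 0 thus ?case using hom_id[of A M] by (simp add: id_def)
next
 case (Suc n) thus ?case using hom_comp[of "a ^^ n" A M M a M] by (simp add: comp_def)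
qed

text \<open>Fitting's lemma, with the splitting given by an idempotent. The exponent is chosen so
  that the image of \<open>b = a ^^ n\<close> has least dimension among positive powers; then
  \<open>b\<close> is bijective on its image \<open>I\<close>, and \<open>e\<close> is
  \<open>b\<close> followed by the inverse of that bijection.\<close>

lemma fitting:
 assumes M: "M\<in>MC" and a: "a\<in>mh M M"
 obtains n e where "n > 0" "e\<in>mh M M" "!!x. x\<in>M ==> e (e x) = e x"
  "e ` M = (a ^^ n) ` M"
  "!!x. x\<in>M ==> e x = 0_M <-> (a ^^ n) x = 0_M"
proof -
 let ?d = "%n. dm (M(|carrier:=(a ^^ n) ` M|))"
 obtain n where n: "n > 0" "!!m. m > 0 ==> ?d n <= ?d m"
  using ex_has_least_nat[of "%n. n > 0" 1 ?d] by auto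
 define b where "b = a ^^ n"
 have b: "b\<in>mh M M" unfolding b_def by (rule hom_funpow[OF a])
 define I where "I = b ` M"
 have sI: "sbm I M" unfolding I_def by (rule sbm_image[OF b M M])
 note ID = sbmD[OF sI M]
 let ?N = "M(|carrier:=I|)"
 \<comment> \<open>Otherwise \<open>a ^^ (n + n)\<close> would have an image of smaller
   dimension.\<close>
 have bI: "b ` I = I"
 proof (rule ccontr)
  assume c: "b ` I ~= I"
  have e: "b ` I = (a ^^ (n + n)) ` M" unfolding I_def b_def funpow_add by auto
  have bN: "b\<in>mh ?N ?N"
   by (rule module_hom_codom[OF module_hom_dom[OF b]]) (use ID(1) in \<open>auto simp: I_def\<close>)
  have "sbm (b ` carrier ?N) ?N" by (rule sbm_image[OF bN ID(6) ID(6)])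
  hence "dm (?N(|carrier:=b ` I|)) < dm ?N" using dm_sub[OF ID(6)] c by simp
  hence "?d (n + n) < ?d n" unfolding e[symmetric] by (simp add: I_def b_def)
  thus False using n(2)[of "n + n"] n(1) by simp
 qed
 have bN: "b\<in>mh ?N ?N"
  by (rule module_hom_codom[OF module_hom_dom[OF b]]) (use ID(1) in \<open>auto simp: I_def\<close>)
 have inj: "inj_on b I" using endo_inj_iff_surj[OF ID(6) bN] bI by simp
 have bij: "bij_betw b (carrier ?N) (carrier ?N)" using inj bI by (simp add: bij_betw_def)
 note v = hom_inv[OF bN bij MC_rm[OF ID(6)], simplified]
 define e where "e x = inv_into I b (b x)" for x
 have b': "b\<in>mh M ?N" by (rule module_hom_codom[OF b]) (simp add: I_def)
 have e: "e\<in>mh M M"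
  unfolding e_def using hom_comp[OF hom_comp[OF b' v(1)] ID(7)] by simp
 have eI: "e x\<in>I" if "x\<in>M" for x
  using hom_closed[OF hom_comp[OF b' v(1)] that] by (simp add: e_def)
 have be: "b (e x) = b x" if "x\<in>M" for x
  unfolding e_def by (rule v(4)) (simp add: I_def that)
 have ey: "e y = y" if "y\<in>I" for y unfolding e_def using v(3) that by simp
 show ?thesis
 proof (rule that[of n e])
  show "n > 0" by (rule n(1))
  show "e\<in>mh M M" by (rule e)
  show "e (e x) = e x" if "x\<in>M" for x by (rule ey[OF eI[OF that]])
  show "e ` M = (a ^^ n) ` M"
   using eI ey ID(1) unfolding b_def[symmetric] I_def[symmetric] by (metis image_eqI image_subsetI subsetI subset_antisym)
  show "e x = 0_M <-> (a ^^ n) x = 0_M" if "x\<in>M" for x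
  proof
   assume "e x = 0_M"
   thus "(a ^^ n) x = 0_M" using be[OF that] hom_zero[OF b M M] by (simp add: b_def)
  next
   assume "(a ^^ n) x = 0_M"
   hence "b (e x) = b 0_M" using be[OF that] hom_zero[OF b M M] by (simp add: b_def)
   thus "e x = 0_M" using inj_onD[OF inj _ eI[OF that] ID(2)] by blast
  qed
 qed
qed

lemma zero_module_iff: "M\<in>MC ==> zero_module M <-> (\<forall>x\<in>M. x = 0_M)"
 unfolding zero_module_def using MC_closed(1)[of M] by auto

lemma direct_sum_simps [simp]:
 "carrier (direct_sum M N) = carrier M \<times> carrier N" "0_(direct_sum M N) = (0_M, 0_N)"
 "v +_(direct_sum M N) w = (fst v +_M fst w, snd v +_N snd w)"
 "a ._(direct_sum M N) v = (a ._M fst v, a ._N snd v)"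
 by (simp_all add: direct_sum_def)

lemma iso_direct_bsum: "mod_iso A (direct_sum M N) (M [+] N)" "mod_iso A (M [+] N) (direct_sum M N)"
 unfolding mod_iso_def
proof -
 show "\<exists>f\<in>mh (direct_sum M N) (M [+] N). bij_betw f (carrier (direct_sum M N)) (carrier (M [+] N))"
  by (intro bexI[of _ "%(x, y). jn x y"] bij_betwI[of _ _ _ "%z. (pr1 z, pr2 z)"] homI) auto
 show "\<exists>f\<in>mh (M [+] N) (direct_sum M N). bij_betw f (carrier (M [+] N)) (carrier (direct_sum M N))"
  by (intro bexI[of _ "%z. (pr1 z, pr2 z)"] bij_betwI[of _ _ _ "%(x, y). jn x y"] homI) auto
qed

text \<open>A biproduct diagram with total module \<open>T\<close>. Keeping the four maps, rather
  than an isomorphism with \<open>M [+] N\<close>, allows summands that are submodules of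
  \<open>T\<close>.\<close>

definition bip :: "('k, 'a) rmod \<Rightarrow> ('k, 'a) rmod \<Rightarrow> ('k, 'a) rmod \<Rightarrow> _" where
 "bip T M N i1 i2 p1 p2 <-> i1\<in>mh M T & i2\<in>mh N T & p1\<in>mh T M & p2\<in>mh T N &
  (\<forall>x\<in>M. p1 (i1 x) = x & p2 (i1 x) = 0_N) &
  (\<forall>y\<in>N. p2 (i2 y) = y & p1 (i2 y) = 0_M) &
  (\<forall>z\<in>T. i1 (p1 z) +_T i2 (p2 z) = z)"

lemma bip_bsum:
 assumes "M\<in>MC" "N\<in>MC"
 shows "bip (M [+] N) M N (%x. jn x 0_N) (%y. jn 0_M y) pr1 pr2"
 using assms bsum_homs[OF MC_rm[OF assms(1)] MC_rm[OF assms(2)]] by (auto simp: bip_def)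

lemma bip_iso:
 assumes "bip T M N i1 i2 p1 p2" "M\<in>MC" "N\<in>MC" "T\<in>MC"
 shows "mod_iso A T (M [+] N)"
proof -
 note b = assms(1)[unfolded bip_def]
 have h: "i1\<in>mh M T" "i2\<in>mh N T" "p1\<in>mh T M" "p2\<in>mh T N" using b by auto
 note hD = homD[OF h(1)] homD[OF h(2)] homD[OF h(3)] homD[OF h(4)]
 have "bij_betw (%z. jn (p1 z) (p2 z)) (carrier T) (carrier (M [+] N))"
  by (rule bij_betwI[of _ _ _ "%w. i1 (pr1 w) +_T i2 (pr2 w)"]) (use b hD assms in auto)
 thus ?thesis unfolding mod_iso_def using bsum_pair[OF h(3,4)] by blast
qed

lemma bip_of_iso:
 assumes "mod_iso A T (M [+] N)" "M\<in>MC" "N\<in>MC" "T\<in>MC"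
 obtains i1 i2 p1 p2 where "bip T M N i1 i2 p1 p2"
proof -
 obtain f where f: "f\<in>mh T (M [+] N)" "bij_betw f (carrier T) (carrier (M [+] N))"
  using assms(1) by (auto simp: mod_iso_def)
 note v = hom_inv[OF f MC_rm[OF assms(4)]]
 note h = bsum_homs[OF MC_rm[OF assms(2)] MC_rm[OF assms(3)]]
 let ?g = "inv_into (carrier T) f"
 have "?g (jn (pr1 (f z)) 0_N) +_T ?g (jn 0_M (pr2 (f z))) = z" if z: "z\<in>T" for z
 proof -
  have c: "pr1 (f z)\<in>M" "pr2 (f z)\<in>N" using hom_closed[OF f(1) z] by auto
  have "?g (jn (pr1 (f z)) 0_N) +_T ?g (jn 0_M (pr2 (f z))) =
   ?g (jn (pr1 (f z)) 0_N +_(M [+] N) jn 0_M (pr2 (f z)))"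
   using homD(2)[OF v(1), of "jn (pr1 (f z)) 0_N" "jn 0_M (pr2 (f z))"] c assms by simp
  also have "\<dots> = z" using c assms v(3)[OF z] by simp
  finally show ?thesis .
 qed
 hence "bip T M N (%x. ?g (jn x 0_N)) (%y. ?g (jn 0_M y)) (%z. pr1 (f z)) (%z. pr2 (f z))"
  unfolding bip_def using hom_comp[OF h(3) v(1)] hom_comp[OF h(4) v(1)]
   hom_comp[OF f(1) h(1)] hom_comp[OF f(1) h(2)] v(4) assms by auto
 thus ?thesis by (rule that)
qed

definition sd :: "('k, 'a) rmod \<Rightarrow> ('k, 'a) rmod \<Rightarrow> bool" where
 "sd N M <-> (\<exists>i\<in>mh N M. \<exists>p\<in>mh M N. \<forall>x\<in>N. p (i x) = x)"

lemma sd_complement: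
 assumes "N\<in>MC" "M\<in>MC" "i\<in>mh N M" "p\<in>mh M N" "!!x. x\<in>N ==> p (i x) = x"
 obtains N' i' p' where "N'\<in>MC" "bip M N N' i i' p p'" "N' = M(|carrier:={x\<in>M. p x = 0_N}|)"
  "i' = (%x. x)"
proof -
 let ?U = "{x\<in>M. p x = 0_N}"
 have s: "sbm ?U M" by (rule sbm_kernel[OF assms(4,2,1)])
 note sD = sbmD[OF s assms(2)]
 let ?p' = "%x. x -_M i (p x)"
 have pk: "p (?p' x) = 0_N" if "x\<in>M" for x
  using that assms(1,2,5) hom_minus[OF assms(4,2,1)] hom_closed[OF assms(3)] hom_closed[OF assms(4)] by simp
 have p': "?p'\<in>mh M (M(|carrier:=?U|))"
  by (rule module_hom_codom[OF hom_diff[OF hom_id hom_comp[OF assms(4,3)] MC_rm[OF assms(2)]]])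
   (use pk hom_closed[OF assms(3)] hom_closed[OF assms(4)] assms(2) in auto)
 have "bip M N (M(|carrier:=?U|)) i (%x. x) p ?p'"
  unfolding bip_def using assms(3,4) sD(7) p'
  by (auto simp: assms(1,2,5) hom_closed[OF assms(3)] hom_closed[OF assms(4)] hom_zero[OF assms(3,1,2)])
 thus ?thesis using that sD(6) by blast
qed

lemma sd_iff_bsum:
 assumes "N\<in>MC" "M\<in>MC"
 shows "sd N M <-> (\<exists>N'\<in>MC. mod_iso A M (N [+] N'))"
proof
 assume "sd N M"
 then obtain i p where ip: "i\<in>mh N M" "p\<in>mh M N" "!!x. x\<in>N ==> p (i x) = x"
  by (auto simp: sd_def)
 obtain N' i' p' where "N'\<in>MC" "bip M N N' i i' p p'" using sd_complement[OF assms ip] by blast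
 thus "\<exists>N'\<in>MC. mod_iso A M (N [+] N')" using bip_iso[of M N N'] assms by blast
next
 assume "\<exists>N'\<in>MC. mod_iso A M (N [+] N')"
 then obtain N' where N': "N'\<in>MC" "mod_iso A M (N [+] N')" by blast
 obtain i1 i2 p1 p2 where "bip M N N' i1 i2 p1 p2" using bip_of_iso[OF N'(2) assms(1) N'(1) assms(2)] by blast
 thus "sd N M" unfolding bip_def sd_def by blast
qed

lemma sd_iso:
 assumes "mod_iso A N M" "N\<in>MC" shows "sd N M"
proof -
 obtain f where f: "f\<in>mh N M" "bij_betw f (carrier N) (carrier M)" using assms(1) by (auto simp: mod_iso_def)
 note v = hom_inv[OF f MC_rm[OF assms(2)]]
 show ?thesis unfolding sd_def using f(1) v(1,3) by blast
qed

lemma sd_refl: "sd M M" unfolding sd_def using hom_id[of A M] by auto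

lemma sd_trans:
 assumes "sd L N" "sd N M" shows "sd L M"
proof -
 obtain i p j q where h: "i\<in>mh L N" "p\<in>mh N L" "!!x. x\<in>L ==> p (i x) = x"
  "j\<in>mh N M" "q\<in>mh M N" "!!x. x\<in>N ==> q (j x) = x"
  using assms by (auto simp: sd_def)
 show ?thesis unfolding sd_def
  by (rule bexI[OF bexI[OF _ hom_comp[OF h(5,2)]] hom_comp[OF h(1,4)]])
   (use h(3,6) hom_closed[OF h(1)] in auto)
qed

lemma iso_sym: "mod_iso A M N ==> M\<in>MC ==> mod_iso A N M" by (rule mod_iso_sym) auto

lemma indD: "ind M ==> M\<in>MC" "ind M ==> ~ zero_module M" by (auto simp: indecomposable_def)

text \<open>The image and the kernel of \<open>e\<close> are complementary summands, so one of them
  is zero.\<close>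

lemma ind_idem:
 assumes "ind M" "e\<in>mh M M" "!!x. x\<in>M ==> e (e x) = e x"
 shows "(\<forall>x\<in>M. e x = 0_M) \<or> (\<forall>x\<in>M. e x = x)"
proof -
 have M: "M\<in>MC" using assms(1) by (rule indD)
 let ?S = "M(|carrier:=e ` M|)"
 have sI: "sbm (e ` M) M" by (rule sbm_image[OF assms(2) M M])
 note SD = sbmD[OF sI M]
 have e': "e\<in>mh M ?S" by (rule module_hom_codom[OF assms(2)]) auto
 have ee: "!!x. x\<in>carrier ?S ==> e x = x" using assms(3) by auto
 obtain N' i' p' where N': "N'\<in>MC" "bip M ?S N' (%x. x) i' e p'"
  "N' = M(|carrier:={x\<in>M. e x = 0_?S}|)"
  using sd_complement[OF SD(6) M SD(7) e' ee] by blast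
 have "mod_iso A M (direct_sum ?S N')"
  by (rule mod_iso_trans[OF bip_iso[OF N'(2) SD(6) N'(1) M] iso_direct_bsum(2)])
 hence "zero_module ?S \<or> zero_module N'" using assms(1) SD(6) N'(1) by (auto simp: indecomposable_def)
 thus ?thesis
 proof
  assume "zero_module ?S" thus ?thesis by (auto simp: zero_module_def)
 next
  assume z: "zero_module N'"
  have "e x = x" if "x\<in>M" for x
  proof -
   have "x -_M e x\<in>N'"
    using that assms(3) M hom_minus[OF assms(2) M M] hom_closed[OF assms(2)] by (simp add: N'(3))
   hence "x -_M e x = 0_N'" using z unfolding zero_module_def by blast
   hence "x -_M e x = 0_M" by (simp add: N'(3))
   thus ?thesis using that M hom_closed[OF assms(2)] by simp
  qed
  thus ?thesis by blast
 qed
qed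

text \<open>Idempotents refer to endomorphisms only, and inflation does not change endomorphisms.
  The criterion therefore transfers indecomposability between a module and its inflation.\<close>

lemma indI:
 assumes M: "M\<in>MC" and "~ zero_module M"
  and id: "!!e. e\<in>mh M M ==> (!!x. x\<in>M ==> e (e x) = e x) ==>
   (\<forall>x\<in>M. e x = 0_M) \<or> (\<forall>x\<in>M. e x = x)"
 shows "ind M"
 unfolding indecomposable_def
proof (intro conjI ballI impI assms(1,2))
 fix S T assume S: "S\<in>MC" and T: "T\<in>MC" and i: "mod_iso A M (direct_sum S T)"
 obtain i1 i2 p1 p2 where b: "bip M S T i1 i2 p1 p2"
  using bip_of_iso[OF mod_iso_trans[OF i iso_direct_bsum(1)] S T M] by blast
 note b = b[unfolded bip_def]
 have h: "i1\<in>mh S M" "p1\<in>mh M S" "i2\<in>mh T M" "p2\<in>mh M T" using b by auto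
 have "(\<forall>x\<in>M. i1 (p1 x) = 0_M) \<or> (\<forall>x\<in>M. i1 (p1 x) = x)"
  by (rule id[OF hom_comp[OF h(2,1)]]) (use b hom_closed[OF h(2)] in auto)
 thus "zero_module S \<or> zero_module T"
 proof
  assume z: "\<forall>x\<in>M. i1 (p1 x) = 0_M"
  have "x = 0_S" if "x\<in>S" for x
   using b that z hom_closed[OF h(1) that] hom_zero[OF h(2) M S] by metis
  thus ?thesis using zero_module_iff[OF S] by blast
 next
  assume z: "\<forall>x\<in>M. i1 (p1 x) = x"
  have "y = 0_T" if "y\<in>T" for y
   using b that z hom_closed[OF h(3) that] hom_zero[OF h(1) S M] hom_zero[OF h(4) M T] by metis
  thus ?thesis using zero_module_iff[OF T] by blast
 qed
qed

lemma IS_iff: "M\<in>MC ==> N\<in>IS M <-> ind N & sd N M"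
proof -
 assume M: "M\<in>MC"
 have "(\<exists>N'\<in>MC. mod_iso A M (direct_sum N N')) <-> sd N M" if "ind N"
 proof -
  have "mod_iso A M (direct_sum N N') <-> mod_iso A M (N [+] N')" for N'
   using mod_iso_trans[OF _ iso_direct_bsum(1)[of N N']] mod_iso_trans[OF _ iso_direct_bsum(2)[of N N']] by blast
  thus ?thesis unfolding sd_iff_bsum[OF indD(1)[OF that] M] by blast
 qed
 thus ?thesis by (auto simp: indecomposable_summands_def)
qed

lemma IS_iso_cong: "mod_iso A M M' ==> mod_iso A M' M ==> IS M = IS M'"
proof -
 assume "mod_iso A M M'" "mod_iso A M' M"
 hence "mod_iso A M (direct_sum N N') <-> mod_iso A M' (direct_sum N N')" for N N' :: "('k, 'a) rmod"
  using mod_iso_trans[of A M M'] mod_iso_trans[of A M' M] by blast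
 thus ?thesis by (simp add: indecomposable_summands_def)
qed

abbreviation isoM where "isoM M N f \<equiv> bij_betw f (carrier M) (carrier N)"

section \<open>Locality of endomorphism rings and the exchange property\<close>

lemma ind_nilpotent:
 assumes "ind M" "a\<in>mh M M" "~ isoM M M a"
 obtains n where "!!x. x\<in>M ==> (a ^^ n) x = 0_M"
proof -
 have M: "M\<in>MC" using assms(1) by (rule indD)
 obtain n e where e: "n > 0" "e\<in>mh M M" "!!x. x\<in>M ==> e (e x) = e x"
  "e ` M = (a ^^ n) ` M"
  "!!x. x\<in>M ==> e x = 0_M <-> (a ^^ n) x = 0_M"
  using fitting[OF M assms(2)] by blast
 have "~ (\<forall>x\<in>M. e x = x)"
 proof
  assume i: "\<forall>x\<in>M. e x = x"
  obtain m where m: "n = Suc m" using e(1) by (cases n) auto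
  have "carrier M = (a ^^ n) ` M" using i e(4) by simp
  also have "\<dots> = a ` ((a ^^ m) ` M)" by (simp add: m image_comp)
  also have "\<dots> <= a ` M" using hom_closed[OF hom_funpow[OF assms(2)]] by blast
  finally have "a ` M = carrier M" using hom_closed[OF assms(2)] by blast
  thus False using endo_inj_iff_surj[OF M assms(2)] assms(3) by (simp add: bij_betw_def)
 qed
 hence "\<forall>x\<in>M. e x = 0_M" using ind_idem[OF assms(1) e(2,3)] by blast
 thus ?thesis using that e(5) by blast
qed

text \<open>If \<open>b\<close> is not invertible it is nilpotent. Then \<open>a x = 0\<close>
  forces \<open>b x = x\<close>, and iterating gives \<open>x = 0\<close>, so \<open>a\<close> is
  injective.\<close>

lemma local_sum_id:
 assumes "ind M" "a\<in>mh M M" "b\<in>mh M M" "!!x. x\<in>M ==> a x +_M b x = x"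
 shows "isoM M M a \<or> isoM M M b"
proof (rule disjCI)
 assume nb: "~ isoM M M b"
 have M: "M\<in>MC" using assms(1) by (rule indD)
 obtain n where n: "!!x. x\<in>M ==> (b ^^ n) x = 0_M" using ind_nilpotent[OF assms(1,3) nb] by blast
 have "x = 0_M" if x: "x\<in>M" "a x = 0_M" for x
 proof -
  have bx: "b x = x" using assms(4)[OF x(1)] x M hom_closed[OF assms(3)] by simp
  have "(b ^^ n) x = x" by (induction n) (auto simp: bx)
  thus ?thesis using n[OF x(1)] by simp
 qed
 hence "inj_on a M" using hom_more(7)[OF assms(2)] M by simp
 thus "isoM M M a" using endo_inj_iff_surj[OF M assms(2)] by (simp add: bij_betw_def)
qed

lemma local_sum:
 assumes "ind M" "a\<in>mh M M" "b\<in>mh M M" "c\<in>mh M M" "isoM M M c"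
  "!!x. x\<in>M ==> a x +_M b x = c x"
 shows "isoM M M a \<or> isoM M M b"
proof -
 have M: "M\<in>MC" using assms(1) by (rule indD)
 note v = hom_inv[OF assms(4,5) MC_rm[OF M]]
 let ?c = "inv_into (carrier M) c"
 have "isoM M M (%x. ?c (a x)) \<or> isoM M M (%x. ?c (b x))"
 proof (rule local_sum_id[OF assms(1) hom_comp[OF assms(2) v(1)] hom_comp[OF assms(3) v(1)]])
  fix x assume x: "x\<in>M"
  show "?c (a x) +_M ?c (b x) = x"
   using homD(2)[OF v(1), of "a x" "b x"] hom_closed[OF assms(2) x] hom_closed[OF assms(3) x]
    assms(6)[OF x] v(3)[OF x] by simp
 qed
 moreover have "isoM M M f" if f: "f\<in>mh M M" "isoM M M (%x. ?c (f x))" for f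
 proof -
  have "isoM M M (%x. c (?c (f x)))" using bij_betw_trans[OF f(2) assms(5)] by (simp add: comp_def)
  thus ?thesis by (rule bij_betw_cong[THEN iffD1, rotated]) (use v(4) hom_closed[OF f(1)] in auto)
 qed
 ultimately show ?thesis using assms(2,3) by blast
qed

text \<open>With \<open>c\<close> the composite of \<open>i\<close> and \<open>p\<close>, the
  endomorphism of \<open>N\<close> given by \<open>p\<close>, the inverse of \<open>c\<close> and
  \<open>i\<close> in this order is a nonzero idempotent, hence the identity.\<close>

lemma local_comp:
 assumes "ind M" "ind N" "i\<in>mh M N" "p\<in>mh N M" "isoM M M (%x. p (i x))"
 shows "isoM M N i" "isoM N M p"
proof -
 have M: "M\<in>MC" and N: "N\<in>MC" using assms(1,2) by (auto simp: indD)
 have c: "(%x. p (i x))\<in>mh M M" by (rule hom_comp[OF assms(3,4)])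
 note v = hom_inv[OF c assms(5) MC_rm[OF M]]
 let ?c = "inv_into (carrier M) (%x. p (i x))"
 let ?e = "%y. i (?c (p y))"
 have e: "?e\<in>mh N N" by (rule hom_comp[OF hom_comp[OF assms(4) v(1)] assms(3)])
 have "?e (?e y) = ?e y" if "y\<in>N" for y
  using v(3)[of "?c (p y)"] hom_closed[OF assms(4) that] hom_closed[OF v(1)] by simp
 hence d: "(\<forall>y\<in>N. ?e y = 0_N) \<or> (\<forall>y\<in>N. ?e y = y)"
  by (rule ind_idem[OF assms(2) e])
 have inji: "inj_on i M" using assms(5) by (auto simp: bij_betw_def inj_on_def)
 have "~ (\<forall>y\<in>N. ?e y = 0_N)"
 proof
  assume z: "\<forall>y\<in>N. ?e y = 0_N"
  have "x = 0_M" if x: "x\<in>M" for x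
  proof -
   have "i x = i 0_M" using z v(3)[OF x] hom_closed[OF assms(3) x] hom_zero[OF assms(3) M N] by metis
   thus ?thesis using inji x M by (auto dest: inj_onD)
  qed
  thus False using indD(2)[OF assms(1)] zero_module_iff[OF M] by blast
 qed
 hence id: "!!y. y\<in>N ==> ?e y = y" using d by blast
 have "i ` M = carrier N"
 proof (intro equalityI subsetI)
  fix y assume "y\<in>N"
  thus "y\<in>i ` M"
   using id[of y] hom_closed[OF v(1) hom_closed[OF assms(4)], of y] by (intro image_eqI[of _ _ "?c (p y)"]) auto
 qed (use hom_closed[OF assms(3)] in blast)
 thus i: "isoM M N i" using inji by (simp add: bij_betw_def)
 show "isoM N M p"
 proof (rule bij_betwI[of _ _ _ "%x. i (?c x)"])
  show "p\<in>N \<rightarrow> carrier M" using hom_closed[OF assms(4)] by auto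
  show "(%x. i (?c x))\<in>M \<rightarrow> carrier N" using hom_closed[OF v(1)] hom_closed[OF assms(3)] by auto
  show "i (?c (p x)) = x" if "x\<in>N" for x using id that by simp
  show "p (i (?c y)) = y" if "y\<in>M" for y using v(4)[OF that] by simp
 qed
qed

text \<open>The identity of \<open>N\<close> is the sum of an endomorphism through \<open>S\<close>
  and one through \<open>T\<close>. By locality one of them is invertible, and \<open>N\<close>
  splits off the module through which it factors.\<close>

lemma sd_bsum:
 assumes "ind N" "S\<in>MC" "T\<in>MC" "sd N (S [+] T)"
 shows "sd N S \<or> sd N T"
proof -
 have N: "N\<in>MC" using assms(1) by (rule indD)
 obtain i p where ip: "i\<in>mh N (S [+] T)" "p\<in>mh (S [+] T) N" "!!x. x\<in>N ==> p (i x) = x"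
  using assms(4) by (auto simp: sd_def)
 note h = bsum_homs[OF MC_rm[OF assms(2)] MC_rm[OF assms(3)]]
 have hc: "pr1 (i x)\<in>S" "pr2 (i x)\<in>T" if "x\<in>N" for x
  using hom_closed[OF ip(1) that] by auto
 note a1 = hom_comp[OF ip(1) h(1)] and a2 = hom_comp[OF ip(1) h(2)]
 note b1 = hom_comp[OF h(3) ip(2)] and b2 = hom_comp[OF h(4) ip(2)]
 have s: "sd N L" if "f\<in>mh N L" "g\<in>mh L N" "isoM N N (%x. g (f x))" for L f g
 proof -
  note v = hom_inv[OF hom_comp[OF that(1,2)] that(3) MC_rm[OF N]]
  show ?thesis unfolding sd_def
   by (rule bexI[OF bexI[OF _ hom_comp[OF that(2) v(1)]] that(1)]) (use v(3) in blast)
 qed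
 have "isoM N N (%x. p (jn (pr1 (i x)) 0_T)) \<or> isoM N N (%x. p (jn 0_S (pr2 (i x))))"
 proof (rule local_sum_id[OF assms(1) hom_comp[OF a1 b1] hom_comp[OF a2 b2]])
  fix x assume x: "x\<in>N"
  show "p (jn (pr1 (i x)) 0_T) +_N p (jn 0_S (pr2 (i x))) = x"
   using homD(2)[OF ip(2), of "jn (pr1 (i x)) 0_T" "jn 0_S (pr2 (i x))"] hc[OF x] ip(3)[OF x] assms(2,3)
   by simp
 qed
 thus ?thesis using s[OF a1 b1] s[OF a2 b2] by blast
qed

lemma sd_ind_iso:
 assumes "ind N" "ind M" "sd N M"
 shows "mod_iso A N M"
proof -
 obtain i p where ip: "i\<in>mh N M" "p\<in>mh M N" "!!x. x\<in>N ==> p (i x) = x"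
  using assms(3) by (auto simp: sd_def)
 have "isoM N N (%x. p (i x))" by (rule bij_betwI[of _ _ _ "%x. x"]) (auto simp: ip(3))
 thus ?thesis unfolding mod_iso_def using local_comp(1)[OF assms(1,2) ip(1,2)] ip(1) by blast
qed

lemma dm_summand_less:
 assumes "bip M U N i1 i2 p1 p2" "M\<in>MC" "U\<in>MC" "N\<in>MC" "~ zero_module U"
 shows "dm N < dm M"
proof -
 note b = assms(1)[unfolded bip_def]
 have h: "i1\<in>mh U M" "i2\<in>mh N M" "p1\<in>mh M U" "p2\<in>mh M N" using b by auto
 have inj: "inj_on i2 N" using b by (metis inj_onI)
 have "i2 ` N ~= carrier M"
 proof
  assume s: "i2 ` N = carrier M"
  have "x = 0_U" if x: "x\<in>U" for x
  proof -
   obtain y where "y\<in>N" "i1 x = i2 y" using s hom_closed[OF h(1) x] by blast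
   thus ?thesis using b x by metis
  qed
  thus False using assms(5) zero_module_iff[OF assms(3)] by blast
 qed
 thus ?thesis using dm_inj[OF assms(4,2) h(2) inj] by linarith
qed

text \<open>A nonzero summand of least dimension is indecomposable.\<close>

lemma ind_summand_exists:
 assumes "M\<in>MC" "~ zero_module M"
 obtains U where "ind U" "sd U M"
proof -
 obtain U where U: "U\<in>MC" "~ zero_module U" "sd U M"
  "!!V. V\<in>MC ==> ~ zero_module V ==> sd V M ==> dm U <= dm V"
  using ex_has_least_nat[of "%U. U\<in>MC & ~ zero_module U & sd U M" M dm] assms sd_refl by blast
 have "ind U" unfolding indecomposable_def
 proof (intro conjI ballI impI U(1,2))
  fix S T assume ST: "S\<in>MC" "T\<in>MC" "mod_iso A U (direct_sum S T)"
  obtain i1 i2 p1 p2 where b: "bip U S T i1 i2 p1 p2"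
   using bip_of_iso[OF mod_iso_trans[OF ST(3) iso_direct_bsum(1)] ST(1,2) U(1)] by blast
  show "zero_module S \<or> zero_module T"
  proof (rule ccontr)
   assume n: "~ (zero_module S \<or> zero_module T)"
   have "sd T U" using b unfolding bip_def sd_def by blast
   hence "dm U <= dm T" using U(4)[OF ST(2)] n sd_trans[OF _ U(3)] by blast
   thus False using dm_summand_less[OF b U(1) ST(1,2)] n by simp
  qed
 qed
 thus ?thesis using that U(3) by blast
qed

text \<open>Splitting off an indecomposable summand lowers the dimension. The rule takes the place
  of complete decompositions in most later arguments.\<close>

lemma decomp_induct [consumes 1, case_names zero sum]:
 assumes "M\<in>MC"
  and "!!Z. Z\<in>MC ==> zero_module Z ==> P Z"
  and "!!M U N i1 i2 p1 p2. M\<in>MC ==> N\<in>MC ==> ind U ==> bip M U N i1 i2 p1 p2 ==> P N ==> P M"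
 shows "P M"
 using assms(1)
proof (induction "dm M" arbitrary: M rule: less_induct)
 case less
 show ?case
 proof (cases "zero_module M")
  case True thus ?thesis using assms(2) less.prems by blast
 next
  case False
  obtain U where U: "ind U" "sd U M" using ind_summand_exists[OF less.prems False] by blast
  then obtain i p where ip: "i\<in>mh U M" "p\<in>mh M U" "!!x. x\<in>U ==> p (i x) = x"
   by (auto simp: sd_def)
  obtain N i' p' where N: "N\<in>MC" "bip M U N i i' p p'"
   using sd_complement[OF indD(1)[OF U(1)] less.prems ip] by blast
  have "dm N < dm M" by (rule dm_summand_less[OF N(2) less.prems indD(1)[OF U(1)] N(1) indD(2)[OF U(1)]])
  from less.hyps[OF this N(1)] show ?thesis by (rule assms(3)[OF less.prems N(1) U(1) N(2)])
 qed
qed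

lemma bip_sd: "bip M U N i1 i2 p1 p2 ==> sd U M" "bip M U N i1 i2 p1 p2 ==> sd N M"
 unfolding bip_def sd_def by blast+

lemma bip_sd_cases:
 assumes "bip M U N i1 i2 p1 p2" "M\<in>MC" "ind U" "N\<in>MC" "ind V" "sd V M"
 shows "mod_iso A V U \<or> sd V N"
proof -
 have U: "U\<in>MC" using assms(3) by (rule indD)
 have "sd V (U [+] N)"
  by (rule sd_trans[OF assms(6) sd_iso[OF bip_iso[OF assms(1) U assms(4,2)] assms(2)]])
 from sd_bsum[OF assms(5) U assms(4) this] show ?thesis using sd_ind_iso[OF assms(5,3)] by blast
qed

lemma zero_no_summand: "Z\<in>MC ==> zero_module Z ==> ind U ==> ~ sd U Z"
proof
 assume Z: "Z\<in>MC" "zero_module Z" and U: "ind U" and "sd U Z"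
 then obtain i p where ip: "i\<in>mh U Z" "p\<in>mh Z U" "!!x. x\<in>U ==> p (i x) = x" by (auto simp: sd_def)
 have "x = 0_U" if "x\<in>U" for x
  using ip(3)[OF that] hom_closed[OF ip(1) that] Z(2) hom_zero[OF ip(2) Z(1) indD(1)[OF U]] by (simp add: zero_module_def)
 thus False using indD(2)[OF U] zero_module_iff[OF indD(1)[OF U]] by blast
qed

section \<open>Representatives of isomorphism classes\<close>

definition noniso :: "('k, 'a) rmod set \<Rightarrow> bool" where "noniso B <-> (\<forall>U\<in>B. \<forall>V\<in>B. mod_iso A U V --> U = V)"

lemma reps_exist:
 assumes "B <= MC"
 obtains R where "R <= B" "noniso R" "!!U. U\<in>B ==> \<exists>V\<in>R. mod_iso A U V"
proof -
 define r :: "('k, 'a) rmod \<Rightarrow> ('k, 'a) rmod" where "r U = (SOME V. V\<in>B & mod_iso A U V)" for U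
 have r: "r U\<in>B & mod_iso A U (r U)" if "U\<in>B" for U
  unfolding r_def by (rule someI[of _ U]) (use that mod_iso_refl in blast)
 have e: "r U = r V" if "U\<in>B" "V\<in>B" "mod_iso A U V" for U V
 proof -
  have "mod_iso A V U" by (rule iso_sym[OF that(3)]) (use that assms in blast)
  hence "(W\<in>B & mod_iso A U W) = (W\<in>B & mod_iso A V W)" for W
   using mod_iso_trans that(3) by blast
  thus ?thesis by (simp add: r_def)
 qed
 show ?thesis
 proof (rule that[of "r ` B"])
  show "r ` B <= B" using r by blast
  show "noniso (r ` B)" unfolding noniso_def
  proof (intro ballI impI)
   fix x y assume "x\<in>r ` B" "y\<in>r ` B" and xy: "mod_iso A x y"
   then obtain U V where UV: "U\<in>B" "V\<in>B" "x = r U" "y = r V" by blast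
   have "mod_iso A V y" "mod_iso A U x" using UV r by auto
   moreover have "mod_iso A y V" by (rule iso_sym[OF \<open>mod_iso A V y\<close>]) (use UV assms in blast)
   ultimately have "mod_iso A U V" using mod_iso_trans xy by blast
   thus "x = y" using e UV by simp
  qed
  show "\<exists>V\<in>r ` B. mod_iso A U V" if "U\<in>B" for U using r that by blast
 qed
qed

definition represents :: "('k, 'a) rmod set \<Rightarrow> ('k, 'a) rmod set \<Rightarrow> bool" where
 "represents R B <-> R <= B & noniso R & (\<forall>U\<in>B. \<exists>V\<in>R. mod_iso A U V)"

text \<open>The count of classes is moved to a transversal, since sets of modules can serve as index
  sets for the families of functionals in the counting arguments.\<close>

lemma card_reps:
 assumes "B <= MC" "represents R B"
 shows "card (B // iso_rel K A) = card R"
proof -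
 have Rm: "U\<in>MC" if "U\<in>R" for U using that assms by (auto simp: represents_def)
 have "B // iso_rel K A = (%U. iso_rel K A `` {U}) ` R"
 proof (intro equalityI subsetI)
  fix c assume "c\<in>B // iso_rel K A"
  then obtain U where U: "U\<in>B" "c = iso_rel K A `` {U}" by (auto simp: quotient_def)
  then obtain V where V: "V\<in>R" "mod_iso A U V" using assms(2) by (auto simp: represents_def)
  have Um: "U\<in>MC" using U assms by auto
  have VU: "mod_iso A V U" by (rule iso_sym[OF V(2) Um])
  have "iso_rel K A `` {U} = iso_rel K A `` {V}"
   unfolding iso_rel_def using V(2) VU Um Rm[OF V(1)] mod_iso_trans by auto
  thus "c\<in>(%U. iso_rel K A `` {U}) ` R" using U V by blast
 next
  fix c assume "c\<in>(%U. iso_rel K A `` {U}) ` R"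
  thus "c\<in>B // iso_rel K A" using assms(2) by (auto simp: represents_def quotient_def)
 qed
 moreover have "inj_on (%U. iso_rel K A `` {U}) R"
 proof (rule inj_onI)
  fix U V assume UV: "U\<in>R" "V\<in>R" "iso_rel K A `` {U} = iso_rel K A `` {V}"
  have "V\<in>iso_rel K A `` {V}" using Rm[OF UV(2)] mod_iso_refl by (auto simp: iso_rel_def)
  hence "mod_iso A U V" using UV(3) by (auto simp: iso_rel_def)
  thus "U = V" using assms(2) UV by (auto simp: represents_def noniso_def)
 qed
 ultimately show ?thesis by (simp add: card_image)
qed

lemma IS_MC: "IS M <= MC" by (auto simp: indecomposable_summands_def indecomposable_def)

lemma num_summands_eq: "represents R (IS M) ==> num_summands K A M = card R"
 unfolding num_summands_def by (rule card_reps[OF IS_MC])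

lemma reps_IS: obtains R where "represents R (IS M)"
 using reps_exist[OF IS_MC[of M]] unfolding represents_def by metis

text \<open>By the exchange property a decomposition meets every class of indecomposable summands.
  Finiteness matters because \<open>card\<close> of an infinite set is 0.\<close>

lemma finite_reps_IS:
 assumes "M\<in>MC" "represents R (IS M)"
 shows "finite R"
proof -
 have "\<exists>B :: ('k, 'a) rmod set. finite B & (\<forall>U. ind U --> sd U M --> (\<exists>V\<in>B. mod_iso A U V))" using assms(1)
 proof (induction rule: decomp_induct)
  case (zero Z) thus ?case using zero_no_summand by blast
 next
  case (sum M U N i1 i2 p1 p2)
  then obtain B :: "('k, 'a) rmod set" where "finite B" "\<forall>V. ind V --> sd V N --> (\<exists>W\<in>B. mod_iso A V W)" by blast
  thus ?case using bip_sd_cases[OF sum(4,1,3,2)] by (intro exI[of _ "insert U B"]) blast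
 qed
 then obtain B :: "('k, 'a) rmod set" where B: "finite B" "!!U. ind U ==> sd U M ==> \<exists>V\<in>B. mod_iso A U V" by blast
 hence "\<exists>b. \<forall>U\<in>R. b U\<in>B & mod_iso A U (b U)"
  using assms IS_iff[OF assms(1)] unfolding represents_def by (metis subsetD)
 then obtain b where b: "!!U. U\<in>R ==> b U\<in>B & mod_iso A U (b U)" by blast
 have "inj_on b R"
 proof (rule inj_onI)
  fix U V assume UV: "U\<in>R" "V\<in>R" "b U = b V"
  have "mod_iso A (b V) V" by (rule iso_sym) (use b UV assms IS_MC in \<open>auto simp: represents_def\<close>)
  hence "mod_iso A U V" using b[OF UV(1)] UV(3) mod_iso_trans by metis
  thus "U = V" using UV assms(2) by (auto simp: represents_def noniso_def)
 qed
 thus ?thesis using B(1) b by (meson finite_subset image_subsetI inj_on_finite)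
qed

end

section \<open>Projective presentations\<close>

context fdalg begin

abbreviation "pj \<equiv> projective K A"

lemma sdI: "i\<in>mh N M ==> p\<in>mh M N ==> (!!x. x\<in>N ==> p (i x) = x) ==> sd N M"
 unfolding sd_def by blast

lemma pj_MC [simp]: "pj P ==> P\<in>MC" by (simp add: projective_def)

text \<open>The map \<open>g\<close> may fail to be onto: it is enough that \<open>f\<close> lands
  in its image, to which \<open>T\<close> is cut down.\<close>

lemma pj_lift:
 assumes "pj P" "S\<in>MC" "T\<in>MC" "g\<in>mh S T" "f\<in>mh P T"
  "!!p. p\<in>P ==> f p\<in>g ` S"
 obtains h where "h\<in>mh P S" "!!p. p\<in>P ==> g (h p) = f p"
proof -
 let ?I = "T(|carrier:=g ` S|)"
 have I: "?I\<in>MC" by (rule sbmD(6)[OF sbm_image[OF assms(4,2,3)] assms(3)])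
 have g: "g\<in>mh S ?I" by (rule module_hom_codom[OF assms(4)]) simp
 have f: "f\<in>mh P ?I" by (rule module_hom_codom[OF assms(5,6)])
 have "\<exists>h\<in>mh P S. \<forall>p\<in>P. g (h p) = f p"
  using assms(1,2) I g f unfolding projective_def by auto
 thus ?thesis using that by blast
qed

lemma pjI:
 assumes "P\<in>MC"
  "!!S T g f. S\<in>MC ==> T\<in>MC ==> g\<in>mh S T ==> f\<in>mh P T ==> g ` S = carrier T ==>
   \<exists>h\<in>mh P S. \<forall>p\<in>P. g (h p) = f p"
 shows "pj P"
 using assms unfolding projective_def by blast

lemma pj_sd:
 assumes "pj P" "N\<in>MC" "sd N P"
 shows "pj N"
proof (rule pjI[OF assms(2)])
 fix S T g f assume h: "S\<in>MC" "T\<in>MC" "g\<in>mh S T" "f\<in>mh N T" "g ` S = carrier T"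
 obtain i p where ip: "i\<in>mh N P" "p\<in>mh P N" "!!x. x\<in>N ==> p (i x) = x"
  using assms(3) by (auto simp: sd_def)
 have fp: "(%x. f (p x))\<in>mh P T" by (rule hom_comp[OF ip(2) h(4)])
 obtain k where k: "k\<in>mh P S" "!!x. x\<in>P ==> g (k x) = f (p x)"
  using pj_lift[OF assms(1) h(1-3) fp] hom_closed[OF fp] h(5) by blast
 show "\<exists>h\<in>mh N S. \<forall>p\<in>N. g (h p) = f p"
  by (rule bexI[OF _ hom_comp[OF ip(1) k(1)]]) (use k(2) ip(3) hom_closed[OF ip(1)] in auto)
qed

lemma pj_zero:
 assumes "Z\<in>MC" "zero_module Z" shows "pj Z"
proof (rule pjI[OF assms(1)])
 fix S T g f assume h: "S\<in>MC" "T\<in>MC" "g\<in>mh S T" "f\<in>mh Z T" "g ` S = carrier T"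
 show "\<exists>h\<in>mh Z S. \<forall>p\<in>Z. g (h p) = f p"
  by (rule bexI[OF _ hom_0[OF MC_rm[OF h(1)]]])
   (use assms hom_zero[OF h(3,1,2)] hom_zero[OF h(4) assms(1) h(2)] in \<open>auto simp: zero_module_def\<close>)
qed

lemma zero_zmod: "zero_module zmod" by (simp add: zero_module_def)

lemma pj_bsum:
 assumes "pj P" "pj Q" shows "pj (P [+] Q)"
proof (rule pjI)
 show "P [+] Q\<in>MC" using assms by simp
 fix S T g f assume h: "S\<in>MC" "T\<in>MC" "g\<in>mh S T" "f\<in>mh (P [+] Q) T" "g ` S = carrier T"
 have r: "rm P" "rm Q" using assms by auto
 note b = bsum_homs[OF r]
 note f1 = hom_comp[OF b(3) h(4)] and f2 = hom_comp[OF b(4) h(4)]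
 obtain k where k: "k\<in>mh P S" "!!x. x\<in>P ==> g (k x) = f (jn x 0_Q)"
  using pj_lift[OF assms(1) h(1-3) f1] hom_closed[OF f1] h(5) by blast
 obtain l where l: "l\<in>mh Q S" "!!x. x\<in>Q ==> g (l x) = f (jn 0_P x)"
  using pj_lift[OF assms(2) h(1-3) f2] hom_closed[OF f2] h(5) by blast
 have "g (k (pr1 z) +_S l (pr2 z)) = f z" if z: "z\<in>(P [+] Q)" for z
 proof -
  have c: "pr1 z\<in>P" "pr2 z\<in>Q" using z by auto
  have "g (k (pr1 z) +_S l (pr2 z)) = f (jn (pr1 z) 0_Q) +_T f (jn 0_P (pr2 z))"
   using homD(2)[OF h(3)] k l c hom_closed[OF k(1)] hom_closed[OF l(1)] by simp
  also have "\<dots> = f z"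
   using homD(2)[OF h(4), of "jn (pr1 z) 0_Q" "jn 0_P (pr2 z)"] c assms by simp
  finally show ?thesis .
 qed
 thus "\<exists>h\<in>mh (P [+] Q) S. \<forall>p\<in>(P [+] Q). g (h p) = f p"
  by (intro bexI[OF _ bsum_copair[OF k(1) l(1) MC_rm[OF h(1)]]]) blast
qed

lemma pj_AA: "pj AA"
proof (rule pjI[OF AA(1)])
 fix S T g f assume h: "S\<in>MC" "T\<in>MC" "g\<in>mh S T" "f\<in>mh AA T" "g ` S = carrier T"
 obtain u where u: "u\<in>AA" "!!M x. M\<in>MC ==> x\<in>M ==> \<exists>h\<in>mh AA M. h u = x"
  "!!y. y\<in>AA ==> \<exists>a\<in>A. y = a ._AA u"
  using AA_generator by metis
 have "f u\<in>g ` S" using hom_closed[OF h(4) u(1)] h(5) by simp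
 then obtain s where s: "s\<in>S" "f u = g s" by blast
 obtain k where k: "k\<in>mh AA S" "k u = s" using u(2)[OF h(1) s(1)] by blast
 have "g (k p) = f p" if p: "p\<in>AA" for p
 proof -
  obtain a where a: "a\<in>A" "p = a ._AA u" using u(3)[OF p] by blast
  thus ?thesis
   using homD(3)[OF h(4), of a u] homD(3)[OF k(1), of a u] homD(3)[OF h(3), of a s] u(1) k(2) s
   by simp
 qed
 thus "\<exists>h\<in>mh AA S. \<forall>p\<in>AA. g (h p) = f p" using k(1) by blast
qed

text \<open>Finite sums of modules from \<open>C\<close>, bracketed to the right and ending in
  \<open>zmod\<close>, so that proofs go by induction over the summands.\<close>

inductive Sm :: "('k, 'a) rmod set \<Rightarrow> ('k, 'a) rmod \<Rightarrow> bool" for C where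
 Sm_zmod: "Sm C zmod"
| Sm_bsum: "U\<in>C ==> Sm C N ==> Sm C (U [+] N)"

lemma Sm_MC: "Sm C R ==> C <= MC ==> R\<in>MC"
 by (induction rule: Sm.induct) (auto intro: MC_zmod)

lemma Sm_sd: "Sm C R ==> C <= MC ==> ind U ==> sd U R ==> \<exists>V\<in>C. sd U V"
proof (induction rule: Sm.induct)
 case Sm_zmod thus ?case using zero_no_summand[OF MC_zmod zero_zmod] by blast
next
 case (Sm_bsum V N) thus ?case using sd_bsum[of U V N] Sm_MC by blast
qed

text \<open>\<open>N\<close> is the sum of the images of all maps from modules in \<open>C\<close>.\<close>

definition gen :: "('k, 'a) rmod set \<Rightarrow> ('k, 'a) rmod \<Rightarrow> bool" where
 "gen C N <-> (\<forall>V. sbm V N --> (\<forall>U\<in>C. \<forall>h\<in>mh U N. h ` U <= V) --> carrier N <= V)"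

text \<open>Among the maps to \<open>N\<close> from finite sums of modules in \<open>C\<close>, one
  has an image of greatest dimension. Adjoining another map from a module in \<open>C\<close> cannot
  enlarge this image, which is therefore all of \<open>N\<close>.\<close>

lemma gen_Sm:
 assumes "C <= MC" "N\<in>MC" "gen C N"
 obtains R ro where "Sm C R" "ro\<in>mh R N" "ro ` R = carrier N"
proof -
 let ?P = "%(R, ro). Sm C R & ro\<in>mh R N"
 let ?d = "%(R, ro). dm (N(|carrier:=ro ` R|))"
 have sI: "sbm (ro ` R) N" if "?P (R, ro)" for R ro
  using that sbm_image[OF _ _ assms(2)] Sm_MC[OF _ assms(1)] by auto
 have bd: "?d y < Suc (dm N)" if "?P y" for y
 proof (cases y)
  case (Pair R ro)
  thus ?thesis using dm_sub[OF assms(2) sI[of R ro]] that by (cases "ro ` R = carrier N") auto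
 qed
 have "?P (zmod, %_. 0_N)" using Sm_zmod hom_0[OF MC_rm[OF assms(2)]] by auto
 then obtain R ro where R: "Sm C R" "ro\<in>mh R N" and mx: "!!y. ?P y ==> ?d y <= ?d (R, ro)"
 proof -
  assume a: "!!R ro. Sm C R ==> ro\<in>mh R N ==> (!!y. ?P y ==> ?d y <= ?d (R, ro)) ==> thesis"
  obtain z where "?P z" "\<forall>y. ?P y --> ?d y <= ?d z"
   using ex_has_greatest_nat[of ?P "(zmod, %_. 0_N)" ?d "Suc (dm N)"] bd \<open>?P (zmod, \<lambda>_. \<zero>\<^bsub>N\<^esub>)\<close> by blast
  thus thesis using a[of "fst z" "snd z"] by (cases z) auto
 qed
 have Rm: "R\<in>MC" using Sm_MC[OF R(1) assms(1)] .
 have sR: "sbm (ro ` R) N" using sI R by auto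
 have "h ` U <= ro ` R" if U: "U\<in>C" "h\<in>mh U N" for U h
 proof -
  have Um: "U\<in>MC" using U assms(1) by auto
  let ?\<sigma> = "%z. h (pr1 z) +_N ro (pr2 z)"
  have s: "?\<sigma>\<in>mh (U [+] R) N" by (rule bsum_copair[OF U(2) R(2) MC_rm[OF assms(2)]])
  have P: "?P (U [+] R, ?\<sigma>)" using s Sm_bsum[OF U(1) R(1)] by simp
  let ?J = "?\<sigma> ` carrier (U [+] R)"
  have sJ: "sbm ?J N" using sI[OF P] .
  have 1: "ro ` R <= ?J"
  proof
   fix y assume "y\<in>ro ` R"
   then obtain x where "x\<in>R" "y = ro x" by blast
   thus "y\<in>?J" using Um Rm hom_closed[OF R(2)] hom_zero[OF U(2) Um assms(2)] assms(2)
    by (intro image_eqI[of _ _ "jn 0_U x"]) auto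
  qed
  have 2: "h ` U <= ?J"
  proof
   fix y assume "y\<in>h ` U"
   then obtain x where "x\<in>U" "y = h x" by blast
   thus "y\<in>?J" using Um Rm hom_closed[OF U(2)] hom_zero[OF R(2) Rm assms(2)] assms(2)
    by (intro image_eqI[of _ _ "jn x 0_R"]) auto
  qed
  have "ro ` R = ?J"
  proof (rule ccontr)
   assume ne: "ro ` R ~= ?J"
   let ?N = "N(|carrier:=?J|)"
   note JD = sbmD[OF sJ assms(2)]
   have "sbm (ro ` R) ?N"
    by (rule sbm_image[OF module_hom_codom[OF R(2)] Rm JD(6)]) (use 1 in blast)
   hence "dm (?N(|carrier:=ro ` R|)) < dm ?N" using dm_sub[OF JD(6)] ne by simp
   thus False using mx[OF P] by simp
  qed
  thus ?thesis using 2 by simp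
 qed
 hence "carrier N <= ro ` R" using assms(3) sR by (auto simp: gen_def)
 hence "ro ` R = carrier N" using hom_closed[OF R(2)] by blast
 thus ?thesis using that R by blast
qed

lemma gen_of_surj:
 assumes "Sm C R" "ro\<in>mh R N" "ro ` R = carrier N" "C <= MC" "N\<in>MC"
 shows "gen C N"
 unfolding gen_def
proof (intro allI impI)
 fix V assume V: "sbm V N" "\<forall>U\<in>C. \<forall>h\<in>mh U N. h ` U <= V"
 note VD = sbmD[OF V(1) assms(5)]
 have "ro ` R <= V" if "Sm C R" "ro\<in>mh R N" for R ro using that
 proof (induction arbitrary: ro rule: Sm.induct)
  case Sm_zmod thus ?case using hom_zero[OF Sm_zmod MC_zmod assms(5)] VD(2) by auto
 next
  case (Sm_bsum U R)
  have m: "U\<in>MC" "R\<in>MC" using Sm_bsum assms(4) Sm_MC by auto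
  note b = bsum_homs[OF MC_rm[OF m(1)] MC_rm[OF m(2)]]
  have 1: "ro (jn x 0_R)\<in>V" if "x\<in>U" for x
   using bspec[OF bspec[OF V(2) Sm_bsum(1)] hom_comp[OF b(3) Sm_bsum.prems]] that by blast
  have 2: "ro (jn 0_U y)\<in>V" if "y\<in>R" for y
   using Sm_bsum.IH[OF hom_comp[OF b(4) Sm_bsum.prems]] that by blast
  show ?case
  proof
   fix v assume "v\<in>ro ` carrier (U [+] R)"
   then obtain z where z: "z\<in>(U [+] R)" "v = ro z" by blast
   have "ro z = ro (jn (pr1 z) 0_R) +_N ro (jn 0_U (pr2 z))"
    using homD(2)[OF Sm_bsum.prems, of "jn (pr1 z) 0_R" "jn 0_U (pr2 z)"] z m by simp
   thus "v\<in>V" using VD(3) 1 2 z by simp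
  qed
 qed
 thus "carrier N <= V" using assms(1-3) by blast
qed

lemma gen_AA: "N\<in>MC ==> gen {AA} N"
 unfolding gen_def
proof (intro allI impI subsetI)
 fix V x assume N: "N\<in>MC" and V: "\<forall>U\<in>{AA}. \<forall>h\<in>mh U N. h ` U <= V" and x: "x\<in>N"
 obtain u where u: "u\<in>AA" "!!M x. M\<in>MC ==> x\<in>M ==> \<exists>h\<in>mh AA M. h u = x"
  using AA_generator by metis
 show "x\<in>V" using u(2)[OF N x] V u(1) by blast
qed

lemma Sm_pj: "Sm C R ==> (!!U. U\<in>C ==> pj U) ==> pj R"
 by (induction rule: Sm.induct) (auto intro: pj_bsum pj_zero MC_zmod zero_zmod)

lemma enough_projectives:
 assumes "M\<in>MC"
 obtains P e where "pj P" "e\<in>mh P M" "e ` P = carrier M" "Sm {AA} P"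
proof -
 obtain R ro where R: "Sm {AA} R" "ro\<in>mh R M" "ro ` R = carrier M"
  using gen_Sm[OF _ assms gen_AA[OF assms]] AA(1) by auto
 thus ?thesis using that Sm_pj[OF R(1)] pj_AA by blast
qed

lemma surj_onto_pj_splits:
 assumes "pj Q" "M\<in>MC" "e\<in>mh M Q" "e ` M = carrier Q"
 shows "sd Q M"
proof -
 obtain h where "h\<in>mh Q M" "!!p. p\<in>Q ==> e (h p) = p"
  using pj_lift[OF assms(1,2) _ assms(3) hom_id] assms by auto
 thus ?thesis unfolding sd_def using assms(3) by blast
qed

text \<open>An indecomposable projective splits off a sum of copies of \<open>AA\<close>, hence off
  one copy by the exchange property.\<close>

lemma ind_pj_iff: "ind Q ==> pj Q <-> sd Q AA"
proof
 assume Q: "ind Q" "pj Q"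
 obtain P e where P: "pj P" "e\<in>mh P Q" "e ` P = carrier Q" "Sm {AA} P"
  using enough_projectives[of Q] Q(2) by auto
 have "sd Q P" by (rule surj_onto_pj_splits[OF Q(2) _ P(2,3)]) (use P in auto)
 from Sm_sd[OF P(4) _ Q(1) this] show "sd Q AA" using AA(1) by auto
qed (use pj_sd pj_AA indD in blast)

section \<open>Projective covers and minimal presentations\<close>

lemma a_kernel_iff: "x\<in>a_kernel P M f <-> x\<in>P & f x = 0_M"
 by (auto simp: a_kernel_def')

lemma set_add_iff: "x\<in>V <+>\<^bsub>P\<^esub> W <-> (\<exists>v\<in>V. \<exists>w\<in>W. x = v +_P w)"
 by (auto simp: set_add_def')

text \<open>\<open>P\<close> has least dimension among the projective modules that map onto
  \<open>M\<close>. If \<open>V\<close> and the kernel of \<open>f\<close> span \<open>P\<close>,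
  lifting \<open>f\<close> through \<open>V\<close> gives an endomorphism \<open>h\<close> of
  \<open>P\<close> over \<open>M\<close>. The image of its Fitting idempotent is projective and
  still maps onto \<open>M\<close>, so it is all of \<open>P\<close>; but it lies in
  \<open>V\<close>.\<close>

lemma cover_exists:
 assumes M: "M\<in>MC"
 obtains P f where "proj_cover_onto K A P M f (carrier M)"
proof -
 let ?P = "%(P, f). pj P & f\<in>mh P M & f ` P = carrier M"
 obtain P0 f0 where "pj P0" "f0\<in>mh P0 M" "f0 ` P0 = carrier M"
  by (rule enough_projectives[OF M]) blast
 hence P0: "?P (P0, f0)" by blast
 obtain z where z: "?P z" "!!y. ?P y ==> dm (fst z) <= dm (fst y)"
  using ex_has_least_nat[of ?P "(P0, f0)" "%y. dm (fst y)"] P0 by blast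
 define P f where "P = fst z" and "f = snd z"
 have P: "pj P" "f\<in>mh P M" "f ` P = carrier M" using z(1) by (auto simp: P_def f_def)
 have mn: "dm P <= dm Q" if "pj Q" "g\<in>mh Q M" "g ` Q = carrier M" for Q g
  using z(2)[of "(Q, g)"] that by (simp add: P_def)
 have Pm: "P\<in>MC" using P(1) by simp
 have "V = carrier P" if V: "sbm V P" "V <+>\<^bsub>P\<^esub> a_kernel P M f = carrier P" for V
 proof -
  note VD = sbmD[OF V(1) Pm]
  let ?V = "P(|carrier:=V|)"
  have fV: "f\<in>mh ?V M" by (rule module_hom_dom[OF P(2)]) (use VD(1) in auto)
  have "f p\<in>f ` carrier ?V" if p: "p\<in>P" for p
  proof -
   obtain v k where vk: "v\<in>V" "k\<in>a_kernel P M f" "p = v +_P k"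
    using p V(2) by (metis set_add_iff)
   hence "f p = f v"
    using homD(2)[OF P(2), of v k] VD(1) hom_closed[OF P(2)] M by (simp add: a_kernel_iff)
   thus ?thesis using vk by simp
  qed
  then obtain h where h: "h\<in>mh P ?V" "!!p. p\<in>P ==> f (h p) = f p"
   using pj_lift[OF P(1) VD(6) M fV P(2)] by blast
  have hP: "h\<in>mh P P" using hom_comp[OF h(1) VD(7)] by simp
  obtain n e where e: "n > 0" "e\<in>mh P P" "!!x. x\<in>P ==> e (e x) = e x"
   "e ` P = (h ^^ n) ` P"
   by (rule fitting[OF Pm hP]) blast
  have fh: "f ((h ^^ m) p) = f p & (h ^^ m) p\<in>P" if "p\<in>P" for m p
   using that by (induction m) (auto simp: h(2) hom_closed[OF hP])
  let ?I = "P(|carrier:=e ` P|)"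
  have sI: "sbm (e ` P) P" by (rule sbm_image[OF e(2) Pm Pm])
  note ID = sbmD[OF sI Pm]
  have eI: "e\<in>mh P ?I" by (rule module_hom_codom[OF e(2)]) auto
  have "sd ?I P" by (rule sdI[OF ID(7) eI]) (use e(3) in auto)
  hence pI: "pj ?I" using pj_sd[OF P(1) ID(6)] by blast
  have fI: "f\<in>mh ?I M" by (rule module_hom_dom[OF P(2)]) (use ID(1) in auto)
  have "f ` carrier ?I = carrier M"
  proof (intro equalityI subsetI)
   fix m assume "m\<in>M"
   then obtain p where "p\<in>P" "m = f p" using P(3) by blast
   thus "m\<in>f ` carrier ?I" using fh[of p n] e(4) by (intro image_eqI[of _ _ "(h ^^ n) p"]) auto
  qed (use hom_closed[OF fI] in blast)
  hence "dm P <= dm ?I" using mn[OF pI fI] by blast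
  hence "~ dm ?I < dm P" by simp
  hence c: "e ` P = carrier P" using dm_sub[OF Pm sI] by blast
  \<comment> \<open>Here \<open>n > 0\<close> is essential: it is the last application of
    \<open>h\<close> that lands in \<open>V\<close>.\<close>
  have hV: "(h ^^ n) p\<in>V" if "p\<in>P" for p
  proof -
   obtain m where m: "n = Suc m" using e(1) not0_implies_Suc by blast
   have 1: "(h ^^ m) p\<in>P" using fh[OF that, of m] by blast
   have 2: "(h ^^ n) p = h ((h ^^ m) p)" unfolding m by simp
   show ?thesis unfolding 2 using hom_closed[OF h(1) 1] by simp
  qed
  have "x\<in>V" if "x\<in>P" for x
  proof -
   have "x\<in>(h ^^ n) ` P" using that c e(4) by simp
   thus ?thesis by (rule imageE) (use hV in simp)
  qed
  thus ?thesis using VD(1) by blast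
 qed
 hence "proj_cover_onto K A P M f (carrier M)" using P unfolding proj_cover_onto_def by blast
 thus ?thesis by (rule that)
qed

lemma cover_rigid:
 assumes "proj_cover_onto K A P M f U" "M\<in>MC" "t\<in>mh P P" "!!p. p\<in>P ==> f (t p) = f p"
 shows "isoM P P t"
proof -
 have P: "pj P" "f\<in>mh P M" and sup: "!!V. sbm V P ==> V <+>\<^bsub>P\<^esub> a_kernel P M f = carrier P ==> V = carrier P"
  using assms(1) by (auto simp: proj_cover_onto_def)
 have Pm: "P\<in>MC" using P by simp
 have "t ` P = carrier P"
 proof (rule sup[OF sbm_image[OF assms(3) Pm Pm]], intro equalityI subsetI)
  fix x assume x: "x\<in>P"
  have tx: "t x\<in>P" by (rule hom_closed[OF assms(3) x])
  have "x -_P t x\<in>a_kernel P M f"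
   using hom_minus[OF P(2) Pm assms(2) x tx] assms(2,4) x tx Pm hom_closed[OF P(2)] by (simp add: a_kernel_iff)
  thus "x\<in>t ` P <+>\<^bsub>P\<^esub> a_kernel P M f"
   unfolding set_add_iff using x tx Pm by (intro bexI[of _ "t x"] bexI[of _ "x -_P t x"]) auto
 next
  fix x assume "x\<in>t ` P <+>\<^bsub>P\<^esub> a_kernel P M f"
  thus "x\<in>P" using hom_closed[OF assms(3)] Pm by (auto simp: set_add_iff a_kernel_iff)
 qed
 thus ?thesis using endo_inj_iff_surj[OF Pm assms(3)] by (simp add: bij_betw_def)
qed

definition pres where
 "pres P1 P0 f e M <-> pj P1 & pj P0 & M\<in>MC & f\<in>mh P1 P0 & e\<in>mh P0 M &
   e ` P0 = carrier M & (\<forall>y\<in>P0. e y = 0_M <-> y\<in>f ` P1)"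

lemma presD:
 assumes "pres P1 P0 f e M"
 shows "pj P1" "pj P0" "M\<in>MC" "f\<in>mh P1 P0" "e\<in>mh P0 M" "e ` P0 = carrier M"
  "!!y. y\<in>P0 ==> e y = 0_M <-> y\<in>f ` P1" "P1\<in>MC" "P0\<in>MC"
  "!!x. x\<in>P1 ==> e (f x) = 0_M"
 using assms hom_closed[of f P1 P0] by (auto simp: pres_def)

lemma min_pres_pres:
 assumes "M\<in>MC" "min_proj_presentation K A M P1 P0 f e"
 shows "pres P1 P0 f e M"
 using assms by (auto simp: pres_def min_proj_presentation_def proj_cover_onto_def a_kernel_iff)

lemma min_pres_exists:
 assumes "M\<in>MC"
 shows "\<exists>P1 P0 f g. min_proj_presentation K A M P1 P0 f g"
proof -
 obtain P0 g where P0: "proj_cover_onto K A P0 M g (carrier M)" using cover_exists[OF assms] by blast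
 hence g: "pj P0" "g\<in>mh P0 M" by (auto simp: proj_cover_onto_def)
 let ?U = "a_kernel P0 M g"
 have e: "?U = {x\<in>P0. g x = 0_M}" by (auto simp: a_kernel_iff)
 have s: "sbm ?U P0" unfolding e by (rule sbm_kernel[OF g(2) pj_MC[OF g(1)] assms])
 note UD = sbmD[OF s pj_MC[OF g(1)]]
 obtain P1 f where P1: "proj_cover_onto K A P1 (P0(|carrier:=?U|)) f ?U"
  using cover_exists[OF UD(6)] by auto
 hence f: "f\<in>mh P1 (P0(|carrier:=?U|))" by (simp add: proj_cover_onto_def)
 have "a_kernel P1 P0 f = a_kernel P1 (P0(|carrier:=?U|)) f" by (auto simp: a_kernel_iff)
 hence "proj_cover_onto K A P1 P0 f ?U"
  using P1 hom_comp[OF f UD(7)] by (simp add: proj_cover_onto_def)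
 thus ?thesis using P0 unfolding min_proj_presentation_def by blast
qed

text \<open>The choice term is the one inside \<open>AR_translate\<close>, so that both refer to the
  same minimal presentation.\<close>

definition mp where
 "mp M = (SOME (P1, P0, f). \<exists>g. min_proj_presentation K A M P1 P0 f g)"

abbreviation "mp1 M \<equiv> fst (mp M)"

abbreviation "mp0 M \<equiv> fst (snd (mp M))"

abbreviation "mpf M \<equiv> snd (snd (mp M))"

lemma mp_min:
 assumes "M\<in>MC"
 obtains g where "min_proj_presentation K A M (mp1 M) (mp0 M) (mpf M) g"
  "pres (mp1 M) (mp0 M) (mpf M) g M"
proof -
 have "\<exists>y. case y of (P1, P0, f) \<Rightarrow> \<exists>g. min_proj_presentation K A M P1 P0 f g"
  using min_pres_exists[OF assms] by auto
 from someI_ex[OF this] have "\<exists>g. min_proj_presentation K A M (mp1 M) (mp0 M) (mpf M) g"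
  unfolding mp_def[symmetric] by (simp add: case_prod_beta)
 thus ?thesis using that min_pres_pres[OF assms] by blast
qed

text \<open>Together with \<open>E0_ext\<close> this says that the modules satisfying
  \<open>E0\<close> form a torsion class. Closure under quotients rests on the projectivity of
  \<open>P1\<close>, closure under extensions on that of \<open>P0\<close>.\<close>

lemma E0_quot:
 assumes "E0 P1 P0 f N" "pj P1" "N\<in>MC" "N'\<in>MC" "q\<in>mh N N'" "q ` N = carrier N'"
 shows "E0 P1 P0 f N'"
 unfolding E0_def
proof
 fix g assume g: "g\<in>mh P1 N'"
 obtain g' where g': "g'\<in>mh P1 N" "!!x. x\<in>P1 ==> q (g' x) = g x"
  using pj_lift[OF assms(2-5) g] hom_closed[OF g] assms(6) by blast
 obtain h where h: "h\<in>mh P0 N" "\<forall>x\<in>P1. h (f x) = g' x"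
  using assms(1) g'(1) by (auto simp: E0_def)
 show "\<exists>h\<in>mh P0 N'. \<forall>x\<in>P1. h (f x) = g x"
  by (rule bexI[OF _ hom_comp[OF h(1) assms(5)]]) (use h(2) g'(2) in auto)
qed

lemma E0_sd:
 assumes "E0 P1 P0 f N" "sd N' N"
 shows "E0 P1 P0 f N'"
 unfolding E0_def
proof
 fix g assume g: "g\<in>mh P1 N'"
 obtain i p where ip: "i\<in>mh N' N" "p\<in>mh N N'" "!!x. x\<in>N' ==> p (i x) = x"
  using assms(2) by (auto simp: sd_def)
 obtain h where h: "h\<in>mh P0 N" "\<forall>x\<in>P1. h (f x) = i (g x)"
  using assms(1) hom_comp[OF g ip(1)] by (auto simp: E0_def)
 show "\<exists>h\<in>mh P0 N'. \<forall>x\<in>P1. h (f x) = g x"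
  by (rule bexI[OF _ hom_comp[OF h(1) ip(2)]]) (use h(2) ip(3) hom_closed[OF g] in auto)
qed

lemma E0_ext:
 assumes "E0 P1 P0 f N'" "pj P0" "P1\<in>MC" "f\<in>mh P1 P0" "N\<in>MC" "N'\<in>MC" "q\<in>mh N N'" "q ` N = carrier N'"
  "E0 P1 P0 f (N(|carrier:={x\<in>N. q x = 0_N'}|))"
 shows "E0 P1 P0 f N"
 unfolding E0_def
proof
 fix g assume g: "g\<in>mh P1 N"
 let ?N = "N(|carrier:={x\<in>N. q x = 0_N'}|)"
 have s: "sbm {x\<in>N. q x = 0_N'} N" by (rule sbm_kernel[OF assms(7,5,6)])
 note D = sbmD[OF s assms(5)]
 obtain h where h: "h\<in>mh P0 N'" "\<forall>x\<in>P1. h (f x) = q (g x)"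
  using assms(1) hom_comp[OF g assms(7)] by (auto simp: E0_def)
 obtain h' where h': "h'\<in>mh P0 N" "!!x. x\<in>P0 ==> q (h' x) = h x"
  using pj_lift[OF assms(2,5-7) h(1)] hom_closed[OF h(1)] assms(8) by blast
 have hf: "(%x. h' (f x))\<in>mh P1 N" by (rule hom_comp[OF assms(4) h'(1)])
 have d: "(%x. g x -_N h' (f x))\<in>mh P1 ?N"
 proof (rule module_hom_codom[OF hom_diff[OF g hf MC_rm[OF assms(5)]]])
  fix x assume x: "x\<in>P1"
  thus "g x -_N h' (f x)\<in>{x\<in>N. q x = 0_N'}"
   using hom_minus[OF assms(7,5,6)] hom_closed[OF g x] hom_closed[OF hf x] h h'(2) hom_closed[OF assms(4) x]
    hom_closed[OF assms(7)] assms(5,6) by simp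
 qed
 obtain k where k: "k\<in>mh P0 ?N" "\<forall>x\<in>P1. k (f x) = g x -_N h' (f x)"
  using assms(9) d by (auto simp: E0_def)
 have k': "k\<in>mh P0 N" using hom_comp[OF k(1) D(7)] by simp
 show "\<exists>h\<in>mh P0 N. \<forall>x\<in>P1. h (f x) = g x"
  by (rule bexI[OF _ hom_add[OF k' h'(1) MC_rm[OF assms(5)]]])
   (use k(2) hom_closed[OF g] hom_closed[OF hf] assms(5) in auto)
qed

lemma E0_zero:
 assumes "N\<in>MC" "zero_module N" shows "E0 P1 P0 f N"
 unfolding E0_def
proof
 fix g assume g: "g\<in>mh P1 N"
 show "\<exists>h\<in>mh P0 N. \<forall>x\<in>P1. h (f x) = g x"
  by (rule bexI[OF _ hom_0[OF MC_rm[OF assms(1)]]])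
   (use hom_closed[OF g] assms(2) in \<open>auto simp: zero_module_def\<close>)
qed

lemma E0_bsum:
 assumes "E0 P1 P0 f N" "E0 P1 P0 f N'" "N\<in>MC" "N'\<in>MC"
 shows "E0 P1 P0 f (N [+] N')"
 unfolding E0_def
proof
 fix g assume g: "g\<in>mh P1 (N [+] N')"
 note b = bsum_homs[OF MC_rm[OF assms(3)] MC_rm[OF assms(4)]]
 obtain h where h: "h\<in>mh P0 N" "\<forall>x\<in>P1. h (f x) = pr1 (g x)"
  using assms(1) hom_comp[OF g b(1)] by (auto simp: E0_def)
 obtain k where k: "k\<in>mh P0 N'" "\<forall>x\<in>P1. k (f x) = pr2 (g x)"
  using assms(2) hom_comp[OF g b(2)] by (auto simp: E0_def)
 show "\<exists>h\<in>mh P0 (N [+] N'). \<forall>x\<in>P1. h (f x) = g x"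
  by (rule bexI[OF _ bsum_pair[OF h(1) k(1)]]) (use h k in auto)
qed

lemma E0_Sm: "Sm C R ==> C <= MC ==> (!!U. U\<in>C ==> E0 P1 P0 f U) ==> E0 P1 P0 f R"
proof (induction rule: Sm.induct)
 case Sm_zmod show ?case by (rule E0_zero[OF MC_zmod zero_zmod])
next
 case (Sm_bsum U N)
 show ?case
  by (rule E0_bsum[OF Sm_bsum.prems(2)[OF Sm_bsum(1)] Sm_bsum.IH[OF Sm_bsum.prems]])
   (use Sm_bsum Sm_MC in auto)
qed

lemma E0_gen:
 assumes "gen C N" "C <= MC" "N\<in>MC" "!!U. U\<in>C ==> E0 P1 P0 f U" "pj P1"
 shows "E0 P1 P0 f N"
proof -
 obtain R ro where R: "Sm C R" "ro\<in>mh R N" "ro ` R = carrier N"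
  using gen_Sm[OF assms(2,3,1)] by blast
 show ?thesis by (rule E0_quot[OF E0_Sm[OF R(1) assms(2,4)] assms(5) Sm_MC[OF R(1) assms(2)] assms(3) R(2,3)])
qed

lemma pres_descend:
 assumes "pres P1 P0 f e M" "N\<in>MC" "h\<in>mh P0 N" "!!x. x\<in>P1 ==> h (f x) = 0_N"
 obtains w where "w\<in>mh M N" "!!y. y\<in>P0 ==> w (e y) = h y"
proof -
 note D = presD[OF assms(1)]
 show ?thesis
  using factor_surj[OF MC_rm[OF D(9)] MC_rm[OF D(3)] MC_rm[OF assms(2)] D(5,6) assms(3)] D(7) assms(4) that
  by blast
qed

text \<open>Maps from \<open>P0\<close> that vanish on the image of \<open>f\<close> are the maps
  from \<open>M\<close>.\<close>

lemma N0_iff: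
 assumes "pres P1 P0 f e M" "N\<in>MC"
 shows "N0 P1 P0 f N <-> (\<forall>w\<in>mh M N. \<forall>x\<in>M. w x = 0_N)"
proof
 note D = presD[OF assms(1)]
 assume n: "N0 P1 P0 f N"
 show "\<forall>w\<in>mh M N. \<forall>x\<in>M. w x = 0_N"
 proof (intro ballI)
  fix w x assume w: "w\<in>mh M N" and x: "x\<in>M"
  have "\<forall>y\<in>P0. w (e y) = 0_N"
   using n hom_comp[OF D(5) w] D(10) hom_zero[OF w D(3) assms(2)] by (auto simp: N0_def)
  thus "w x = 0_N" using x unfolding D(6)[symmetric] by blast
 qed
next
 note D = presD[OF assms(1)]
 assume w: "\<forall>w\<in>mh M N. \<forall>x\<in>M. w x = 0_N"
 show "N0 P1 P0 f N" unfolding N0_def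
 proof (intro ballI impI)
  fix h y assume h: "h\<in>mh P0 N" "\<forall>x\<in>P1. h (f x) = 0_N" and y: "y\<in>P0"
  obtain v where "v\<in>mh M N" "!!y. y\<in>P0 ==> v (e y) = h y"
   using pres_descend[OF assms h(1)] h(2) by blast
  thus "h y = 0_N" using w y hom_closed[OF D(5) y] by metis
 qed
qed

text \<open>A lift of \<open>u\<close> to \<open>P0\<close> restricts to a map from
  \<open>P1\<close> into the kernel of \<open>q\<close>. By \<open>E0\<close> this obstruction
  extends to \<open>P0\<close> and can be subtracted; in other words, \<open>E0\<close> makes the
  first Ext group from \<open>M\<close> to the kernel vanish.\<close>

lemma lift_along:
 assumes "pres P1 P0 f e M" "N\<in>MC" "N'\<in>MC" "q\<in>mh N N'" "q ` N = carrier N'"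
  "E0 P1 P0 f (N(|carrier:={x\<in>N. q x = 0_N'}|))" "u\<in>mh M N'"
 obtains w where "w\<in>mh M N" "!!x. x\<in>M ==> q (w x) = u x"
proof -
 note D = presD[OF assms(1)]
 let ?N = "N(|carrier:={x\<in>N. q x = 0_N'}|)"
 have s: "sbm {x\<in>N. q x = 0_N'} N" by (rule sbm_kernel[OF assms(4,2,3)])
 note SD = sbmD[OF s assms(2)]
 have ue: "(%y. u (e y))\<in>mh P0 N'" by (rule hom_comp[OF D(5) assms(7)])
 obtain h where h: "h\<in>mh P0 N" "!!y. y\<in>P0 ==> q (h y) = u (e y)"
  using pj_lift[OF D(2) assms(2-4) ue] hom_closed[OF ue] assms(5) by blast
 have hf: "(%x. h (f x))\<in>mh P1 ?N"
  by (rule module_hom_codom[OF hom_comp[OF D(4) h(1)]])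
   (use hom_closed[OF D(4)] hom_closed[OF h(1)] h(2) D(10) hom_zero[OF assms(7) D(3) assms(3)] in auto)
 obtain k where k: "k\<in>mh P0 ?N" "\<forall>x\<in>P1. k (f x) = h (f x)"
  using assms(6) hf by (auto simp: E0_def)
 have k': "k\<in>mh P0 N" using hom_comp[OF k(1) SD(7)] by simp
 have qk: "q (k y) = 0_N'" if "y\<in>P0" for y using hom_closed[OF k(1) that] by simp
 have hk: "(%y. h y -_N k y)\<in>mh P0 N" by (rule hom_diff[OF h(1) k' MC_rm[OF assms(2)]])
 have hk0: "h (f x) -_N k (f x) = 0_N" if "x\<in>P1" for x
  using k(2) that hom_closed[OF h(1) hom_closed[OF D(4) that]] assms(2) by simp
 obtain w where w: "w\<in>mh M N" "!!y. y\<in>P0 ==> w (e y) = h y -_N k y"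
  using pres_descend[OF assms(1,2) hk hk0] by blast
 have "q (w x) = u x" if x: "x\<in>M" for x
 proof -
  obtain y where y: "y\<in>P0" "x = e y" using D(6) x by blast
  thus ?thesis
   using w(2) hom_minus[OF assms(4,2,3)] hom_closed[OF h(1)] hom_closed[OF k'] h(2) qk hom_closed[OF ue] assms(3)
   by simp
 qed
 thus ?thesis using that w(1) by blast
qed

end

section \<open>Index functionals\<close>

context fdalg begin

lemma cover_normalize:
 assumes "proj_cover_onto K A P M f U" "M\<in>MC" "t\<in>mh P P" "!!p. p\<in>P ==> f (t p) = f p"
 obtains s where "s\<in>mh P P" "!!p. p\<in>P ==> s (t p) = p" "!!p. p\<in>P ==> f (s p) = f p"
proof -
 have "pj P" using assms(1) by (simp add: proj_cover_onto_def)
 have "isoM P P t" by (rule cover_rigid[OF assms])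
 note v = hom_inv[OF assms(3) \<open>isoM P P t\<close> MC_rm[OF pj_MC[OF \<open>pj P\<close>]]]
 let ?s = "inv_into (carrier P) t"
 have "f (?s p) = f p" if "p\<in>P" for p
  using assms(4)[OF hom_closed[OF v(1) that]] v(4)[OF that] by simp
 thus ?thesis using that v(1,3) by blast
qed

text \<open>The minimal presentation of a summand is a direct summand, compatibly with all maps, of
  every presentation of \<open>M\<close>. Lifts in both directions exist by projectivity, and
  \<open>cover_normalize\<close> corrects their composites to identities.\<close>

lemma compare:
 assumes p: "pres P1 P0 f e M" and V: "V\<in>MC" and i: "i\<in>mh V M" and q: "q\<in>mh M V"
  and qi: "\<forall>x\<in>V. q (i x) = x" and m: "min_proj_presentation K A V Q1 Q0 f' e'"
 obtains a0 b0 a1 b1 where "a0\<in>mh Q0 P0" "b0\<in>mh P0 Q0" "a1\<in>mh Q1 P1" "b1\<in>mh P1 Q1"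
  "!!x. x\<in>Q0 ==> b0 (a0 x) = x" "!!x. x\<in>Q1 ==> b1 (a1 x) = x"
  "!!x. x\<in>Q0 ==> e (a0 x) = i (e' x)" "!!x. x\<in>P0 ==> e' (b0 x) = q (e x)"
  "!!x. x\<in>Q1 ==> f (a1 x) = a0 (f' x)" "!!x. x\<in>P1 ==> f' (b1 x) = b0 (f x)"
proof -
 note D = presD[OF p] and D' = presD[OF min_pres_pres[OF V m]]
 have c0: "proj_cover_onto K A Q0 V e' (carrier V)" and c1: "proj_cover_onto K A Q1 Q0 f' (a_kernel Q0 V e')"
  using m by (auto simp: min_proj_presentation_def)
 note ie = hom_comp[OF D'(5) i] and qe = hom_comp[OF D(5) q]
 obtain a0 where a0: "a0\<in>mh Q0 P0" "!!x. x\<in>Q0 ==> e (a0 x) = i (e' x)"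
  using pj_lift[OF D'(2) D(9) D(3) D(5) ie] hom_closed[OF ie] D(6) by blast
 obtain b where b: "b\<in>mh P0 Q0" "!!x. x\<in>P0 ==> e' (b x) = q (e x)"
  using pj_lift[OF D(2) D'(9) D'(3) D'(5) qe] hom_closed[OF qe] D'(6) by blast
 have ba: "(%x. b (a0 x))\<in>mh Q0 Q0" by (rule hom_comp[OF a0(1) b(1)])
 have eba: "e' (b (a0 x)) = e' x" if "x\<in>Q0" for x
  using b(2)[OF hom_closed[OF a0(1) that]] a0(2)[OF that] bspec[OF qi hom_closed[OF D'(5) that]] by simp
 obtain s where s: "s\<in>mh Q0 Q0" "!!x. x\<in>Q0 ==> s (b (a0 x)) = x" "!!x. x\<in>Q0 ==> e' (s x) = e' x"
  using cover_normalize[OF c0 V ba eba] by blast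
 define b0 where "b0 x = s (b x)" for x
 have b0: "b0\<in>mh P0 Q0" unfolding b0_def by (rule hom_comp[OF b(1) s(1)])
 have b0a: "b0 (a0 x) = x" if "x\<in>Q0" for x unfolding b0_def by (rule s(2)[OF that])
 have b0e: "e' (b0 x) = q (e x)" if "x\<in>P0" for x
  unfolding b0_def using s(3)[OF hom_closed[OF b(1) that]] b(2)[OF that] by simp
 note af = hom_comp[OF D'(4) a0(1)] and bf = hom_comp[OF D(4) b0]
 have "a0 (f' x)\<in>f ` P1" if x: "x\<in>Q1" for x
 proof -
  have "e (a0 (f' x)) = 0_M"
   using a0(2)[OF hom_closed[OF D'(4) x]] D'(10)[OF x] hom_zero[OF i V D(3)] by simp
  thus ?thesis using D(7)[OF hom_closed[OF af x]] by simp
 qed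
 then obtain a1 where a1: "a1\<in>mh Q1 P1" "!!x. x\<in>Q1 ==> f (a1 x) = a0 (f' x)"
  using pj_lift[OF D'(1) D(8) D(9) D(4) af] by blast
 have "b0 (f x)\<in>f' ` Q1" if x: "x\<in>P1" for x
 proof -
  have "e' (b0 (f x)) = 0_V"
   using b0e[OF hom_closed[OF D(4) x]] D(10)[OF x] hom_zero[OF q D(3) V] by simp
  thus ?thesis using D'(7)[OF hom_closed[OF bf x]] by simp
 qed
 then obtain c where c: "c\<in>mh P1 Q1" "!!x. x\<in>P1 ==> f' (c x) = b0 (f x)"
  using pj_lift[OF D(1) D'(8) D'(9) D'(4) bf] by blast
 have ca: "(%x. c (a1 x))\<in>mh Q1 Q1" by (rule hom_comp[OF a1(1) c(1)])
 have fca: "f' (c (a1 x)) = f' x" if "x\<in>Q1" for x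
  using c(2)[OF hom_closed[OF a1(1) that]] a1(2)[OF that] b0a[OF hom_closed[OF D'(4) that]] by simp
 obtain t where t: "t\<in>mh Q1 Q1" "!!x. x\<in>Q1 ==> t (c (a1 x)) = x" "!!x. x\<in>Q1 ==> f' (t x) = f' x"
  using cover_normalize[OF c1 D'(9) ca fca] by blast
 show ?thesis
 proof (rule that[of a0 b0 a1 "%x. t (c x)"])
  show "f' (t (c x)) = b0 (f x)" if "x\<in>P1" for x
   using t(3)[OF hom_closed[OF c(1) that]] c(2)[OF that] by simp
 qed (use a0 b0 b0a b0e a1 t hom_comp[OF c(1) t(1)] in auto)
qed

text \<open>By \<open>AR_zero\<close> below, \<open>Ez M N\<close> means that \<open>Hom(N, \<tau> M) = 0\<close>.\<close>

definition Ez where "Ez M N <-> E0 (mp1 M) (mp0 M) (mpf M) N"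

definition pd1 where "pd1 M <-> inj_on (mpf M) (carrier (mp1 M))"

text \<open>Both properties pass to direct summands of the map \<open>f\<close>, and by
  \<open>compare\<close> the minimal presentation of \<open>V\<close> is one. With
  \<open>V = M\<close> it follows that \<open>Ez\<close> and \<open>pd1\<close> can be derived from
  any presentation.\<close>

lemma compare_E0:
 assumes p: "pres P1 P0 f e M" and V: "V\<in>MC" and sd: "sd V M"
 shows "E0 P1 P0 f N ==> Ez V N" "inj_on f P1 ==> pd1 V"
proof -
 obtain i q where iq: "i\<in>mh V M" "q\<in>mh M V" "\<forall>x\<in>V. q (i x) = x"
  using sd by (auto simp: sd_def)
 obtain e' where m: "min_proj_presentation K A V (mp1 V) (mp0 V) (mpf V) e'"
  and p': "pres (mp1 V) (mp0 V) (mpf V) e' V"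
  using mp_min[OF V] by blast
 note D = presD[OF p] and D' = presD[OF p']
 obtain a0 b0 a1 b1 where c: "a0\<in>mh (mp0 V) P0" "b0\<in>mh P0 (mp0 V)" "a1\<in>mh (mp1 V) P1" "b1\<in>mh P1 (mp1 V)"
  "!!x. x\<in>carrier (mp0 V) ==> b0 (a0 x) = x" "!!x. x\<in>carrier (mp1 V) ==> b1 (a1 x) = x"
  "!!x. x\<in>carrier (mp1 V) ==> f (a1 x) = a0 (mpf V x)"
  by (rule compare[OF p V iq m]) blast
 show "Ez V N" if E: "E0 P1 P0 f N"
  unfolding Ez_def E0_def
 proof
  fix g assume g: "g\<in>mh (mp1 V) N"
  obtain h where h: "h\<in>mh P0 N" "\<forall>x\<in>P1. h (f x) = g (b1 x)"
   using E hom_comp[OF c(4) g] by (auto simp: E0_def)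
  show "\<exists>h\<in>mh (mp0 V) N. \<forall>x\<in>carrier (mp1 V). h (mpf V x) = g x"
   by (rule bexI[OF _ hom_comp[OF c(1) h(1)]])
    (use h(2) c(6,7) hom_closed[OF c(3)] in \<open>auto simp flip: c(7)\<close>)
 qed
 show "pd1 V" if "inj_on f P1"
  unfolding pd1_def
 proof (rule inj_onI)
  fix x y assume xy: "x\<in>carrier (mp1 V)" "y\<in>carrier (mp1 V)" "mpf V x = mpf V y"
  hence "f (a1 x) = f (a1 y)" by (simp add: c(7))
  hence "a1 x = a1 y" using that hom_closed[OF c(3)] xy by (auto dest: inj_onD)
  thus "x = y" using c(6) xy by metis
 qed
qed

lemma hd_bip:
 assumes "bip T M N i1 i2 p1 p2" "T\<in>MC" "M\<in>MC" "N\<in>MC" "Z\<in>MC"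
 shows "hd T Z = hd M Z + hd N Z"
proof -
 obtain g where g: "g\<in>mh T (M [+] N)" "isoM T (M [+] N) g"
  using bip_iso[OF assms(1,3,4,2)] by (auto simp: mod_iso_def)
 have "hd T Z = hd (M [+] N) Z" by (rule hd_iso[OF assms(2) _ assms(5) g]) (use assms in simp)
 thus ?thesis using hd_bsum[OF assms(3,4,5)] by simp
qed

text \<open>The functional \<open>Z \<mapsto> dim Hom(P, Z)\<close>, and the functional given by a two-term complex of
 projectives, which plays the role of its class in the Grothendieck group.\<close>

definition hf :: "('k, 'a) rmod \<Rightarrow> ('k, 'a) rmod \<Rightarrow> rat" where
 "hf P = (%Z. if Z\<in>MC then of_nat (hd P Z) else 0)"

definition vf where "vf P1 P0 = (%Z. hf P0 Z - hf P1 Z)"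

definition gv where "gv M = vf (mp1 M) (mp0 M)"

lemma hf_bip:
 assumes "bip T M N i1 i2 p1 p2" "T\<in>MC" "M\<in>MC" "N\<in>MC"
 shows "hf T Z = hf M Z + hf N Z"
 using hd_bip[OF assms] by (simp add: hf_def)

lemma hf_zero: "Z\<in>MC ==> zero_module Z ==> hf Z L = 0"
 unfolding hf_def using hd_zero[of Z L] hom_zero[of _ Z L] by (auto simp: zero_module_def)

text \<open>The complements of the minimal presentation of \<open>V\<close> form a presentation of
  \<open>N\<close>, which may fail to be minimal. Its map is \<open>f\<close> itself, restricted to
  the complementary submodules.\<close>

lemma split_off_summand:
 assumes p: "pres P1 P0 f e M" and b: "bip M V N i1 i2 p1 p2" and V: "V\<in>MC" and N: "N\<in>MC"
 obtains R1 R0 e' where "pres R1 R0 f e' N" "!!Z. vf P1 P0 Z = gv V Z + vf R1 R0 Z"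
  "!!L :: ('k, 'a) rmod. E0 P1 P0 f L ==> E0 R1 R0 f L" "inj_on f P1 ==> inj_on f R1"
proof -
 note bb = b[unfolded bip_def]
 have h: "i1\<in>mh V M" "i2\<in>mh N M" "p1\<in>mh M V" "p2\<in>mh M N" using bb by auto
 have qi: "\<forall>x\<in>V. p1 (i1 x) = x" using bb by blast
 obtain e' where m: "min_proj_presentation K A V (mp1 V) (mp0 V) (mpf V) e'"
  and p': "pres (mp1 V) (mp0 V) (mpf V) e' V"
  using mp_min[OF V] by blast
 note D = presD[OF p] and D' = presD[OF p']
 obtain a0 b0 a1 b1 where c: "a0\<in>mh (mp0 V) P0" "b0\<in>mh P0 (mp0 V)" "a1\<in>mh (mp1 V) P1" "b1\<in>mh P1 (mp1 V)"
  "!!x. x\<in>carrier (mp0 V) ==> b0 (a0 x) = x" "!!x. x\<in>carrier (mp1 V) ==> b1 (a1 x) = x"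
  "!!x. x\<in>carrier (mp0 V) ==> e (a0 x) = i1 (e' x)" "!!x. x\<in>P0 ==> e' (b0 x) = p1 (e x)"
  "!!x. x\<in>carrier (mp1 V) ==> f (a1 x) = a0 (mpf V x)" "!!x. x\<in>P1 ==> mpf V (b1 x) = b0 (f x)"
  by (rule compare[OF p V h(1,3) qi m]) blast
 obtain R0 j0 r0 where R0: "R0\<in>MC" "bip P0 (mp0 V) R0 a0 j0 b0 r0"
  "R0 = P0(|carrier:={x\<in>P0. b0 x = 0_(mp0 V)}|)" "j0 = (%x. x)"
  by (rule sd_complement[OF D'(9) D(9) c(1,2,5)]) blast+
 obtain R1 j1 r1 where R1: "R1\<in>MC" "bip P1 (mp1 V) R1 a1 j1 b1 r1"
  "R1 = P1(|carrier:={x\<in>P1. b1 x = 0_(mp1 V)}|)" "j1 = (%x. x)"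
  by (rule sd_complement[OF D'(8) D(8) c(3,4,6)]) blast+
 have R0i: "x\<in>R0 <-> x\<in>P0 & b0 x = 0_(mp0 V)" for x by (simp add: R0(3))
 have R1i: "x\<in>R1 <-> x\<in>P1 & b1 x = 0_(mp1 V)" for x by (simp add: R1(3))
 have incl0: "(%x. x)\<in>mh R0 P0" and incl1: "(%x. x)\<in>mh R1 P1" and r1: "r1\<in>mh P1 R1"
  using R0(2,4) R1(2,4) by (auto simp: bip_def)
 have r1id: "r1 x = x" if "x\<in>R1" for x using R1(2,4) that by (auto simp: bip_def)
 have pR: "pj R0" "pj R1"
  using pj_sd[OF D(2) R0(1) bip_sd(2)[OF R0(2)]] pj_sd[OF D(1) R1(1) bip_sd(2)[OF R1(2)]] by auto
 have f: "f\<in>mh R1 R0"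
 proof -
  have "f\<in>mh R1 P0" using hom_comp[OF incl1 D(4)] by simp
  hence "f\<in>mh R1 (P0(|carrier:={x\<in>P0. b0 x = 0_(mp0 V)}|))"
  proof (rule module_hom_codom)
   fix x assume "x\<in>R1"
   thus "f x\<in>{x\<in>P0. b0 x = 0_(mp0 V)}"
    using c(10)[of x] hom_closed[OF D(4)] hom_zero[OF D'(4) D'(8,9)] by (simp add: R1i)
  qed
  thus ?thesis by (simp add: R0(3))
 qed
 note e'' = hom_comp[OF hom_comp[OF incl0 D(5)] h(4)]
 have pr: "pres R1 R0 f (%x. p2 (e x)) N"
  unfolding pres_def
 proof (intro conjI ballI pR N f e'')
  show "(%x. p2 (e x)) ` R0 = carrier N"
  proof (intro equalityI subsetI)
   fix n assume n: "n\<in>N"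
   hence "i2 n\<in>e ` P0" using hom_closed[OF h(2)] D(6) by simp
   then obtain y where y: "y\<in>P0" "e y = i2 n" by auto
   \<comment> \<open>Subtracting its component in the split summand moves \<open>y\<close> into
     \<open>R0\<close> without changing its image under \<open>e\<close>.\<close>
   let ?z = "y -_P0 a0 (b0 y)"
   have b0y: "b0 y\<in>carrier (mp0 V)" "a0 (b0 y)\<in>P0" using hom_closed[OF c(1)] hom_closed[OF c(2)] y by auto
   have "e' (b0 y) = 0_V" using c(8)[OF y(1)] y(2) bb n by simp
   hence "e (a0 (b0 y)) = 0_M" using c(7)[OF b0y(1)] hom_zero[OF h(1) V D(3)] by simp
   hence ez: "e ?z = i2 n" using hom_minus[OF D(5) D(9) D(3) y(1) b0y(2)] y D(3) hom_closed[OF h(2) n] by simp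
   have "b0 ?z = 0_(mp0 V)" using hom_minus[OF c(2) D(9) D'(9) y(1) b0y(2)] c(5)[OF b0y(1)] b0y D'(9) by simp
   hence "?z\<in>R0" using y b0y D(9) by (simp add: R0i)
   moreover have "p2 (e ?z) = n" using ez bb n by simp
   ultimately show "n\<in>(%x. p2 (e x)) ` R0" by (metis imageI)
  next
   fix n assume "n\<in>(%x. p2 (e x)) ` R0"
   thus "n\<in>N" using hom_closed[OF e''] by blast
  qed
  fix y assume y: "y\<in>R0"
  hence yP: "y\<in>P0" "b0 y = 0_(mp0 V)" by (auto simp: R0i)
  show "p2 (e y) = 0_N <-> y\<in>f ` R1"
  proof
   assume z: "p2 (e y) = 0_N"
   have z1: "p1 (e y) = 0_V" using c(8)[OF yP(1)] yP(2) hom_zero[OF D'(5) D'(9,3)] by simp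
   have "e y = i1 (p1 (e y)) +_M i2 (p2 (e y))" using bb hom_closed[OF D(5) yP(1)] by simp
   also have "\<dots> = 0_M" unfolding z z1 using hom_zero[OF h(1) V D(3)] hom_zero[OF h(2) N D(3)] D(3) by simp
   finally have "y\<in>f ` P1" using D(7)[OF yP(1)] by simp
   then obtain x where x: "x\<in>P1" "y = f x" by blast
   let ?u = "x -_P1 a1 (b1 x)"
   have bx: "b1 x\<in>carrier (mp1 V)" "a1 (b1 x)\<in>P1" using hom_closed[OF c(3)] hom_closed[OF c(4)] x by auto
   have "b1 ?u = 0_(mp1 V)" using hom_minus[OF c(4) D(8) D'(8) x(1) bx(2)] c(6)[OF bx(1)] bx D'(8) by simp
   hence uR: "?u\<in>R1" using x bx D(8) by (simp add: R1i)
   have "f (a1 (b1 x)) = 0_P0"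
    using c(9)[OF bx(1)] c(10)[OF x(1)] x(2) yP(2) hom_zero[OF c(1) D'(9) D(9)] by simp
   hence "f ?u = y" using hom_minus[OF D(4) D(8) D(9) x(1) bx(2)] x(2) yP(1) D(9) by simp
   thus "y\<in>f ` R1" using uR by blast
  next
   assume "y\<in>f ` R1"
   thus "p2 (e y) = 0_N" using D(10) hom_zero[OF h(4) D(3) N] by (auto simp: R1i)
  qed
 qed
 show ?thesis
 proof (rule that[OF pr])
  show "vf P1 P0 Z = gv V Z + vf R1 R0 Z" for Z
   using hf_bip[OF R0(2) D(9) D'(9) R0(1)] hf_bip[OF R1(2) D(8) D'(8) R1(1)] by (simp add: vf_def gv_def)
  show "E0 R1 R0 f L" if E: "E0 P1 P0 f L" for L
   unfolding E0_def
  proof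
   fix g assume g: "g\<in>mh R1 L"
   obtain k where k: "k\<in>mh P0 L" "\<forall>x\<in>P1. k (f x) = g (r1 x)"
    using E hom_comp[OF r1 g] by (auto simp: E0_def)
   show "\<exists>k\<in>mh R0 L. \<forall>x\<in>R1. k (f x) = g x"
    by (rule bexI[OF _ hom_comp[OF incl0 k(1)]]) (use k(2) r1id in \<open>auto simp: R1i\<close>)
  qed
  show "inj_on f R1" if "inj_on f P1"
   by (rule inj_on_subset[OF that]) (auto simp: R1i)
 qed
qed

end

text \<open>Indices are compared in the rational vector space of all functions on modules, where
  independence and the exchange lemma are available without forming a Grothendieck group.\<close>

interpretation fv: vector_space "%(c :: rat) (f :: 'z \<Rightarrow> rat) x. c * f x"
 by unfold_locales (auto simp: fun_eq_iff algebra_simps)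

context fdalg begin

definition homz where "homz Q L <-> (\<forall>w\<in>mh Q L. \<forall>x\<in>Q. w x = 0_L)"

lemma homz_sd1:
 assumes "homz Q L" "sd V Q" shows "homz V L"
 unfolding homz_def
proof (intro ballI)
 fix w x assume w: "w\<in>mh V L" and x: "x\<in>V"
 obtain i p where ip: "i\<in>mh V Q" "p\<in>mh Q V" "!!x. x\<in>V ==> p (i x) = x"
  using assms(2) by (auto simp: sd_def)
 have "w (p (i x)) = 0_L"
  using assms(1) hom_comp[OF ip(2) w] hom_closed[OF ip(1) x] by (auto simp: homz_def)
 thus "w x = 0_L" using ip(3)[OF x] by simp
qed

lemma hf_span: "P\<in>MC ==> hf P\<in>fv.span (hf ` {Q. ind Q & sd Q P})"
proof (induction rule: decomp_induct)
 case (zero Z)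
 hence e: "hf Z = 0" using hf_zero by (auto simp: fun_eq_iff)
 show ?case unfolding e by (rule fv.span_zero)
next
 case (sum M U N i1 i2 p1 p2)
 have e: "hf M = hf U + hf N" using hf_bip[OF sum(4,1) indD(1)[OF sum(3)] sum(2)] by (auto simp: fun_eq_iff)
 have "hf U\<in>fv.span (hf ` {Q. ind Q & sd Q M})"
  by (rule fv.span_base) (use sum bip_sd in blast)
 moreover have "hf N\<in>fv.span (hf ` {Q. ind Q & sd Q M})"
  by (rule subsetD[OF fv.span_mono sum(5)]) (use sd_trans[OF _ bip_sd(2)[OF sum(4)]] in blast)
 ultimately show ?case unfolding e by (rule fv.span_add)
qed

text \<open>Indecomposable summands of \<open>M\<close> are split off one by one. What is left
  presents a zero module, so it is a split surjection with some kernel \<open>N\<close>, and its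
  index is \<open>- hf N\<close>. Maps from \<open>N\<close> extend to \<open>P1\<close> by zero on
  the complement, so \<open>E0\<close> forces \<open>Hom(N, L) = 0\<close>; and \<open>N\<close>
  vanishes if \<open>f\<close> is injective.\<close>

lemma vf_span:
 assumes "M\<in>MC" "pres P1 P0 f e M"
 shows "vf P1 P0\<in>fv.span (gv ` {U. ind U & sd U M} \<union>
  hf ` {Q. ind Q & pj Q & (\<forall>L\<in>MC. E0 P1 P0 f L --> homz Q L) & ~ inj_on f P1})"
 using assms
proof (induction arbitrary: P1 P0 e rule: decomp_induct)
 case (zero Z)
 note D = presD[OF zero(3)]
 have s: "f ` P1 = carrier P0"
  using D(7) zero(2) hom_closed[OF D(5)] hom_closed[OF D(4)] by (auto simp: zero_module_def)
 obtain t where t: "t\<in>mh P0 P1" "!!x. x\<in>P0 ==> f (t x) = x"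
  using pj_lift[OF D(2,8,9,4) hom_id] s by blast
 obtain N i p where N: "N\<in>MC" "bip P1 P0 N t i f p" "N = P1(|carrier:={x\<in>P1. f x = 0_P0}|)"
  "i = (%x. x)"
  by (rule sd_complement[OF D(9,8) t(1) D(4) t(2)]) blast+
 have pN: "pj N" by (rule pj_sd[OF D(1) N(1) bip_sd(2)[OF N(2)]])
 have p: "p\<in>mh P1 N" "!!x. x\<in>N ==> p x = x" using N(2,4) by (auto simp: bip_def)
 have hz: "homz N L" if L: "L\<in>MC" "E0 P1 P0 f L" for L
  unfolding homz_def
 proof (intro ballI)
  fix w x assume w: "w\<in>mh N L" and x: "x\<in>N"
  obtain h where h: "h\<in>mh P0 L" "\<forall>x\<in>P1. h (f x) = w (p x)"
   using L(2) hom_comp[OF p(1) w] by (auto simp: E0_def)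
  have "x\<in>P1" using x by (simp add: N(3))
  hence "w x = h (f x)" using h(2) p(2)[OF x] by metis
  thus "w x = 0_L" using x hom_zero[OF h(1) D(9) L(1)] by (simp add: N(3))
 qed
 have ni: "~ inj_on f P1" if "ind Q" "sd Q N" for Q
 proof
  assume i: "inj_on f P1"
  have "x = 0_N" if "x\<in>N" for x
  proof -
   have x: "x\<in>P1" "f x = f 0_P1" using that hom_zero[OF D(4,8,9)] by (auto simp: N(3))
   hence "x = 0_P1" using inj_onD[OF i x(2,1)] D(8) by simp
   thus ?thesis by (simp add: N(3))
  qed
  thus False using zero_no_summand[OF N(1) _ that(1)] that(2) zero_module_iff[OF N(1)] by blast
 qed
 let ?S = "{Q. ind Q & pj Q & (\<forall>L\<in>MC. E0 P1 P0 f L --> homz Q L) & ~ inj_on f P1}"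
 have sub: "{Q. ind Q & sd Q N} <= ?S"
  using hz homz_sd1 ni pj_sd[OF pN] indD(1) by blast
 have "hf N\<in>fv.span (hf ` ?S)"
  by (rule subsetD[OF fv.span_mono[OF image_mono[OF sub]] hf_span[OF N(1)]])
 hence 1: "hf N\<in>fv.span (gv ` {U. ind U & sd U Z} \<union> hf ` ?S)"
  by (rule subsetD[OF fv.span_mono, rotated]) blast
 have e: "vf P1 P0 = - hf N" using hf_bip[OF N(2) D(8,9) N(1)] by (auto simp: vf_def fun_eq_iff)
 show ?case unfolding e by (rule fv.span_neg[OF 1])
next
 case (sum M U N i1 i2 p1 p2)
 obtain R1 R0 e' where R: "pres R1 R0 f e' N" "!!Z. vf P1 P0 Z = gv U Z + vf R1 R0 Z"
  "!!L :: ('k, 'a) rmod. E0 P1 P0 f L ==> E0 R1 R0 f L" "inj_on f P1 ==> inj_on f R1"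
  by (rule split_off_summand[OF sum(6,4) indD(1)[OF sum(3)] sum(2)]) blast
 let ?T = "gv ` {U. ind U & sd U M} \<union>
  hf ` {Q. ind Q & pj Q & (\<forall>L\<in>MC. E0 P1 P0 f L --> homz Q L) & ~ inj_on f P1}"
 have "vf R1 R0\<in>fv.span ?T"
 proof (rule subsetD[OF fv.span_mono[OF Un_mono[OF image_mono image_mono]] sum(5)[OF R(1)]])
  show "{U. ind U & sd U N} <= {U. ind U & sd U M}"
   using sd_trans[OF _ bip_sd(2)[OF sum(4)]] by auto
  show "{Q. ind Q & pj Q & (\<forall>L\<in>MC. E0 R1 R0 f L --> homz Q L) & ~ inj_on f R1}
   <= {Q. ind Q & pj Q & (\<forall>L\<in>MC. E0 P1 P0 f L --> homz Q L) & ~ inj_on f P1}"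
   using R(3,4) by auto
 qed
 moreover have "gv U\<in>fv.span ?T"
  by (rule fv.span_base) (use sum(3) bip_sd(1)[OF sum(4)] in blast)
 moreover have e: "vf P1 P0 = vf R1 R0 + gv U" using R(2) by (auto simp: fun_eq_iff)
 ultimately show ?case unfolding e by (intro fv.span_add)
qed

end

section \<open>Linear independence of the index functionals\<close>

lemma sum_fun_eval: "(\<Sum>x\<in>S. F x) z = (\<Sum>x\<in>S. F x z :: rat)"
 by (induction S rule: infinite_finite_induct) auto

text \<open>The hypothesis is about an indexed family, so injectivity of \<open>v\<close> is a
  conclusion and no functional is counted twice.\<close>

lemma family_independent:
 fixes v :: "'i \<Rightarrow> 'z \<Rightarrow> rat"
 assumes "finite I" "\<forall>c. (\<forall>z. (\<Sum>i\<in>I. c i * v i z) = 0) --> (\<forall>i\<in>I. c i = 0)"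
 shows "inj_on v I" "fv.independent (v ` I)"
proof -
 show inj: "inj_on v I"
 proof (rule inj_onI, rule ccontr)
  fix i j assume ij: "i\<in>I" "j\<in>I" "v i = v j" "i ~= j"
  let ?c = "%k. if k = i then 1 else if k = j then -1 else (0 :: rat)"
  have "(\<Sum>k\<in>I. ?c k * v k z) = 0" for z
  proof -
   have "(\<Sum>k\<in>I. ?c k * v k z) = (\<Sum>k\<in>I. (if k = i then v i z else 0) + (if k = j then - v j z else 0))"
    by (rule sum.cong) (use ij in auto)
   also have "\<dots> = 0" using ij assms(1) by (simp add: sum.distrib)
   finally show ?thesis .
  qed
  hence "\<forall>k\<in>I. ?c k = 0" using assms(2)[rule_format, of ?c] by blast
  thus False using ij(1) by auto
 qed
 show "fv.independent (v ` I)"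
 proof (rule fv.independent_if_scalars_zero)
  show "finite (v ` I)" using assms(1) by simp
  fix f x assume s: "(\<Sum>x\<in>v ` I. (%z. f x * x z)) = 0" and x: "x\<in>v ` I"
  have "(\<Sum>i\<in>I. f (v i) * v i z) = 0" for z
  proof -
   have "(\<Sum>i\<in>I. f (v i) * v i z) = (\<Sum>x\<in>v ` I. (%z. f x * x z)) z"
    by (simp add: sum.reindex[OF inj] sum_fun_eval)
   thus ?thesis using s by simp
  qed
  thus "f x = 0" using assms(2)[rule_format, of "%i. f (v i)"] x by blast
 qed
qed

lemma family_card_le:
 fixes v :: "'i \<Rightarrow> 'z \<Rightarrow> rat"
 assumes "finite I" "\<forall>c. (\<forall>z. (\<Sum>i\<in>I. c i * v i z) = 0) --> (\<forall>i\<in>I. c i = 0)"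
  "v ` I <= fv.span W" "finite W"
 shows "card I <= card W"
proof -
 note i = family_independent[OF assms(1,2)]
 have "card (v ` I) <= card W" using fv.independent_span_bound[OF assms(4) i(2) assms(3)] by blast
 thus ?thesis using card_image[OF i(1)] by simp
qed

text \<open>A member of \<open>W\<close> outside the span would extend the family to an independent
  set with more elements than \<open>W\<close>.\<close>

lemma family_spans:
 fixes v :: "'i \<Rightarrow> 'z \<Rightarrow> rat"
 assumes "finite I" "\<forall>c. (\<forall>z. (\<Sum>i\<in>I. c i * v i z) = 0) --> (\<forall>i\<in>I. c i = 0)"
  "v ` I <= fv.span W" "finite W" "card W <= card I"
 shows "W <= fv.span (v ` I)"
proof -
 note i = family_independent[OF assms(1,2)]
 show ?thesis
 proof (rule ccontr)
  assume "~ W <= fv.span (v ` I)"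
  then obtain w where w: "w\<in>W" "w \<notin> fv.span (v ` I)" by blast
  have 1: "fv.independent (insert w (v ` I))" by (rule fv.independent_insertI[OF w(2) i(2)])
  have 2: "insert w (v ` I) <= fv.span W" using assms(3) fv.span_base[OF w(1)] by blast
  have "w \<notin> v ` I" using w(2) fv.span_base by blast
  hence "card (insert w (v ` I)) = Suc (card I)" using assms(1) card_image[OF i(1)] by simp
  thus False using fv.independent_span_bound[OF assms(4) 1 2] assms(5) by simp
 qed
qed

context fdalg begin

text \<open>The pair \<open>(R, ro)\<close> is a map from a finite sum of modules in \<open>B\<close> to \<open>V\<close> none of whose
 components is an isomorphism; a large one is a right almost split map in \<open>add B\<close>.\<close>

inductive RR :: "('k, 'a) rmod set \<Rightarrow> ('k, 'a) rmod \<Rightarrow> ('k, 'a) rmod \<Rightarrow> ((nat \<Rightarrow> 'k) \<Rightarrow> nat \<Rightarrow> 'k) \<Rightarrow> bool"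
 for B V where
 RR_zero: "RR B V zmod (%_. 0_V)"
| RR_add: "U\<in>B ==> w\<in>mh U V ==> ~ isoM U V w ==> RR B V R ro ==>
  RR B V (U [+] R) (%z. w (pr1 z) +_V ro (pr2 z))"

lemma RR_hom: "RR B V R ro ==> V\<in>MC ==> ro\<in>mh R V"
 by (induction rule: RR.induct) (auto intro: hom_0 bsum_copair)

lemma RR_Sm: "RR B V R ro ==> Sm B R"
 by (induction rule: RR.induct) (auto intro: Sm.intros)

text \<open>By locality an invertible sum of endomorphisms of \<open>V\<close> has an invertible
  term. A term through a component \<open>w\<close> is invertible only if \<open>w\<close> is an
  isomorphism, which is excluded.\<close>

lemma RR_not_iso:
 assumes "RR B V R ro" "ind V" "!!U. U\<in>B ==> ind U" "u\<in>mh V R"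
 shows "~ isoM V V (%x. ro (u x))"
 using assms(1,4)
proof (induction arbitrary: u rule: RR.induct)
 case RR_zero
 show ?case
 proof
  assume "isoM V V (%x. 0_V)"
  hence "carrier V = {0_V}" using MC_closed(1)[OF indD(1)[OF assms(2)]] by (auto simp: bij_betw_def)
  thus False using indD(2)[OF assms(2)] by (simp add: zero_module_def)
 qed
next
 case (RR_add U w R ro)
 have m: "V\<in>MC" "U\<in>MC" "R\<in>MC" "B <= MC"
  using indD(1) assms(2,3) RR_add(1) Sm_MC[OF RR_Sm[OF RR_add(4)]] by auto
 note b = bsum_homs[OF MC_rm[OF m(2)] MC_rm[OF m(3)]]
 note h1 = hom_comp[OF RR_add.prems b(1)] and h2 = hom_comp[OF RR_add.prems b(2)]
 note k1 = hom_comp[OF h1 RR_add(2)] and k2 = hom_comp[OF h2 RR_hom[OF RR_add(4) m(1)]]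
 show ?case
 proof
  assume i: "isoM V V (%x. w (pr1 (u x)) +_V ro (pr2 (u x)))"
  have "isoM V V (%x. w (pr1 (u x))) \<or> isoM V V (%x. ro (pr2 (u x)))"
   by (rule local_sum[OF assms(2) k1 k2 hom_add[OF k1 k2 MC_rm[OF m(1)]] i]) simp
  thus False
   using local_comp(2)[OF assms(2) assms(3)[OF RR_add(1)] h1 RR_add(2)] RR_add(3) RR_add.IH[OF h2] by blast
 qed
qed

text \<open>A pair \<open>(R, ro)\<close> is measured by the total dimension, over \<open>U\<close>
  in \<open>B\<close>, of the space of maps from \<open>U\<close> to \<open>V\<close> that factor
  through \<open>ro\<close>. This is bounded. At a maximal pair, adjoining \<open>w\<close> as a new
  component does not enlarge these spaces, so \<open>w\<close> already factors.\<close>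

lemma RR_approx:
 assumes B: "finite B" "B <= MC" and V: "V\<in>MC"
 obtains R ro where "RR B V R ro"
  "!!U w. U\<in>B ==> w\<in>mh U V ==> ~ isoM U V w ==> \<exists>t\<in>mh U R. \<forall>x\<in>U. ro (t x) = w x"
proof -
 define S where "S R ro U = {s\<in>Hom A U V. \<exists>t\<in>mh U R. \<forall>x\<in>U. ro (t x) = s x}"
  for R :: "('k, 'a) rmod" and ro :: "(nat \<Rightarrow> 'k) \<Rightarrow> nat \<Rightarrow> 'k" and U :: "('k, 'a) rmod"
 have subS: "subspace K (S R ro U) (hs U V)" if h: "R\<in>MC" "ro\<in>mh R V" "U\<in>MC" for R ro U
 proof (rule subspaceI)
  show v: "vectorspace K (hs U V)" by (rule vs_hs[OF MC_rm[OF h(3)] MC_rm[OF V]])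
  interpret vectorspace K "hs U V" by (rule v)
  have tr: "t' = (\<lambda>x\<in>U. t' x)" if "t'\<in>Hom A U V" for t'
   using that by (auto simp: Hom_iff extensional_def)
  show "S R ro U <= carrier (hs U V)" by (auto simp: S_def)
  show "0_(hs U V)\<in>S R ro U"
   unfolding S_def mem_Collect_eq
  proof (intro conjI bexI[of _ "%_. 0_R"])
   show "0_(hs U V)\<in>Hom A U V" using module.M.zero_closed by simp
  qed (use hom_zero[OF h(2,1) V] hom_0[OF MC_rm[OF h(1)]] in auto)
  show "s +_(hs U V) s'\<in>S R ro U" if s: "s\<in>S R ro U" "s'\<in>S R ro U" for s s'
  proof -
   obtain t t' where t: "t\<in>mh U R" "\<forall>x\<in>U. ro (t x) = s x" "t'\<in>mh U R" "\<forall>x\<in>U. ro (t' x) = s' x"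
    using s by (auto simp: S_def)
   show ?thesis unfolding S_def mem_Collect_eq
   proof (intro conjI bexI[OF _ hom_add[OF t(1,3) MC_rm[OF h(1)]]])
    show "s +_(hs U V) s'\<in>Hom A U V" using s module.M.a_closed[of s s'] by (simp add: S_def)
   qed (use t homD(2)[OF h(2)] hom_closed[OF t(1)] hom_closed[OF t(3)] in auto)
  qed
  show "c ._(hs U V) s\<in>S R ro U" if c: "c\<in>K" "s\<in>S R ro U" for c s
  proof -
   obtain t where t: "t\<in>mh U R" "\<forall>x\<in>U. ro (t x) = s x" using c by (auto simp: S_def)
   show ?thesis unfolding S_def mem_Collect_eq
   proof (intro conjI bexI[OF _ module_hom_scale[OF t(1) MC_rm[OF h(1)] c(1)]])
    show "c ._(hs U V) s\<in>Hom A U V" using c smult_closed[of c s] by (simp add: S_def)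
   qed (use t homD(3)[OF h(2) sc_facts(1)[OF c(1)]] hom_closed[OF t(1)] in auto)
  qed
 qed
 define D where "D R ro = (\<Sum>U\<in>B. vectorspace.dim K ((hs U V)(|carrier:=S R ro U|)))" for R ro
 have RRm: "R\<in>MC" "ro\<in>mh R V" if "RR B V R ro" for R ro
  using Sm_MC[OF RR_Sm[OF that] B(2)] RR_hom[OF that V] by auto
 have bound: "D R ro < Suc (\<Sum>U\<in>B. hd U V)" if "RR B V R ro" for R ro
 proof -
  have "D R ro <= (\<Sum>U\<in>B. hd U V)" unfolding D_def hd_def
  proof (rule sum_mono)
   fix U assume "U\<in>B"
   hence U: "U\<in>MC" using B by auto
   show "vectorspace.dim K ((hs U V)(|carrier:=S R ro U|)) <= vectorspace.dim K (hs U V)"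
    by (rule fdvs_subspace(2)[OF fdvs_hs[OF U V] subS[OF RRm[OF that] U]])
  qed
  thus ?thesis by simp
 qed
 let ?P = "%y. RR B V (fst y) (snd y)" and ?D = "%y. D (fst y) (snd y)"
 have P0: "?P (zmod, %_. 0_V)" using RR_zero by simp
 have bd: "\<forall>y. ?P y --> ?D y < Suc (\<Sum>U\<in>B. hd U V)" using bound by blast
 obtain y where y: "?P y" "\<forall>z. ?P z --> ?D z <= ?D y"
  using ex_has_greatest_nat[of ?P "(zmod, %_. 0_V)" ?D, OF P0 bd] by blast
 define R ro where "R = fst y" and "ro = snd y"
 have R: "RR B V R ro" and mx: "D R' ro' <= D R ro" if "RR B V R' ro'" for R' ro'
  using y(1) y(2)[rule_format, of "(R', ro')"] that by (auto simp: R_def ro_def)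
 have R: "RR B V R ro" using y(1) by (simp add: R_def ro_def)
 have "\<exists>t\<in>mh U R. \<forall>x\<in>U. ro (t x) = w x" if U: "U\<in>B" "w\<in>mh U V" "~ isoM U V w" for U w
 proof -
  have Um: "U\<in>MC" using U B by auto
  note Rm = RRm[OF R]
  let ?R = "U [+] R" and ?ro = "%z. w (pr1 z) +_V ro (pr2 z)"
  have RR': "RR B V ?R ?ro" by (rule RR_add[OF U R])
  note Rm' = RRm[OF RR']
  note b = bsum_homs[OF MC_rm[OF Um] MC_rm[OF Rm(1)]]
  have le: "S R ro U' <= S ?R ?ro U'" if U': "U'\<in>B" for U'
  proof
   fix s assume "s\<in>S R ro U'"
   then obtain t where t: "s\<in>Hom A U' V" "t\<in>mh U' R" "\<forall>x\<in>U'. ro (t x) = s x" by (auto simp: S_def)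
   have "s x\<in>V" if "x\<in>U'" for x using t(1) that by (auto simp: Hom_iff dest: hom_closed)
   thus "s\<in>S ?R ?ro U'" unfolding S_def mem_Collect_eq
    using t(1,3) hom_zero[OF U(2) Um V] V by (intro conjI bexI[OF _ hom_comp[OF t(2) b(4)]]) auto
  qed
  have dle: "vectorspace.dim K ((hs U' V)(|carrier:=S R ro U'|)) <= vectorspace.dim K ((hs U' V)(|carrier:=S ?R ?ro U'|))"
   and deq: "vectorspace.dim K ((hs U' V)(|carrier:=S R ro U'|)) = vectorspace.dim K ((hs U' V)(|carrier:=S ?R ?ro U'|))
    ==> S R ro U' = S ?R ?ro U'" if U': "U'\<in>B" for U'
  proof -
   have U'm: "U'\<in>MC" using U' B by auto
   note s1 = subS[OF Rm U'm] and s2 = subS[OF Rm' U'm]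
   have s3: "subspace K (S R ro U') ((hs U' V)(|carrier:=S ?R ?ro U'|))"
    by (rule subspaceI[OF subspaceD(6)[OF s2]]) (use le[OF U'] subspaceD[OF s1] in auto)
   note f = fdvs_subspace(2,3)[OF fdvs_subspace(1)[OF fdvs_hs[OF U'm V] s2] s3]
   show "vectorspace.dim K ((hs U' V)(|carrier:=S R ro U'|)) <= vectorspace.dim K ((hs U' V)(|carrier:=S ?R ?ro U'|))"
    using f(1) by simp
   show "S R ro U' = S ?R ?ro U'"
    if "vectorspace.dim K ((hs U' V)(|carrier:=S R ro U'|)) = vectorspace.dim K ((hs U' V)(|carrier:=S ?R ?ro U'|))"
    using f(2) that by simp
  qed
  have "S R ro U = S ?R ?ro U"
  proof (rule ccontr)
   assume "S R ro U ~= S ?R ?ro U"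
   hence "vectorspace.dim K ((hs U V)(|carrier:=S R ro U|)) < vectorspace.dim K ((hs U V)(|carrier:=S ?R ?ro U|))"
    using dle[OF U(1)] deq[OF U(1)] by linarith
   hence "D R ro < D ?R ?ro" unfolding D_def by (intro sum_strict_mono_ex1) (use B(1) dle U(1) in auto)
   thus False using mx[OF RR'] by simp
  qed
  moreover have "restrict w U\<in>S ?R ?ro U" unfolding S_def mem_Collect_eq
  proof (intro conjI bexI[OF _ b(3)] ballI)
   show "restrict w U\<in>Hom A U V" by (rule restrict_Hom[OF U(2) MC_rm[OF Um]])
   show "w (pr1 (jn x 0_R)) +_V ro (pr2 (jn x 0_R)) = restrict w U x" if "x\<in>U" for x
    using that hom_zero[OF Rm(2,1) V] hom_closed[OF U(2) that] V by simp
  qed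
  ultimately have "restrict w U\<in>S R ro U" by simp
  thus ?thesis by (auto simp: S_def)
 qed
 thus ?thesis using that R by blast
qed

text \<open>The trace of \<open>C\<close> in \<open>N\<close>, obtained as the intersection of all
  submodules that contain the images; being the least of them, it is itself generated by
  \<open>C\<close>.\<close>

lemma trace_exists:
 assumes C: "C <= MC" and N: "N\<in>MC"
 obtains W where "sbm W N" "!!U h. U\<in>C ==> h\<in>mh U N ==> h ` U <= W" "gen C (N(|carrier:=W|))"
proof -
 define F where "F = {V. sbm V N & (\<forall>U\<in>C. \<forall>h\<in>mh U N. h ` U <= V)}"
 define W where "W = \<Inter> F"
 have cF: "carrier N\<in>F"
  unfolding F_def
 proof (intro CollectI conjI ballI image_subsetI sbm_carrier[OF N])
  fix U h x assume "U\<in>C" "h\<in>mh U N" "x\<in>U"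
  thus "h x\<in>N" by (simp add: hom_closed)
 qed
 have Fd: "sbm V N" "!!U h. U\<in>C ==> h\<in>mh U N ==> h ` U <= V" if "V\<in>F" for V
  using that by (auto simp: F_def)
 have sW: "sbm W N"
 proof (rule right_module.right_submoduleI[OF MC_rm[OF N]])
  show "W <= carrier N" using cF by (auto simp: W_def)
 qed (use sbmD[OF Fd(1) N] in \<open>auto simp: W_def\<close>)
 have im: "h ` U <= W" if "U\<in>C" "h\<in>mh U N" for U h unfolding W_def using Fd(2)[OF _ that] by blast
 note WD = sbmD[OF sW N]
 have "gen C (N(|carrier:=W|))" unfolding gen_def
 proof (intro allI impI)
  fix V assume V: "sbm V (N(|carrier:=W|))" "\<forall>U\<in>C. \<forall>h\<in>mh U (N(|carrier:=W|)). h ` U <= V"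
  note VD = sbmD[OF V(1) WD(6)]
  have "sbm V N"
   by (rule right_module.right_submoduleI[OF MC_rm[OF N]]) (use VD WD(1) in auto)
  moreover have "h ` U <= V" if "U\<in>C" "h\<in>mh U N" for U h
  proof -
   have "h\<in>mh U (N(|carrier:=W|))" by (rule module_hom_codom[OF that(2)]) (use im[OF that] in auto)
   thus ?thesis using V(2) that(1) by blast
  qed
  ultimately have "V\<in>F" by (auto simp: F_def)
  thus "carrier (N(|carrier:=W|)) <= V" by (auto simp: W_def)
 qed
 thus ?thesis using that sW im by blast
qed

lemma homz_quot:
 assumes "homz Q N" "pj Q" "N\<in>MC" "N'\<in>MC" "q\<in>mh N N'" "q ` N = carrier N'"
 shows "homz Q N'"
 unfolding homz_def
proof (intro ballI)
 fix w x assume w: "w\<in>mh Q N'" and x: "x\<in>Q"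
 obtain h where h: "h\<in>mh Q N" "!!x. x\<in>Q ==> q (h x) = w x"
  using pj_lift[OF assms(2-5) w] hom_closed[OF w] assms(6) by blast
 show "w x = 0_N'" using h(2)[OF x] assms(1) h(1) x hom_zero[OF assms(5,3,4)] by (simp add: homz_def)
qed

lemma homz_Sm: "Sm C R ==> C <= MC ==> (!!U. U\<in>C ==> homz Q U) ==> homz Q R"
proof (induction rule: Sm.induct)
 case Sm_zmod
 show ?case unfolding homz_def using hom_closed[of _ Q zmod] by auto
next
 case (Sm_bsum U N)
 have m: "U\<in>MC" "N\<in>MC" using Sm_bsum Sm_MC by auto
 note b = bsum_homs[OF MC_rm[OF m(1)] MC_rm[OF m(2)]]
 have z: "homz Q U" "homz Q N" using Sm_bsum by auto
 show ?case unfolding homz_def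
 proof (intro ballI)
  fix w x assume w: "w\<in>mh Q (U [+] N)" and x: "x\<in>Q"
  have "pr1 (w x) = 0_U" "pr2 (w x) = 0_N"
   using z hom_comp[OF w b(1)] hom_comp[OF w b(2)] x by (auto simp: homz_def)
  thus "w x = 0_(U [+] N)" by (subst pr_eq) simp
 qed
qed

lemma homz_gen:
 assumes "gen C N" "C <= MC" "N\<in>MC" "!!U. U\<in>C ==> homz Q U" "pj Q"
 shows "homz Q N"
proof -
 obtain R ro where R: "Sm C R" "ro\<in>mh R N" "ro ` R = carrier N"
  using gen_Sm[OF assms(2,3,1)] by blast
 show ?thesis by (rule homz_quot[OF homz_Sm[OF R(1) assms(2,4)] assms(5) Sm_MC[OF R(1) assms(2)] assms(3) R(2,3)])
qed

lemma homz_sub: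
 assumes "homz Q N" "sbm W N" "N\<in>MC" shows "homz Q (N(|carrier:=W|))"
 using assms(1) hom_comp[OF _ sbmD(7)[OF assms(2,3)]] by (force simp: homz_def)

text \<open>\<open>E0\<close> concerns the cokernel of \<open>Hom(f, Z)\<close> and
  \<open>homz\<close> its kernel. Nothing can be said when both spaces are nonzero, since their
  dimensions may cancel.\<close>

lemma vf_values:
 assumes "pres P1 P0 f e M" "Z\<in>MC"
 shows "E0 P1 P0 f Z ==> homz M Z ==> vf P1 P0 Z = 0"
  "E0 P1 P0 f Z ==> ~ homz M Z ==> vf P1 P0 Z ~= 0"
  "~ E0 P1 P0 f Z ==> homz M Z ==> vf P1 P0 Z ~= 0"
 using hd_compare[OF presD(8,9)[OF assms(1)] assms(2) presD(4)[OF assms(1)]] N0_iff[OF assms] assms(2)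
 by (auto simp: vf_def hf_def homz_def)

text \<open>The module dual to \<open>V\<close> is either the largest quotient of \<open>V\<close> by the radical of \<open>add B\<close>, or,
 when that quotient vanishes, the torsion-free part of the kernel of the right almost split map.\<close>

lemma dual_module_exists:
 assumes B: "finite B" "!!U. U\<in>B ==> ind U" "noniso B"
  and p: "!!U. U\<in>B ==> pres (a U) (b U) (f U) (e U) U"
  and E: "!!U V. U\<in>B ==> V\<in>B ==> E0 (a U) (b U) (f U) V"
  and V: "V\<in>B"
 obtains Z where "Z\<in>MC" "vf (a V) (b V) Z ~= 0" "!!U. U\<in>B ==> U ~= V ==> vf (a U) (b U) Z = 0"
  "!!Q. pj Q ==> (!!U. U\<in>B ==> homz Q U) ==> homz Q Z"
proof -
 have BM: "B <= MC" using B(2) indD(1) by blast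
 have Vm: "V\<in>MC" and Vi: "ind V" using V BM B(2) by auto
 obtain R ro where R: "RR B V R ro"
  and ap: "!!U w. U\<in>B ==> w\<in>mh U V ==> ~ isoM U V w ==> \<exists>t\<in>mh U R. \<forall>x\<in>U. ro (t x) = w x"
  using RR_approx[OF B(1) BM Vm] by blast
 have ro: "ro\<in>mh R V" by (rule RR_hom[OF R Vm])
 have SR: "Sm B R" by (rule RR_Sm[OF R])
 have Rm: "R\<in>MC" by (rule Sm_MC[OF SR BM])
 have ER: "E0 (a U) (b U) (f U) R" if "U\<in>B" for U by (rule E0_Sm[OF SR BM E[OF that]])
 have fac: "\<exists>t\<in>mh U R. \<forall>x\<in>U. ro (t x) = w x" if "U\<in>B" "U ~= V" "w\<in>mh U V" for U w
 proof -
  have "~ isoM U V w" using B(3) that V by (auto simp: noniso_def mod_iso_def)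
  thus ?thesis using ap that by blast
 qed
 have hR: "homz Q R" if "!!U. U\<in>B ==> homz Q U" for Q by (rule homz_Sm[OF SR BM that])
 let ?I = "ro ` R"
 have sI: "sbm ?I V" by (rule sbm_image[OF ro Rm Vm])
 note ID = sbmD[OF sI Vm]
 show ?thesis
 proof (cases "?I = carrier V")
  case False
  \<comment> \<open>A map from another \<open>U\<close> to this quotient lifts to \<open>V\<close>,
    factors through \<open>ro\<close>, and hence dies in \<open>Z\<close>. The projection
    \<open>q\<close> shows that \<open>Hom(V, Z)\<close> is not zero.\<close>
  obtain Z q where Z: "Z\<in>MC" "q\<in>mh V Z" "q ` V = carrier Z" "!!x. x\<in>V ==> q x = 0_Z <-> x\<in>?I"
   using quotient_exists[OF Vm sI] by blast
  have ker: "{x\<in>V. q x = 0_Z} = ?I" using Z(4) ID(1) by blast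
  have roI: "ro\<in>mh R (V(|carrier:=?I|))" by (rule module_hom_codom[OF ro]) simp
  have EZ: "E0 (a U) (b U) (f U) Z" if "U\<in>B" for U
   by (rule E0_quot[OF E[OF that V] presD(1)[OF p[OF that]] Vm Z(1-3)])
  have EI: "E0 (a U) (b U) (f U) (V(|carrier:=?I|))" if "U\<in>B" for U
   by (rule E0_quot[OF ER[OF that] presD(1)[OF p[OF that]] Rm ID(6) roI]) simp
  show ?thesis
  proof (rule that[of Z])
   show "Z\<in>MC" by (rule Z)
   have "~ homz V Z"
   proof
    assume "homz V Z"
    hence "!!x. x\<in>V ==> x\<in>?I" using Z(2,4) by (auto simp: homz_def)
    thus False using False ID(1) by blast
   qed
   thus "vf (a V) (b V) Z ~= 0" by (rule vf_values(2)[OF p[OF V] Z(1) EZ[OF V]])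
   show "vf (a U) (b U) Z = 0" if U: "U\<in>B" "U ~= V" for U
   proof (rule vf_values(1)[OF p[OF U(1)] Z(1) EZ[OF U(1)]])
    show "homz U Z" unfolding homz_def
    proof (intro ballI)
     fix w x assume w: "w\<in>mh U Z" and x: "x\<in>U"
     obtain w' where w': "w'\<in>mh U V" "!!x. x\<in>U ==> q (w' x) = w x"
      using lift_along[OF p[OF U(1)] Vm Z(1-3) _ w] EI[OF U(1)] unfolding ker by blast
     obtain t where t: "t\<in>mh U R" "\<forall>x\<in>U. ro (t x) = w' x" using fac[OF U w'(1)] by blast
     have "w' x\<in>?I" using t x hom_closed[OF t(1) x] by (metis imageI)
     thus "w x = 0_Z" using w'(2)[OF x] Z(4)[OF hom_closed[OF w'(1) x]] by simp
    qed
   qed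
   show "homz Q Z" if "pj Q" "!!U. U\<in>B ==> homz Q U" for Q
    by (rule homz_quot[OF that(2)[OF V] that(1) Vm Z(1-3)])
  qed
 next
  case True
  let ?K = "{x\<in>R. ro x = 0_V}"
  have sK: "sbm ?K R" by (rule sbm_kernel[OF ro Rm Vm])
  note KD = sbmD[OF sK Rm]
  define N where "N = R(|carrier:=?K|)"
  have N: "N\<in>MC" "(%x. x)\<in>mh N R" using KD by (auto simp: N_def)
  have Ni: "x\<in>N <-> x\<in>R & ro x = 0_V" for x by (simp add: N_def)
  \<comment> \<open>Dividing the kernel of \<open>ro\<close> by its trace gives
    \<open>Hom(U, Z) = 0\<close> for every \<open>U\<close> in \<open>B\<close>, so that only
    \<open>E0\<close> remains to be decided.\<close>
  obtain W where W: "sbm W N" "!!U h. U\<in>B ==> h\<in>mh U N ==> h ` U <= W" "gen B (N(|carrier:=W|))"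
   using trace_exists[OF BM N(1)] by blast
  note WD = sbmD[OF W(1) N(1)]
  obtain Z q where Z: "Z\<in>MC" "q\<in>mh N Z" "q ` N = carrier Z" "!!x. x\<in>N ==> q x = 0_Z <-> x\<in>W"
   using quotient_exists[OF N(1) W(1)] by blast
  have ker: "{x\<in>N. q x = 0_Z} = W" using Z(4) WD(1) by blast
  have EW: "E0 (a U) (b U) (f U) (N(|carrier:=W|))" if "U\<in>B" for U
   by (rule E0_gen[OF W(3) BM WD(6) E[OF that] presD(1)[OF p[OF that]]])
  have hz: "homz U Z" if U: "U\<in>B" for U unfolding homz_def
  proof (intro ballI)
   fix w x assume w: "w\<in>mh U Z" and x: "x\<in>U"
   obtain w' where w': "w'\<in>mh U N" "!!x. x\<in>U ==> q (w' x) = w x"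
    using lift_along[OF p[OF U] N(1) Z(1-3) _ w] EW[OF U] unfolding ker by blast
   have "w' x\<in>W" using W(2)[OF U w'(1)] x by blast
   thus "w x = 0_Z" using w'(2)[OF x] Z(4)[OF hom_closed[OF w'(1) x]] by simp
  qed
  show ?thesis
  proof (rule that[of Z])
   show "Z\<in>MC" by (rule Z)
   show "homz Q Z" if "pj Q" "!!U. U\<in>B ==> homz Q U" for Q
    by (rule homz_quot[OF homz_sub[OF hR[OF that(2)] sK Rm, folded N_def] that(1) N(1) Z(1-3)])
   \<comment> \<open>Otherwise \<open>E0\<close> would hold for the kernel of \<open>ro\<close>, and
     the identity of \<open>V\<close> would lift to a section of \<open>ro\<close>, against
     \<open>RR_not_iso\<close>.\<close>
   have "~ E0 (a V) (b V) (f V) Z"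
   proof
    assume EZ: "E0 (a V) (b V) (f V) Z"
    note D = presD[OF p[OF V]]
    have "E0 (a V) (b V) (f V) N"
     by (rule E0_ext[OF EZ D(2,8,4) N(1) Z(1-3)]) (use EW[OF V] ker in simp)
    hence EN: "E0 (a V) (b V) (f V) (R(|carrier:=?K|))" by (simp add: N_def)
    obtain s where s: "s\<in>mh V R" "!!x. x\<in>V ==> ro (s x) = x"
     using lift_along[OF p[OF V] Rm Vm ro True EN hom_id] by blast
    have "isoM V V (%x. ro (s x))" by (rule bij_betwI[of _ _ _ "%x. x"]) (auto simp: s(2))
    thus False using RR_not_iso[OF R Vi B(2) s(1)] by blast
   qed
   thus "vf (a V) (b V) Z ~= 0" by (rule vf_values(3)[OF p[OF V] Z(1) _ hz[OF V]])
   show "vf (a U) (b U) Z = 0" if U: "U\<in>B" "U ~= V" for U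
   proof (rule vf_values(1)[OF p[OF U(1)] Z(1) _ hz[OF U(1)]])
    note D = presD[OF p[OF U(1)]]
    \<comment> \<open>The extension \<open>h\<close> of \<open>g\<close> to \<open>R\<close> may
      leave the kernel of \<open>ro\<close>. Its composite with \<open>ro\<close> descends to a map
      from \<open>U\<close> to \<open>V\<close>, which factors through \<open>ro\<close> because
      \<open>U ~= V\<close>; subtracting this factorization brings \<open>h\<close> back into the
      kernel.\<close>
    have "E0 (a U) (b U) (f U) N" unfolding E0_def
    proof
     fix g assume g: "g\<in>mh (a U) N"
     have g': "g\<in>mh (a U) R" using hom_comp[OF g N(2)] by simp
     obtain h where h: "h\<in>mh (b U) R" "\<forall>x\<in>carrier (a U). h (f U x) = g x"
      using ER[OF U(1)] g' by (auto simp: E0_def)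
     have gk: "ro (g x) = 0_V" if "x\<in>carrier (a U)" for x using hom_closed[OF g that] Ni by simp
     note hr = hom_comp[OF h(1) ro]
     obtain v where v: "v\<in>mh U V" "!!y. y\<in>carrier (b U) ==> v (e U y) = ro (h y)"
     proof (rule pres_descend[OF p[OF U(1)] Vm hr])
      show "ro (h (f U x)) = 0_V" if "x\<in>carrier (a U)" for x using h(2) gk that by simp
     qed blast
     obtain t where t: "t\<in>mh U R" "\<forall>x\<in>U. ro (t x) = v x" using fac[OF U v(1)] by blast
     have te: "(%y. t (e U y))\<in>mh (b U) R" by (rule hom_comp[OF D(5) t(1)])
     have "(%y. h y -_R t (e U y))\<in>mh (b U) (R(|carrier:=?K|))"
     proof (rule module_hom_codom[OF hom_diff[OF h(1) te MC_rm[OF Rm]]])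
      fix y assume y: "y\<in>carrier (b U)"
      have "ro (h y -_R t (e U y)) = 0_V"
       using hom_minus[OF ro Rm Vm hom_closed[OF h(1) y] hom_closed[OF te y]] t(2) v(2)[OF y]
        hom_closed[OF D(5) y] hom_closed[OF hr y] Vm by simp
      thus "h y -_R t (e U y)\<in>?K" using hom_closed[OF h(1) y] hom_closed[OF te y] Rm by simp
     qed
     hence k: "(%y. h y -_R t (e U y))\<in>mh (b U) N" by (simp add: N_def)
     show "\<exists>k\<in>mh (b U) N. \<forall>x\<in>carrier (a U). k (f U x) = g x"
     proof (rule bexI[OF _ k], intro ballI)
      fix x assume x: "x\<in>carrier (a U)"
      have "t (e U (f U x)) = 0_R" using D(10)[OF x] hom_zero[OF t(1) D(3) Rm] by simp
      thus "h (f U x) -_R t (e U (f U x)) = g x" using h(2) x hom_closed[OF g' x] Rm by simp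
     qed
    qed
    thus "E0 (a U) (b U) (f U) Z" by (rule E0_quot[OF _ D(1) N(1) Z(1-3)])
   qed
  qed
 qed
qed

lemma pres_projective:
 assumes "pj Q" shows "pres zmod Q (%_. 0_Q) (%x. x) Q"
 unfolding pres_def
 using assms pj_zero[OF MC_zmod zero_zmod] hom_0[OF MC_rm[OF pj_MC[OF assms]]] hom_id by auto

lemma E0_projective: "L\<in>MC ==> Q\<in>MC ==> E0 (zmod :: ('k, 'a) rmod) Q f L"
 unfolding E0_def
proof
 fix g assume L: "L\<in>MC" and g: "g\<in>mh (zmod :: ('k, 'a) rmod) L"
 show "\<exists>h\<in>mh Q L. \<forall>x\<in>carrier (zmod :: ('k, 'a) rmod). h (f x) = g x"
  using hom_zero[OF g MC_zmod L] by (intro bexI[OF _ hom_0[OF MC_rm[OF L]]]) auto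
qed

lemma vf_projective: "vf zmod Q = hf Q"
 using hf_zero[OF MC_zmod zero_zmod] by (auto simp: vf_def fun_eq_iff)

text \<open>At the dual module of \<open>V\<close> all other indices vanish, and so does every
  \<open>hf Q\<close>, since \<open>Hom(Q, -)\<close> is zero on \<open>B\<close> and hence on
  modules built from it. This isolates \<open>c V\<close>. The coefficients \<open>d Q\<close> are
  isolated in the same way, with the presentations of projectives by a zero module.\<close>

lemma vf_independent:
 assumes B: "finite B" "!!U. U\<in>B ==> ind U" "noniso B"
  and p: "!!U. U\<in>B ==> pres (a U) (b U) (f U) (e U) U"
  and E: "!!U V. U\<in>B ==> V\<in>B ==> E0 (a U) (b U) (f U) V"
  and C: "finite C" "!!Q. Q\<in>C ==> ind Q" "!!Q. Q\<in>C ==> pj Q" "noniso C"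
  and h: "!!U Q. U\<in>B ==> Q\<in>C ==> homz Q U"
  and z: "!!Z. Z\<in>MC ==> (\<Sum>U\<in>B. c U * vf (a U) (b U) Z) + (\<Sum>Q\<in>C. d Q * hf Q Z) = 0"
 shows "\<forall>U\<in>B. c U = 0" "\<forall>Q\<in>C. d Q = 0"
proof -
 show c0: "\<forall>U\<in>B. c U = 0"
 proof
  fix V assume V: "V\<in>B"
  obtain Z where Z: "Z\<in>MC" "vf (a V) (b V) Z ~= 0" "!!U. U\<in>B ==> U ~= V ==> vf (a U) (b U) Z = 0"
   "!!Q. pj Q ==> (!!U. U\<in>B ==> homz Q U) ==> homz Q Z"
   using dual_module_exists[OF B p E V] by blast
  have "hf Q Z = 0" if "Q\<in>C" for Q
   using hd_zero[of Q Z] Z(4)[OF C(3)[OF that]] h[OF _ that] Z(1) pj_MC[OF C(3)[OF that]] by (simp add: hf_def homz_def)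
  hence "(\<Sum>Q\<in>C. d Q * hf Q Z) = 0" by simp
  moreover have "(\<Sum>U\<in>B. c U * vf (a U) (b U) Z) = (\<Sum>U\<in>B. if U = V then c V * vf (a V) (b V) Z else 0)"
   by (rule sum.cong) (use Z(3) in auto)
  ultimately show "c V = 0" using z[OF Z(1)] Z(2) V B(1) by simp
 qed
 show "\<forall>Q\<in>C. d Q = 0"
 proof
  fix Q assume Q: "Q\<in>C"
  obtain Z where Z: "Z\<in>MC" "vf zmod Q Z ~= 0" "!!U. U\<in>C ==> U ~= Q ==> vf zmod U Z = 0"
  proof (rule dual_module_exists[where a = "%_. zmod" and b = "%U. U" and f = "%U _. 0_U" and e = "%_ x. x",
     OF C(1,2,4) _ _ Q])
   show "pres zmod U (%_. 0_U) (%x. x) U" if "U\<in>C" for U by (rule pres_projective[OF C(3)[OF that]])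
   show "E0 (zmod :: ('k, 'a) rmod) U (%_. 0_U) V" if "U\<in>C" "V\<in>C" for U V
    by (rule E0_projective[OF pj_MC[OF C(3)[OF that(2)]] pj_MC[OF C(3)[OF that(1)]]])
  qed blast+
  have "(\<Sum>U\<in>B. c U * vf (a U) (b U) Z) = 0" using c0 by simp
  moreover have "(\<Sum>U\<in>C. d U * hf U Z) = (\<Sum>U\<in>C. if U = Q then d Q * hf Q Z else 0)"
   by (rule sum.cong) (use Z(3) vf_projective in auto)
  ultimately show "d Q = 0" using z[OF Z(1)] Z(2) Q C(1) vf_projective by simp
 qed
qed

lemma vf_family:
 assumes B: "finite B" "!!U. U\<in>B ==> ind U" "noniso B"
  and p: "!!U. U\<in>B ==> pres (a U) (b U) (f U) (e U) U"
  and E: "!!U V. U\<in>B ==> V\<in>B ==> E0 (a U) (b U) (f U) V"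
  and C: "finite C" "!!Q. Q\<in>C ==> ind Q" "!!Q. Q\<in>C ==> pj Q" "noniso C"
  and h: "!!U Q. U\<in>B ==> Q\<in>C ==> homz Q U"
  and z: "!!Z. (\<Sum>i\<in>B <+> C. c i * case_sum (%U. vf (a U) (b U)) hf i Z) = 0"
 shows "\<forall>i\<in>B <+> C. c i = 0"
proof -
 have "(\<Sum>U\<in>B. c (Inl U) * vf (a U) (b U) Z) + (\<Sum>Q\<in>C. c (Inr Q) * hf Q Z) = 0" for Z
  using z[of Z] B(1) C(1) by (simp add: sum.Plus)
 from vf_independent[OF B p E C h this] show ?thesis by auto
qed

lemma ind_pj_represented:
 assumes "represents PR (IS AA)" "ind Q" "pj Q"
 shows "\<exists>Q'\<in>PR. mod_iso A Q Q'"
 using assms ind_pj_iff[OF assms(2)] IS_iff[OF AA(1)] by (auto simp: represents_def)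

lemma hf_iso: "mod_iso A P Q ==> P\<in>MC ==> Q\<in>MC ==> hf P = hf Q"
 unfolding mod_iso_def hf_def using hd_iso by (auto simp: fun_eq_iff)

lemma hf_in_span:
 assumes R: "represents PR (IS AA)" and P: "pj P"
 shows "hf P\<in>fv.span (hf ` PR)"
proof -
 have "hf ` {Q. ind Q & sd Q P} <= hf ` PR"
 proof
  fix y assume "y\<in>hf ` {Q. ind Q & sd Q P}"
  then obtain Q where Q: "ind Q" "sd Q P" "y = hf Q" by blast
  have "pj Q" by (rule pj_sd[OF P indD(1)[OF Q(1)] Q(2)])
  then obtain Q' where Q': "Q'\<in>PR" "mod_iso A Q Q'" using ind_pj_represented[OF R Q(1)] by blast
  have "Q'\<in>MC" using Q'(1) R IS_MC by (auto simp: represents_def)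
  thus "y\<in>hf ` PR" using hf_iso[OF Q'(2) indD(1)[OF Q(1)]] Q(3) Q'(1) by blast
 qed
 thus ?thesis using hf_span[OF pj_MC[OF P]] fv.span_mono by blast
qed

lemma num_regular:
 assumes "represents PR (IS AA)"
 shows "num_summands K A (regular_module A) = card PR" "finite PR"
proof -
 have "IS (regular_module A) = IS AA"
  by (rule IS_iso_cong[OF AA(2) mod_iso_sym[OF AA(2) rm_regular]])
 thus "num_summands K A (regular_module A) = card PR" using num_summands_eq assms by metis
 show "finite PR" by (rule finite_reps_IS[OF AA(1) assms])
qed

text \<open>The family is independent inside the span of the functionals \<open>hf Q\<close>, where
  \<open>Q\<close> runs through the indecomposable projectives.\<close>

lemma rank_bound:
 assumes B: "!!U. U\<in>B ==> ind U" "noniso B"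
  and p: "!!U. U\<in>B ==> pres (a U) (b U) (f U) (e U) U"
  and E: "!!U V. U\<in>B ==> V\<in>B ==> E0 (a U) (b U) (f U) V"
  and C: "!!Q. Q\<in>C ==> ind Q" "!!Q. Q\<in>C ==> pj Q" "noniso C"
  and h: "!!U Q. U\<in>B ==> Q\<in>C ==> homz Q U"
 shows "finite B" "finite C" "card B + card C <= num_summands K A (regular_module A)"
proof -
 obtain PR where PR: "represents PR (IS AA)" using reps_IS by blast
 note n = num_regular[OF PR]
 \<comment> \<open>The bound is proved for finite subfamilies first, because finiteness of
   \<open>B\<close> and \<open>C\<close> is itself a conclusion.\<close>
 have fin: "card B' + card C' <= card PR" if s: "finite B'" "finite C'" "B' <= B" "C' <= C" for B' C'
 proof -
  have ni: "noniso B'" "noniso C'" using s B(2) C(3) unfolding noniso_def by blast+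
  have "card (B' <+> C') <= card (hf ` PR)"
  proof (rule family_card_le[of "B' <+> C'" "case_sum (%U. vf (a U) (b U)) hf"])
   show "finite (B' <+> C')" "finite (hf ` PR)" using s n(2) by auto
   have sub: "!!U. U\<in>B' ==> ind U" "!!U. U\<in>B' ==> pres (a U) (b U) (f U) (e U) U"
    "!!U V. U\<in>B' ==> V\<in>B' ==> E0 (a U) (b U) (f U) V"
    "!!Q. Q\<in>C' ==> ind Q" "!!Q. Q\<in>C' ==> pj Q"
    "!!U Q. U\<in>B' ==> Q\<in>C' ==> homz Q U"
    using s(3,4) B(1) p E C(1,2) h by (simp_all add: subset_iff)
   show "\<forall>c. (\<forall>z. (\<Sum>i\<in>B' <+> C'. c i * case_sum (%U. vf (a U) (b U)) hf i z) = 0) --> (\<forall>i\<in>B' <+> C'. c i = 0)"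
    using vf_family[OF s(1) sub(1) ni(1) sub(2,3) s(2) sub(4,5) ni(2) sub(6)] by blast
   show "case_sum (%U. vf (a U) (b U)) hf ` (B' <+> C') <= fv.span (hf ` PR)"
   proof
    fix y assume "y\<in>case_sum (%U. vf (a U) (b U)) hf ` (B' <+> C')"
    then consider U where "U\<in>B'" "y = vf (a U) (b U)" | Q where "Q\<in>C'" "y = hf Q" by auto
    thus "y\<in>fv.span (hf ` PR)"
    proof cases
     case 1
     note D = presD[OF p[OF subsetD[OF s(3) 1(1)]]]
     have "y = hf (b U) - hf (a U)" using 1 by (auto simp: vf_def fun_eq_iff)
     thus ?thesis using fv.span_diff[OF hf_in_span[OF PR D(2)] hf_in_span[OF PR D(1)]] by metis
    next
     case 2
     thus ?thesis using hf_in_span[OF PR C(2)] s(4) by blast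
    qed
   qed
  qed
  also have "\<dots> <= card PR" by (rule card_image_le[OF n(2)])
  finally show ?thesis using s by (simp add: card_Plus)
 qed
 show fB: "finite B"
 proof (rule ccontr)
  assume "infinite B"
  then obtain B' where "B' <= B" "finite B'" "card B' = Suc (card PR)" using infinite_arbitrarily_large by blast
  thus False using fin[of B' "{}"] by simp
 qed
 show fC: "finite C"
 proof (rule ccontr)
  assume "infinite C"
  then obtain C' where "C' <= C" "finite C'" "card C' = Suc (card PR)" using infinite_arbitrarily_large by blast
  thus False using fin[of "{}" C'] by simp
 qed
 show "card B + card C <= num_summands K A (regular_module A)" using fin[OF fB fC] n(1) by simp
qed

end

section \<open>The Auslander-Reiten translation\<close>

context fdalg begin

abbreviation "rg \<equiv> regular_module A"

abbreviation "combine N g L \<equiv> foldr (%(x, y) s. g x y +_N s) L 0_N"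

text \<open>The pairs of elements and functionals from the dual basis lemma for projective
  modules.\<close>

definition dual_basis where
 "dual_basis P L <-> (\<forall>(x, ph)\<in>set L. x\<in>carrier P & ph\<in>mh P rg) & (\<forall>y\<in>carrier P. combine P (%x ph. ph y ._P x) L = y)"

lemma dual_basisD:
 assumes "dual_basis P L"
 shows "(x, ph)\<in>set L ==> x\<in>P" "(x, ph)\<in>set L ==> ph\<in>mh P rg"
  "y\<in>P ==> combine P (%x ph. ph y ._P x) L = y"
 using assms by (auto simp: dual_basis_def)

lemma dual_basis_Sm: "Sm {AA} F ==> \<exists>L. dual_basis F L"
proof (induction rule: Sm.induct)
 case Sm_zmod
 show ?case by (rule exI[of _ "[]"]) (auto simp: dual_basis_def)
next
 case (Sm_bsum U F)
 have U: "U = AA" "U\<in>MC" and F: "F\<in>MC" using Sm_bsum.hyps AA(1) Sm_MC by auto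
 note b = bsum_homs[OF MC_rm[OF U(2)] MC_rm[OF F]]
 obtain q where q: "q\<in>mh rg AA" "bij_betw q (carrier A) (carrier AA)" using AA(2) by (auto simp: mod_iso_def)
 note v = hom_inv[OF q(1) _ rm_regular, simplified, OF q(2)]
 obtain L where L: "dual_basis F L" using Sm_bsum.IH by blast
 interpret R: ring A by (rule ring_A)
 interpret F: right_module A F by (rule MC_rm[OF F])
 define L' where "L' = map (%(x, ph). (jn 0_U x, %z. ph (pr2 z))) L"
 define e where "e = (jn (q 1_A) 0_F, %z. inv_into (carrier A) q (pr1 z))"
 have c: "combine (U [+] F) (%x ph. ph z ._(U [+] F) x) (map (%(x, ph). (jn 0_U x, %z. ph (pr2 z))) l) =
   jn 0_U (combine F (%x ph. ph (pr2 z) ._F x) l)" if "set l <= set L" "pr2 z\<in>F" for l z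
  using that(1)
 proof (induction l)
  case (Cons p l)
  obtain x ph where p: "p = (x, ph)" by fastforce
  hence x: "x\<in>F" "ph\<in>mh F rg" using dual_basisD(1,2)[OF L] Cons.prems by auto
  have "ph (pr2 z)\<in>A" using hom_closed[OF x(2) that(2)] by simp
  thus ?case using Cons U(2) x(1) by (simp add: p right_module.ract_zero[OF MC_rm[OF U(2)]])
 qed simp
 have q1: "q 1_A\<in>U" using hom_closed[OF q(1), of "1_A"] U(1) by simp
 have "dual_basis (U [+] F) (e # L')" unfolding dual_basis_def
 proof (intro conjI ballI)
  have "fst e\<in>(U [+] F)" "snd e\<in>mh (U [+] F) rg" using q1 F hom_comp[OF b(1), of "inv_into (carrier A) q" rg] v(1) U(1) by (auto simp: e_def)
  moreover have "\<forall>(x, ph)\<in>set L'. x\<in>(U [+] F) & ph\<in>mh (U [+] F) rg"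
   using L U(2) hom_comp[OF b(2)] by (fastforce simp: dual_basis_def L'_def)
  ultimately show "case p of (x, ph) \<Rightarrow> x\<in>(U [+] F) & ph\<in>mh (U [+] F) rg" if "p\<in>set (e # L')" for p
   using that by (auto split: prod.splits)
  fix z assume z: "z\<in>(U [+] F)"
  have i: "inv_into (carrier A) q (pr1 z)\<in>A" using hom_closed[OF v(1), of "pr1 z"] z U(1) by simp
  have "inv_into (carrier A) q (pr1 z) ._AA q 1_A = pr1 z"
   using homD(3)[OF q(1) i, of "1_A"] v(4)[of "pr1 z"] z U(1) i by simp
  thus "combine (U [+] F) (%x ph. ph z ._(U [+] F) x) (e # L') = z"
   using c[of L z] L z U F i by (simp add: e_def L'_def dual_basis_def)
 qed
 thus ?case by blast
qed

lemma combine_hom: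
 assumes h: "h\<in>mh M N" and m: "rm M" "rm N" and c: "\<forall>(x, y)\<in>set L. g x y\<in>M"
 shows "combine M g L\<in>M & h (combine M g L) = combine N (%x y. h (g x y)) L"
proof -
 interpret M: right_module A M by (rule m)
 show ?thesis using c by (induction L) (use hom_more(1)[OF h m] homD(2)[OF h] in \<open>auto simp: case_prod_beta\<close>)
qed

text \<open>A dual basis of a free module is carried along a split surjection.\<close>

lemma dual_basis_exists:
 assumes P: "pj P" obtains L where "dual_basis P L"
proof -
 obtain F e where F: "e\<in>mh F P" "e ` F = carrier P" "Sm {AA} F" "pj F"
  using enough_projectives[OF pj_MC[OF P]] by metis
 obtain s where s: "s\<in>mh P F" "!!x. x\<in>P ==> e (s x) = x"
  using pj_lift[OF P pj_MC[OF F(4)] pj_MC[OF P] F(1) hom_id] F(2) by blast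
 obtain L where L: "dual_basis F L" using dual_basis_Sm[OF F(3)] by blast
 interpret F: right_module A F by (rule MC_rm[OF pj_MC[OF F(4)]])
 have "dual_basis P (map (%(x, ph). (e x, %y. ph (s y))) L)" unfolding dual_basis_def
 proof (intro conjI ballI)
  show "case p of (x, ph) \<Rightarrow> x\<in>P & ph\<in>mh P rg" if "p\<in>set (map (%(x, ph). (e x, %y. ph (s y))) L)" for p
   using that L hom_closed[OF F(1)] hom_comp[OF s(1)] by (fastforce simp: dual_basis_def)
  fix y assume y: "y\<in>P"
  note sy = hom_closed[OF s(1) y]
  have c: "\<forall>(x, ph)\<in>set L. x\<in>F & ph (s y)\<in>A" using L hom_closed[OF _ sy, where N = rg] by (fastforce simp: dual_basis_def)
  have "combine P (%x ph. ph y ._P x) (map (%(x, ph). (e x, %y. ph (s y))) L) = combine P (%x ph. ph (s y) ._P e x) L"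
   by (simp add: foldr_map comp_def case_prod_unfold)
  also have "\<dots> = combine P (%x ph. e (ph (s y) ._F x)) L"
   using c homD(3)[OF F(1)] by (intro foldr_cong) auto
  also have "\<dots> = e (combine F (%x ph. ph (s y) ._F x) L)"
   by (rule conjunct2[OF combine_hom[OF F(1) MC_rm[OF pj_MC[OF F(4)]] MC_rm[OF pj_MC[OF P]]], symmetric]) (use c F.ract_closed in auto)
  also have "\<dots> = y" using L sy s(2)[OF y] by (simp add: dual_basis_def)
  finally show "combine P (%x ph. ph y ._P x) (map (%(x, ph). (e x, %y. ph (s y))) L) = y" .
 qed
 thus ?thesis by (rule that)
qed

lemma mult_elem_hom:
 assumes "N\<in>MC" "m\<in>N" "ph\<in>mh P rg" shows "(%x. ph x ._N m)\<in>mh P N"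
proof -
 interpret N: right_module A N by (rule MC_rm[OF assms(1)])
 show ?thesis using homD[OF assms(3)] assms(2) by (intro homI) (auto simp: N.ract_closed N.ract_add_ring N.ract_mult)
qed

text \<open>The dual basis writes every \<open>g\<close> as a finite sum of maps
  \<open>x \<mapsto> ph x ._N m\<close>, so an additive property needs to be checked on these
  alone.\<close>

lemma tensor_span:
 assumes P: "pj P" and N: "N\<in>MC"
  and cong: "!!g g'. (!!x. x\<in>P ==> g x = g' x) ==> W g ==> W g'"
  and add: "!!g g'. g\<in>mh P N ==> g'\<in>mh P N ==> W g ==> W g' ==> W (%x. g x +_N g' x)"
  and base: "!!m ph. m\<in>N ==> ph\<in>mh P rg ==> W (%x. ph x ._N m)"
  and g: "g\<in>mh P N"
 shows "W g"
proof -
 interpret P: right_module A P by (rule MC_rm[OF pj_MC[OF P]])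
 obtain L where L: "dual_basis P L" by (rule dual_basis_exists[OF P]) blast
 note m = dual_basisD(1,2)[OF L]
 have "(%y. combine N (%x ph. ph y ._N g x) l)\<in>{h\<in>mh P N. W h}" if "set l <= set L" for l
  using that
 proof (induction l)
  case Nil
  have "W (%x. 0_A ._N 0_N)" by (rule base) (use N hom_0[OF rm_regular] in auto)
  hence "W (%y. 0_N)" by (rule cong[rotated]) (use right_module.ract_zero_ring[OF MC_rm[OF N]] N in simp)
  thus ?case by (simp add: hom_0[OF MC_rm[OF N]])
 next
  case (Cons p l)
  obtain x ph where p: "p = (x, ph)" by fastforce
  have x: "x\<in>P" "ph\<in>mh P rg" using m[of x ph] Cons.prems p by auto
  note h = mult_elem_hom[OF N hom_closed[OF g x(1)] x(2)]
  show ?case using Cons add[OF h] hom_add[OF h _ MC_rm[OF N]] base[OF hom_closed[OF g x(1)] x(2)] by (simp add: p)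
 qed
 from this[of L] have "W (%y. combine N (%x ph. ph y ._N g x) L)" by simp
 thus ?thesis
 proof (rule cong[rotated])
  fix y assume y: "y\<in>P"
  have c: "ph y\<in>A" "x\<in>P" if "(x, ph)\<in>set L" for x ph using hom_closed[OF m(2)[OF that] y] m(1)[OF that] by auto
  have "combine N (%x ph. ph y ._N g x) L = combine N (%x ph. g (ph y ._P x)) L"
   using c homD(3)[OF g] by (intro foldr_cong) auto
  also have "\<dots> = g (combine P (%x ph. ph y ._P x) L)"
   by (rule conjunct2[OF combine_hom[OF g MC_rm[OF pj_MC[OF P]] MC_rm[OF N]], symmetric]) (use c P.ract_closed in auto)
  finally show "combine N (%x ph. ph y ._N g x) L = g y" using L y by (simp add: dual_basis_def)
 qed
qed

text \<open>The universal property of \<open>N \<otimes> P\<^sup>*\<close>, which is \<open>Hom(P, N)\<close> for projective \<open>P\<close>.\<close>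

definition balanced where
 "balanced P N b <->
   (\<forall>m\<in>carrier N. \<forall>ph\<in>mh P rg. b m ph\<in>carrier K) &
   (\<forall>m\<in>carrier N. \<forall>ph ps. (\<forall>x\<in>carrier P. ph x = ps x) --> b m ph = b m ps) &
   (\<forall>m\<in>carrier N. \<forall>m'\<in>carrier N. \<forall>ph\<in>mh P rg. b (m +_N m') ph = b m ph +_K b m' ph) &
   (\<forall>m\<in>carrier N. \<forall>ph\<in>mh P rg. \<forall>ps\<in>mh P rg. b m (%x. ph x +_A ps x) = b m ph +_K b m ps) &
   (\<forall>a\<in>carrier A. \<forall>m\<in>carrier N. \<forall>ph\<in>mh P rg. b (a ._N m) ph = b m (%x. a *_A ph x))"

definition hom_functional where
 "hom_functional P N b xi <->
   (\<forall>m\<in>carrier N. \<forall>ph\<in>mh P rg. xi (%x. ph x ._N m) = b m ph) &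
   (\<forall>g\<in>mh P N. xi g\<in>carrier K) & (\<forall>g g'. (\<forall>x\<in>carrier P. g x = g' x) --> xi g = xi g') &
   (\<forall>g\<in>mh P N. \<forall>g'\<in>mh P N. xi (%x. g x +_N g' x) = xi g +_K xi g')"

lemma balancedD:
 assumes "balanced P N b"
 shows "!!m ph. m\<in>N ==> ph\<in>mh P rg ==> b m ph\<in>K"
  "!!m ph ps. m\<in>N ==> (!!x. x\<in>P ==> ph x = ps x) ==> b m ph = b m ps"
  "!!m m' ph. m\<in>N ==> m'\<in>N ==> ph\<in>mh P rg ==> b (m +_N m') ph = b m ph +_K b m' ph"
  "!!m ph ps. m\<in>N ==> ph\<in>mh P rg ==> ps\<in>mh P rg ==>
   b m (%x. ph x +_A ps x) = b m ph +_K b m ps"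
  "!!a m ph. a\<in>A ==> m\<in>N ==> ph\<in>mh P rg ==> b (a ._N m) ph = b m (%x. a *_A ph x)"
 using assms unfolding balanced_def by blast+

lemma hom_functionalD:
 assumes "hom_functional P N b xi"
 shows "!!g. g\<in>mh P N ==> xi g\<in>K"
  "!!g g'. (!!x. x\<in>P ==> g x = g' x) ==> xi g = xi g'"
  "!!g g'. g\<in>mh P N ==> g'\<in>mh P N ==> xi (%x. g x +_N g' x) = xi g +_K xi g'"
  "!!m ph. m\<in>N ==> ph\<in>mh P rg ==> xi (%x. ph x ._N m) = b m ph"
 using assms unfolding hom_functional_def by blast+

lemma mult_hom:
 assumes "a\<in>A" "ph\<in>mh P rg" shows "(%x. a *_A ph x)\<in>mh P rg"
proof -
 interpret R: ring A by (rule ring_A)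
 have c: "!!x. x\<in>P ==> ph x\<in>A" using hom_closed[OF assms(2)] by simp
 show ?thesis
  using homD(2,3)[OF assms(2)] assms(1) c by (intro homI) (auto simp: R.r_distr R.m_assoc)
qed

text \<open>The functional sends \<open>g\<close> to the sum of \<open>b (g x) ph\<close> over a
  dual basis. On a map \<open>x \<mapsto> ps x ._N m\<close>, balance moves the scalars to the
  second argument, where the dual basis reassembles \<open>ps\<close>.\<close>

lemma tensor_functional:
 assumes P: "pj P" and N: "N\<in>MC" and b: "balanced P N b"
 shows "\<exists>xi. hom_functional P N b xi"
proof -
 interpret N: right_module A N by (rule MC_rm[OF N])
 interpret K: field K by (rule field_K)
 interpret R: ring A by (rule ring_A)
 obtain L where L: "dual_basis P L" by (rule dual_basis_exists[OF P]) blast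
 note bD = balancedD[OF b]
 note m = dual_basisD(1,2)[OF L]
 have K: "combine K (%x. b (g x)) l\<in>K" if "set l <= set L" "g\<in>mh P N" for g l
  using that(1)
 proof (induction l)
  case (Cons p l)
  obtain x ph where p: "p = (x, ph)" by fastforce
  hence x: "x\<in>P" "ph\<in>mh P rg" using m Cons.prems by auto
  show ?case using Cons bD(1)[OF hom_closed[OF that(2) x(1)] x(2)] by (simp add: p)
 qed simp
 have add: "combine K (%x. b (g x +_N g' x)) l = combine K (%x. b (g x)) l +_K combine K (%x. b (g' x)) l"
  if "set l <= set L" and g: "g\<in>mh P N" "g'\<in>mh P N" for g g' l
  using that(1)
 proof (induction l)
  case (Cons p l)
  obtain x ph where p: "p = (x, ph)" by fastforce
  hence x: "x\<in>P" "ph\<in>mh P rg" using m Cons.prems by auto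
  show ?case using Cons bD(3)[OF hom_closed[OF g(1) x(1)] hom_closed[OF g(2) x(1)] x(2)] K[OF _ g(1), of l] K[OF _ g(2), of l]
    bD(1)[OF hom_closed[OF g(1) x(1)] x(2)] bD(1)[OF hom_closed[OF g(2) x(1)] x(2)] by (simp add: p K.a_ac)
 qed simp
 have "combine K (%x. b (ps x ._N m)) L = b m ps" if mN: "m\<in>N" and ps: "ps\<in>mh P rg" for m ps
 proof -
  have z: "(%y. 0_A)\<in>mh P rg" using hom_0[OF rm_regular, of P] by simp
  have "b m (%y. 0_A +_A 0_A) = b m (%y. 0_A) +_K b m (%y. 0_A)" by (rule bD(4)[OF mN z z])
  hence b0: "b m (%y. 0_A) = 0_K" using bD(1)[OF mN z] by simp
  have "(%y. combine A (%x ph. ps x *_A ph y) l)\<in>mh P rg &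
   b m (%y. combine A (%x ph. ps x *_A ph y) l) = combine K (%x. b (ps x ._N m)) l" if "set l <= set L" for l
   using that
  proof (induction l)
   case (Cons p l)
   obtain x ph where p: "p = (x, ph)" by fastforce
   hence x: "x\<in>P" "ph\<in>mh P rg" using m Cons.prems by auto
   have a: "ps x\<in>A" using hom_closed[OF ps x(1)] by simp
   note h = mult_hom[OF a x(2)]
   show ?case using Cons bD(4)[OF mN h] bD(5)[OF a mN x(2)] hom_add[OF h _ rm_regular] by (simp add: p)
  qed (use z b0 in simp)
  from conjunct2[OF this[OF subset_refl]]
  have e: "b m (%y. combine A (%x ph. ps x *_A ph y) L) = combine K (%x. b (ps x ._N m)) L" .
  have "combine A (%x ph. ps x *_A ph y) L = ps y" if y: "y\<in>P" for y
  proof -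
   have c: "x\<in>P" "ph y\<in>A" if "(x, ph)\<in>set L" for x ph using m[OF that] hom_closed[OF m(2)[OF that] y] by auto
   interpret P: right_module A P by (rule MC_rm[OF pj_MC[OF P]])
   have "combine A (%x ph. ps x *_A ph y) L = combine rg (%x ph. ps (ph y ._P x)) L"
    using c homD(3)[OF ps] by (simp, intro foldr_cong) auto
   also have "\<dots> = ps (combine P (%x ph. ph y ._P x) L)"
    by (rule conjunct2[OF combine_hom[OF ps MC_rm[OF pj_MC[OF P]] rm_regular], symmetric]) (use c P.ract_closed in auto)
   finally show ?thesis using L y by (simp add: dual_basis_def)
  qed
  from bD(2)[OF mN this] show ?thesis using e by simp
 qed
 hence "hom_functional P N b (%g. combine K (%x. b (g x)) L)"
  unfolding hom_functional_def using K[OF subset_refl] add[OF subset_refl] m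
  by (auto intro!: foldr_cong)
 thus ?thesis by blast
qed

end

text \<open>The last clause resolves the union in the scalar action of
  \<open>quotient_module\<close>: an additive map that preserves \<open>I\<close> takes each coset
  into a single coset.\<close>

lemma additive_coset:
 fixes S :: "('s, 'z) ring_scheme"
 assumes S: "abelian_group S" and I: "additive_subgroup I S"
 shows "x\<in>S ==> y\<in>S ==> (I +>\<^bsub>S\<^esub> x) <+>\<^bsub>S\<^esub> (I +>\<^bsub>S\<^esub> y) = I +>\<^bsub>S\<^esub> (x +_S y)"
  "x\<in>I ==> I +>\<^bsub>S\<^esub> x = I"
  "x\<in>S ==> I +>\<^bsub>S\<^esub> x = I +>\<^bsub>S\<^esub> y ==> \<exists>i\<in>I. x = i +_S y"
  "a_rcosets\<^bsub>S\<^esub> I = (%x. I +>\<^bsub>S\<^esub> x) ` S"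
  "(!!x. x\<in>S ==> g x\<in>S) ==> (!!x. x\<in>I ==> g x\<in>I) ==>
   (!!x y. x\<in>S ==> y\<in>S ==> g (x +_S y) = g x +_S g y) ==>
   x\<in>S ==> (\<Union>z\<in>I +>\<^bsub>S\<^esub> x. I +>\<^bsub>S\<^esub> g z) = I +>\<^bsub>S\<^esub> g x"
proof -
 interpret abelian_group S by fact
 interpret additive_subgroup I S by fact
 interpret abelian_subgroup I S by (rule abelian_subgroupI3[OF I S])
 show sum: "x\<in>S ==> y\<in>S ==> (I +>\<^bsub>S\<^esub> x) <+>\<^bsub>S\<^esub> (I +>\<^bsub>S\<^esub> y) = I +>\<^bsub>S\<^esub> (x +_S y)" for x y
  by (rule a_rcos_sum)
 show I: "x\<in>I ==> I +>\<^bsub>S\<^esub> x = I" for x by (rule a_rcos_const)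
 have self: "x\<in>I +>\<^bsub>S\<^esub> x" if "x\<in>S" for x
  using that zero_closed unfolding a_r_coset_def' by force
 show "x\<in>S ==> I +>\<^bsub>S\<^esub> x = I +>\<^bsub>S\<^esub> y ==> \<exists>i\<in>I. x = i +_S y"
  using self[of x] unfolding a_r_coset_def' by auto
 show "a_rcosets\<^bsub>S\<^esub> I = (%x. I +>\<^bsub>S\<^esub> x) ` S"
  by (auto simp: A_RCOSETS_def')
 assume g: "!!x. x\<in>S ==> g x\<in>S" "!!x. x\<in>I ==> g x\<in>I"
  "!!x y. x\<in>S ==> y\<in>S ==> g (x +_S y) = g x +_S g y" and x: "x\<in>S"
 have "I +>\<^bsub>S\<^esub> g z = I +>\<^bsub>S\<^esub> g x" if zI: "z\<in>I +>\<^bsub>S\<^esub> x" for z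
 proof -
  obtain i where i: "i\<in>I" "z = i +_S x" using zI unfolding a_r_coset_def' by auto
  hence "i\<in>S" using a_subset by auto
  hence "I +>\<^bsub>S\<^esub> g z = (I +>\<^bsub>S\<^esub> g i) <+>\<^bsub>S\<^esub> (I +>\<^bsub>S\<^esub> g x)"
   using i g(1,3) x sum by simp
  also have "I +>\<^bsub>S\<^esub> g i = I" using I[OF g(2)[OF i(1)]] .
  also have "I <+>\<^bsub>S\<^esub> (I +>\<^bsub>S\<^esub> g x) = I +>\<^bsub>S\<^esub> g x"
   using sum[of "0_S" "g x"] I[of "0_S"] g(1)[OF x] zero_closed by simp
  finally show ?thesis .
 qed
 thus "(\<Union>z\<in>I +>\<^bsub>S\<^esub> x. I +>\<^bsub>S\<^esub> g z) = I +>\<^bsub>S\<^esub> g x" using self[OF x] by blast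
qed

context fdalg begin

lemma star_simps [simp]:
 "carrier (star_module A P) = Hom A P rg" "0_(star_module A P) = (\<lambda>x\<in>P. 0_A)"
 "ph +_(star_module A P) ps = (\<lambda>x\<in>P. ph x +_A ps x)"
 "a ._(star_module A P) ph = (\<lambda>x\<in>P. a *_A ph x)"
 by (simp_all add: star_module_def Hom_group_def)

lemma abelian_group_star: "rm P ==> abelian_group (star_module A P)"
proof -
 assume P: "rm P"
 interpret vectorspace K "hs P rg" by (rule vs_hs[OF P rm_regular])
 show ?thesis
 proof (rule abelian_groupI)
  show "\<exists>ps\<in>carrier (star_module A P). ps +_(star_module A P) ph = 0_(star_module A P)"
   if "ph\<in>carrier (star_module A P)" for ph
   using M.l_neg[of ph] M.a_inv_closed[of ph] that by auto
 qed (use M.a_closed M.zero_closed M.a_assoc M.a_comm M.l_zero in auto)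
qed

lemma mult_Hom: "a\<in>A ==> rm P ==> ph\<in>Hom A P rg ==> (\<lambda>x\<in>P. a *_A ph x)\<in>Hom A P rg"
 by (rule restrict_Hom[OF mult_hom]) (simp_all add: Hom_iff)

lemma AR_translate_mp: "AR_translate K A M = dual_module K A (transpose_module A (mp1 M) (mp0 M) (mpf M))"
 by (simp add: AR_translate_def mp_def[symmetric] case_prod_beta)

lemma transpose_facts:
 fixes P1 P0 :: "('k, 'a) rmod"
 assumes P: "P1\<in>MC" "P0\<in>MC" and f: "f\<in>mh P1 P0"
 defines "S \<equiv> star_module A P1"
 defines "I \<equiv> (%ph. compose (carrier P1) ph f) ` carrier (star_module A P0)"
 defines "T \<equiv> transpose_module A P1 P0 f"
 shows "abelian_group S" "additive_subgroup I S" "carrier T = (%ph. I +>\<^bsub>S\<^esub> ph) ` Hom A P1 rg"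
  "!!ph ps. ph\<in>Hom A P1 rg ==> ps\<in>Hom A P1 rg ==> (I +>\<^bsub>S\<^esub> ph) +_T (I +>\<^bsub>S\<^esub> ps) = I +>\<^bsub>S\<^esub> (\<lambda>x\<in>P1. ph x +_A ps x)"
  "!!a ph. a\<in>A ==> ph\<in>Hom A P1 rg ==> a ._T (I +>\<^bsub>S\<^esub> ph) = I +>\<^bsub>S\<^esub> (\<lambda>x\<in>P1. a *_A ph x)"
  "I\<in>T" "I +_T I = I"
proof -
 have r: "rm P1" "rm P0" using P by auto
 interpret R: ring A by (rule ring_A)
 show S: "abelian_group S" unfolding S_def by (rule abelian_group_star[OF r(1)])
 interpret S: abelian_group S by (rule S)
 interpret S0: abelian_group "star_module A P0" by (rule abelian_group_star[OF r(2)])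
 have fc: "f x\<in>P0" if "x\<in>P1" for x using hom_closed[OF f that] .
 have Hc: "!!ph x. ph\<in>Hom A P0 rg ==> x\<in>P0 ==> ph x\<in>A"
  using homD(1)[where N = rg] by (fastforce simp: Hom_iff)
 have c: "compose (carrier P1) ph f\<in>Hom A P1 rg" if "ph\<in>Hom A P0 rg" for ph
  using restrict_Hom[OF hom_comp[OF f] r(1), of ph rg] that unfolding Hom_iff compose_def by blast
 have Ic: "I <= carrier S" using c by (auto simp: I_def S_def)
 show I: "additive_subgroup I S"
 proof (rule S.add.subgroupI[folded additive_subgroup_def, simplified])
  show "I <= carrier S" by (rule Ic)
  show "I ~= {}" using S0.zero_closed by (auto simp: I_def)
  show "x +_S y\<in>I" if xy: "x\<in>I" "y\<in>I" for x y
  proof -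
   obtain ph ps where p: "ph\<in>Hom A P0 rg" "x = compose (carrier P1) ph f" "ps\<in>Hom A P0 rg" "y = compose (carrier P1) ps f"
    using xy by (auto simp: I_def)
   have "x +_S y = compose (carrier P1) (ph +_(star_module A P0) ps) f"
    using fc by (auto simp: p S_def compose_def fun_eq_iff)
   thus ?thesis using S0.a_closed[of ph ps] p by (auto simp: I_def)
  qed
  show "-_S x\<in>I" if xI: "x\<in>I" for x
  proof -
   obtain ph where p: "ph\<in>Hom A P0 rg" "x = compose (carrier P1) ph f" using xI by (auto simp: I_def)
   let ?n = "-_(star_module A P0) ph"
   have n: "?n\<in>Hom A P0 rg" using S0.a_inv_closed[of ph] p by simp
   have "ph +_(star_module A P0) ?n = 0_(star_module A P0)" using S0.r_neg[of ph] p by simp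
   hence e: "ph y +_A ?n y = 0_A" if "y\<in>P0" for y
    using that by (simp add: fun_eq_iff) metis
   have "x +_S compose (carrier P1) ?n f = 0_S"
    using fc e by (auto simp: p S_def compose_def fun_eq_iff)
   hence "compose (carrier P1) ?n f = -_S x"
    using S.minus_equality[of "compose (carrier P1) ?n f" x] S.a_comm[of x "compose (carrier P1) ?n f"] c[OF p(1)] c[OF n]
    unfolding p S_def star_simps by metis
   thus ?thesis using n by (force simp: I_def)
  qed
 qed
 note co = additive_coset[OF S I]
 have T: "T = quotient_module S I" by (simp add: T_def transpose_module_def S_def I_def)
 show C: "carrier T = (%ph. I +>\<^bsub>S\<^esub> ph) ` Hom A P1 rg" unfolding T using co(4) by (simp add: S_def quotient_module_def)
 show "(I +>\<^bsub>S\<^esub> ph) +_T (I +>\<^bsub>S\<^esub> ps) = I +>\<^bsub>S\<^esub> (\<lambda>x\<in>P1. ph x +_A ps x)"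
  if "ph\<in>Hom A P1 rg" "ps\<in>Hom A P1 rg" for ph ps
  using co(1)[of ph ps] that by (simp add: T quotient_module_def S_def)
 show "a ._T (I +>\<^bsub>S\<^esub> ph) = I +>\<^bsub>S\<^esub> (\<lambda>x\<in>P1. a *_A ph x)"
  if a: "a\<in>A" and p: "ph\<in>Hom A P1 rg" for a ph
 proof -
  have "(\<Union>z\<in>I +>\<^bsub>S\<^esub> ph. I +>\<^bsub>S\<^esub> (a ._S z)) = I +>\<^bsub>S\<^esub> (a ._S ph)"
  proof (rule co(5))
   show "a ._S ps\<in>S" if "ps\<in>S" for ps using mult_Hom[OF a r(1)] that by (simp add: S_def)
   show "a ._S (ps +_S ch) = a ._S ps +_S a ._S ch" if "ps\<in>S" "ch\<in>S" for ps ch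
    using that homD(1)[of ps A P1 rg] homD(1)[of ch A P1 rg] a by (auto simp: S_def fun_eq_iff Hom_iff R.r_distr)
   show "a ._S ps\<in>I" if pI: "ps\<in>I" for ps
   proof -
    obtain ch where p: "ch\<in>Hom A P0 rg" "ps = compose (carrier P1) ch f" using pI by (auto simp: I_def)
    have "a ._S ps = compose (carrier P1) (\<lambda>x\<in>P0. a *_A ch x) f"
     using fc by (auto simp: p S_def compose_def fun_eq_iff)
    thus ?thesis using mult_Hom[OF a r(2) p(1)] by (auto simp: I_def)
   qed
  qed (use p in \<open>simp add: S_def\<close>)
  thus ?thesis by (simp add: T quotient_module_def S_def)
 qed
 have "I = I +>\<^bsub>S\<^esub> 0_S" using co(2) additive_subgroup.zero_closed[OF I] by metis
 thus "I\<in>T" unfolding C using S.zero_closed by (force simp: S_def)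
 show "I +_T I = I"
  using co(1)[OF S.zero_closed S.zero_closed] co(2)[OF additive_subgroup.zero_closed[OF I]]
  by (simp add: T quotient_module_def)
qed

lemma dual_simps:
 "carrier (dual_module K A L) = module_hom K (us L) (regular_module K) \<inter> extensional L"
  "0_(dual_module K A L) = (\<lambda>x\<in>L. 0_K)"
  "xi +_(dual_module K A L) ze = (\<lambda>x\<in>L. xi x +_K ze x)"
  "a ._(dual_module K A L) xi = (\<lambda>x\<in>L. xi (a ._L x))"
 by (simp_all add: dual_module_def Hom_group_def Hom_def Let_def regular_module_def)

text \<open>By adjunction, maps from \<open>N\<close> to the dual of the transpose are functionals
  on the tensor product of \<open>N\<close> with the transpose, which is the cokernel of
  \<open>Hom(f, N)\<close>. The proof passes between such maps and functionals on
  \<open>Hom(P1, N)\<close> that vanish on maps extending along \<open>f\<close>, without forming a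
  tensor product.\<close>

lemma hom_dual_transpose_zero:
 fixes P1 P0 N :: "('k, 'a) rmod"
 assumes P: "pj P1" "pj P0" and f: "f\<in>mh P1 P0" and N: "N\<in>MC"
 shows "Hom_zero A N (dual_module K A (transpose_module A P1 P0 f)) <-> E0 P1 P0 f N"
proof -
 interpret R: ring A by (rule ring_A)
 interpret K: field K by (rule field_K)
 interpret N: right_module A N by (rule MC_rm[OF N])
 have m: "P1\<in>MC" "P0\<in>MC" and r: "rm P1" "rm P0" using P by auto
 define S where "S = star_module A P1"
 define I where "I = (%ph. compose (carrier P1) ph f) ` carrier (star_module A P0)"
 define T where "T = transpose_module A P1 P0 f"
 note tf = transpose_facts[OF m f, folded S_def I_def, folded T_def]
 note co = additive_coset[OF tf(1,2)]
 define c where "c ph = I +>\<^bsub>S\<^esub> restrict ph P1" for ph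
 have rH: "restrict ph P1\<in>Hom A P1 rg" if "ph\<in>mh P1 rg" for ph by (rule restrict_Hom[OF that r(1)])
 have cT: "c ph\<in>T" if "ph\<in>mh P1 rg" for ph using rH[OF that] by (auto simp: c_def tf(3))
 have Tc: "\<exists>ph\<in>mh P1 rg. C = c ph" if C: "C\<in>T" for C
 proof -
  obtain ph where "ph\<in>Hom A P1 rg" "C = I +>\<^bsub>S\<^esub> ph" using C by (auto simp: tf(3))
  thus ?thesis by (intro bexI[of _ ph]) (auto simp: c_def Hom_iff extensional_restrict)
 qed
 have cc: "c ph = c ps" if "!!x. x\<in>P1 ==> ph x = ps x" for ph ps
  using that by (auto simp: c_def intro!: arg_cong[where f = "%x. I +>\<^bsub>S\<^esub> x"])
 have ca: "c ph +_T c ps = c (%x. ph x +_A ps x)" if "ph\<in>mh P1 rg" "ps\<in>mh P1 rg" for ph ps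
  using tf(4)[OF rH rH, OF that] by (simp add: c_def cong: restrict_cong)
 have cs: "a ._T c ph = c (%x. a *_A ph x)" if "a\<in>A" "ph\<in>mh P1 rg" for a ph
  using tf(5)[OF that(1) rH, OF that(2)] by (simp add: c_def cong: restrict_cong)
 have cI: "c (%x. ph (f x)) = I" if p: "ph\<in>mh P0 rg" for ph
 proof -
  have "restrict (%x. ph (f x)) (carrier P1) = compose (carrier P1) (restrict ph P0) f"
   using hom_closed[OF f] by (auto simp: compose_def)
  hence "restrict (%x. ph (f x)) (carrier P1)\<in>I" using restrict_Hom[OF p r(2)] by (auto simp: I_def)
  thus ?thesis unfolding c_def by (rule co(2))
 qed
 define D where "D = dual_module K A T"
 have Ds: "carrier D = module_hom K (us T) (regular_module K) \<inter> extensional T"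
  "0_D = (\<lambda>x\<in>T. 0_K)" "!!xi ze. xi +_D ze = (\<lambda>x\<in>T. xi x +_K ze x)"
  "!!a xi. a ._D xi = (\<lambda>x\<in>T. xi (a ._T x))"
  by (simp_all add: D_def dual_simps)
 have Ta: "C +_T C'\<in>T" if CT: "C\<in>T" "C'\<in>T" for C C'
 proof -
  obtain ph ps where p: "ph\<in>mh P1 rg" "C = c ph" "ps\<in>mh P1 rg" "C' = c ps"
   using Tc[OF CT(1)] Tc[OF CT(2)] by auto
  show ?thesis using cT[OF hom_add[OF p(1,3) rm_regular]] ca[OF p(1,3)] by (simp add: p)
 qed
 have Ts: "a ._T C\<in>T" if "a\<in>A" "C\<in>T" for C a
  using Tc[OF that(2)] cs[OF that(1)] cT[OF mult_hom[OF that(1)]] by metis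
 let ?Z = "\<lambda>x\<in>N. 0_D"
 have Z: "?Z\<in>Hom A N D"
  unfolding Hom_iff using Ta Ts N.ract_closed
  by (intro conjI homI) (auto simp: Ds functional_iff[OF field_K] sc_facts fun_eq_iff)
 have mphi: "(%x. ph x ._N m)\<in>mh Q N" if "m\<in>N" "ph\<in>mh Q rg" for m ph and Q :: "('k, 'a) rmod"
  using homD[OF that(2)] that(1)
  by (intro homI) (auto simp: N.ract_closed N.ract_add_ring N.ract_mult)
 have 1: "h = ?Z" if E: "E0 P1 P0 f N" and h: "h\<in>Hom A N D" for h
 proof -
  have hm: "h\<in>mh N D" and he: "h\<in>extensional N" using h by (auto simp: Hom_iff)
  note hD = homD[OF hm]
  have hF: "functional K (us T) (h m)" "h m\<in>extensional T" if "m\<in>N" for m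
   using hD(1)[OF that] by (auto simp: Ds)
  note hf = hF(1)[unfolded functional_iff[OF field_K] us_simps]
  \<comment> \<open>The pairing attached to \<open>h\<close>. The functional \<open>xi\<close> that
    it induces on \<open>Hom(P1, N)\<close> vanishes on all maps that extend along \<open>f\<close>,
    hence on all maps, and so \<open>h\<close> is zero.\<close>
  define b where "b m ph = h m (c ph)" for m ph
  have "balanced P1 N b" unfolding balanced_def b_def
  proof (intro conjI ballI allI impI)
   fix m m' ph assume m: "m\<in>N" "ph\<in>mh P1 rg"
   show "h m (c ph)\<in>K" using hf[OF m(1)] cT[OF m(2)] by blast
   show "h (m +_N m') (c ph) = h m (c ph) +_K h m' (c ph)" if "m'\<in>N"
    using hD(2)[OF m(1) that] cT[OF m(2)] by (simp add: Ds)
   show "h (a ._N m) (c ph) = h m (c (%x. a *_A ph x))" if "a\<in>A" for a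
    using hD(3)[OF that m(1)] cT[OF m(2)] cs[OF that m(2)] by (simp add: Ds)
   show "h m (c (%x. ph x +_A ps x)) = h m (c ph) +_K h m (c ps)" if "ps\<in>mh P1 rg" for ps
    using hf[OF m(1)] cT m(2) that by (simp flip: ca)
  next
   fix m and ph ps :: "(nat \<Rightarrow> 'k) \<Rightarrow> 'a" assume "\<forall>x\<in>P1. ph x = ps x"
   thus "h m (c ph) = h m (c ps)" using cc[of ph ps] by simp
  qed
  then obtain xi where xi: "hom_functional P1 N b xi" using tensor_functional[OF P(1) N] by blast
  have 0: "h m I = 0_K" if "m\<in>N" for m
  proof -
   have "h m I +_K h m I = h m I" "h m I\<in>K" using hf[OF that] tf(6,7) by (metis, blast)
   thus ?thesis by simp
  qed
  have van: "xi (%x. g (f x)) = 0_K" if g: "g\<in>mh P0 N" for g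
  proof -
   have "g\<in>mh P0 N & xi (%x. g (f x)) = 0_K"
   proof (rule tensor_span[OF P(2) N _ _ _ g])
    fix g g' assume "!!x. x\<in>P0 ==> g x = g' x" "g\<in>mh P0 N & xi (%x. g (f x)) = 0_K"
    thus "g'\<in>mh P0 N & xi (%x. g' (f x)) = 0_K"
     using hom_functionalD(2)[OF xi, of "%x. g (f x)" "%x. g' (f x)"] hom_closed[OF f] hom_cong[of g A P0 N g'] r(2) by auto
   next
    fix g g' assume "g\<in>mh P0 N & xi (%x. g (f x)) = 0_K" "g'\<in>mh P0 N & xi (%x. g' (f x)) = 0_K"
    thus "(%x. g x +_N g' x)\<in>mh P0 N & xi (%x. g (f x) +_N g' (f x)) = 0_K"
     using hom_functionalD(3)[OF xi hom_comp[OF f] hom_comp[OF f], of g g'] hom_add[OF _ _ MC_rm[OF N], of g P0 g'] by simp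
   next
    fix m ph assume m: "m\<in>N" "ph\<in>mh P0 rg"
    have "xi (%x. ph (f x) ._N m) = h m I"
     using hom_functionalD(4)[OF xi m(1) hom_comp[OF f m(2)]] cI[OF m(2)] by (simp add: b_def)
    thus "(%x. ph x ._N m)\<in>mh P0 N & xi (%x. ph (f x) ._N m) = 0_K"
     using 0[OF m(1)] mphi[OF m] by simp
   qed
   thus ?thesis by simp
  qed
  have "h m = 0_D" if mN: "m\<in>N" for m
  proof -
   have "h m C = 0_K" if C: "C\<in>T" for C
   proof -
    obtain ph where p: "ph\<in>mh P1 rg" "C = c ph" using Tc[OF C] by blast
    obtain g where g: "g\<in>mh P0 N" "\<forall>x\<in>P1. g (f x) = ph x ._N m"
     using bspec[OF E[unfolded E0_def] mphi[OF mN p(1)]] by auto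
    have "h m C = xi (%x. ph x ._N m)" using hom_functionalD(4)[OF xi mN p(1)] by (simp add: b_def p)
    also have "\<dots> = xi (%x. g (f x))" by (rule hom_functionalD(2)[OF xi]) (simp add: g)
    finally show ?thesis using van[OF g(1)] by simp
   qed
   thus ?thesis using hF(2)[OF mN] unfolding Ds by (auto intro!: extensionalityI)
  qed
  thus ?thesis by (intro extensionalityI[OF he]) auto
 qed
 have 2: "E0 P1 P0 f N" if z: "Hom A N D = {?Z}"
 proof (rule ccontr)
  assume "~ E0 P1 P0 f N"
  then obtain g where g: "g\<in>mh P1 N" "!!h. h\<in>mh P0 N ==> \<exists>x\<in>P1. h (f x) ~= g x" unfolding E0_def by blast
  \<comment> \<open>A functional \<open>xi\<close> that vanishes on the extendable maps but not on
    \<open>g\<close> yields a map \<open>h\<close> with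
    \<open>h m (c ph) = xi (x \<mapsto> ph x ._N m)\<close>. By assumption \<open>h\<close> is zero;
    then \<open>xi\<close> vanishes on everything by \<open>tensor_span\<close>, a
    contradiction.\<close>
  define J where "J = (%h. \<lambda>x\<in>P1. h (f x)) ` mh P0 N"
  have Jr: "(\<lambda>x\<in>P1. h (f x))\<in>Hom A P1 N" if "h\<in>mh P0 N" for h
   by (rule restrict_Hom[OF hom_comp[OF f that] r(1)])
  have J: "subspace K J (hs P1 N)"
  proof (rule subspaceI[OF vs_hs[OF r(1) MC_rm[OF N]]])
   show "J <= carrier (hs P1 N)" using Jr by (auto simp: J_def)
   show "0_(hs P1 N)\<in>J" using hom_0[OF MC_rm[OF N], of P0] by (force simp: J_def)
   show "x +_(hs P1 N) y\<in>J" if xy: "x\<in>J" "y\<in>J" for x y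
   proof -
    obtain u v where uv: "u\<in>mh P0 N" "x = (\<lambda>x\<in>P1. u (f x))" "v\<in>mh P0 N" "y = (\<lambda>x\<in>P1. v (f x))"
     using xy by (auto simp: J_def)
    show ?thesis unfolding J_def by (rule image_eqI[OF _ hom_add[OF uv(1,3) MC_rm[OF N]]]) (auto simp: uv)
   qed
   show "k ._(hs P1 N) x\<in>J" if k: "k\<in>K" and x: "x\<in>J" for k x
   proof -
    obtain u where u: "u\<in>mh P0 N" "x = (\<lambda>x\<in>P1. u (f x))" using x by (auto simp: J_def)
    show ?thesis unfolding J_def by (rule image_eqI[OF _ module_hom_scale[OF u(1) MC_rm[OF N] k]]) (auto simp: u)
   qed
  qed
  have gJ: "restrict g P1 \<notin> J"
  proof
   assume "restrict g P1\<in>J"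
   then obtain h where "h\<in>mh P0 N" "restrict g P1 = (\<lambda>x\<in>P1. h (f x))" by (auto simp: J_def)
   thus False using g(2)[of h] by (metis restrict_apply')
  qed
  obtain xi where xi: "functional K (hs P1 N) xi" "!!s. s\<in>J ==> xi s = 0_K" "xi (restrict g P1) = 1_K"
   using functional_separate[OF fdvs_hs[OF m(1) N] J _ gJ] restrict_Hom[OF g(1) r(1)] by auto
  note xd = xi(1)[unfolded functional_iff[OF field_K] hs_simps, THEN conjunct1]
   xi(1)[unfolded functional_iff[OF field_K] hs_simps, THEN conjunct2, THEN conjunct1]
   xi(1)[unfolded functional_iff[OF field_K] hs_simps, THEN conjunct2, THEN conjunct2]
  define v where "v m ph = xi (\<lambda>x\<in>P1. ph x ._N m)" for m ph
  have mH: "(\<lambda>x\<in>P1. ph x ._N m)\<in>Hom A P1 N" if "m\<in>N" "ph\<in>mh P1 rg" for m ph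
   by (rule restrict_Hom[OF mphi[OF that] r(1)])
  have wd: "v m ph = v m ps" if mN: "m\<in>N" and p: "ph\<in>mh P1 rg" "ps\<in>mh P1 rg" and e: "c ph = c ps" for m ph ps
  proof -
   have "\<exists>i\<in>I. restrict ph P1 = i +_S restrict ps P1"
    by (rule co(3)[OF _ e[unfolded c_def]]) (use rH[OF p(1)] in \<open>simp add: S_def\<close>)
   then obtain i where i: "i\<in>I" "restrict ph P1 = i +_S restrict ps P1" by blast
   obtain ch where ch: "ch\<in>mh P0 rg" "i = compose (carrier P1) ch f" using i(1) by (auto simp: I_def Hom_iff)
   have phi: "ph x = ch (f x) +_A ps x" if "x\<in>P1" for x
    using fun_cong[OF i(2), of x] that by (simp add: S_def ch compose_def)
   have cl: "ch (f x)\<in>A" "ps x\<in>A" if "x\<in>P1" for x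
    using homD(1)[OF ch(1)] homD(1)[OF p(2) that] hom_closed[OF f that] by auto
   note jm = mphi[OF mN ch(1)]
   have eq: "(\<lambda>x\<in>P1. ph x ._N m) =
    (\<lambda>x\<in>P1. (\<lambda>x\<in>P1. ch (f x) ._N m) x +_N (\<lambda>x\<in>P1. ps x ._N m) x)"
    using phi cl mN by (auto simp: N.ract_add_ring fun_eq_iff)
   have "v m ph = xi (\<lambda>x\<in>P1. ch (f x) ._N m) +_K v m ps"
    unfolding v_def eq by (rule xd(2)[rule_format, OF Jr[OF jm] mH[OF mN p(2)]])
   moreover have "xi (\<lambda>x\<in>P1. ch (f x) ._N m) = 0_K" by (rule xi(2)) (use jm in \<open>auto simp: J_def\<close>)
   moreover have "v m ps\<in>K" unfolding v_def using xd(1) mH[OF mN p(2)] by blast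
   ultimately show ?thesis by simp
  qed
  define h where "h = (\<lambda>m\<in>N. \<lambda>C\<in>T. v m (SOME ph. ph\<in>mh P1 rg & C = c ph))"
  have hv: "h m (c ph) = v m ph" if "m\<in>N" "ph\<in>mh P1 rg" for m ph
  proof -
   let ?p = "SOME ps. ps\<in>mh P1 rg & c ph = c ps"
   have "?p\<in>mh P1 rg & c ph = c ?p" by (rule someI[of _ ph]) (use that in simp)
   thus ?thesis using wd[OF that(1), of ?p ph] that cT by (simp add: h_def)
  qed
  have vk: "v m ph\<in>K" if "m\<in>N" "ph\<in>mh P1 rg" for m ph
   unfolding v_def using xd(1) mH[OF that] by blast
  have ad: "v m (%x. ph x +_A ps x) = v m ph +_K v m ps" if "m\<in>N" "ph\<in>mh P1 rg" "ps\<in>mh P1 rg" for m ph ps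
  proof -
   have eq: "(\<lambda>x\<in>P1. (ph x +_A ps x) ._N m) =
    (\<lambda>x\<in>P1. (\<lambda>x\<in>P1. ph x ._N m) x +_N (\<lambda>x\<in>P1. ps x ._N m) x)"
    using that homD(1)[OF that(2)] homD(1)[OF that(3)] by (auto simp: N.ract_add_ring fun_eq_iff)
   show ?thesis unfolding v_def eq by (rule xd(2)[rule_format, OF mH[OF that(1,2)] mH[OF that(1,3)]])
  qed
  have am: "v (m +_N m') ph = v m ph +_K v m' ph" if "m\<in>N" "m'\<in>N" "ph\<in>mh P1 rg" for m m' ph
  proof -
   have eq: "(\<lambda>x\<in>P1. ph x ._N (m +_N m')) =
    (\<lambda>x\<in>P1. (\<lambda>x\<in>P1. ph x ._N m) x +_N (\<lambda>x\<in>P1. ph x ._N m') x)"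
    using that homD(1)[OF that(3)] by (auto simp: N.ract_add fun_eq_iff)
   show ?thesis unfolding v_def eq by (rule xd(2)[rule_format, OF mH[OF that(1,3)] mH[OF that(2,3)]])
  qed
  have ml: "v m (%x. a *_A ph x) = v (a ._N m) ph" if "a\<in>A" "m\<in>N" "ph\<in>mh P1 rg" for a m ph
   unfolding v_def using that homD(1)[OF that(3)]
   by (intro arg_cong[where f = xi]) (auto simp: N.ract_mult fun_eq_iff)
  have ks: "v m (%x. sc k *_A ph x) = k *_K v m ph" if "k\<in>K" "m\<in>N" "ph\<in>mh P1 rg" for k m ph
  proof -
   have cl: "ph x\<in>A" if "x\<in>P1" for x using homD(1)[OF \<open>ph \<in> mh P1 rg\<close> that] by simp
   have eq: "(\<lambda>x\<in>P1. (sc k *_A ph x) ._N m) = (\<lambda>x\<in>P1. sc k ._N (\<lambda>x\<in>P1. ph x ._N m) x)"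
    using cl that sc_facts(1,5,6) N.ract_mult[of _ "sc k" m] by (auto simp: fun_eq_iff)
   show ?thesis unfolding v_def eq by (rule xd(3)[rule_format, OF that(1) mH[OF that(2,3)]])
  qed
  have hD: "h m\<in>D" if mN: "m\<in>N" for m
   unfolding Ds
  proof (rule IntI, unfold functional_iff[OF field_K] us_simps, intro conjI ballI)
   fix C assume "C\<in>T"
   then obtain ph where ph: "ph\<in>mh P1 rg" "C = c ph" using Tc by blast
   show "h m C\<in>K" using hv vk mN ph by simp
   show "h m (C +_T C') = h m C +_K h m C'" if CT: "C'\<in>T" for C'
   proof -
    obtain ps where ps: "ps\<in>mh P1 rg" "C' = c ps" using Tc[OF CT] by blast
    show ?thesis using hv[OF mN hom_add[OF ph(1) ps(1) rm_regular]] hv[OF mN ph(1)] hv[OF mN ps(1)] ad[OF mN ph(1) ps(1)]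
     by (simp add: ph(2) ps(2) ca[OF ph(1) ps(1)])
   qed
   show "h m (sc k ._T C) = k *_K h m C" if "k\<in>K" for k
    using hv[OF mN mult_hom[OF sc_facts(1)[OF that] ph(1)]] hv[OF mN ph(1)] ks[OF that mN ph(1)]
    by (simp add: ph(2) cs[OF sc_facts(1)[OF that] ph(1)])
  next
   show "h m\<in>extensional T" using mN by (simp add: h_def)
  qed
  have "h\<in>Hom A N D" unfolding Hom_iff
  proof (intro conjI homI)
   show "h\<in>extensional N" by (simp add: h_def)
   show "h m\<in>D" if "m\<in>N" for m by (rule hD[OF that])
   show "h (m +_N m') = h m +_D h m'" if "m\<in>N" "m'\<in>N" for m m'
   proof (rule extensionalityI[of _ "carrier T"])
    fix C assume "C\<in>T"
    then obtain ph where ph: "ph\<in>mh P1 rg" "C = c ph" using Tc by blast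
    show "h (m +_N m') C = (h m +_D h m') C"
     using hv[OF _ ph(1)] am[OF that ph(1)] that cT[OF ph(1)] by (simp add: ph(2) Ds)
   qed (use that in \<open>auto simp: h_def Ds\<close>)
   show "h (a ._N m) = a ._D h m" if "a\<in>A" "m\<in>N" for a m
   proof (rule extensionalityI[of _ "carrier T"])
    fix C assume "C\<in>T"
    then obtain ph where ph: "ph\<in>mh P1 rg" "C = c ph" using Tc by blast
    show "h (a ._N m) C = (a ._D h m) C"
     using hv[OF N.ract_closed[OF that] ph(1)] hv[OF that(2) mult_hom[OF that(1) ph(1)]] ml[OF that ph(1)] cT[OF ph(1)]
     by (simp add: ph(2) Ds cs[OF that(1) ph(1)])
   qed (use that N.ract_closed in \<open>auto simp: h_def Ds\<close>)
  qed
  hence hz: "h = ?Z" using z by blast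
  have v0: "v m ph = 0_K" if "m\<in>N" "ph\<in>mh P1 rg" for m ph
   using hv[OF that] cT[OF that(2)] that by (simp add: hz Ds)
  have "g\<in>mh P1 N & xi (restrict g P1) = 0_K"
  proof (rule tensor_span[OF P(1) N _ _ _ g(1)])
   fix g g' assume a: "!!x. x\<in>P1 ==> g x = g' x" "g\<in>mh P1 N & xi (restrict g P1) = 0_K"
   hence "restrict g P1 = restrict g' P1" by auto
   thus "g'\<in>mh P1 N & xi (restrict g' P1) = 0_K" using a hom_cong[of g A P1 N g'] r(1) by auto
  next
   fix g g' assume a: "g\<in>mh P1 N & xi (restrict g P1) = 0_K" "g'\<in>mh P1 N & xi (restrict g' P1) = 0_K"
   have "xi (\<lambda>x\<in>P1. restrict g P1 x +_N restrict g' P1 x) = 0_K"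
    using xd(2)[rule_format, OF restrict_Hom[OF _ r(1)] restrict_Hom[OF _ r(1)], of g g'] a by simp
   thus "(%x. g x +_N g' x)\<in>mh P1 N & xi (\<lambda>x\<in>P1. g x +_N g' x) = 0_K"
    using hom_add[OF _ _ MC_rm[OF N], of g P1 g'] a by (simp cong: restrict_cong)
  next
   fix m ph assume "m\<in>N" "ph\<in>mh P1 rg"
   thus "(%x. ph x ._N m)\<in>mh P1 N & xi (\<lambda>x\<in>P1. ph x ._N m) = 0_K"
    using v0 mphi by (simp add: v_def)
  qed
  thus False using xi(3) by simp
 qed
 show ?thesis unfolding Hom_zero_def T_def[symmetric] D_def[symmetric]
  using 1 2 Z by blast
qed

lemma AR_zero: "M\<in>MC ==> N\<in>MC ==> Hom_zero A N (AR_translate K A M) <-> Ez M N"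
 unfolding AR_translate_mp Ez_def
 by (erule mp_min, rule hom_dual_transpose_zero) (auto dest: presD(1,2,4))

end

section \<open>Ext and projective dimension\<close>

context fdalg begin

text \<open>Vanishing of cohomology at \<open>P1\<close>. By exactness the cocycles are the maps
  that vanish on the kernel of \<open>f\<close>, so two terms of a resolution suffice.\<close>

definition ext_zero where
 "ext_zero P1 P0 f N <-> (\<forall>g\<in>mh P1 N. (\<forall>x\<in>P1. f x = 0_P0 --> g x = 0_N) -->
   (\<exists>h\<in>mh P0 N. \<forall>x\<in>P1. h (f x) = g x))"

text \<open>\<open>\<alpha>\<close> and \<open>\<beta>\<close> lift the identity of
  \<open>M\<close>, and \<open>s\<close> is a homotopy from their composite to the identity. A
  cocycle \<open>g\<close> is pulled back along \<open>\<alpha>1\<close>, extended there,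
  transported back by \<open>\<beta>\<close>, and corrected by the composite of \<open>s\<close> and
  \<open>g\<close>.\<close>

lemma ext_zero_compare:
 assumes p: "pres P1 P0 f e M" and q: "pres Q1 Q0 d c M" and N: "N\<in>MC" and z: "ext_zero P1 P0 f N"
 shows "ext_zero Q1 Q0 d N"
 unfolding ext_zero_def
proof (intro ballI impI)
 fix g assume g: "g\<in>mh Q1 N" and gz: "\<forall>x\<in>Q1. d x = 0_Q0 --> g x = 0_N"
 note D = presD[OF p] and D' = presD[OF q]
 obtain \<alpha> where a: "\<alpha>\<in>mh P0 Q0" "!!x. x\<in>P0 ==> c (\<alpha> x) = e x"
  by (rule pj_lift[OF D(2) D'(9) D(3) D'(5) D(5)]) (use D'(6) hom_closed[OF D(5)] in auto)
 obtain \<beta> where b: "\<beta>\<in>mh Q0 P0" "!!x. x\<in>Q0 ==> e (\<beta> x) = c x"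
  by (rule pj_lift[OF D'(2) D(9) D(3) D(5) D'(5)]) (use D(6) hom_closed[OF D'(5)] in auto)
 note ac = hom_closed[OF a(1)] and bc = hom_closed[OF b(1)] and fc = hom_closed[OF D(4)] and dc = hom_closed[OF D'(4)]
 have i1: "\<alpha> (f x)\<in>d ` Q1" if "x\<in>P1" for x
  using D'(7)[OF ac[OF fc[OF that]]] D(10)[OF that] a(2)[OF fc[OF that]] by simp
 have i2: "\<beta> (d x)\<in>f ` P1" if "x\<in>Q1" for x
  using D(7)[OF bc[OF dc[OF that]]] D'(10)[OF that] b(2)[OF dc[OF that]] by simp
 obtain \<alpha>1 where a1: "\<alpha>1\<in>mh P1 Q1" "!!x. x\<in>P1 ==> d (\<alpha>1 x) = \<alpha> (f x)"
  by (rule pj_lift[OF D(1) D'(8,9,4) hom_comp[OF D(4) a(1)] i1]) blast+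
 obtain \<beta>1 where b1: "\<beta>1\<in>mh Q1 P1" "!!x. x\<in>Q1 ==> f (\<beta>1 x) = \<beta> (d x)"
  by (rule pj_lift[OF D'(1) D(8,9,4) hom_comp[OF D'(4) b(1)] i2]) blast+
 have mh: "(%x. x -_Q0 \<alpha> (\<beta> x))\<in>mh Q0 Q0"
  by (rule hom_diff[OF hom_id hom_comp[OF b(1) a(1)] MC_rm[OF D'(9)]])
 have i3: "y -_Q0 \<alpha> (\<beta> y)\<in>d ` Q1" if y: "y\<in>Q0" for y
 proof -
  have "c (y -_Q0 \<alpha> (\<beta> y)) = 0_M"
   using y a(2) b(2) ac bc hom_closed[OF D'(5)] D(3) by (simp add: hom_minus[OF D'(5,9) D(3)])
  thus ?thesis using D'(7) y ac bc D'(9) by auto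
 qed
 obtain s where s: "s\<in>mh Q0 Q1" "!!x. x\<in>Q0 ==> d (s x) = x -_Q0 \<alpha> (\<beta> x)"
  by (rule pj_lift[OF D'(2,8,9,4) mh i3]) blast+
 have "(%x. g (\<alpha>1 x))\<in>mh P1 N" by (rule hom_comp[OF a1(1) g])
 moreover have "g (\<alpha>1 x) = 0_N" if "x\<in>P1" "f x = 0_P0" for x
  using gz a1 that hom_closed[OF a1(1)] hom_zero[OF a(1) D(9) D'(9)] by simp
 ultimately obtain h where h: "h\<in>mh P0 N" "!!x. x\<in>P1 ==> h (f x) = g (\<alpha>1 x)"
  using z unfolding ext_zero_def by metis
 have k: "(%x. h (\<beta> x) +_N g (s x))\<in>mh Q0 N"
  by (rule hom_add[OF hom_comp[OF b(1) h(1)] hom_comp[OF s(1) g] MC_rm[OF N]])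
 have "h (\<beta> (d x)) +_N g (s (d x)) = g x" if x: "x\<in>Q1" for x
 proof -
  have c1: "\<beta>1 x\<in>P1" "\<alpha>1 (\<beta>1 x)\<in>Q1" "s (d x)\<in>Q1"
   using hom_closed[OF b1(1) x] hom_closed[OF a1(1)] hom_closed[OF s(1)] dc[OF x] by auto
  have "d ((\<alpha>1 (\<beta>1 x) +_Q1 s (d x)) -_Q1 x) = 0_Q0"
   using c1 x a1(2) b1(2) s(2) dc ac bc D'(8,9) by (simp add: hom_minus[OF D'(4,8,9)] homD(2)[OF D'(4)])
  hence "g ((\<alpha>1 (\<beta>1 x) +_Q1 s (d x)) -_Q1 x) = 0_N"
   using gz c1 x D'(8) by simp
  hence "g (\<alpha>1 (\<beta>1 x)) +_N g (s (d x)) = g x"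
   using c1 x D'(8) N hom_closed[OF g] by (simp add: hom_minus[OF g D'(8) N] homD(2)[OF g])
  thus ?thesis using h(2)[OF c1(1)] b1(2)[OF x] by simp
 qed
 thus "\<exists>h\<in>mh Q0 N. \<forall>x\<in>Q1. h (d x) = g x" by (intro bexI[OF _ k]) auto
qed

text \<open>The syzygies \<open>Z n\<close> are obtained by iterating kernels of chosen surjections
  from projectives. Existence makes the choice in \<open>chosen_resolution\<close> an actual
  resolution.\<close>

lemma resolution_exists:
 assumes M: "M\<in>MC"
 obtains P d e where "proj_resolution K A M P d e"
proof -
 define cov where "cov L = (SOME (P, e). pj P & e\<in>mh P L & e ` P = carrier L)" for L :: "('k, 'a) rmod"
 have cov: "pj (fst (cov L)) & snd (cov L)\<in>mh (fst (cov L)) L & snd (cov L) ` carrier (fst (cov L)) = carrier L"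
  if L: "L\<in>MC" for L
 proof -
  have "\<exists>z. case z of (P, e) \<Rightarrow> pj P & e\<in>mh P L & e ` P = carrier L"
   by (rule enough_projectives[OF L]) auto
  from someI_ex[OF this] show ?thesis unfolding cov_def[symmetric] by (simp add: case_prod_beta)
 qed
 define ker where "ker L = (fst (cov L))(|carrier:=a_kernel (fst (cov L)) L (snd (cov L))|)" for L
 have kerM: "ker L\<in>MC" if L: "L\<in>MC" for L
  unfolding ker_def by (rule sbmD(6)) (use cov[OF L] sbm_kernel[of "snd (cov L)" "fst (cov L)" L] L in \<open>auto simp: a_kernel_def'\<close>)
 define Z where "Z n = (ker ^^ n) M" for n
 have Z: "Z n\<in>MC" for n by (induction n) (auto simp: Z_def M kerM)
 have Z0: "Z 0 = M" by (simp add: Z_def)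
 have ZS: "Z (Suc n) = ker (Z n)" for n by (simp add: Z_def)
 define P where "P n = fst (cov (Z n))" for n
 define c where "c n = snd (cov (Z n))" for n
 have P: "pj (P n)" "c n\<in>mh (P n) (Z n)" "c n ` carrier (P n) = carrier (Z n)" for n
  using cov[OF Z[of n]] by (auto simp: P_def c_def)
 have ZP: "Z (Suc n) = (P n)(|carrier:=a_kernel (P n) (Z n) (c n)|)" for n by (simp add: ZS ker_def P_def c_def)
 have im: "c (Suc n) ` carrier (P (Suc n)) = a_kernel (P n) (Z n) (c n)" for n using P(3)[of "Suc n"] by (simp add: ZP)
 have hm: "c (Suc n)\<in>mh (P (Suc n)) (P n)" for n
  using P(2)[of "Suc n"] unfolding ZP module_hom_def by (auto simp: a_kernel_iff Pi_iff)
 have "a_kernel (P (Suc n)) (P n) (c (Suc n)) = a_kernel (P (Suc n)) (Z (Suc n)) (c (Suc n))" for n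
  unfolding set_eq_iff a_kernel_iff by (simp add: ZP)
 hence "proj_resolution K A M P (%n. c (Suc n)) (c 0)"
  using P(1) hm im P(2,3)[of 0, unfolded Z0] im[of 0, unfolded Z0] by (simp add: proj_resolution_def)
 thus ?thesis by (rule that)
qed

lemma resolution_pres:
 assumes M: "M\<in>MC" and r: "proj_resolution K A M P d e"
 shows "pres (P 1) (P 0) (d 0) e M"
 using assms unfolding proj_resolution_def pres_def by (auto simp: set_eq_iff a_kernel_iff)

lemma ext_zero_trivial:
 assumes M: "M\<in>MC" and N: "N\<in>MC"
 shows "\<exists>P1 P0 f e. pres P1 P0 f e M & (trivial_group (Ext K A 1 M N) <-> ext_zero P1 P0 f N)"
proof -
 obtain P d where c: "chosen_resolution K A M = (P, d)" by force
 have "\<exists>z. case z of (P, d) \<Rightarrow> \<exists>e. proj_resolution K A M P d e"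
  by (rule resolution_exists[OF M]) auto
 from someI_ex[OF this] obtain e where r: "proj_resolution K A M P d e"
  unfolding chosen_resolution_def[symmetric] c by auto
 define P1 P0 f0 Z B where "P1 = P 1" and "P0 = P 0" and "f0 = d 0"
  and "Z = cocycles A P d N 1" and "B = coboundaries A P d N 1"
 note defs = this
 note p = resolution_pres[OF M r, folded defs] note D = presD[OF p]
 have e1: "d 1 ` carrier (P 2) = a_kernel P1 P0 f0"
  using r unfolding proj_resolution_def defs by (auto simp: numeral_2_eq_2)
 have r1: "rm P1" and r0: "rm P0" and rN: "rm N" using D N by auto
 define G where "G = (Hom_group A P1 N)(|carrier:=Z|)"
 have E: "Ext K A 1 M N = G A_Mod B" by (simp add: Ext_def c G_def defs)
 have Zc: "f\<in>Z <-> f\<in>Hom A P1 N & (\<forall>x\<in>P1. f0 x = 0_P0 --> f x = 0_N)" for f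
 proof -
  have "f\<in>Z <-> f\<in>Hom A P1 N & (\<forall>x\<in>d 1 ` carrier (P 2). f x = 0_N)"
   by (auto simp: defs cocycles_def numeral_2_eq_2)
  thus ?thesis unfolding e1 by (auto simp: a_kernel_iff)
 qed
 interpret V: vectorspace K "hs P1 N" by (rule vs_hs[OF r1 rN])
 have Gs: "carrier G = Z" "0_G = 0_(hs P1 N)" "f +_G g = f +_(hs P1 N) g" for f g
  by (simp_all add: G_def Hom_group_def)
 have hc: "f x\<in>N" if "f\<in>Hom A P1 N" "x\<in>P1" for f x
  using hom_closed[of f P1 N x] that by (simp add: Hom_iff)
 interpret N: right_module A N by (rule rN)
 have neg: "(\<lambda>x\<in>P1. -_N f x)\<in>Hom A P1 N" "(\<lambda>x\<in>P1. -_N f x) +_(hs P1 N) f = 0_(hs P1 N)"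
  if f: "f\<in>Hom A P1 N" for f
 proof -
  have "(%x. 0_N -_N f x)\<in>mh P1 N"
   by (rule hom_diff[OF hom_0[OF rN] _ rN]) (use f in \<open>simp add: Hom_iff\<close>)
  hence "(%x. -_N f x)\<in>mh P1 N"
   by (rule hom_cong[OF _ r1]) (use hc[OF f] in \<open>simp add: N.M.minus_eq\<close>)
  thus "(\<lambda>x\<in>P1. -_N f x)\<in>Hom A P1 N" using r1 by (rule restrict_Hom)
  show "(\<lambda>x\<in>P1. -_N f x) +_(hs P1 N) f = 0_(hs P1 N)"
   using hc[OF f] by (auto simp: fun_eq_iff N.M.l_neg)
 qed
 have G: "abelian_group G"
 proof (rule abelian_groupI, unfold Gs)
  show "x +_(hs P1 N) y\<in>Z" if "x\<in>Z" "y\<in>Z" for x y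
   using V.a_closed[of x y] that by (auto simp: Zc)
  show "0_(hs P1 N)\<in>Z" using V.zero_closed by (auto simp: Zc)
  show "\<exists>y\<in>Z. y +_(hs P1 N) x = 0_(hs P1 N)" if "x\<in>Z" for x
   using neg[of x] that by (intro bexI[of _ "\<lambda>y\<in>P1. -_N x y"]) (auto simp: Zc)
 qed (use V.a_assoc V.a_comm V.l_zero in \<open>auto simp: Zc\<close>)
 interpret G: abelian_group G by (rule G)
 have Bi: "B = (%f. compose (carrier P1) f f0) ` Hom A P0 N" by (simp add: defs)
 have BH: "compose (carrier P1) f f0\<in>Z" if "f\<in>Hom A P0 N" for f
  using restrict_Hom[OF hom_comp[OF D(4)] r1, of f N] that hom_zero[of f "P0" N] D(9) N
  unfolding Zc by (auto simp: Hom_iff compose_def)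
 have B: "additive_subgroup B G"
 proof (rule G.add.subgroupI[folded additive_subgroup_def, simplified])
  interpret V0: vectorspace K "hs P0 N" by (rule vs_hs[OF r0 rN])
  show "B <= carrier G" using BH by (auto simp: Bi Gs)
  show "B ~= {}" using V0.zero_closed by (auto simp: Bi)
  show "x +_G y\<in>B" if xy: "x\<in>B" "y\<in>B" for x y
  proof -
   obtain f g where fg: "f\<in>Hom A P0 N" "x = compose (carrier P1) f f0" "g\<in>Hom A P0 N" "y = compose (carrier P1) g f0"
    using xy by (auto simp: Bi)
   have "x +_G y = compose (carrier P1) (f +_(hs P0 N) g) f0"
    using hom_closed[OF D(4)] by (auto simp: Gs fg compose_def fun_eq_iff)
   thus ?thesis using V0.a_closed[of f g] fg by (auto simp: Bi)
  qed
  show "-_G x\<in>B" if x: "x\<in>B" for x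
  proof -
   obtain f where f: "f\<in>Hom A P0 N" "x = compose (carrier P1) f f0" using x by (auto simp: Bi)
   let ?g = "%x. 0_N -_N f x"
   have fm: "f\<in>mh P0 N" using f by (simp add: Hom_iff)
   have g: "restrict ?g P0\<in>Hom A P0 N"
    by (rule restrict_Hom[OF hom_diff[OF hom_0[OF rN] fm rN] r0])
   let ?y = "compose (carrier P1) (restrict ?g P0) f0"
   have "?y +_G x = 0_G"
    using hom_closed[OF D(4)] hom_closed[OF fm] N by (auto simp: Gs f compose_def fun_eq_iff)
   hence "-_G x = ?y" using BH[OF g] BH[OF f(1)] by (intro G.minus_equality) (auto simp: Gs f)
   thus ?thesis using g by (auto simp: Bi)
  qed
 qed
 note co = additive_coset[OF G B]
 have cE: "carrier (Ext K A 1 M N) = (%x. B +>\<^bsub>G\<^esub> x) ` G" "1_(Ext K A 1 M N) = B"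
  unfolding E co(4)[symmetric] by (simp_all add: A_FactGroup_def FactGroup_def A_RCOSETS_def)
 have gr: "group (Ext K A 1 M N)" unfolding E by (rule abelian_subgroup.a_factorgroup_is_group[OF abelian_subgroupI3[OF B G]])
 have B0: "0_G\<in>B" using additive_subgroup.zero_closed[OF B] .
 have "trivial_group (Ext K A 1 M N) <-> carrier G <= B"
 proof
  assume t: "trivial_group (Ext K A 1 M N)"
  show "carrier G <= B"
  proof
   fix x assume x: "x\<in>G"
   hence "B +>\<^bsub>G\<^esub> x = B" using t cE by (auto simp: trivial_group_def)
   also have "\<dots> = B +>\<^bsub>G\<^esub> 0_G" using co(2)[OF B0] by simp
   finally obtain i where i: "i\<in>B" "x = i +_G 0_G" using co(3)[OF x] by blast
   thus "x\<in>B" using additive_subgroup.a_subset[OF B] by auto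
  qed
 next
  assume "carrier G <= B"
  thus "trivial_group (Ext K A 1 M N)" using gr co(2) B0 G.zero_closed cE unfolding trivial_group_def by auto
 qed
 also have "\<dots> <-> ext_zero P1 P0 f0 N"
 proof
  assume s: "carrier G <= B"
  show "ext_zero P1 P0 f0 N" unfolding ext_zero_def
  proof (intro ballI impI)
   fix g assume g: "g\<in>mh P1 N" "\<forall>x\<in>P1. f0 x = 0_P0 --> g x = 0_N"
   have "restrict g P1\<in>G" using restrict_Hom[OF g(1) r1] g(2) by (simp add: Gs Zc)
   then obtain f where f: "f\<in>Hom A P0 N" "restrict g P1 = compose (carrier P1) f f0"
    using s by (auto simp: Bi)
   have "f (f0 x) = g x" if "x\<in>P1" for x using fun_cong[OF f(2), of x] that by (simp add: compose_def)
   thus "\<exists>h\<in>mh P0 N. \<forall>x\<in>P1. h (f0 x) = g x" using f(1) by (auto simp: Hom_iff)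
  qed
 next
  assume z: "ext_zero P1 P0 f0 N"
  show "carrier G <= B"
  proof
   fix g assume "g\<in>G"
   hence g: "g\<in>mh P1 N" "g\<in>extensional P1" "\<forall>x\<in>P1. f0 x = 0_P0 --> g x = 0_N"
    by (auto simp: Gs Zc Hom_iff)
   then obtain h where h: "h\<in>mh P0 N" "\<forall>x\<in>P1. h (f0 x) = g x" using z unfolding ext_zero_def by blast
   have "g = compose (carrier P1) (restrict h P0) f0"
    using h(2) hom_closed[OF D(4)] by (intro extensionalityI[OF g(2)]) (auto simp: compose_def)
   thus "g\<in>B" using restrict_Hom[OF h(1) r0] by (auto simp: Bi)
  qed
 qed
 finally show ?thesis using p by blast
qed

text \<open>If the minimal presentation is injective, every map from its first term is a cocycle,
  and vanishing cohomology becomes \<open>E0\<close>. The change of resolution is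
  \<open>ext_zero_compare\<close>.\<close>

lemma Ext_trivial_iff:
 assumes M: "M\<in>MC" and N: "N\<in>MC" and pd: "pd1 M"
 shows "trivial_group (Ext K A 1 M N) <-> Ez M N"
proof -
 obtain P1 P0 f e where p: "pres P1 P0 f e M" "trivial_group (Ext K A 1 M N) <-> ext_zero P1 P0 f N"
  using ext_zero_trivial[OF M N] by auto
 obtain g where q: "pres (mp1 M) (mp0 M) (mpf M) g M" using mp_min[OF M] by blast
 note D = presD[OF q]
 have "ext_zero (mp1 M) (mp0 M) (mpf M) N <-> Ez M N"
 proof -
  have 0: "h x = 0_N" if "h\<in>mh (mp1 M) N" "x\<in>carrier (mp1 M)" "mpf M x = 0_(mp0 M)" for h x
  proof -
   have "x = 0_(mp1 M)"
    using hom_more(7)[OF D(4) MC_rm[OF D(8)] MC_rm[OF D(9)]] pd that by (auto simp: pd1_def)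
   thus ?thesis using hom_zero[OF that(1) D(8) N] by simp
  qed
  have "(\<forall>x\<in>carrier (mp1 M). mpf M x = 0_(mp0 M) --> g x = 0_N)" if "g\<in>mh (mp1 M) N" for g
   using 0[OF that] by blast
  thus ?thesis unfolding ext_zero_def Ez_def E0_def by (simp cong: ball_cong)
 qed
 thus ?thesis using ext_zero_compare[OF p(1) q N] ext_zero_compare[OF q p(1) N] p(2) by blast
qed

text \<open>A resolution of length at most 1 has an injective first differential, and injectivity
  passes to the minimal presentation. Conversely, an injective minimal presentation is continued by
  zero modules.\<close>

lemma proj_dim_le_1_iff:
 assumes M: "M\<in>MC"
 shows "proj_dim K A M <= 1 <-> pd1 M"
proof
 define S where "S = {enat n | n. \<exists>P d e. proj_resolution K A M P d e & (\<forall>i>n. zero_module (P i))}"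
 have pdS: "proj_dim K A M = Inf S" by (simp add: proj_dim_def S_def)
 assume le: "proj_dim K A M <= 1"
 \<comment> \<open>The infimum of the empty set is infinite; otherwise the infimum is
   attained.\<close>
 have "S ~= {}"
 proof
  assume "S = {}" thus False using le by (simp add: pdS Inf_enat_def one_enat_def)
 qed
 hence "Inf S\<in>S" using wellorder_InfI[of _ S] by blast
 then obtain n P d e where n: "Inf S = enat n" "proj_resolution K A M P d e" "\<forall>i>n. zero_module (P i)" by (auto simp: S_def)
 have "n <= 1" using le n(1) by (simp add: pdS one_enat_def)
 hence z: "zero_module (P 2)" using n(3) by simp
 note p = resolution_pres[OF M n(2)] note D = presD[OF p]
 have P2: "pj (P 2)" and d1: "d 1\<in>mh (P 2) (P 1)" and e1: "d 1 ` carrier (P 2) = a_kernel (P 1) (P 0) (d 0)"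
  using n(2) unfolding proj_resolution_def by (auto simp: numeral_2_eq_2)
 have "x = 0_(P 1)" if "x\<in>carrier (P 1)" "d 0 x = 0_(P 0)" for x
 proof -
  have "x\<in>d 1 ` carrier (P 2)" unfolding e1 using that by (simp add: a_kernel_iff)
  thus ?thesis using z hom_zero[OF d1 pj_MC[OF P2] D(8)] by (auto simp: zero_module_def)
 qed
 hence "inj_on (d 0) (carrier (P 1))" using hom_more(7)[OF D(4) MC_rm[OF D(8)] MC_rm[OF D(9)]] by blast
 thus "pd1 M" by (rule compare_E0(2)[OF p M sd_refl])
next
 assume pd: "pd1 M"
 obtain e where p: "pres (mp1 M) (mp0 M) (mpf M) e M" using mp_min[OF M] by blast
 note D = presD[OF p]
 define P where "P = case_nat (mp0 M) (case_nat (mp1 M) (%_. zmod))"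
 define d where "d = case_nat (mpf M) (%n _. 0_(P (Suc n)))"
 have Pz [simp]: "P 0 = mp0 M" "P (Suc 0) = mp1 M" "P (Suc (Suc n)) = zmod" for n by (auto simp: P_def)
 have dz [simp]: "d 0 = mpf M" "d (Suc n) = (%_. 0_(P (Suc n)))" for n by (auto simp: d_def)
 have PM: "pj (P n)" for n using D(1,2) pj_zero[OF MC_zmod zero_zmod] by (cases n rule: nat.exhaust; cases "n - 1") auto
 have k0: "a_kernel (mp1 M) (mp0 M) (mpf M) = {0_(mp1 M)}"
  using hom_more(7)[OF D(4) MC_rm[OF D(8)] MC_rm[OF D(9)]] pd hom_zero[OF D(4,8,9)] D(8)
  by (auto simp: pd1_def a_kernel_iff set_eq_iff)
 have "d (Suc n) ` carrier (P (Suc (Suc n))) = a_kernel (P (Suc n)) (P n) (d n)" for n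
  using k0 by (cases n) (auto simp: a_kernel_iff set_eq_iff image_iff)
 moreover have "d n\<in>mh (P (Suc n)) (P n)" for n
  using D(4) hom_0[OF MC_rm[OF pj_MC[OF PM]], where M = "P (Suc n)"] by (cases n) auto
 moreover have k: "mpf M ` carrier (mp1 M) = a_kernel (mp0 M) M e"
  using D(7,10) hom_closed[OF D(4)] by (auto simp: a_kernel_iff)
 ultimately have "proj_resolution K A M P d e"
  using PM D(5,6) k by (simp add: proj_resolution_def)
 moreover have "zero_module (P i)" if "i > 1" for i
  using that zero_zmod by (cases i; cases "i - 1") auto
 ultimately have "enat 1\<in>{enat n | n. \<exists>P d e. proj_resolution K A M P d e & (\<forall>i>n. zero_module (P i))}" by blast
 thus "proj_dim K A M <= 1" unfolding proj_dim_def one_enat_def by (rule Inf_lower)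
qed

lemma Hom_zero_iff:
 assumes "P\<in>MC" "M\<in>MC" shows "Hom_zero A P M <-> homz P M"
proof -
 have "restrict h P = (\<lambda>x\<in>P. 0_M) <-> (\<forall>x\<in>P. h x = 0_M)" for h
  by (auto simp: fun_eq_iff)
 moreover have "Hom A P M = (%h. restrict h P) ` mh P M"
 proof (intro equalityI subsetI)
  fix h assume "h\<in>Hom A P M"
  thus "h\<in>(%h. restrict h P) ` mh P M"
   by (intro image_eqI[of _ _ h]) (auto simp: Hom_iff extensional_restrict)
 qed (use restrict_Hom[OF _ MC_rm[OF assms(1)], of _ M] in auto)
 moreover have "(%x. 0_M)\<in>mh P M" by (rule hom_0[OF MC_rm[OF assms(2)]])
 ultimately show ?thesis unfolding Hom_zero_def homz_def by auto
qed

end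

section \<open>Basic modules\<close>

context fdalg begin

lemma bsum_iso:
 assumes "mod_iso A M M'" "mod_iso A N N'"
 shows "mod_iso A (M [+] N) (M' [+] N')"
proof -
 obtain f g where f: "f\<in>mh M M'" "isoM M M' f" and g: "g\<in>mh N N'" "isoM N N' g"
  using assms unfolding mod_iso_def by blast
 have "(%z. jn (f (pr1 z)) (g (pr2 z)))\<in>mh (M [+] N) (M' [+] N')"
  using homD[OF f(1)] homD[OF g(1)] by (auto intro!: homI)
 moreover have "isoM (M [+] N) (M' [+] N') (%z. jn (f (pr1 z)) (g (pr2 z)))"
 proof (rule bij_betw_byWitness[where f' = "%z. jn (inv_into (carrier M) f (pr1 z)) (inv_into (carrier N) g (pr2 z))"])
  show "\<forall>z\<in>(M [+] N). jn (inv_into (carrier M) f (pr1 (jn (f (pr1 z)) (g (pr2 z))))) (inv_into (carrier N) g (pr2 (jn (f (pr1 z)) (g (pr2 z))))) = z"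
   using bij_betw_inv_into_left[OF f(2)] bij_betw_inv_into_left[OF g(2)] by simp
  show "\<forall>z\<in>(M' [+] N'). jn (f (pr1 (jn (inv_into (carrier M) f (pr1 z)) (inv_into (carrier N) g (pr2 z)))))
    (g (pr2 (jn (inv_into (carrier M) f (pr1 z)) (inv_into (carrier N) g (pr2 z))))) = z"
   using bij_betw_inv_into_right[OF f(2)] bij_betw_inv_into_right[OF g(2)] by simp
 qed (use bij_betwE[OF f(2)] bij_betwE[OF g(2)] bij_betwE[OF bij_betw_inv_into[OF f(2)]] bij_betwE[OF bij_betw_inv_into[OF g(2)]] in auto)
 ultimately show ?thesis unfolding mod_iso_def by blast
qed

lemma bsum_swap:
 assumes "U\<in>MC" "V\<in>MC" "L\<in>MC"
 shows "mod_iso A (U [+] (V [+] L)) (V [+] (U [+] L))"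
 unfolding mod_iso_def
proof
 show "(%z. jn (pr1 (pr2 z)) (jn (pr1 z) (pr2 (pr2 z))))\<in>mh (U [+] (V [+] L)) (V [+] (U [+] L))"
  by (auto intro!: homI)
 show "isoM (U [+] (V [+] L)) (V [+] (U [+] L)) (%z. jn (pr1 (pr2 z)) (jn (pr1 z) (pr2 (pr2 z))))"
  by (rule bij_betw_byWitness[where f' = "%z. jn (pr1 (pr2 z)) (jn (pr1 z) (pr2 (pr2 z)))"]) auto
qed

lemma sd_bsum_left: "U\<in>MC ==> N\<in>MC ==> sd U (U [+] N)" "U\<in>MC ==> N\<in>MC ==> sd N (U [+] N)"
 using bip_sd[OF bip_bsum] by blast+

text \<open>Cancellation of an indecomposable summand: adding a suitable \<open>y \<circ> p2\<close> to \<open>p1\<close> makes its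
 restriction to the other copy of \<open>U\<close> invertible, since \<open>End U\<close> is local.\<close>

lemma cancel_inj:
 assumes "ind U" and m: "T\<in>MC" "N\<in>MC" "N'\<in>MC"
  and b: "bip T U N i1 i2 p1 p2" "bip T U N' j1 j2 q1 q2"
 obtains h where "h\<in>mh N N'" "inj_on h N"
proof -
 have U: "U\<in>MC" using assms(1) by (rule indD(1))
 have h: "i1\<in>mh U T" "i2\<in>mh N T" "p1\<in>mh T U" "p2\<in>mh T N" "j1\<in>mh U T" "j2\<in>mh N' T" "q1\<in>mh T U" "q2\<in>mh T N'"
  using b by (auto simp: bip_def)
 have e: "!!x. x\<in>U ==> p1 (i1 x) = x" "!!x. x\<in>U ==> p2 (i1 x) = 0_N"
  "!!y. y\<in>N ==> p2 (i2 y) = y" "!!y. y\<in>N ==> p1 (i2 y) = 0_U"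
  "!!z. z\<in>T ==> i1 (p1 z) +_T i2 (p2 z) = z"
  "!!x. x\<in>U ==> q1 (j1 x) = x" "!!z. z\<in>T ==> j1 (q1 z) +_T j2 (q2 z) = z"
  using b unfolding bip_def by auto
 note c = hom_closed[OF h(1)] hom_closed[OF h(2)] hom_closed[OF h(3)] hom_closed[OF h(4)]
  hom_closed[OF h(5)] hom_closed[OF h(6)] hom_closed[OF h(7)] hom_closed[OF h(8)]
 let ?a = "%x. p1 (j1 x)" and ?b = "%x. q1 (i2 (p2 (j1 x)))"
 have ha: "?a\<in>mh U U" by (rule hom_comp[OF h(5,3)])
 have hy: "(%n. q1 (i2 n))\<in>mh N U" by (rule hom_comp[OF h(2,7)])
 have hb: "?b\<in>mh U U" by (rule hom_comp[OF hom_comp[OF h(5,4)] hy])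
 obtain y where y: "y\<in>mh N U" "isoM U U (%x. p1 (j1 x) +_U y (p2 (j1 x)))"
 proof (cases "isoM U U ?a")
  case True
  have "isoM U U (%x. p1 (j1 x) +_U 0_U)"
   using True bij_betw_cong[of "carrier U" ?a "%x. p1 (j1 x) +_U 0_U"] c U by simp
  thus ?thesis using that[of "%_. 0_U"] hom_0[OF MC_rm[OF U]] by blast
 next
  \<comment> \<open>The identity of \<open>U\<close>, as the composite of \<open>j1\<close> and
    \<open>q1\<close>, is the sum of a part through \<open>p1 j1\<close> and the part
    \<open>?b\<close>. The first is not invertible, so \<open>?b\<close> is, and the composite of
    \<open>i2\<close> and \<open>q1\<close> serves as \<open>y\<close>.\<close>
  case False
  note ha' = hom_comp[OF ha hom_comp[OF h(1,7)]]
  have "isoM U U (%x. q1 (i1 (p1 (j1 x)))) \<or> isoM U U ?b"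
  proof (rule local_sum_id[OF assms(1) ha' hb])
   fix x assume x: "x\<in>U"
   have "q1 (i1 (p1 (j1 x)) +_T i2 (p2 (j1 x))) = q1 (j1 x)" using e(5) c x by simp
   thus "q1 (i1 (p1 (j1 x))) +_U ?b x = x" using homD(2)[OF h(7)] c x e(6) by simp
  qed
  moreover have "~ isoM U U (%x. q1 (i1 (p1 (j1 x))))"
   using False local_comp(1)[OF assms(1,1) ha hom_comp[OF h(1,7)]] by auto
  ultimately have ib: "isoM U U ?b" by blast
  have "isoM U U (%x. p1 (j1 x) +_U ?b x)"
  proof -
   let ?s = "%x. p1 (j1 x) +_U ?b x"
   have hs: "?s\<in>mh U U" by (rule hom_add[OF ha hb MC_rm[OF U]])
   have hn: "(%x. 0_U -_U p1 (j1 x))\<in>mh U U"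
    by (rule hom_diff[OF hom_0[OF MC_rm[OF U]] ha MC_rm[OF U]])
   interpret Ur: right_module A U by (rule MC_rm[OF U])
   have ab: "(x +_U y) +_U (0_U -_U x) = y" if "x\<in>U" "y\<in>U" for x y
    using that by (simp add: Ur.M.minus_eq Ur.M.a_comm[of x y] Ur.M.a_assoc Ur.M.r_neg)
   have "isoM U U ?s \<or> isoM U U (%x. 0_U -_U p1 (j1 x))"
    by (rule local_sum[OF assms(1) hs hn hb ib]) (use c ab in simp)
   moreover have "isoM U U ?a" if i: "isoM U U (%x. 0_U -_U p1 (j1 x))"
   proof -
    have "inj_on ?a U"
    proof (rule inj_onI)
     fix x x' assume "x\<in>U" "x'\<in>U" "p1 (j1 x) = p1 (j1 x')"
     thus "x = x'" using inj_onD[OF bij_betw_imp_inj_on[OF i], of x x'] by simp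
    qed
    thus ?thesis using endo_inj_iff_surj[OF U ha] by (simp add: bij_betw_def)
   qed
   ultimately show ?thesis using False by blast
  qed
  thus ?thesis using that[OF hy] by blast
 qed
 note yc = hom_closed[OF y(1)]
 \<comment> \<open>\<open>k\<close> embeds \<open>N\<close> into the kernel of the modified
   projection \<open>p\<close>. Since \<open>p\<close> is injective on the image of
   \<open>j1\<close>, the image of \<open>k\<close> meets it in zero only.\<close>
 define k where "k n = i2 n -_T i1 (y n)" for n
 define p where "p t = p1 t +_U y (p2 t)" for t
 have k: "k\<in>mh N T" unfolding k_def[abs_def]
  by (rule hom_diff[OF h(2) hom_comp[OF y(1) h(1)] MC_rm[OF m(1)]])
 have pk: "p (k n) = 0_U" and p2k: "p2 (k n) = n" if n: "n\<in>N" for n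
 proof -
  interpret Ur: right_module A U by (rule MC_rm[OF U])
  have "p1 (k n) = 0_U -_U y n" "p2 (k n) = n -_N 0_N"
   unfolding k_def using hom_minus[OF h(3) m(1) U] hom_minus[OF h(4) m(1,2)] c yc n e(1-4) by auto
  thus "p (k n) = 0_U" "p2 (k n) = n" unfolding p_def using yc[OF n] n m by (auto simp: Ur.M.minus_eq Ur.M.l_neg)
 qed
 have "(%n. q2 (k n))\<in>mh N N'" by (rule hom_comp[OF k h(8)])
 moreover have "inj_on (%n. q2 (k n)) (carrier N)"
 proof -
  have "n = 0_N" if n: "n\<in>N" and z: "q2 (k n) = 0_N'" for n
  proof -
   have kn: "k n\<in>T" using hom_closed[OF k n] .
   have "k n = j1 (q1 (k n)) +_T j2 0_N'" using e(7)[OF kn] z by simp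
   hence kj: "k n = j1 (q1 (k n))" using hom_zero[OF h(6) m(3,1)] c kn m by simp
   let ?u = "q1 (k n)"
   have u: "?u\<in>U" using c kn by simp
   have "p (j1 ?u) = 0_U" using pk[OF n] kj by simp
   moreover have "p (j1 0_U) = 0_U"
    unfolding p_def using hom_zero[OF h(5) U m(1)] hom_zero[OF h(3) m(1) U] hom_zero[OF h(4) m(1,2)] hom_zero[OF y(1) m(2) U] U by simp
   ultimately have "?u = 0_U"
    using inj_onD[OF bij_betw_imp_inj_on[OF y(2)], of ?u "0_U"] u U by (simp add: p_def)
   hence "k n = 0_T" using kj hom_zero[OF h(5) U m(1)] by simp
   thus ?thesis using p2k[OF n] hom_zero[OF h(4) m(1,2)] by simp
  qed
  thus ?thesis using hom_more(7)[OF hom_comp[OF k h(8)] MC_rm[OF m(2)] MC_rm[OF m(3)]] by blast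
 qed
 ultimately show ?thesis by (rule that)
qed

text \<open>Injections in both directions between finite dimensional modules are bijective.\<close>

lemma cancel:
 assumes U: "ind U" and m: "N\<in>MC" "N'\<in>MC" and iso: "mod_iso A (U [+] N) (U [+] N')"
 shows "mod_iso A N N'"
proof -
 have um: "U\<in>MC" using U by (rule indD(1))
 have t: "U [+] N\<in>MC" using um m by simp
 note b = bip_bsum[OF um m(1)]
 obtain j1 j2 q1 q2 where b': "bip (U [+] N) U N' j1 j2 q1 q2" using bip_of_iso[OF iso um m(2) t] by blast
 obtain h where h: "h\<in>mh N N'" "inj_on h N" using cancel_inj[OF U t m b b'] by blast
 obtain h' where h': "h'\<in>mh N' N" "inj_on h' N'" using cancel_inj[OF U t m(2,1) b' b] by blast
 have "dm N = dm N'" using dm_inj(1)[OF m h] dm_inj(1)[OF m(2,1) h'] by simp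
 hence "isoM N N' h" using dm_inj(2)[OF m h] h(2) by (simp add: bij_betw_def)
 thus ?thesis using h(1) unfolding mod_iso_def by blast
qed

text \<open>Multiplicity-freeness in terms of binary sums, which suits \<open>decomp_induct\<close>;
  \<open>basic_iff\<close> identifies it with \<open>basic_module\<close>.\<close>

definition mfree :: "('k, 'a) rmod \<Rightarrow> bool" where
 "mfree M <-> (\<forall>V N. ind V --> N\<in>MC --> mod_iso A M (V [+] N) --> ~ sd V N)"

lemma mfree_iso: "mfree M ==> mod_iso A N M ==> N\<in>MC ==> mfree N"
 unfolding mfree_def using mod_iso_trans[of A M N] iso_sym by blast

text \<open>For the direction from right to left, let \<open>V\<close> occur twice. If
  \<open>V\<close> is isomorphic to \<open>U\<close>, cancelling one copy leaves another in
  \<open>N\<close>. Otherwise \<open>U\<close> splits off the second factor, and cancelling it shows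
  that either \<open>V\<close> occurs twice in \<open>N\<close>, or \<open>V\<close> is isomorphic
  to \<open>U\<close> and occurs in \<open>N\<close>.\<close>

lemma mfree_bsum:
 assumes U: "ind U" and N: "N\<in>MC"
 shows "mfree (U [+] N) <-> mfree N & ~ sd U N"
proof
 have um: "U\<in>MC" using U by (rule indD(1))
 assume f: "mfree (U [+] N)"
 have "~ sd V L" if V: "ind V" and L: "L\<in>MC" and i: "mod_iso A N (V [+] L)" for V L
 proof
  assume s: "sd V L"
  have v: "V\<in>MC" using V by (rule indD(1))
  have "mod_iso A (U [+] N) (V [+] (U [+] L))"
   by (rule mod_iso_trans[OF bsum_iso[OF mod_iso_refl i] bsum_swap[OF um v L]])
  hence "~ sd V (U [+] L)" using f V um L unfolding mfree_def by (metis MC_bsum)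
  thus False using sd_trans[OF s sd_bsum_left(2)[OF um L]] by blast
 qed
 moreover have "~ sd U N" using f U N mod_iso_refl unfolding mfree_def by blast
 ultimately show "mfree N & ~ sd U N" unfolding mfree_def by blast
next
 have um: "U\<in>MC" using U by (rule indD(1))
 assume f: "mfree N & ~ sd U N"
 show "mfree (U [+] N)" unfolding mfree_def
 proof (intro allI impI notI)
  fix V L assume V: "ind V" and L: "L\<in>MC" and i: "mod_iso A (U [+] N) (V [+] L)" and s: "sd V L"
  have v: "V\<in>MC" using V by (rule indD(1))
  have "sd U (V [+] L)" using sd_trans[OF sd_bsum_left(1)[OF um N] sd_iso[OF i]] um N by simp
  then consider "mod_iso A U V" | "sd U L" using bip_sd_cases[OF bip_bsum[OF v L] _ V L U] v L by auto
  thus False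
  proof cases
   case 1
   have iu: "mod_iso A (U [+] N) (U [+] L)"
    by (rule mod_iso_trans[OF i bsum_iso[OF iso_sym[OF 1 um] mod_iso_refl]])
   have "sd L N" by (rule sd_iso[OF iso_sym[OF cancel[OF U N L iu] N] L])
   thus False using f sd_trans[OF sd_iso[OF 1 um] sd_trans[OF s]] by blast
  next
   case 2
   obtain L' where L': "L'\<in>MC" "mod_iso A L (U [+] L')" using 2 sd_iff_bsum[OF um L] by blast
   have "mod_iso A (U [+] N) (U [+] (V [+] L'))"
    by (rule mod_iso_trans[OF i mod_iso_trans[OF bsum_iso[OF mod_iso_refl L'(2)] bsum_swap[OF v um L'(1)]]])
   hence n: "mod_iso A N (V [+] L')" using cancel[OF U N] v L'(1) by simp
   hence nl: "~ sd V L'" using f V L'(1) unfolding mfree_def by blast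
   have "sd V (U [+] L')" by (rule sd_trans[OF s sd_iso[OF L'(2) L]])
   hence "mod_iso A V U" using bip_sd_cases[OF bip_bsum[OF um L'(1)] _ U L'(1) V] um L'(1) nl by auto
   hence "sd U V" by (rule sd_iso[OF iso_sym[OF _ v] um])
   hence "sd U N" using sd_trans[OF _ sd_trans[OF sd_bsum_left(1)[OF v L'(1)] sd_iso[OF iso_sym[OF n N]]]] v L'(1) by simp
   thus False using f by blast
  qed
 qed
qed

text \<open>An indecomposable summand is split off both modules. Since it occurs in neither
  complement, the complements again have the same indecomposable summands.\<close>

lemma ind_summands_determine:
 assumes "M\<in>MC" "N\<in>MC" "mfree M" "mfree N" "\<forall>U. ind U --> (sd U M <-> sd U N)"
 shows "mod_iso A M N"
 using assms
proof (induction arbitrary: N rule: decomp_induct)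
 case (zero Z)
 have zN: "zero_module N"
 proof (rule ccontr)
  assume "~ zero_module N"
  then obtain U where "ind U" "sd U N" using ind_summand_exists[OF zero(3)] by blast
  thus False using zero zero_no_summand by blast
 qed
 have "bij_betw (%_. 0_N) (carrier Z) (carrier N)"
  using zN zero(2) by (auto simp: zero_module_def bij_betw_def)
 thus ?case unfolding mod_iso_def using hom_0[OF MC_rm[OF zero(3)]] by blast
next
 case (sum M U L i1 i2 p1 p2)
 have um: "U\<in>MC" using sum(3) by (rule indD(1))
 have iM: "mod_iso A M (U [+] L)" by (rule bip_iso[OF sum(4) um sum(2,1)])
 hence fL: "mfree (U [+] L)" using mfree_iso[OF sum(7) iso_sym[OF iM sum(1)]] um sum(2) by simp
 have "sd U N" using sum.prems(4) sum(3) bip_sd(1)[OF sum(4)] by blast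
 then obtain N' where N': "N'\<in>MC" "mod_iso A N (U [+] N')" using sd_iff_bsum[OF um sum(6)] by blast
 have fN: "mfree (U [+] N')" using mfree_iso[OF sum(8) iso_sym[OF N'(2) sum(6)]] um N'(1) by simp
 note fL' = fL[unfolded mfree_bsum[OF sum(3,2)]] and fN' = fN[unfolded mfree_bsum[OF sum(3) N'(1)]]
 have eq: "sd V (U [+] L) <-> sd V (U [+] N')" if V: "ind V" for V
  using sum.prems(4) V sd_trans[OF _ sd_iso[OF iM sum(1)]] sd_trans[OF _ sd_iso[OF iso_sym[OF iM sum(1)]]]
   sd_trans[OF _ sd_iso[OF N'(2) sum(6)]] sd_trans[OF _ sd_iso[OF iso_sym[OF N'(2) sum(6)]]] um sum(2) N'(1)
  by (metis MC_bsum)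
 have half: "sd V L2" if V: "ind V" and s: "sd V L1" and L: "L1\<in>MC" "L2\<in>MC" "~ sd U L1" and e: "sd V (U [+] L1) --> sd V (U [+] L2)"
  for V L1 L2
 proof -
  have v: "V\<in>MC" using V by (rule indD(1))
  have "sd V (U [+] L2)" using e sd_trans[OF s sd_bsum_left(2)[OF um L(1)]] by blast
  then consider "mod_iso A V U" | "sd V L2" using bip_sd_cases[OF bip_bsum[OF um L(2)] _ sum(3) L(2) V] um L(2) by auto
  thus ?thesis
  proof cases
   case 1
   thus ?thesis using sd_trans[OF sd_iso[OF iso_sym[OF 1 v] um] s] L(3) by blast
  qed
 qed
 have "mod_iso A L N'"
 proof (rule sum.IH)
  show "\<forall>V. ind V --> (sd V L <-> sd V N')"
   using half[OF _ _ sum(2) N'(1)] half[OF _ _ N'(1) sum(2)] eq fL' fN' by blast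
 qed (use fL' fN' N'(1) in auto)
 thus ?case
  using mod_iso_trans[OF mod_iso_trans[OF iM bsum_iso[OF mod_iso_refl]] iso_sym[OF N'(2) sum(6)]] by blast
qed

lemma mfree_zmod: "mfree (zmod :: ('k, 'a) rmod)"
 unfolding mfree_def
 proof (intro allI impI)
  fix V N assume V: "ind V" "N\<in>MC" "mod_iso A (zmod :: ('k, 'a) rmod) (V [+] N)"
  have "sd (V [+] N) zmod" using sd_iso[OF iso_sym[OF V(3) MC_zmod]] indD(1)[OF V(1)] V(2) by simp
  thus "~ sd V N"
   using zero_no_summand[OF MC_zmod zero_zmod V(1)] sd_trans[OF sd_bsum_left(1)[OF indD(1)[OF V(1)] V(2)]] by blast
 qed

lemma realize:
 assumes "finite B" "!!U. U\<in>B ==> ind U" "noniso B"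
 obtains T where "T\<in>MC" "mfree T" "Sm B T" "represents B (IS T)"
proof -
 have "\<exists>T. Sm B T & T\<in>MC & mfree T & (\<forall>U\<in>B. sd U T)"
  using assms
 proof (induction rule: finite_induct)
  case empty
  show ?case using Sm_zmod MC_zmod mfree_zmod by auto
 next
  case (insert U B)
  have ni: "noniso B" using insert(5) unfolding noniso_def by blast
  have iB: "!!V. V\<in>B ==> ind V" and iU: "ind U" using insert(4) by auto
  obtain T where T: "Sm B T" "T\<in>MC" "mfree T" "\<forall>V\<in>B. sd V T" using insert(3)[OF iB ni] by blast
  have BM: "B <= MC" using iB indD(1) by blast
  have um: "U\<in>MC" using iU by (rule indD(1))
  have "~ sd U T"
  proof
   assume "sd U T"
   then obtain V where V: "V\<in>B" "sd U V" using Sm_sd[OF T(1) BM iU] by blast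
   have "mod_iso A U V" by (rule sd_ind_iso[OF iU iB[OF V(1)] V(2)])
   thus False using insert(5,2) V(1) unfolding noniso_def by auto
  qed
  hence f: "mfree (U [+] T)" using mfree_bsum[OF iU T(2)] T(3) by blast
  have mono: "Sm B N ==> Sm (insert U B) N" for N by (induction rule: Sm.induct) (auto intro: Sm.intros)
  have "Sm (insert U B) (U [+] T)" using Sm_bsum[OF _ mono[OF T(1)], of U] by simp
  moreover have "sd V (U [+] T)" if "V\<in>insert U B" for V
   using that sd_bsum_left[OF um T(2)] sd_trans T(4) by blast
  ultimately show ?case using f um T(2) by (intro exI[of _ "U [+] T"]) simp
 qed
 then obtain T where T: "Sm B T" "T\<in>MC" "mfree T" "\<forall>U\<in>B. sd U T" by blast
 have "represents B (IS T)" unfolding represents_def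
 proof (intro conjI ballI)
  show "B <= IS T" using T(4) assms(2) IS_iff[OF T(2)] by blast
  fix U assume "U\<in>IS T"
  hence U: "ind U" "sd U T" using IS_iff[OF T(2)] by auto
  have "B <= MC" using assms(2) indD(1) by blast
  then obtain V where "V\<in>B" "sd U V" using Sm_sd[OF T(1) _ U] by blast
  thus "\<exists>V\<in>B. mod_iso A U V" using sd_ind_iso[OF U(1)] assms(2) by blast
 qed (rule assms(3))
 thus ?thesis using that T by blast
qed

text \<open>The elements of \<open>family_sum\<close> are functions with values in coordinate
  vectors, which is not the element type of \<open>mod_cat\<close>; \<open>fs\<close> is the
  corresponding iterated sum inside \<open>mod_cat\<close>.\<close>

fun fs :: "nat \<Rightarrow> (nat \<Rightarrow> ('k, 'a) rmod) \<Rightarrow> ('k, 'a) rmod" where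
 "fs 0 F = zmod" | "fs (Suc n) F = F n [+] fs n F"

lemma fs_MC: "(!!i. i < n ==> F i\<in>MC) ==> fs n F\<in>MC"
 by (induction n) (auto simp: MC_zmod)

lemma fs_cong: "(!!i. i < n ==> F i = G i) ==> fs n F = fs n G"
 by (induction n) auto

lemma family_sum_simps [simp]:
 "carrier (family_sum n F) = (\<Pi>\<^sub>E i\<in>{..<n}. carrier (F i))" "0_(family_sum n F) = (\<lambda>i\<in>{..<n}. 0_(F i))"
 "x +_(family_sum n F) y = (\<lambda>i\<in>{..<n}. x i +_(F i) y i)" "a ._(family_sum n F) x = (\<lambda>i\<in>{..<n}. a ._(F i) x i)"
 by (simp_all add: family_sum_def)

lemma fs_family_sum:
 assumes "!!i. i < n ==> F i\<in>MC"
 shows "mod_iso A (fs n F) (family_sum n F)"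
 using assms
proof (induction n)
 case 0
 show ?case unfolding mod_iso_def
  by (rule bexI[of _ "%_ _. undefined"]) (auto simp: bij_betw_def intro!: homI)
next
 case (Suc n)
 then obtain u where u: "u\<in>mh (fs n F) (family_sum n F)" "isoM (fs n F) (family_sum n F) u"
  by (auto simp: mod_iso_def)
 note uD = homD[OF u(1)]
 have uE: "u z i\<in>carrier (F i)" if "z\<in>carrier (fs n F)" "i < n" for z i using uD(1)[OF that(1)] that(2) by auto
 define w where "w z = (\<lambda>i\<in>{..<Suc n}. if i < n then u (pr2 z) i else pr1 z)" for z
 have "w\<in>mh (fs (Suc n) F) (family_sum (Suc n) F)"
 proof (rule homI)
  fix x y a assume x: "x\<in>carrier (fs (Suc n) F)"
  show "w x\<in>carrier (family_sum (Suc n) F)" using x uE by (auto simp: w_def less_Suc_eq)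
  show "w (x +_(fs (Suc n) F) y) = w x +_(family_sum (Suc n) F) w y" if "y\<in>carrier (fs (Suc n) F)"
   using x that uD(2)[of "pr2 x" "pr2 y"] by (auto simp: w_def less_Suc_eq fun_eq_iff)
  show "w (a ._(fs (Suc n) F) x) = a ._(family_sum (Suc n) F) w x" if "a\<in>A"
   using x uD(3)[OF that, of "pr2 x"] by (auto simp: w_def less_Suc_eq fun_eq_iff)
 qed
 moreover have "isoM (fs (Suc n) F) (family_sum (Suc n) F) w"
 proof (rule bij_betw_byWitness[where f' = "%x. jn (x n) (inv_into (carrier (fs n F)) u (restrict x {..<n}))"])
  have r: "(\<lambda>i\<in>{..<n}. w z i) = u (pr2 z)" if "z\<in>carrier (fs (Suc n) F)" for z
   using uD(1)[of "pr2 z"] that by (auto simp: w_def fun_eq_iff PiE_def extensional_def)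
  show "\<forall>z\<in>carrier (fs (Suc n) F). jn (w z n) (inv_into (carrier (fs n F)) u (restrict (w z) {..<n})) = z"
  proof
   fix z assume z: "z\<in>carrier (fs (Suc n) F)"
   have "w z n = pr1 z" by (simp add: w_def)
   thus "jn (w z n) (inv_into (carrier (fs n F)) u (restrict (w z) {..<n})) = z"
    unfolding r[OF z] using bij_betw_inv_into_left[OF u(2), of "pr2 z"] z by simp
  qed
  have R: "restrict x {..<n}\<in>carrier (family_sum n F)" if "x\<in>carrier (family_sum (Suc n) F)" for x
   using that by (auto simp: PiE_def)
  show "\<forall>x\<in>carrier (family_sum (Suc n) F). w (jn (x n) (inv_into (carrier (fs n F)) u (restrict x {..<n}))) = x"
   using R bij_betw_inv_into_right[OF u(2)] by (auto simp: w_def fun_eq_iff less_Suc_eq PiE_def extensional_def)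
  show "(%x. jn (x n) (inv_into (carrier (fs n F)) u (restrict x {..<n}))) ` carrier (family_sum (Suc n) F) <= carrier (fs (Suc n) F)"
   using R bij_betwE[OF bij_betw_inv_into[OF u(2)]] by (auto simp: PiE_def)
  show "w ` carrier (fs (Suc n) F) <= carrier (family_sum (Suc n) F)" using uE by (auto simp: w_def less_Suc_eq)
 qed
 ultimately show ?case unfolding mod_iso_def by blast
qed

lemma iso_family_sum:
 assumes "!!i. i < n ==> F i\<in>MC" "M\<in>MC"
 shows "mod_iso A M (family_sum n F) <-> mod_iso A M (fs n F)"
proof -
 note i = fs_family_sum[of n F, OF assms(1)]
 note j = mod_iso_sym[OF i MC_rm[OF fs_MC[of n F, OF assms(1)]]]
 show ?thesis using mod_iso_trans[OF _ i, of M] mod_iso_trans[OF _ j, of M] by blast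
qed

lemma fs_split:
 assumes "!!i. i < n ==> F i\<in>MC" "j < n"
 shows "\<exists>N\<in>MC. mod_iso A (fs n F) (F j [+] N) & (\<forall>i<n. i ~= j --> sd (F i) N)"
 using assms
proof (induction n)
 case (Suc n)
 have F: "F i\<in>MC" if "i < Suc n" for i using Suc(2)[OF that] .
 have fm: "fs n F\<in>MC" by (rule fs_MC) (use F in simp)
 have sdn: "sd (F i) (fs n F)" if "i < n" for i
 proof -
  obtain N where N: "N\<in>MC" "mod_iso A (fs n F) (F i [+] N)"
  proof -
   have "\<exists>N\<in>MC. mod_iso A (fs m F) (F i [+] N)" if "i < m" "m <= n" for m
    using that
   proof (induction m)
    case (Suc m)
    have Fm: "F m\<in>MC" "F i\<in>MC" "fs m F\<in>MC" using Suc F fs_MC[of m F] by auto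
    show ?case
    proof (cases "i = m")
     case True
     thus ?thesis using Fm mod_iso_refl by auto
    next
     case False
     then obtain N where N: "N\<in>MC" "mod_iso A (fs m F) (F i [+] N)" using Suc by auto
     show ?thesis
      using mod_iso_trans[OF bsum_iso[OF mod_iso_refl N(2), of "F m"] bsum_swap[OF Fm(1,2) N(1)]] Fm N(1)
      by (intro bexI[of _ "F m [+] N"]) auto
    qed
   qed simp
   thus ?thesis using that \<open>i < n\<close> by blast
  qed
  thus ?thesis using sd_iff_bsum[OF F fm, of i] that by auto
 qed
 show ?case
 proof (cases "j = n")
  case True
  thus ?thesis using fm mod_iso_refl sdn by (intro bexI[of _ "fs n F"]) auto
 next
  case False
  then obtain N where N: "N\<in>MC" "mod_iso A (fs n F) (F j [+] N)" "\<forall>i<n. i ~= j --> sd (F i) N" using Suc by auto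
  have i: "mod_iso A (fs (Suc n) F) (F j [+] (F n [+] N))"
   using mod_iso_trans[OF bsum_iso[OF mod_iso_refl N(2), of "F n"] bsum_swap[OF F F N(1)]] Suc(3) by simp
  have "sd (F k) (F n [+] N)" if "k < Suc n" "k ~= j" for k
   using that N(3) sd_bsum_left[OF F[OF lessI] N(1)] sd_trans[of "F k" N] by (cases "k = n") auto
  thus ?thesis using i F N(1) by (intro bexI[of _ "F n [+] N"]) auto
 qed
qed simp

lemma fs_decomp: "M\<in>MC ==> \<exists>n F. (\<forall>i<n. ind (F i)) & mod_iso A M (fs n F)"
proof (induction rule: decomp_induct)
 case (zero Z)
 have "isoM Z (zmod :: ('k, 'a) rmod) (%_. 0_((zmod :: ('k, 'a) rmod)))" using zero(2) by (simp add: bij_betw_def zero_module_def)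
 hence "mod_iso A Z (zmod :: ('k, 'a) rmod)" unfolding mod_iso_def
  by (intro bexI[OF _ hom_0[OF MC_rm[OF MC_zmod]]])
 thus ?case by (intro exI[of _ 0]) simp
next
 case (sum M U N i1 i2 p1 p2)
 then obtain n F where nF: "\<forall>i<n. ind (F i)" "mod_iso A N (fs n F)" by blast
 let ?G = "F(n := U)"
 have "fs n ?G = fs n F" by (rule fs_cong) simp
 hence "mod_iso A M (fs (Suc n) ?G)"
  using mod_iso_trans[OF bip_iso[OF sum(4) indD(1)[OF sum(3)] sum(2,1)] bsum_iso[OF mod_iso_refl nF(2)]] by simp
 moreover have "\<forall>i<Suc n. ind (?G i)" using nF(1) sum(3) by (auto simp: less_Suc_eq)
 ultimately show ?case by blast
qed

lemma basic_iff:
 assumes M: "M\<in>MC"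
 shows "basic_module K A M <-> mfree M"
proof
 assume b: "basic_module K A M"
 show "mfree M" unfolding mfree_def
 proof (intro allI impI notI)
  fix V N assume V: "ind V" and N: "N\<in>MC" and i: "mod_iso A M (V [+] N)" and s: "sd V N"
  have v: "V\<in>MC" using V by (rule indD(1))
  obtain N' where N': "N'\<in>MC" "mod_iso A N (V [+] N')" using s sd_iff_bsum[OF v N] by blast
  obtain n F where nF: "\<forall>i<n. ind (F i)" "mod_iso A N' (fs n F)" using fs_decomp[OF N'(1)] by blast
  \<comment> \<open>The positions \<open>n\<close> and \<open>Suc n\<close> both carry
    \<open>V\<close>, which contradicts basicness of the family of length
    \<open>Suc (Suc n)\<close>.\<close>
  let ?G = "%i. if i < n then F i else V"
  have "fs n ?G = fs n F" by (rule fs_cong) simp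
  hence "mod_iso A M (fs (Suc (Suc n)) ?G)"
   using mod_iso_trans[OF i bsum_iso[OF mod_iso_refl mod_iso_trans[OF N'(2) bsum_iso[OF mod_iso_refl nF(2)]]]] by simp
  moreover have ii: "\<forall>i<Suc (Suc n). ind (?G i)" using nF(1) V by auto
  ultimately have "mod_iso A M (family_sum (Suc (Suc n)) ?G)"
   using iso_family_sum[of "Suc (Suc n)" ?G M] M indD(1) by blast
  hence "~ mod_iso A (?G n) (?G (Suc n))" using b ii unfolding basic_module_def
   by (metis (no_types, lifting) lessI less_SucI n_not_Suc_n)
  thus False using mod_iso_refl[of A V] by simp
 qed
next
 assume f: "mfree M"
 show "basic_module K A M" unfolding basic_module_def
 proof (intro allI impI notI)
  fix n F i j assume F: "(\<forall>i<n. ind (F i)) & mod_iso A M (family_sum n F)" and ij: "i < n" "j < n" "i ~= j" "mod_iso A (F i) (F j)"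
  have Fm: "F i\<in>MC" if "i < n" for i using F that indD(1) by blast
  have "mod_iso A M (fs n F)" using iso_family_sum[of n F M] Fm M F by simp
  moreover have "\<exists>N\<in>MC. mod_iso A (fs n F) (F j [+] N) & (\<forall>i<n. i ~= j --> sd (F i) N)"
   by (rule fs_split) (use Fm ij(2) in auto)
  then obtain N where N: "N\<in>MC" "mod_iso A (fs n F) (F j [+] N)" "\<forall>i<n. i ~= j --> sd (F i) N" by blast
  ultimately have "mod_iso A M (F j [+] N)" by (blast intro: mod_iso_trans)
  hence "~ sd (F j) N" using f F ij(2) N(1) unfolding mfree_def by blast
  moreover have "sd (F j) N" using sd_trans[OF sd_iso[OF iso_sym[OF ij(4) Fm[OF ij(1)]] Fm[OF ij(2)]]] N(3) ij by blast
  ultimately show False by blast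
 qed
qed

text \<open>Quotients of powers of \<open>M\<close> are traded for \<open>gen\<close>, which
  mentions no exponent and composes well; the sums \<open>Sm {M}\<close> mediate.\<close>

lemma Fac_iff:
 assumes M: "M\<in>MC"
 shows "N\<in>Fac K A M <-> N\<in>MC & gen {M} N"
proof
 assume "N\<in>Fac K A M"
 then obtain n f where N: "N\<in>MC" and f: "f\<in>mh (family_sum n (%_. M)) N" "f ` carrier (family_sum n (%_. M)) = carrier N"
  by (auto simp: Fac_def)
 obtain u where u: "u\<in>mh (fs n (%_. M)) (family_sum n (%_. M))" "isoM (fs n (%_. M)) (family_sum n (%_. M)) u"
  using fs_family_sum[of n "%_. M"] M by (auto simp: mod_iso_def)
 have S: "Sm {M} (fs n (%_. M))" by (induction n) (auto intro: Sm.intros)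
 have "(%x. f (u x)) ` carrier (fs n (%_. M)) = carrier N"
  using u(2) f(2) unfolding bij_betw_def by (metis image_image)
 thus "N\<in>MC & gen {M} N" using gen_of_surj[OF S hom_comp[OF u(1) f(1)]] M N by auto
next
 assume N: "N\<in>MC & gen {M} N"
 then obtain R ro where R: "Sm {M} R" "ro\<in>mh R N" "ro ` R = carrier N"
  using gen_Sm[of "{M}" N] M by auto
 have "\<exists>n. R = fs n (%_. M)" using R(1)
 proof (induction rule: Sm.induct)
  case Sm_zmod
  show ?case by (intro exI[of _ 0]) simp
 next
  case (Sm_bsum U R)
  then obtain n where "R = fs n (%_. M)" by blast
  thus ?case using Sm_bsum(1) by (intro exI[of _ "Suc n"]) simp
 qed
 then obtain n where n: "R = fs n (%_. M)" by blast
 obtain u where u: "u\<in>mh R (family_sum n (%_. M))" "isoM R (family_sum n (%_. M)) u"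
  using fs_family_sum[of n "%_. M"] M by (auto simp: mod_iso_def n)
 note v = hom_inv[OF u MC_rm[OF Sm_MC[OF R(1)]]]
 have "(%x. ro (inv_into (carrier R) u x)) ` carrier (family_sum n (%_. M)) = carrier N"
  using v(2) M R(3) unfolding bij_betw_def by (simp flip: image_image)
 thus "N\<in>Fac K A M" unfolding Fac_def using N hom_comp[OF v(1) R(2)] M by auto
qed

lemma Ez_sd:
 assumes "M\<in>MC" "V\<in>MC" "sd V M"
 shows "Ez M L ==> Ez V L" "pd1 M ==> pd1 V"
proof -
 obtain e where p: "pres (mp1 M) (mp0 M) (mpf M) e M" using mp_min[OF assms(1)] by blast
 show "Ez M L ==> Ez V L" by (rule compare_E0(1)[OF p assms(2,3)]) (simp add: Ez_def)
 show "pd1 M ==> pd1 V" by (rule compare_E0(2)[OF p assms(2,3)]) (simp add: pd1_def)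
qed

lemma Ez_pj:
 assumes "pj Q" shows "L\<in>MC ==> Ez Q L" "pd1 Q"
 using compare_E0[OF pres_projective[OF assms] pj_MC[OF assms] sd_refl] E0_projective[OF _ pj_MC[OF assms]]
 by auto

text \<open>The direct sum of the two minimal presentations presents \<open>M [+] N\<close>, and
  \<open>compare_E0\<close> accepts any presentation.\<close>

lemma Ez_bsum:
 assumes M: "M\<in>MC" and N: "N\<in>MC"
 shows "L\<in>MC ==> Ez M L ==> Ez N L ==> Ez (M [+] N) L" "pd1 M ==> pd1 N ==> pd1 (M [+] N)"
proof -
 obtain e where p: "pres (mp1 M) (mp0 M) (mpf M) e M" using mp_min[OF M] by blast
 obtain d where q: "pres (mp1 N) (mp0 N) (mpf N) d N" using mp_min[OF N] by blast
 note D = presD[OF p] and D' = presD[OF q]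
 let ?f = "%z. jn (mpf M (pr1 z)) (mpf N (pr2 z))" and ?e = "%z. jn (e (pr1 z)) (d (pr2 z))"
 note b1 = bsum_homs[OF MC_rm[OF D(8)] MC_rm[OF D'(8)]] and b0 = bsum_homs[OF MC_rm[OF D(9)] MC_rm[OF D'(9)]]
 have f: "?f\<in>mh (mp1 M [+] mp1 N) (mp0 M [+] mp0 N)"
  by (rule bsum_pair[OF hom_comp[OF b1(1) D(4)] hom_comp[OF b1(2) D'(4)]])
 have e: "?e\<in>mh (mp0 M [+] mp0 N) (M [+] N)"
  by (rule bsum_pair[OF hom_comp[OF b0(1) D(5)] hom_comp[OF b0(2) D'(5)]])
 have pr: "pres (mp1 M [+] mp1 N) (mp0 M [+] mp0 N) ?f ?e (M [+] N)"
  unfolding pres_def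
 proof (intro conjI ballI)
  show "?e ` carrier (mp0 M [+] mp0 N) = carrier (M [+] N)"
  proof (intro equalityI subsetI)
   fix z assume "z\<in>(M [+] N)"
   hence "pr1 z\<in>e ` carrier (mp0 M)" "pr2 z\<in>d ` carrier (mp0 N)" using D(6) D'(6) by simp_all
   then obtain x y where "x\<in>carrier (mp0 M)" "e x = pr1 z" "y\<in>carrier (mp0 N)" "d y = pr2 z" by auto
   thus "z\<in>?e ` carrier (mp0 M [+] mp0 N)" by (intro image_eqI[of _ _ "jn x y"]) auto
  qed (use hom_closed[OF e] in auto)
  fix y assume y: "y\<in>carrier (mp0 M [+] mp0 N)"
  have "?e y = 0_(M [+] N) <-> e (pr1 y) = 0_M & d (pr2 y) = 0_N" by (metis bsum_simps(2) pr_jn)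
  also have "\<dots> <-> pr1 y\<in>mpf M ` carrier (mp1 M) & pr2 y\<in>mpf N ` carrier (mp1 N)" using D(7) D'(7) y by simp
  also have "\<dots> <-> y\<in>?f ` carrier (mp1 M [+] mp1 N)"
  proof
   assume "pr1 y\<in>mpf M ` carrier (mp1 M) & pr2 y\<in>mpf N ` carrier (mp1 N)"
   then obtain u v where "u\<in>carrier (mp1 M)" "mpf M u = pr1 y" "v\<in>carrier (mp1 N)" "mpf N v = pr2 y" by auto
   thus "y\<in>?f ` carrier (mp1 M [+] mp1 N)" by (intro image_eqI[of _ _ "jn u v"]) auto
  qed auto
  finally show "?e y = 0_(M [+] N) <-> y\<in>?f ` carrier (mp1 M [+] mp1 N)" .
 qed (use D D' M N f e pj_bsum in auto)
 have MN: "M [+] N\<in>MC" using M N by simp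
 show "Ez (M [+] N) L" if L: "L\<in>MC" and E: "Ez M L" "Ez N L"
 proof (rule compare_E0(1)[OF pr MN sd_refl])
  show "E0 (mp1 M [+] mp1 N) (mp0 M [+] mp0 N) ?f L" unfolding E0_def
  proof
   fix g assume g: "g\<in>mh (mp1 M [+] mp1 N) L"
   obtain h1 where h1: "h1\<in>mh (mp0 M) L" "\<forall>x\<in>carrier (mp1 M). h1 (mpf M x) = g (jn x 0_(mp1 N))"
    using bspec[OF E(1)[unfolded Ez_def E0_def] hom_comp[OF b1(3) g]] by auto
   obtain h2 where h2: "h2\<in>mh (mp0 N) L" "\<forall>x\<in>carrier (mp1 N). h2 (mpf N x) = g (jn 0_(mp1 M) x)"
    using bspec[OF E(2)[unfolded Ez_def E0_def] hom_comp[OF b1(4) g]] by auto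
   have "h1 (mpf M (pr1 z)) +_L h2 (mpf N (pr2 z)) = g z" if "z\<in>carrier (mp1 M [+] mp1 N)" for z
    using homD(2)[OF g, of "jn (pr1 z) 0_(mp1 N)" "jn 0_(mp1 M) (pr2 z)"] h1(2) h2(2) that D(8) D'(8) by simp
   thus "\<exists>h\<in>mh (mp0 M [+] mp0 N) L. \<forall>x\<in>carrier (mp1 M [+] mp1 N). h (?f x) = g x"
    by (intro bexI[OF _ bsum_copair[OF h1(1) h2(1) MC_rm[OF L]]]) simp
  qed
 qed
 show "pd1 (M [+] N)" if i: "pd1 M" "pd1 N"
 proof (rule compare_E0(2)[OF pr MN sd_refl], rule inj_onI)
  fix z w assume zw: "z\<in>carrier (mp1 M [+] mp1 N)" "w\<in>carrier (mp1 M [+] mp1 N)" "?f z = ?f w"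
  hence "mpf M (pr1 z) = mpf M (pr1 w)" "mpf N (pr2 z) = mpf N (pr2 w)" by (metis pr_jn)+
  hence "pr1 z = pr1 w" "pr2 z = pr2 w" using i zw(1,2) by (auto simp: pd1_def inj_on_def)
  thus "z = w" by (subst pr_eq) simp
 qed
qed

lemma Ez_summands:
 assumes "T\<in>MC"
 shows "L\<in>MC ==> Ez T L <-> (\<forall>U. ind U --> sd U T --> Ez U L)" (is "_ ==> ?P T")
  "pd1 T <-> (\<forall>U. ind U --> sd U T --> pd1 U)" (is "?Q T")
  "E0 P1 P0 f T <-> (\<forall>U. ind U --> sd U T --> E0 P1 P0 f U)" (is "?R T")
proof -
 have "(L\<in>MC --> (\<forall>U. ind U --> sd U T --> Ez U L) --> Ez T L) & ((\<forall>U. ind U --> sd U T --> pd1 U) --> pd1 T) &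
   ((\<forall>U. ind U --> sd U T --> E0 P1 P0 f U) --> E0 P1 P0 f T)" for L
  using assms
 proof (induction rule: decomp_induct)
  case (zero Z)
  thus ?case using Ez_pj[OF pj_zero[OF zero]] E0_zero[OF zero] by blast
 next
  case (sum M U N i1 i2 p1 p2)
  have um: "U\<in>MC" using sum(3) by (rule indD(1))
  have s: "sd M (U [+] N)" by (rule sd_iso[OF bip_iso[OF sum(4) um sum(2,1)] sum(1)])
  have un: "U [+] N\<in>MC" using um sum(2) by simp
  have t: "sd V N ==> sd V M" for V using sd_trans[OF _ bip_sd(2)[OF sum(4)]] .
  show ?case
  proof (intro conjI impI)
   assume "\<forall>U. ind U --> sd U M --> pd1 U"
   hence "pd1 U" "pd1 N" using sum(3,5) bip_sd(1)[OF sum(4)] t by blast+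
   thus "pd1 M" using Ez_sd(2)[OF un sum(1) s] Ez_bsum(2)[OF um sum(2)] by blast
  next
   assume L: "L\<in>MC" and "\<forall>U. ind U --> sd U M --> Ez U L"
   hence "Ez U L" "Ez N L" using sum(3,5) bip_sd(1)[OF sum(4)] t by blast+
   thus "Ez M L" using Ez_sd(1)[OF un sum(1) s] Ez_bsum(1)[OF um sum(2) L] by blast
  next
   assume "\<forall>U. ind U --> sd U M --> E0 P1 P0 f U"
   hence "E0 P1 P0 f U" "E0 P1 P0 f N" using sum(3,5) bip_sd(1)[OF sum(4)] t by blast+
   thus "E0 P1 P0 f M" using E0_sd[OF E0_bsum[OF _ _ um sum(2)] s] by blast
  qed
 qed
 thus "L\<in>MC ==> ?P T" "?Q T" "?R T"
  using Ez_sd[OF assms indD(1)] E0_sd by blast+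
qed

end

section \<open>Rigidity and maximality\<close>

context fdalg begin

lemma tilting_iff:
 "tilting K A T <-> T\<in>MC & mfree T & pd1 T & Ez T T & num_summands K A T = num_summands K A (regular_module A)"
 unfolding tilting_def using basic_iff[of T] proj_dim_le_1_iff[of T] Ext_trivial_iff[of T T] by blast

lemma mp_pres: "M\<in>MC ==> \<exists>e. pres (mp1 M) (mp0 M) (mpf M) e M"
 using mp_min by blast

lemma Ez_gen: "Ez M N ==> gen {N} N' ==> M\<in>MC ==> N\<in>MC ==> N'\<in>MC ==> Ez M N'"
 using E0_gen[of "{N}" N' "mp1 M" "mp0 M" "mpf M"] mp_pres presD(1) unfolding Ez_def by blast

lemma homzD: "homz Q L ==> w\<in>mh Q L ==> x\<in>Q ==> w x = 0_L"
 by (simp add: homz_def)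

lemma homz_sd2: "homz Q N ==> sd V N ==> V\<in>MC ==> N\<in>MC ==> homz Q V"
proof -
 assume a: "homz Q N" "sd V N" "V\<in>MC" "N\<in>MC"
 obtain i p where ip: "i\<in>mh V N" "p\<in>mh N V" "!!x. x\<in>V ==> p (i x) = x" using a(2) by (auto simp: sd_def)
 show ?thesis unfolding homz_def
 proof (intro ballI)
  fix w x assume w: "w\<in>mh Q V" and x: "x\<in>Q"
  have "i (w x) = 0_N" by (rule homzD[OF a(1) hom_comp[OF w ip(1)] x])
  thus "w x = 0_V" using ip(3)[OF hom_closed[OF w x]] hom_zero[OF ip(2) a(4,3)] by simp
 qed
qed

lemma homz_self: "ind U ==> ~ homz U U"
 using homzD[OF _ hom_id, of U] indD[of U] zero_module_iff[of U] by blast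

lemma homz_summands: "P\<in>MC ==> homz P M <-> (\<forall>Q. ind Q --> sd Q P --> homz Q M)" if M: "M\<in>MC"
proof (intro iffI allI impI)
 show "homz P M" if "P\<in>MC" "\<forall>Q. ind Q --> sd Q P --> homz Q M"
  using that
 proof (induction rule: decomp_induct)
  case (zero Z)
  thus ?case using hom_zero[OF _ zero(1) M] by (auto simp: homz_def zero_module_def)
 next
  case (sum P U N i1 i2 p1 p2)
  have h: "i1\<in>mh U P" "i2\<in>mh N P" "p1\<in>mh P U" "p2\<in>mh P N"
   "!!z. z\<in>P ==> i1 (p1 z) +_P i2 (p2 z) = z" using sum(4) by (auto simp: bip_def)
  have z: "homz U M" "homz N M" using sum(3,5,6) bip_sd[OF sum(4)] sd_trans by blast+
  show ?case unfolding homz_def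
  proof (intro ballI)
   fix w x assume w: "w\<in>mh P M" and x: "x\<in>P"
   have "w (i1 (p1 x)) = 0_M" "w (i2 (p2 x)) = 0_M"
    using homzD[OF z(1) hom_comp[OF h(1) w] hom_closed[OF h(3) x]]
     homzD[OF z(2) hom_comp[OF h(2) w] hom_closed[OF h(4) x]] by auto
   thus "w x = 0_M"
    using homD(2)[OF w hom_closed[OF h(1) hom_closed[OF h(3) x]] hom_closed[OF h(2) hom_closed[OF h(4) x]]] h(5)[OF x] M
    by simp
  qed
 qed
qed (use homz_sd1 in blast)

text \<open>A common summand \<open>U\<close> would satisfy \<open>Hom(U, U) = 0\<close>, so
  \<open>M\<close> and \<open>P\<close> share no summand and the counts add up.\<close>

lemma represents_bsum:
 assumes M: "M\<in>MC" and P: "P\<in>MC" and z: "homz P M" and R: "represents R (IS M)" and S: "represents S (IS P)"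
 shows "represents (R \<union> S) (IS (M [+] P))" "R \<inter> S = {}"
  "num_summands K A (direct_sum M P) = card R + card S"
proof -
 have no: False if U: "ind U" "sd U M" "sd U P" for U
  using homz_self[OF U(1)] homz_sd1[OF homz_sd2[OF z U(2) indD(1)[OF U(1)] M] U(3)] by blast
 have iR: "ind U" "sd U M" if "U\<in>R" for U using that R IS_iff[OF M] by (auto simp: represents_def)
 have iS: "ind U" "sd U P" if "U\<in>S" for U using that S IS_iff[OF P] by (auto simp: represents_def)
 have no': "~ mod_iso A U V" "~ mod_iso A V U" if "U\<in>R" "V\<in>S" for U V
  using no[of U] no[of V] iR[OF that(1)] iS[OF that(2)] sd_trans[OF sd_iso] indD(1) by blast+
 show d: "R \<inter> S = {}" using no'(1) mod_iso_refl by blast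
 have MP: "M [+] P\<in>MC" using M P by simp
 show r: "represents (R \<union> S) (IS (M [+] P))" unfolding represents_def
 proof (intro conjI ballI)
  show "R \<union> S <= IS (M [+] P)" using iR iS IS_iff[OF MP] sd_trans sd_bsum_left[OF M P] by blast
  show "noniso (R \<union> S)" using R S no' unfolding represents_def noniso_def by blast
  fix U assume "U\<in>IS (M [+] P)"
  hence "ind U" "sd U M \<or> sd U P" using IS_iff[OF MP] sd_bsum[OF _ M P] by auto
  thus "\<exists>V\<in>R \<union> S. mod_iso A U V" using R S IS_iff[OF M] IS_iff[OF P] unfolding represents_def by blast
 qed
 have "IS (direct_sum M P) = IS (M [+] P)" by (rule IS_iso_cong[OF iso_direct_bsum])
 hence "num_summands K A (direct_sum M P) = num_summands K A (M [+] P)" by (simp add: num_summands_def)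
 also have "\<dots> = card (R \<union> S)" by (rule num_summands_eq[OF r])
 also have "\<dots> = card R + card S"
  using finite_reps_IS[OF M R] finite_reps_IS[OF P S] d by (simp add: card_Un_disjoint)
 finally show "num_summands K A (direct_sum M P) = card R + card S" .
qed

lemma support_tau_tilting_iff:
 assumes R: "represents R (IS M)" and S: "represents S (IS P)"
 shows "support_tau_tilting K A M P <-> M\<in>MC & mfree M & pj P & mfree P & Ez M M & homz P M &
  card R + card S = num_summands K A (regular_module A)"
 unfolding support_tau_tilting_def
 using basic_iff[of M] basic_iff[of P] AR_zero[of M M] Hom_zero_iff[of P M] represents_bsum(3)[OF _ _ _ R S]
 by (metis pj_MC)

text \<open>A \<tau>-rigid pair given by the sets of its indecomposable summands; the hypotheses of
  \<open>rank_bound\<close> for minimal presentations.\<close>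

definition "rigid R C <-> finite R & finite C & (\<forall>U\<in>R. ind U) & noniso R & (\<forall>U\<in>R. \<forall>V\<in>R. Ez U V) &
 (\<forall>Q\<in>C. ind Q & pj Q) & noniso C & (\<forall>U\<in>R. \<forall>Q\<in>C. homz Q U)"

lemma rigid_bound: "rigid R C ==> card R + card C <= num_summands K A (regular_module A)"
proof -
 assume r: "rigid R C"
 define e where "e M = (SOME e. pres (mp1 M) (mp0 M) (mpf M) e M)" for M
 have "pres (mp1 U) (mp0 U) (mpf U) (e U) U" if "U\<in>R" for U
  unfolding e_def by (rule someI_ex[OF mp_pres]) (use r that indD(1) in \<open>auto simp: rigid_def\<close>)
 thus ?thesis using r rank_bound(3)[of R mp1 mp0 mpf e C] unfolding rigid_def Ez_def by blast
qed

text \<open>Adjoining a compatible module that is not yet represented would violate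
  \<open>rigid_bound\<close>.\<close>

lemma rigid_maximal:
 assumes r: "rigid R C" and n: "card R + card C = num_summands K A (regular_module A)"
 shows "ind U ==> Ez U U ==> \<forall>V\<in>R. Ez U V & Ez V U ==> \<forall>Q\<in>C. homz Q U ==> \<exists>V\<in>R. mod_iso A U V"
  "ind Q ==> pj Q ==> \<forall>V\<in>R. homz Q V ==> \<exists>Q'\<in>C. mod_iso A Q Q'"
proof -
 note d = r[unfolded rigid_def]
 have ni: "noniso (insert U B)" if "noniso B" "\<forall>V\<in>B. ~ mod_iso A U V" "ind U" "\<forall>V\<in>B. ind V" for U B
  using that iso_sym[OF _ indD(1)] unfolding noniso_def by blast
 show "\<exists>V\<in>R. mod_iso A U V" if U: "ind U" "Ez U U" "\<forall>V\<in>R. Ez U V & Ez V U" "\<forall>Q\<in>C. homz Q U"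
 proof (rule ccontr)
  assume no: "~ (\<exists>V\<in>R. mod_iso A U V)"
  hence "rigid (insert U R) C" using d U ni[of R U] unfolding rigid_def by blast
  from rigid_bound[OF this] show False using no mod_iso_refl d n by (cases "U\<in>R") auto
 qed
 show "\<exists>Q'\<in>C. mod_iso A Q Q'" if Q: "ind Q" "pj Q" "\<forall>V\<in>R. homz Q V"
 proof (rule ccontr)
  assume no: "~ (\<exists>Q'\<in>C. mod_iso A Q Q')"
  hence "rigid R (insert Q C)" using d Q ni[of C Q] unfolding rigid_def by blast
  from rigid_bound[OF this] show False using no mod_iso_refl d n by (cases "Q\<in>C") auto
 qed
qed

text \<open>The case \<open>P = 0\<close> covers tilting modules.\<close>

definition "mrp M P <-> M\<in>MC & mfree M & pj P & mfree P & Ez M M & homz P M &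
 (\<exists>R S. represents R (IS M) & represents S (IS P) & card R + card S = num_summands K A (regular_module A))"

lemma support_tau_tilting_mrp: "support_tau_tilting K A M P <-> mrp M P"
 unfolding mrp_def using support_tau_tilting_iff reps_IS by metis

lemma reps_zmod: "represents {} (IS (zmod :: ('k, 'a) rmod))"
 unfolding represents_def noniso_def
 using zero_no_summand[OF MC_zmod zero_zmod] IS_iff[OF MC_zmod] by blast

lemma tilting_mrp: "tilting K A T <-> pd1 T & mrp T zmod"
proof -
 have S: "S = {}" if "represents S (IS (zmod :: ('k, 'a) rmod))" for S
  using that zero_no_summand[OF MC_zmod zero_zmod] IS_iff[OF MC_zmod] unfolding represents_def by blast
 have z: "homz (zmod :: ('k, 'a) rmod) T" if "T\<in>MC" for T :: "('k, 'a) rmod"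
  using hom_zero[OF _ MC_zmod that] unfolding homz_def by simp
 have "(\<exists>R S. represents R (IS T) & represents S (IS (zmod :: ('k, 'a) rmod)) & card R + card S = num_summands K A (regular_module A))
  <-> num_summands K A T = num_summands K A (regular_module A)"
  using reps_IS[of T] num_summands_eq[of _ T] S reps_zmod by (metis add_0_right card.empty)
 thus ?thesis unfolding tilting_iff mrp_def
  using z pj_zero[OF MC_zmod zero_zmod] mfree_zmod by blast
qed

lemma mrp_rigid:
 assumes "mrp M P" "represents R (IS M)" "represents S (IS P)"
 shows "rigid R S" "card R + card S = num_summands K A (regular_module A)"
proof -
 note d = assms(1)[unfolded mrp_def]
 have P: "P\<in>MC" and M: "M\<in>MC" using d by auto
 have iR: "ind U" "sd U M" if "U\<in>R" for U using that assms(2) IS_iff[OF M] by (auto simp: represents_def)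
 have iS: "ind U" "sd U P" if "U\<in>S" for U using that assms(3) IS_iff[OF P] by (auto simp: represents_def)
 show "rigid R S" unfolding rigid_def
 proof (intro conjI ballI)
  show "finite R" "finite S" using finite_reps_IS assms(2,3) M P by blast+
  show "noniso R" "noniso S" using assms(2,3) by (auto simp: represents_def)
  show "Ez U V" if "U\<in>R" "V\<in>R" for U V
   using Ez_sd(1)[OF M indD(1)[OF iR(1)[OF that(1)]] iR(2)[OF that(1)]] E0_sd[OF _ iR(2)[OF that(2)]] d unfolding Ez_def by blast
  show "homz Q U" if "U\<in>R" "Q\<in>S" for U Q
   using homz_sd1[OF homz_sd2[OF _ iR(2)[OF that(1)] indD(1)[OF iR(1)[OF that(1)]] M] iS(2)[OF that(2)]] d by blast
  show "pj Q" if "Q\<in>S" for Q using pj_sd[OF _ indD(1)[OF iS(1)[OF that]] iS(2)[OF that]] d by blast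
 qed (use iR iS in auto)
 obtain R' S' where r: "represents R' (IS M)" "represents S' (IS P)" "card R' + card S' = num_summands K A (regular_module A)"
  using d by blast
 thus "card R + card S = num_summands K A (regular_module A)"
  using num_summands_eq[of R M] num_summands_eq[of R' M] num_summands_eq[of S P] num_summands_eq[of S' P] assms(2,3) by simp
qed

lemma mrp_summand:
 assumes m: "mrp M P" and U: "ind U" "Ez U U" "Ez U M" "Ez M U" "homz P U"
 shows "sd U M"
proof -
 note d = m[unfolded mrp_def]
 have P: "P\<in>MC" and M: "M\<in>MC" using d by auto
 obtain R S where r: "represents R (IS M)" "represents S (IS P)" using reps_IS by metis
 have iR: "ind V" "sd V M" if "V\<in>R" for V using that r IS_iff[OF M] by (auto simp: represents_def)
 have iS: "ind V" "sd V P" if "V\<in>S" for V using that r IS_iff[OF P] by (auto simp: represents_def)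
 have "\<exists>V\<in>R. mod_iso A U V"
 proof (rule rigid_maximal(1)[OF mrp_rigid[OF m r] U(1,2)])
  show "\<forall>V\<in>R. Ez U V & Ez V U"
   using Ez_sd(1)[OF M indD(1)[OF iR(1)] iR(2) U(4)] E0_sd[OF U(3)[unfolded Ez_def] iR(2)] unfolding Ez_def by blast
  show "\<forall>Q\<in>S. homz Q U" using homz_sd1[OF U(5)] iS by blast
 qed
 thus ?thesis using iR sd_trans[OF sd_iso[OF _ indD(1)[OF U(1)]]] by blast
qed

lemma mrp_projective:
 assumes m: "mrp M P" and Q: "ind Q" "pj Q" "homz Q M"
 shows "sd Q P"
proof -
 note d = m[unfolded mrp_def]
 have P: "P\<in>MC" and M: "M\<in>MC" using d by auto
 obtain R S where r: "represents R (IS M)" "represents S (IS P)" using reps_IS by metis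
 have iR: "ind V" "sd V M" if "V\<in>R" for V using that r IS_iff[OF M] by (auto simp: represents_def)
 have iS: "ind V" "sd V P" if "V\<in>S" for V using that r IS_iff[OF P] by (auto simp: represents_def)
 have "\<exists>V\<in>S. mod_iso A Q V"
  by (rule rigid_maximal(2)[OF mrp_rigid[OF m r] Q(1,2)]) (use homz_sd2[OF Q(3) iR(2) indD(1)[OF iR(1)] M] in blast)
 thus ?thesis using iS sd_trans[OF sd_iso[OF _ indD(1)[OF Q(1)]]] by blast
qed

text \<open>The conditions \<open>Ez\<close> and \<open>homz\<close> pass to generated modules in
  the second argument. Hence each summand of one module is compatible with the other module and, by
  maximality, is a summand of it. The second component is recovered as the projectives without
  nonzero maps to \<open>M\<close>.\<close>

lemma mrp_antisym:
 assumes m: "mrp M P" and m': "mrp M' P'" and g: "gen {M} M'" "gen {M'} M"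
 shows "mod_iso A M M'" "mod_iso A P P'"
proof -
 note d = m[unfolded mrp_def] and d' = m'[unfolded mrp_def]
 have M: "M\<in>MC" "M'\<in>MC" and P: "P\<in>MC" "P'\<in>MC" using d d' by auto
 have half: "sd U N" if m: "mrp N Q" "mrp N' Q'" and g: "gen {N} N'" "gen {N'} N" and U: "ind U" "sd U N'" for N Q N' Q' U
 proof -
  note d = m(1)[unfolded mrp_def] and d' = m(2)[unfolded mrp_def]
  have um: "U\<in>MC" using U(1) by (rule indD(1))
  have N: "N\<in>MC" "N'\<in>MC" using d d' by auto
  have "Ez U N'" using Ez_sd(1)[OF N(2) um U(2)] d' by blast
  hence "Ez U U" "Ez U N" using E0_sd[OF _ U(2)] Ez_gen[OF _ g(2) um N(2,1)] unfolding Ez_def by blast+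
  moreover have "Ez N U" using Ez_gen[OF _ g(1) N(1,1,2)] d E0_sd[OF _ U(2)] unfolding Ez_def by blast
  moreover have "homz Q U"
   using homz_sd2[OF homz_gen[OF g(1) _ N(2) _ ] U(2) um N(2)] d by blast
  ultimately show ?thesis by (rule mrp_summand[OF m(1) U(1)])
 qed
 show "mod_iso A M M'"
  by (rule ind_summands_determine) (use half[OF m m' g] half[OF m' m g(2,1)] d d' in blast)+
 have half2: "sd U Q" if m: "mrp N Q" "mrp N' Q'" and g: "gen {N'} N" and U: "ind U" "sd U Q'" for N Q N' Q' U
 proof -
  note d = m(1)[unfolded mrp_def] and d' = m(2)[unfolded mrp_def]
  have "pj U" using pj_sd[OF _ indD(1)[OF U(1)] U(2)] d' by blast
  moreover have "homz U N" using homz_sd1[OF _ U(2)] d' homz_gen[OF g] d calculation by blast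
  ultimately show ?thesis by (rule mrp_projective[OF m(1) U(1)])
 qed
 show "mod_iso A P P'"
  by (rule ind_summands_determine) (use half2[OF m m' g(2)] half2[OF m' m g(1)] d d' in \<open>auto\<close>)
qed

end

section \<open>The duplicated algebra\<close>

lemma fdvs_regular:
 assumes "field K" shows "fdvs K (regular_module K)"
proof (rule fdvsI[OF vectorspace_regular[OF assms], of "{1_K}"])
 interpret field K by fact
 show "{1_K} <= carrier (regular_module K)" by (simp add: regular_module_def)
 fix W assume W: "subspace K W (regular_module K)" "{1_K} <= W"
 have "c\<in>W" if "c\<in>K" for c
  using subspaceD(5)[OF W(1) that, of "1_K"] W(2) that by (simp add: regular_module_def)
 thus "carrier (regular_module K) <= W" by (auto simp: regular_module_def)
qed simp

text \<open>The kernel of one functional is treated by the remaining ones. This is applied to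
  \<open>D A\<close> with the evaluations at generators of \<open>A\<close>.\<close>

lemma fdvs_by_functionals:
 assumes K: "field K" and V: "vectorspace K V" and T: "finite T" "\<forall>t\<in>T. functional K V (e t)"
  and z: "\<forall>x\<in>V. (\<forall>t\<in>T. e t x = 0_K) --> x = 0_V"
 shows "fdvs K V"
 using T V z
proof (induction T arbitrary: V rule: finite_induct)
 case empty
 interpret vectorspace K V by (rule empty(2))
 show ?case using fdvs_zero(1)[OF empty(2)] empty(3) zero_closed by blast
next
 case (insert t T)
 have h: "functional K V (e t)" using insert.prems(1) by simp
 let ?L = "V(|carrier:=lker V (regular_module K) (e t)|)"
 note lf = linear_map_facts[OF insert.prems(2) vectorspace_regular[OF K] h]
 note LD = subspaceD[OF lf(1)]
 have "fdvs K ?L"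
 proof (rule insert.IH[OF _ LD(6)])
  show "\<forall>s\<in>T. functional K ?L (e s)"
   using insert.prems(1) by (intro ballI module_hom_dom[OF _ LD(2)]) simp
 qed (use insert.prems(3) LD(2) in \<open>auto simp: lker_def regular_module_def\<close>)
 thus ?case by (rule lf(5)[OF _ fdvs_regular[OF K]])
qed

context fdalg begin

abbreviation "dalg \<equiv> duplicated_algebra K A"

abbreviation "DA \<equiv> Hom K A (regular_module K)"

lemma DA_iff: "ph\<in>DA <-> (\<forall>x\<in>A. ph x\<in>K) &
  (\<forall>x\<in>A. \<forall>y\<in>A. ph (x +_A y) = ph x +_K ph y) &
  (\<forall>c\<in>K. \<forall>x\<in>A. ph (c ._A x) = c *_K ph x) & ph\<in>extensional A"
 unfolding Hom_def Int_iff functional_iff[OF field_K] by (simp only: conj_assoc)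

lemma DA_D:
 assumes "ph\<in>DA"
 shows "x\<in>A ==> ph x\<in>K" "x\<in>A ==> y\<in>A ==> ph (x +_A y) = ph x +_K ph y"
  "c\<in>K ==> x\<in>A ==> ph (c ._A x) = c *_K ph x" "ph\<in>extensional A"
 using assms unfolding DA_iff by blast+

lemma dalg_simps [simp]:
 "carrier dalg = carrier A \<times> DA \<times> carrier A"
 "(a, ph, b) *_dalg (a', ph', b') = (a *_A a', (\<lambda>x\<in>A. ph (a' *_A x) +_K ph' (x *_A b)), b *_A b')"
 "1_dalg = (1_A, (\<lambda>x\<in>A. 0_K), 1_A)" "0_dalg = (0_A, (\<lambda>x\<in>A. 0_K), 0_A)"
 "(a, ph, b) +_dalg (a', ph', b') = (a +_A a', (\<lambda>x\<in>A. ph x +_K ph' x), b +_A b')"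
 "c ._dalg (a, ph, b) = (c ._A a, (\<lambda>x\<in>A. c *_K ph x), c ._A b)"
 by (simp_all add: duplicated_algebra_def Let_def Hom_group_def regular_module_def)

lemma DA_closed:
 shows "(\<lambda>x\<in>A. 0_K)\<in>DA"
  "ph\<in>DA ==> ps\<in>DA ==> (\<lambda>x\<in>A. ph x +_K ps x)\<in>DA"
  "ph\<in>DA ==> c\<in>K ==> (\<lambda>x\<in>A. c *_K ph x)\<in>DA"
  "ph\<in>DA ==> a\<in>A ==> (\<lambda>x\<in>A. ph (a *_A x))\<in>DA"
  "ph\<in>DA ==> a\<in>A ==> (\<lambda>x\<in>A. ph (x *_A a))\<in>DA"
proof -
 interpret K: field K by (rule field_K)
 interpret R: ring A by (rule ring_A)
 interpret V: vectorspace K A by (rule vs_A)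
 show "(\<lambda>x\<in>A. 0_K)\<in>DA" unfolding DA_iff by auto
 show "ph\<in>DA ==> ps\<in>DA ==> (\<lambda>x\<in>A. ph x +_K ps x)\<in>DA"
  unfolding DA_iff by (auto simp: K.a_ac K.r_distr)
 show "ph\<in>DA ==> c\<in>K ==> (\<lambda>x\<in>A. c *_K ph x)\<in>DA"
  unfolding DA_iff by (auto simp: K.m_ac K.r_distr)
 show "ph\<in>DA ==> a\<in>A ==> (\<lambda>x\<in>A. ph (a *_A x))\<in>DA"
  unfolding DA_iff by (auto simp: R.r_distr alg_smult)
 show "ph\<in>DA ==> a\<in>A ==> (\<lambda>x\<in>A. ph (x *_A a))\<in>DA"
  unfolding DA_iff by (auto simp: R.l_distr alg_smult)
qed

lemma DA_mult_closed:
 assumes "ph\<in>DA" "ps\<in>DA" "a\<in>A" "b\<in>A"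
 shows "(\<lambda>x\<in>A. ph (a *_A x) +_K ps (x *_A b))\<in>DA"
 using DA_closed(2)[OF DA_closed(4)[OF assms(1,3)] DA_closed(5)[OF assms(2,4)]] by (simp cong: restrict_cong)

lemma vs_dalg: "vectorspace K dalg"
proof -
 interpret K: field K by (rule field_K)
 interpret V: vectorspace K A by (rule vs_A)
 have neg: "\<exists>w\<in>dalg. v +_dalg w = 0_dalg" if v: "v\<in>dalg" for v
 proof -
  obtain a ph b where w: "v = (a, ph, b)" "a\<in>A" "ph\<in>DA" "b\<in>A" using v by auto
  have "-_K 1_K\<in>K" by simp
  hence "(-_A a, (\<lambda>x\<in>A. (-_K 1_K) *_K ph x), -_A b)\<in>dalg" using w DA_closed(3) by simp
  moreover have "v +_dalg (-_A a, (\<lambda>x\<in>A. (-_K 1_K) *_K ph x), -_A b) = 0_dalg"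
   using w DA_D(1)[OF w(3)] by (auto simp: fun_eq_iff V.M.r_neg K.r_neg K.l_minus)
  ultimately show ?thesis by blast
 qed
 have ext: "(\<lambda>x\<in>A. ph x) = ph" if "ph\<in>DA" for ph using DA_D(4)[OF that] by (simp add: extensional_restrict)
 show ?thesis
  by (rule vs_criteria[OF field_K])
   (use neg DA_D(1) ext in \<open>auto simp: DA_closed V.M.a_ac K.a_ac V.smult_assoc1 K.m_assoc V.smult_l_distr V.smult_r_distr
     K.l_distr K.r_distr cong: restrict_cong intro!: restrict_ext\<close>)
qed

lemma ring_dalg: "ring dalg"
proof -
 interpret K: field K by (rule field_K)
 interpret V: vectorspace K A by (rule vs_A)
 interpret R: ring A by (rule ring_A)
 interpret D: vectorspace K dalg by (rule vs_dalg)
 have ext: "(\<lambda>x\<in>A. ph x) = ph" if "ph\<in>DA" for ph using DA_D(4)[OF that] by (simp add: extensional_restrict)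
 have z: "ph 0_A = 0_K" if "ph\<in>DA" for ph
  using DA_D(3)[OF that, of "0_K" "0_A"] DA_D(1)[OF that] by simp
 show ?thesis
 proof (rule ringI)
  show "abelian_group dalg" by (rule D.M.abelian_group_axioms)
  show "monoid dalg"
   by (rule monoidI)
    (auto simp: DA_mult_closed DA_closed R.m_assoc DA_D ext K.a_ac cong: restrict_cong intro!: restrict_ext)
 qed (auto simp: R.l_distr R.r_distr DA_D K.a_ac intro!: restrict_ext)
qed

text \<open>The projections to the two diagonal entries have finite dimensional values. Their common
  kernel is \<open>D A\<close>, where finitely many evaluations separate the elements.\<close>

lemma fd_dalg: "fd_algebra K dalg"
proof -
 interpret K: field K by (rule field_K)
 interpret V: vectorspace K A by (rule vs_A)
 interpret R: ring A by (rule ring_A)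
 note v = vs_dalg
 have h1: "fst\<in>module_hom K dalg A" by (rule homI) auto
 note l1 = linear_map_facts[OF v vs_A h1]
 let ?W1 = "dalg(|carrier:=lker dalg A fst|)"
 have h2: "(%v. snd (snd v))\<in>module_hom K ?W1 A" by (rule homI) (auto simp: lker_def)
 note l2 = linear_map_facts[OF subspaceD(6)[OF l1(1)] vs_A h2]
 let ?W2 = "?W1(|carrier:=lker ?W1 A (%v. snd (snd v))|)"
 have W2: "v\<in>carrier ?W2 <-> (\<exists>ph\<in>DA. v = (0_A, ph, 0_A))" for v by (auto simp: lker_def)
 obtain S where S: "finite S" "S <= carrier A" "\<forall>W. subspace K W A --> S <= W --> carrier A <= W"
  using fdvs_A fin_dim_iff[OF vs_A] by (auto simp: fdvs_def)
 have "fdvs K ?W2"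
 proof (rule fdvs_by_functionals[OF field_K subspaceD(6)[OF l2(1)] S(1)])
  show "\<forall>s\<in>S. functional K ?W2 (%v. fst (snd v) s)"
   unfolding functional_iff[OF field_K] Ball_def W2 using S(2) DA_D(1) by auto
  show "\<forall>v\<in>carrier ?W2. (\<forall>s\<in>S. fst (snd v) s = 0_K) --> v = 0_?W2"
  proof (intro ballI impI)
   fix v assume "v\<in>carrier ?W2" and z: "\<forall>s\<in>S. fst (snd v) s = 0_K"
   then obtain ph where p: "ph\<in>DA" "v = (0_A, ph, 0_A)" using W2 by blast
   have "subspace K {x\<in>A. ph x = 0_K} A"
   proof (rule subspaceI[OF vs_A])
    show "0_A\<in>{x\<in>A. ph x = 0_K}"
     using DA_D(3)[OF p(1), of "0_K" "0_A"] DA_D(1)[OF p(1)] by simp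
   qed (use DA_D[OF p(1)] in auto)
   moreover have "S <= {x\<in>A. ph x = 0_K}" using z S(2) by (auto simp: p(2))
   ultimately have "carrier A <= {x\<in>A. ph x = 0_K}" using S(3) by blast
   hence "ph = (\<lambda>x\<in>A. 0_K)" by (intro extensionalityI[OF DA_D(4)[OF p(1)]]) auto
   thus "v = 0_?W2" using p(2) by simp
  qed
 qed
 hence "fdvs K ?W1" using l2(5) fdvs_A by blast
 hence f: "fdvs K dalg" using l1(5) fdvs_A by blast
 show ?thesis unfolding fd_algebra_def
  using v f ring_dalg
  by (auto simp: fdvs_def alg_smult DA_D K.r_distr K.m_ac intro!: restrict_ext)
qed

end

section \<open>Modules over the duplicated algebra\<close>

locale dupl = fdalg K A + D: fdalg K "duplicated_algebra K A"
 for K :: "'k ring" and A :: "('k, 'a) module"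

context dupl begin

abbreviation "z0 \<equiv> (\<lambda>x\<in>A. 0_K)"

abbreviation "e1 \<equiv> (1_A, z0, 0_A)"

abbreviation "e2 \<equiv> (0_A, z0, 1_A)"

lemma A_simps [simp]:
 "0_A\<in>A" "1_A\<in>A" "a\<in>A ==> b\<in>A ==> a +_A b\<in>A"
 "a\<in>A ==> b\<in>A ==> a *_A b\<in>A" "a\<in>A ==> 1_A *_A a = a" "a\<in>A ==> a *_A 1_A = a"
 "a\<in>A ==> 0_A *_A a = 0_A" "a\<in>A ==> a *_A 0_A = 0_A"
 "a\<in>A ==> a +_A 0_A = a" "a\<in>A ==> 0_A +_A a = a" "c\<in>K ==> c ._A 0_A = 0_A"
 "c\<in>K ==> a\<in>A ==> c ._A a\<in>A"
 "a\<in>A ==> b\<in>A ==> d\<in>A ==> a *_A b *_A d = a *_A (b *_A d)"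
proof -
 interpret R: ring A by (rule ring_A)
 interpret V: vectorspace K A by (rule vs_A)
 show "0_A\<in>A" "1_A\<in>A" "a\<in>A ==> b\<in>A ==> a +_A b\<in>A"
  "a\<in>A ==> b\<in>A ==> a *_A b\<in>A" "a\<in>A ==> 1_A *_A a = a" "a\<in>A ==> a *_A 1_A = a"
  "a\<in>A ==> 0_A *_A a = 0_A" "a\<in>A ==> a *_A 0_A = 0_A"
  "a\<in>A ==> a +_A 0_A = a" "a\<in>A ==> 0_A +_A a = a" "c\<in>K ==> c ._A 0_A = 0_A"
  "c\<in>K ==> a\<in>A ==> c ._A a\<in>A"
  "a\<in>A ==> b\<in>A ==> d\<in>A ==> a *_A b *_A d = a *_A (b *_A d)"
  by (simp_all add: R.m_assoc)
qed

lemma K_simps [simp]: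
 "0_K\<in>K" "1_K\<in>K" "c\<in>K ==> 0_K +_K c = c" "c\<in>K ==> c +_K 0_K = c"
 "c\<in>K ==> c *_K 0_K = 0_K"
proof -
 interpret K: field K by (rule field_K)
 show "0_K\<in>K" "1_K\<in>K" "c\<in>K ==> 0_K +_K c = c" "c\<in>K ==> c +_K 0_K = c"
  "c\<in>K ==> c *_K 0_K = 0_K" by simp_all
qed

lemma DA_ext [simp]: "ph\<in>DA ==> (\<lambda>x\<in>A. ph x) = ph"
 using DA_D(4) by (simp add: extensional_restrict)

lemma DA_zero [simp]: "ph\<in>DA ==> ph 0_A = 0_K" "z0\<in>DA"
proof -
 show "ph\<in>DA ==> ph 0_A = 0_K"
 proof -
  assume p: "ph\<in>DA"
  interpret K: field K by (rule field_K)
  show ?thesis using DA_D(2)[OF p, of "0_A" "0_A"] DA_D(1)[OF p, of "0_A"] by simp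
 qed
qed (rule DA_closed(1))

lemma D_sc: "c\<in>K ==> D.sc c = (sc c, z0, sc c)"
 by (simp add: D.sc_def sc_def cong: restrict_cong)

text \<open>Restriction of scalars along the algebra map \<open>fst\<close>. Elements and
  homomorphisms stay the same, so this is a full embedding of module categories.\<close>

definition infl :: "('a, 'm, 'z) module_scheme \<Rightarrow> ('a \<times> ('a \<Rightarrow> 'k) \<times> 'a, 'm) module" where
 "infl M = (|carrier = carrier M, monoid.mult = undefined, one = undefined, zero = 0_M, add = add M,
   smult = (%v x. fst v ._M x)|)"

lemma infl_simps [simp]:
 "carrier (infl M) = carrier M" "0_(infl M) = 0_M" "x +_(infl M) y = x +_M y" "v ._(infl M) x = fst v ._M x"
 by (simp_all add: infl_def)

lemma infl_hom [simp]: "D.mh (infl M) (infl N) = mh M N"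
proof (intro equalityI subsetI)
 fix f assume f: "f\<in>D.mh (infl M) (infl N)"
 show "f\<in>mh M N"
 proof (rule homI)
  show "f (a ._M x) = a ._N f x" if "a\<in>A" "x\<in>M" for a x
   using homD(3)[OF f, of "(a, z0, 0_A)" x] that by simp
 qed (use homD(1,2)[OF f] in auto)
qed (auto intro!: homI dest: homD)

lemma infl_rm: assumes "rm M" shows "D.rm (infl M)"
proof -
 interpret right_module A M by fact
 show ?thesis
 proof (rule right_moduleI[OF ring_dalg])
  show "abelian_group (infl M)"
   by (rule abelian_groupI) (use M.a_assoc M.a_comm M.l_neg in \<open>auto intro: exI[of _ "-_M x" for x] bexI[of _ "-_M x" for x]\<close>)
 qed (auto simp: ract_closed ract_add_ring ract_add ract_mult ract_one)
qed

lemma infl_MC [simp]: assumes "M\<in>MC" shows "infl M\<in>D.MC"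
proof -
 have r: "D.rm (infl M)" by (rule infl_rm[OF MC_rm[OF assms]])
 have "fdvs K (D.us (infl M))"
  by (rule fdvs_inj(1)[OF D.vs_us[OF r], of "us M" "%x. x"]) (use assms in \<open>auto simp: MC_iff D_sc intro!: homI\<close>)
 thus ?thesis using r by (simp add: D.MC_iff)
qed

lemma infl_iso [simp]: "mod_iso dalg (infl M) (infl N) <-> mod_iso A M N"
 by (simp add: mod_iso_def)

lemma infl_sd [simp]: "D.sd (infl M) (infl N) <-> sd M N"
 by (simp add: D.sd_def sd_def)

lemma infl_zero [simp]: "zero_module (infl M) <-> zero_module M"
 by (simp add: zero_module_def)

lemma infl_homz [simp]: "D.homz (infl M) (infl N) <-> homz M N"
 by (simp add: D.homz_def homz_def)

lemma infl_ind: assumes "M\<in>MC" shows "D.ind (infl M) <-> ind M"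
proof
 assume i: "D.ind (infl M)"
 show "ind M"
  by (rule indI[OF assms]) (use D.indD(2)[OF i] D.ind_idem[OF i] in auto)
next
 assume i: "ind M"
 show "D.ind (infl M)"
  by (rule D.indI[OF infl_MC[OF assms]]) (use indD(2)[OF i] ind_idem[OF i] in auto)
qed

text \<open>If \<open>e2\<close> acts as zero then \<open>e1\<close> acts as the identity, and the
  product of \<open>e1\<close> with \<open>v\<close> depends only on the first entry of
  \<open>v\<close>.\<close>

lemma infl_of_e2_zero:
 assumes Q: "Q\<in>D.MC" and z: "!!x. x\<in>Q ==> e2 ._Q x = 0_Q"
 obtains R where "R\<in>MC" "(%x. x)\<in>D.mh Q (infl R)" "carrier R = carrier Q" "0_R = 0_Q"
proof -
 interpret Q: right_module dalg Q by (rule D.MC_rm[OF Q])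
 define R :: "('k, 'a) rmod" where "R = (|carrier = carrier Q, monoid.mult = undefined, one = undefined, zero = 0_Q, add = add Q,
  smult = (%a x. (a, z0, 0_A) ._Q x)|)"
 have Rs: "carrier R = carrier Q" "0_R = 0_Q" "x +_R y = x +_Q y" "a ._R x = (a, z0, 0_A) ._Q x" for x y a
  by (simp_all add: R_def)
 have ec: "e1\<in>dalg" "e2\<in>dalg" by simp_all
 have e1: "e1 ._Q x = x" if x: "x\<in>Q" for x
 proof -
  have "1_dalg = e1 +_dalg e2" by (simp cong: restrict_cong)
  hence "x = e1 ._Q x +_Q e2 ._Q x" using Q.ract_add_ring[OF ec x] Q.ract_one[OF x] by metis
  thus ?thesis using z[OF x] Q.ract_closed[OF ec(1) x] by simp
 qed
 have act: "v ._Q x = (fst v, z0, 0_A) ._Q x" if v: "v\<in>dalg" and x: "x\<in>Q" for v x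
 proof -
  have "v ._Q x = (e1 *_dalg v) ._Q x" using Q.ract_mult[OF ec(1) v x] e1[OF x] by simp
  also have "e1 *_dalg v = (fst v, z0, 0_A)" using v by (auto simp: DA_D cong: restrict_cong)
  finally show ?thesis .
 qed
 have m3: "(a, z0, 0_A)\<in>dalg" if "a\<in>A" for a using that by simp
 have r: "rm R"
 proof (rule right_moduleI[OF ring_A])
  show "abelian_group R"
   by (rule abelian_groupI, unfold Rs) (use Q.M.a_assoc Q.M.a_comm Q.M.l_neg in \<open>auto intro: bexI[of _ "-_Q x" for x]\<close>)
  fix a b x y assume a: "a\<in>A" and x: "x\<in>R"
  show "a ._R x\<in>R" using Q.ract_closed[OF m3[OF a]] x by (simp add: Rs)
  show "a ._R (x +_R y) = a ._R x +_R a ._R y" if "y\<in>R"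
   using Q.ract_add[OF m3[OF a]] x that by (simp add: Rs)
  assume b: "b\<in>A"
  show "(a +_A b) ._R x = a ._R x +_R b ._R x"
   using Q.ract_add_ring[OF m3[OF a] m3[OF b], of x] x by (simp add: Rs cong: restrict_cong)
  show "(a *_A b) ._R x = b ._R (a ._R x)"
   using Q.ract_mult[OF m3[OF a] m3[OF b], of x] x a b by (simp add: Rs cong: restrict_cong)
 qed (simp add: Rs e1)
 have h: "(%x. x)\<in>D.mh Q (infl R)" by (rule homI) (auto simp: Rs act)
 have "fdvs K (us R)"
 proof (rule fdvs_inj(1)[OF vs_us[OF r], of "D.us Q" "%x. x"])
  show "fdvs K (D.us Q)" using Q by (simp add: D.MC_iff)
  show "(%x. x)\<in>module_hom K (us R) (D.us Q)"
  proof (rule homI)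
   show "c ._(us R) x = c ._(D.us Q) x" if "c\<in>K" "x\<in>(us R)" for c x
    using act[of "(sc c, z0, sc c)" x] that by (simp add: Rs D_sc sc_facts)
  qed (simp_all add: Rs)
 qed (simp add: Rs)
 hence "R\<in>MC" using r by (simp add: MC_iff)
 thus ?thesis using that h Rs(1,2) by blast
qed

section \<open>The projective-injective module\<close>

definition "ER = (regular_module dalg)(|carrier:={v\<in>dalg. fst v = 0_A}|)"

definition "EE = (SOME Y. Y\<in>D.MC & mod_iso dalg ER Y)"

lemma ER_iff: "v\<in>ER <-> (\<exists>ph\<in>DA. \<exists>b\<in>A. v = (0_A, ph, b))"
 by (auto simp: ER_def)

lemma ER_simps [simp]: "0_ER = 0_dalg" "v +_ER w = v +_dalg w" "v ._ER w = w *_dalg v"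
 by (simp_all add: ER_def regular_module_def)

lemma ER_sbm: "D.sbm (carrier ER) (regular_module dalg)"
proof -
 interpret right_module dalg "regular_module dalg" by (rule D.rm_regular)
 show ?thesis
  by (rule right_submoduleI) (auto simp: ER_iff DA_closed DA_mult_closed simp del: restrict_apply cong: restrict_cong)
qed

lemma ER_rm: "D.rm ER"
 using right_module.right_module_submodule[OF D.rm_regular ER_sbm] by (simp add: ER_def)

lemma EE: "EE\<in>D.MC" "mod_iso dalg ER EE"
proof -
 have "fdvs K (D.us ER)"
  using fdvs_subspace(1)[OF D.fd_regular D.subspace_us[OF D.rm_regular ER_sbm]] by (simp add: ER_def)
 hence "\<exists>Y. Y\<in>D.MC & mod_iso dalg ER Y"
  using D.fd_realize[OF ER_rm] unfolding mod_iso_def by metis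
 from someI_ex[OF this] show "EE\<in>D.MC" "mod_iso dalg ER EE" by (auto simp: EE_def)
qed

lemma e_closed [simp]: "e1\<in>dalg" "e2\<in>dalg" by simp_all

text \<open>The generator is the image of \<open>e2\<close>; maps from \<open>EE\<close> to
  \<open>N\<close> correspond to the elements of \<open>N\<close> fixed by
  \<open>e2\<close>.\<close>

lemma EE_generator:
 obtains w where "w\<in>EE" "e2 ._EE w = w"
  "!!N x. N\<in>D.MC ==> x\<in>N ==> e2 ._N x = x ==> \<exists>h\<in>D.mh EE N. h w = x"
  "!!y. y\<in>EE ==> \<exists>v\<in>dalg. y = v ._EE w"
proof -
 obtain f where f: "f\<in>D.mh ER EE" "bij_betw f (carrier ER) (carrier EE)" using EE(2) by (auto simp: mod_iso_def)
 note v = hom_inv[OF f ER_rm]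
 have e2: "e2\<in>ER" by (auto simp: ER_iff)
 have e2v: "e2 *_dalg v = v" if "v\<in>ER" for v
  using that by (auto simp: ER_iff DA_D cong: restrict_cong)
 have e22: "e2 *_dalg e2 = e2" by (rule e2v[OF e2])
 show ?thesis
 proof (rule that[of "f e2"])
  show "f e2\<in>EE" by (rule D.hom_closed[OF f(1) e2])
  show "e2 ._EE f e2 = f e2" using homD(3)[OF f(1) e_closed(2) e2] e22 by simp
  show "\<exists>h\<in>D.mh EE N. h (f e2) = x" if N: "N\<in>D.MC" and x: "x\<in>N" "e2 ._N x = x" for N x
  proof -
   interpret N: right_module dalg N by (rule D.MC_rm[OF N])
   have c: "!!v. v\<in>ER ==> v\<in>dalg" by (auto simp: ER_def)
   have "(%v. v ._N x)\<in>D.mh ER N"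
    by (rule homI) (use c x N.ract_closed N.ract_add_ring N.ract_mult in auto)
   from hom_comp[OF v(1) this] show ?thesis using v(3)[OF e2] x(2) by (intro bexI) auto
  qed
  show "\<exists>v\<in>dalg. y = v ._EE f e2" if y: "y\<in>EE" for y
  proof -
   let ?v = "inv_into (carrier ER) f y"
   have vc: "?v\<in>ER" using D.hom_closed[OF v(1) y] .
   hence vd: "?v\<in>dalg" by (auto simp: ER_def)
   have "?v ._EE f e2 = f (e2 *_dalg ?v)" using homD(3)[OF f(1) vd e2] by simp
   thus ?thesis using e2v[OF vc] v(4)[OF y] vd by metis
  qed
 qed
qed

lemma e2_idem: "N\<in>D.MC ==> x\<in>N ==> e2 ._N (e2 ._N x) = e2 ._N x"
proof -
 assume N: "N\<in>D.MC" and x: "x\<in>N"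
 interpret N: right_module dalg N by (rule D.MC_rm[OF N])
 have "e2 *_dalg e2 = e2" by (auto cong: restrict_cong)
 thus ?thesis using N.ract_mult[OF e_closed(2) e_closed(2) x] by simp
qed

lemma EE_pj: "D.pj EE"
proof (rule D.pjI[OF EE(1)])
 fix S T g f assume h: "S\<in>D.MC" "T\<in>D.MC" "g\<in>D.mh S T" "f\<in>D.mh EE T" "g ` S = carrier T"
 obtain w where w: "w\<in>EE" "e2 ._EE w = w"
  "!!N x. N\<in>D.MC ==> x\<in>N ==> e2 ._N x = x ==> \<exists>h\<in>D.mh EE N. h w = x"
  "!!y. y\<in>EE ==> \<exists>v\<in>dalg. y = v ._EE w" by (rule EE_generator) blast
 interpret S: right_module dalg S by (rule D.MC_rm[OF h(1)])
 obtain s where s: "s\<in>S" "g s = f w" using D.hom_closed[OF h(4) w(1)] h(5) by (metis imageE)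
 let ?s = "e2 ._S s"
 have sc: "?s\<in>S" by (rule S.ract_closed[OF e_closed(2) s(1)])
 have "g ?s = f w" using homD(3)[OF h(3) e_closed(2) s(1)] s(2) homD(3)[OF h(4) e_closed(2) w(1)] w(2) by simp
 obtain k where k: "k\<in>D.mh EE S" "k w = ?s" using w(3)[OF h(1) sc e2_idem[OF h(1) s(1)]] by blast
 have "g (k y) = f y" if y: "y\<in>EE" for y
 proof -
  obtain v where v: "v\<in>dalg" "y = v ._EE w" using w(4)[OF y] by blast
  show ?thesis
   using homD(3)[OF k(1) v(1) w(1)] homD(3)[OF h(3) v(1) sc] homD(3)[OF h(4) v(1) w(1)] k(2) \<open>g ?s = f w\<close>
   by (simp add: v(2))
 qed
 thus "\<exists>k\<in>D.mh EE S. \<forall>y\<in>EE. g (k y) = f y" using k(1) by blast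
qed

lemma EE_infl_zero: assumes "h\<in>D.mh EE (infl Z)" "Z\<in>MC" "y\<in>EE" shows "h y = 0_Z"
proof -
 obtain w where w: "w\<in>EE" "e2 ._EE w = w"
  "!!y. y\<in>EE ==> \<exists>v\<in>dalg. y = v ._EE w" by (rule EE_generator) blast
 interpret Z: right_module A Z by (rule MC_rm[OF assms(2)])
 obtain v where v: "v\<in>dalg" "y = v ._EE w" using w(3)[OF assms(3)] by blast
 have "h w = 0_Z" using homD(3)[OF assms(1) e_closed(2) w(1)] D.hom_closed[OF assms(1) w(1)] w(2) by simp
 thus ?thesis using homD(3)[OF assms(1) v(1) w(1)] v by auto
qed

lemma EE_homz: "Z\<in>MC ==> D.homz EE (infl Z)"
 using EE_infl_zero by (auto simp: D.homz_def)

text \<open>The value of the lower left entry at 1. Composed with multiplication it pairs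
  \<open>ER\<close> with the left ideal generated by \<open>e1\<close>, and \<open>ev1_mult\<close>
  shows that the pairing matches the \<open>D A\<close> entry of each side with the \<open>A\<close>
  entry of the other.\<close>

definition ev1 :: "'a \<times> ('a \<Rightarrow> 'k) \<times> 'a \<Rightarrow> 'k" where "ev1 r = fst (snd r) 1_A"

lemma ev1_mult: "ph\<in>DA ==> ps\<in>DA ==> a\<in>A ==> b\<in>A ==> c\<in>A ==>
  ev1 ((0_A, ph, b) *_dalg (a, ps, c)) = ph a +_K ps b"
 by (simp add: ev1_def)

lemma DA_separates:
 assumes "b\<in>A" "b'\<in>A" "!!ps. ps\<in>DA ==> ps b = ps b'"
 shows "b = b'"
proof (rule ccontr)
 interpret V: vectorspace K A by (rule vs_A)
 interpret K: field K by (rule field_K)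
 assume ne: "b ~= b'"
 have S: "subspace K {0_A} A" by (rule subspaceI[OF vs_A]) auto
 have "b -_A b' \<notin> {0_A}" using ne assms(1,2) by simp
 then obtain xi where xi: "functional K A xi" "xi (b -_A b') = 1_K"
  using functional_separate[OF fdvs_A S, of "b -_A b'"] assms(1,2) by auto
 note x = xi(1)[unfolded functional_iff[OF field_K]]
 have "(\<lambda>x\<in>A. xi x)\<in>DA" using x unfolding DA_iff by auto
 from assms(3)[OF this] have e: "xi b = xi b'" using assms(1,2) by simp
 have "b = (b -_A b') +_A b'" using assms(1,2) by (simp add: V.M.minus_eq V.M.a_assoc V.M.l_neg)
 hence "xi b = xi (b -_A b') +_K xi b'" using x assms(1,2) by (metis V.M.minus_closed)
 hence "xi b' = 1_K +_K xi b'" using e xi(2) by simp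
 thus False using x assms(2) by simp
qed

lemma ER_separates:
 assumes "r\<in>ER" "r'\<in>ER" "!!v. v\<in>dalg ==> ev1 (r *_dalg v) = ev1 (r' *_dalg v)"
 shows "r = r'"
proof -
 obtain ph b ph' b' where r: "ph\<in>DA" "b\<in>A" "r = (0_A, ph, b)" "ph'\<in>DA" "b'\<in>A" "r' = (0_A, ph', b')"
  using assms(1,2) unfolding ER_iff by blast
 have "ph a = ph' a" if "a\<in>A" for a
  using assms(3)[of "(a, z0, 0_A)"] that r DA_D(1) by (simp add: ev1_mult del: dalg_simps(2))
 hence "ph = ph'" by (intro extensionalityI[OF DA_D(4)[OF r(1)] DA_D(4)[OF r(4)]]) simp
 moreover have "b = b'"
  by (rule DA_separates[OF r(2,5)])
   (use assms(3)[of "(0_A, ps, 0_A)" for ps] r DA_D(1) in \<open>simp add: ev1_mult del: dalg_simps(2)\<close>)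
 ultimately show ?thesis using r by simp
qed

text \<open>By hypothesis the functional lives on triples whose last entry is 0. Its part on
  \<open>D A\<close> is evaluation at some \<open>b\<close> by \<open>double_dual\<close>, and its
  part on \<open>A\<close> is an element \<open>ph\<close> of \<open>D A\<close>.\<close>

lemma ER_represents:
 assumes X: "functional K dalg \<Xi>" and e: "!!v. v\<in>dalg ==> \<Xi> (v *_dalg e1) = \<Xi> v"
 shows "\<exists>r\<in>ER. \<forall>v\<in>dalg. ev1 (r *_dalg v) = \<Xi> v"
proof -
 note x = X[unfolded functional_iff[OF field_K]]
 let ?Th = "%ps. \<Xi> (0_A, ps, 0_A)"
 have "\<exists>b\<in>A. \<forall>ps\<in>DA. ?Th ps = ps b"
 proof (rule double_dual[OF fdvs_A])
  show "?Th ps\<in>K" if "ps\<in>DA" for ps using x that by simp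
  show "?Th (\<lambda>x\<in>A. ps x +_K ch x) = ?Th ps +_K ?Th ch" if "ps\<in>DA" "ch\<in>DA" for ps ch
   using x[THEN conjunct2, THEN conjunct1, rule_format, of "(0_A, ps, 0_A)" "(0_A, ch, 0_A)"] that by simp
  show "?Th (\<lambda>x\<in>A. c *_K ps x) = c *_K ?Th ps" if "c\<in>K" "ps\<in>DA" for c ps
   using x[THEN conjunct2, THEN conjunct2, rule_format, of c "(0_A, ps, 0_A)"] that by simp
 qed
 then obtain b where b: "b\<in>A" "\<forall>ps\<in>DA. ?Th ps = ps b" by blast
 define ph where "ph = (\<lambda>a\<in>A. \<Xi> (a, z0, 0_A))"
 have p: "ph\<in>DA" unfolding DA_iff
 proof (intro conjI ballI)
  fix a c assume a: "a\<in>A"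
  show "ph a\<in>K" using x a by (simp add: ph_def)
  show "ph (a +_A c) = ph a +_K ph c" if "c\<in>A"
   using x[THEN conjunct2, THEN conjunct1, rule_format, of "(a, z0, 0_A)" "(c, z0, 0_A)"] a that
   by (simp add: ph_def cong: restrict_cong)
  show "ph (k ._A a) = k *_K ph a" if "k\<in>K" for k
   using x[THEN conjunct2, THEN conjunct2, rule_format, of k "(a, z0, 0_A)"] a that
   by (simp add: ph_def cong: restrict_cong)
 qed (simp add: ph_def)
 have "ev1 ((0_A, ph, b) *_dalg v) = \<Xi> v" if v: "v\<in>dalg" for v
 proof -
  obtain a ps c where w: "v = (a, ps, c)" "a\<in>A" "ps\<in>DA" "c\<in>A" using v by auto
  have "\<Xi> v = \<Xi> ((a, z0, 0_A) +_dalg (0_A, ps, 0_A))"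
   using e[OF v] w DA_D(1)[OF w(3)] by (simp cong: restrict_cong)
  also have "\<dots> = ph a +_K ps b"
   using x[THEN conjunct2, THEN conjunct1, rule_format, of "(a, z0, 0_A)" "(0_A, ps, 0_A)"] w b(2)
   by (simp add: ph_def del: dalg_simps(5))
  also have "\<dots> = ev1 ((0_A, ph, b) *_dalg v)" unfolding w(1) by (rule ev1_mult[OF p w(3,2) b(1) w(4), symmetric])
  finally show ?thesis by simp
 qed
 moreover have "(0_A, ph, b)\<in>ER" using p b(1) unfolding ER_iff by blast
 ultimately show ?thesis by blast
qed

text \<open>\<open>EE\<close> is the dual of \<open>dalg e1\<close>; \<open>th\<close> is evaluation at \<open>e1\<close>.\<close>

lemma EE_dual:
 obtains th where "functional K (D.us EE) th" "!!y. y\<in>EE ==> th (e1 ._EE y) = th y"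
  "!!\<Xi>. functional K dalg \<Xi> ==> (!!v. v\<in>dalg ==> \<Xi> (v *_dalg e1) = \<Xi> v) ==>
   \<exists>y\<in>EE. \<forall>v\<in>dalg. th (v ._EE y) = \<Xi> v"
  "!!y y'. y\<in>EE ==> y'\<in>EE ==> (!!v. v\<in>dalg ==> th (v ._EE y) = th (v ._EE y')) ==> y = y'"
proof -
 obtain f where f: "f\<in>D.mh ER EE" "bij_betw f (carrier ER) (carrier EE)" using EE(2) by (auto simp: mod_iso_def)
 note v = hom_inv[OF f ER_rm]
 let ?g = "inv_into (carrier ER) f"
 define th where "th y = ev1 (?g y)" for y
 have c: "?g y\<in>ER" if "y\<in>EE" for y using D.hom_closed[OF v(1) that] .
 have act: "th (u ._EE y) = ev1 (?g y *_dalg u)" if "u\<in>dalg" "y\<in>EE" for u y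
  using homD(3)[OF v(1) that] by (simp add: th_def)
 show ?thesis
 proof (rule that[of th])
  show "functional K (D.us EE) th"
   unfolding functional_iff[OF field_K]
  proof (intro conjI ballI)
   fix x assume x: "x\<in>carrier (D.us EE)"
   obtain ph b where p: "ph\<in>DA" "b\<in>A" "?g x = (0_A, ph, b)" using c[of x] x unfolding ER_iff by auto
   show "th x\<in>K" using p DA_D(1) by (simp add: th_def ev1_def)
   show "th (x +_(D.us EE) y) = th x +_K th y" if y: "y\<in>carrier (D.us EE)" for y
   proof -
    obtain ps d where q: "?g y = (0_A, ps, d)" using c[of y] y unfolding ER_iff by auto
    show ?thesis using homD(2)[OF v(1), of x y] x y p q by (simp add: th_def ev1_def)
   qed
   show "th (k ._(D.us EE) x) = k *_K th x" if k: "k\<in>K" for k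
    using act[of "(sc k, z0, sc k)" x] x p k sc_facts(1)[OF k] DA_D(3)[OF p(1) k, of "1_A"] DA_D(1)[OF p(1), of "k ._A 1_A"]
    by (simp add: D_sc ev1_mult th_def[of x] ev1_def[of "(0_A, ph, b)"] sc_def del: dalg_simps(2))
  qed
  show "th (e1 ._EE y) = th y" if y: "y\<in>EE" for y
  proof -
   obtain ph b where p: "ph\<in>DA" "b\<in>A" "?g y = (0_A, ph, b)" using c[OF y] unfolding ER_iff by auto
   show ?thesis using act[OF e_closed(1) y] p DA_D(1)[OF p(1)]
    by (simp add: ev1_mult th_def[of y] ev1_def[of "(0_A, ph, b)"] del: dalg_simps(2))
  qed
  show "y = y'" if y: "y\<in>EE" "y'\<in>EE" "!!v. v\<in>dalg ==> th (v ._EE y) = th (v ._EE y')" for y y'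
  proof -
   have "?g y = ?g y'" by (rule ER_separates[OF c[OF y(1)] c[OF y(2)]]) (use y act in simp)
   thus ?thesis using v(4) y(1,2) by metis
  qed
  show "\<exists>y\<in>EE. \<forall>v\<in>dalg. th (v ._EE y) = \<Xi> v"
   if X: "functional K dalg \<Xi>" "!!v. v\<in>dalg ==> \<Xi> (v *_dalg e1) = \<Xi> v" for \<Xi>
  proof -
   obtain r where r: "r\<in>ER" "\<forall>v\<in>dalg. ev1 (r *_dalg v) = \<Xi> v" using ER_represents[OF X] by blast
   show ?thesis using act[OF _ D.hom_closed[OF f(1) r(1)]] v(3)[OF r(1)] r(2) D.hom_closed[OF f(1) r(1)]
    by (intro bexI[of _ "f r"]) auto
  qed
 qed
qed

text \<open>As the dual of a projective left module, \<open>EE\<close> is coinduced: a functional on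
  the part of \<open>N\<close> fixed by \<open>e1\<close> determines a homomorphism from
  \<open>N\<close> to \<open>EE\<close>.\<close>

lemma EE_coind:
 obtains th where "functional K (D.us EE) th" "!!y. y\<in>EE ==> th (e1 ._EE y) = th y"
  "!!y y'. y\<in>EE ==> y'\<in>EE ==> (!!v. v\<in>dalg ==> th (v ._EE y) = th (v ._EE y')) ==> y = y'"
  "!!N xi. N\<in>D.MC ==> functional K (D.us N) xi ==> \<exists>k\<in>D.mh N EE. \<forall>n\<in>N. th (k n) = xi (e1 ._N n)"
proof -
 obtain th where t: "functional K (D.us EE) th" "!!y. y\<in>EE ==> th (e1 ._EE y) = th y"
  "!!\<Xi>. functional K dalg \<Xi> ==> (!!v. v\<in>dalg ==> \<Xi> (v *_dalg e1) = \<Xi> v) ==>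
   \<exists>y\<in>EE. \<forall>v\<in>dalg. th (v ._EE y) = \<Xi> v"
  "!!y y'. y\<in>EE ==> y'\<in>EE ==> (!!v. v\<in>dalg ==> th (v ._EE y) = th (v ._EE y')) ==> y = y'"
  by (rule EE_dual) blast
 interpret R: ring dalg by (rule ring_dalg)
 interpret E: right_module dalg EE by (rule D.MC_rm[OF EE(1)])
 have main: "\<exists>k\<in>D.mh N EE. \<forall>n\<in>N. th (k n) = xi (e1 ._N n)"
  if N: "N\<in>D.MC" and X: "functional K (D.us N) xi" for N xi
 proof -
 interpret N: right_module dalg N by (rule D.MC_rm[OF N])
 note x = X[unfolded functional_iff[OF field_K] D.us_simps]
 have ee: "e1 *_dalg e1 = e1" by (simp cong: restrict_cong)
 \<comment> \<open>The value of the homomorphism at \<open>n\<close> is the element of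
   \<open>EE\<close> representing \<open>v \<mapsto> xi (n v e1)\<close>, in right module notation.
   Since \<open>th\<close> determines elements of \<open>EE\<close>, the chosen values are additive
   and linear.\<close>
 have ex: "\<exists>y\<in>EE. \<forall>v\<in>dalg. th (v ._EE y) = xi ((v *_dalg e1) ._N n)" if n: "n\<in>N" for n
 proof (rule t(3))
  have c: "v *_dalg e1\<in>dalg" if "v\<in>dalg" for v using R.m_closed[OF that e_closed(1)] .
  show "functional K dalg (%v. xi ((v *_dalg e1) ._N n))" unfolding functional_iff[OF field_K]
  proof (intro conjI ballI)
   fix v assume v: "v\<in>dalg"
   show "xi ((v *_dalg e1) ._N n)\<in>K" using x N.ract_closed[OF c[OF v] n] by blast
   show "xi (((v +_dalg w) *_dalg e1) ._N n) = xi ((v *_dalg e1) ._N n) +_K xi ((w *_dalg e1) ._N n)"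
    if w: "w\<in>dalg" for w
    using x N.ract_closed[OF c[OF v] n] N.ract_closed[OF c[OF w] n] N.ract_add_ring[OF c[OF v] c[OF w] n] R.l_distr[OF v w e_closed(1)]
    by metis
   show "xi (((k ._dalg v) *_dalg e1) ._N n) = k *_K xi ((v *_dalg e1) ._N n)" if k: "k\<in>K" for k
   proof -
    have "(k ._dalg v) *_dalg e1 = (v *_dalg e1) *_dalg D.sc k"
     using D.alg_smult(1)[OF k v e_closed(1)] D.sc_facts(5)[OF k c[OF v]] by simp
    thus ?thesis using N.ract_mult[OF c[OF v] D.sc_facts(1)[OF k] n] x k N.ract_closed[OF c[OF v] n] by metis
   qed
  qed
  show "xi (((v *_dalg e1) *_dalg e1) ._N n) = xi ((v *_dalg e1) ._N n)" if "v\<in>dalg" for v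
   using R.m_assoc[OF that e_closed(1) e_closed(1)] ee by simp
 qed
 define Q where "Q n y <-> y\<in>EE & (\<forall>v\<in>dalg. th (v ._EE y) = xi ((v *_dalg e1) ._N n))" for n y
 define k where "k n = (SOME y. Q n y)" for n
 have "\<exists>y. Q n y" if "n\<in>N" for n using ex[OF that] unfolding Q_def by blast
 hence k: "Q n (k n)" if "n\<in>N" for n unfolding k_def using someI_ex that by metis
 note k = k[unfolded Q_def]
 note kc = k[THEN conjunct1] and kt = k[THEN conjunct2, rule_format]
 note tl = t(1)[unfolded functional_iff[OF field_K] D.us_simps]
 have "k\<in>D.mh N EE"
 proof (rule homI)
  show "k n\<in>EE" if "n\<in>N" for n using kc[OF that] .
  fix n assume n: "n\<in>N"
  show "k (n +_N n') = k n +_EE k n'" if n': "n'\<in>N" for n'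
  proof (rule t(4))
   fix v assume v: "v\<in>dalg"
   have c: "v *_dalg e1\<in>dalg" using R.m_closed[OF v e_closed(1)] .
   have "th (v ._EE k (n +_N n')) = xi ((v *_dalg e1) ._N n) +_K xi ((v *_dalg e1) ._N n')"
    using kt[OF _ v, of "n +_N n'"] N.M.a_closed[OF n n'] N.ract_add[OF c n n'] x N.ract_closed[OF c n] N.ract_closed[OF c n'] by metis
   also have "\<dots> = th (v ._EE k n +_EE v ._EE k n')"
    using kt[OF n v] kt[OF n' v] tl E.ract_closed[OF v kc[OF n]] E.ract_closed[OF v kc[OF n']] by metis
   finally show "th (v ._EE k (n +_N n')) = th (v ._EE (k n +_EE k n'))"
    using E.ract_add[OF v kc[OF n] kc[OF n']] by simp
  qed (use kc n n' N.M.a_closed E.M.a_closed in auto)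
  show "k (u ._N n) = u ._EE k n" if u: "u\<in>dalg" for u
  proof (rule t(4))
   fix v assume v: "v\<in>dalg"
   have c: "v *_dalg e1\<in>dalg" using R.m_closed[OF v e_closed(1)] .
   have "th (v ._EE k (u ._N n)) = xi ((v *_dalg e1) ._N (u ._N n))" by (rule kt[OF N.ract_closed[OF u n] v])
   also have "\<dots> = th ((u *_dalg v) ._EE k n)"
    using kt[OF n R.m_closed[OF u v]] N.ract_mult[OF u c n] R.m_assoc[OF u v e_closed(1)] by simp
   finally show "th (v ._EE k (u ._N n)) = th (v ._EE (u ._EE k n))"
    using E.ract_mult[OF u v kc[OF n]] by simp
  qed (use kc[OF n] kc[OF N.ract_closed[OF u n]] E.ract_closed[OF u] in auto)
 qed
 moreover have "th (k n) = xi (e1 ._N n)" if n: "n\<in>N" for n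
  using kt[OF n e_closed(1)] t(2)[OF kc[OF n]] ee by simp
 ultimately show ?thesis by blast
 qed
 show ?thesis using that[of th] t(1,2,4) main by blast
qed

text \<open>Composing \<open>h\<close> with \<open>th\<close> gives a functional on the image of
  \<open>i\<close>; its extension to \<open>N\<close> is turned back into a homomorphism by
  \<open>EE_coind\<close>.\<close>

lemma EE_injective:
 assumes M: "M\<in>D.MC" and N: "N\<in>D.MC" and i: "i\<in>D.mh M N" "inj_on i M"
 shows "D.E0 M N i EE"
 unfolding D.E0_def
proof
 fix h assume h: "h\<in>D.mh M EE"
 obtain th where t: "functional K (D.us EE) th" "!!y. y\<in>EE ==> th (e1 ._EE y) = th y"
  "!!y y'. y\<in>EE ==> y'\<in>EE ==> (!!v. v\<in>dalg ==> th (v ._EE y) = th (v ._EE y')) ==> y = y'"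
  "!!N xi. N\<in>D.MC ==> functional K (D.us N) xi ==> \<exists>k\<in>D.mh N EE. \<forall>n\<in>N. th (k n) = xi (e1 ._N n)"
  by (rule EE_coind) blast
 interpret M: right_module dalg M by (rule D.MC_rm[OF M])
 interpret E: right_module dalg EE by (rule D.MC_rm[OF EE(1)])
 let ?S = "i ` M"
 have S: "D.sbm ?S N" by (rule D.sbm_image[OF i(1) M N])
 have b: "bij_betw i (carrier M) (carrier (N(|carrier:=?S|)))" using i(2) by (simp add: bij_betw_def)
 have i': "i\<in>D.mh M (N(|carrier:=?S|))" by (rule module_hom_codom[OF i(1)]) auto
 note j = hom_inv[OF i' b D.MC_rm[OF M]]
 have "functional K ((D.us N)(|carrier:=?S|)) (%s. th (h (inv_into (carrier M) i s)))"
  using hom_comp[OF D.hom_us[OF hom_comp[OF j(1) h]] t(1)] by simp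
 then obtain xi where xi: "functional K (D.us N) xi" "!!s. s\<in>?S ==> xi s = th (h (inv_into (carrier M) i s))"
  using functional_extend[OF _ D.subspace_us[OF D.MC_rm[OF N] S]] N unfolding D.MC_iff by blast
 have xd: "xi (i m) = th (h m)" if "m\<in>M" for m using xi(2)[of "i m"] j(3)[OF that] that by simp
 obtain k where k: "k\<in>D.mh N EE" "\<forall>n\<in>N. th (k n) = xi (e1 ._N n)" using t(4)[OF N xi(1)] by blast
 have "k (i m) = h m" if m: "m\<in>M" for m
 proof (rule t(3))
  note im = D.hom_closed[OF i(1) m] and hm = D.hom_closed[OF h m]
  fix v assume v: "v\<in>dalg"
  note vm = M.ract_closed[OF v m]
  have "th (v ._EE k (i m)) = xi (i (e1 ._M (v ._M m)))"
   using homD(3)[OF k(1) v im] homD(3)[OF i(1) v m] homD(3)[OF i(1) e_closed(1) vm]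
    k(2)[rule_format, OF D.hom_closed[OF i(1) vm]] by simp
  also have "\<dots> = th (e1 ._EE (v ._EE h m))"
   using xd[OF M.ract_closed[OF e_closed(1) vm]] homD(3)[OF h e_closed(1) vm] homD(3)[OF h v m] by simp
  finally show "th (v ._EE k (i m)) = th (v ._EE h m)" using t(2)[OF E.ract_closed[OF v hm]] by simp
 qed (use D.hom_closed[OF k(1) D.hom_closed[OF i(1) m]] D.hom_closed[OF h m] in auto)
 thus "\<exists>k\<in>D.mh N EE. \<forall>m\<in>M. k (i m) = h m" using k(1) by blast
qed

lemma Sm_EE:
 assumes "D.Sm {EE} Q"
 shows "D.pj Q" "Z\<in>MC ==> D.homz Q (infl Z)"
  "M\<in>D.MC ==> N\<in>D.MC ==> i\<in>D.mh M N ==> inj_on i M ==> D.E0 M N i Q"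
proof -
 show "D.pj Q" using D.Sm_pj[OF assms] EE_pj by blast
 show "D.homz Q (infl Z)" if Z: "Z\<in>MC"
  using assms
 proof (induction rule: D.Sm.induct)
  case Sm_zmod
  show ?case unfolding D.homz_def using D.hom_zero[OF _ D.MC_zmod infl_MC[OF Z]] by auto
 next
  case (Sm_bsum U N)
  have m: "U\<in>D.MC" "N\<in>D.MC" using Sm_bsum EE(1) D.Sm_MC[of "{EE}" N] by auto
  have z: "D.homz U (infl Z)" using Sm_bsum EE_homz[OF Z] by simp
  note b = bsum_homs[OF D.MC_rm[OF m(1)] D.MC_rm[OF m(2)]]
  show ?case unfolding D.homz_def
  proof (intro ballI)
   fix w x assume w: "w\<in>D.mh (U [+] N) (infl Z)" and x: "x\<in>(U [+] N)"
   have "w (jn (pr1 x) 0_N +_(U [+] N) jn 0_U (pr2 x)) = 0_Z +_Z 0_Z"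
    using homD(2)[OF w, of "jn (pr1 x) 0_N" "jn 0_U (pr2 x)"] x m
     D.homzD[OF z hom_comp[OF b(3) w], of "pr1 x"] D.homzD[OF Sm_bsum.IH hom_comp[OF b(4) w], of "pr2 x"]
    by (simp del: bsum_simps(3))
   thus "w x = 0_(infl Z)" using x m Z by simp
  qed
 qed
 show "D.E0 M N i Q" if "M\<in>D.MC" "N\<in>D.MC" "i\<in>D.mh M N" "inj_on i M"
  by (rule D.E0_Sm[OF assms]) (use EE(1) EE_injective[OF that] in auto)
qed

text \<open>A functional that is 1 at \<open>x\<close> induces a map to \<open>EE\<close>. As
  \<open>e1\<close> acts as the identity on an inflated module, the map does not vanish at
  \<open>x\<close>.\<close>

lemma EE_separates:
 assumes M: "M\<in>MC" and x: "x\<in>M" "x ~= 0_M"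
 shows "\<exists>h\<in>D.mh (infl M) EE. h x ~= 0_EE"
proof -
 obtain th where t: "functional K (D.us EE) th"
  "!!N xi. N\<in>D.MC ==> functional K (D.us N) xi ==> \<exists>k\<in>D.mh N EE. \<forall>n\<in>N. th (k n) = xi (e1 ._N n)"
  by (rule EE_coind) blast
 interpret K: field K by (rule field_K)
 interpret M: right_module A M by (rule MC_rm[OF M])
 have f: "fdvs K (D.us (infl M))" using infl_MC[OF M] by (simp add: D.MC_iff)
 have S: "subspace K {0_M} (D.us (infl M))"
  by (rule subspaceI) (use f in \<open>auto simp: fdvs_def D_sc sc_facts\<close>)
 obtain xi where xi: "functional K (D.us (infl M)) xi" "xi x = 1_K"
  using functional_separate[OF f S, of x] x by auto
 obtain k where k: "k\<in>D.mh (infl M) EE" "\<forall>n\<in>(infl M). th (k n) = xi (e1 ._(infl M) n)"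
  using t(2)[OF infl_MC[OF M] xi(1)] by blast
 have "th (k x) = 1_K" using k(2) x(1) xi(2) M.ract_one by simp
 moreover have "th 0_EE = 0_K" using functional_zero[OF D.vs_us[OF D.MC_rm[OF EE(1)]] t(1)] by simp
 ultimately have "k x ~= 0_EE" by auto
 thus ?thesis using k(1) by blast
qed

text \<open>As long as the kernel is nonzero, a further map to \<open>EE\<close> makes it strictly
  smaller.\<close>

lemma infl_embeds:
 assumes M: "M\<in>MC"
 obtains Q j where "D.Sm {EE} Q" "j\<in>D.mh (infl M) Q" "inj_on j M"
proof -
 define ker where "ker Q j = (infl M)(|carrier:={x\<in>M. j x = 0_Q}|)" for Q :: "('k, 'a \<times> ('a \<Rightarrow> 'k) \<times> 'a) rmod" and j
 have im: "infl M\<in>D.MC" using M by simp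
 have "\<exists>Q j. D.Sm {EE} Q & j\<in>D.mh (infl M) Q & inj_on j M"
  if "D.Sm {EE} Q" "j\<in>D.mh (infl M) Q" for Q j
  using that
 proof (induction "D.dm (ker Q j)" arbitrary: Q j rule: less_induct)
  case less
  have Q: "Q\<in>D.MC" using D.Sm_MC[OF less(2)] EE(1) by simp
  have sk: "D.sbm {x\<in>M. j x = 0_Q} (infl M)" using D.sbm_kernel[OF less(3) im Q] by simp
  show ?case
  proof (cases "\<exists>x\<in>M. j x = 0_Q & x ~= 0_M")
   case False
   hence "inj_on j M" using hom_more(7)[OF less(3) D.MC_rm[OF im] D.MC_rm[OF Q]] by auto
   thus ?thesis using less(2,3) by blast
  next
   case True
   then obtain x where x: "x\<in>M" "j x = 0_Q" "x ~= 0_M" by blast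
   obtain h where h: "h\<in>D.mh (infl M) EE" "h x ~= 0_EE" using EE_separates[OF M x(1,3)] by blast
   let ?j = "%x. jn (h x) (j x)"
   have hj: "?j\<in>D.mh (infl M) (EE [+] Q)" by (rule bsum_pair[OF h(1) less(3)])
   have EQ: "EE [+] Q\<in>D.MC" using EE(1) Q by simp
   have sm: "D.Sm {EE} (EE [+] Q)" using D.Sm_bsum[OF _ less(2)] by simp
   let ?U = "{x\<in>M. j x = 0_Q}" and ?V = "{y\<in>M. ?j y = 0_(EE [+] Q)}"
   note U = D.sbmD[OF sk im]
   have sV: "D.sbm ?V (infl M)" using D.sbm_kernel[OF hj im EQ] by simp
   have VU: "?V \<subset> ?U" using x h(2) by auto
   have "D.sbm ?V ((infl M)(|carrier:=?U|))"
    by (rule right_module.right_submoduleI[OF D.MC_rm[OF U(6)]])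
     (use VU D.sbmD[OF sV im] in auto)
   from D.dm_sub[OF U(6) this] VU have "D.dm (ker (EE [+] Q) ?j) < D.dm (ker Q j)"
    unfolding ker_def by auto
   thus ?thesis using less(1)[OF _ sm hj] by blast
  qed
 qed
 from this[OF D.Sm_zmod hom_0[OF D.MC_rm[OF D.MC_zmod]]] show ?thesis using that by blast
qed

text \<open>The reflection of \<open>N\<close> is its largest inflated quotient \<open>N / N e2 dalg\<close>.\<close>

definition reflects where
 "reflects N R r <-> R\<in>MC & r\<in>D.mh N (infl R) & r ` N = carrier R &
   D.gen {EE} (N(|carrier:={x\<in>N. r x = 0_R}|))"

text \<open>The last clause is the universal property: the kernel of \<open>r\<close> is generated
  by \<open>EE\<close>, which has no nonzero map to an inflated module.\<close>

lemma reflectsD: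
 assumes "reflects N R r" and N: "N\<in>D.MC"
 shows "R\<in>MC" "r\<in>D.mh N (infl R)" "r ` N = carrier R"
  "N(|carrier:={x\<in>N. r x = 0_R}|)\<in>D.MC" "D.gen {EE} (N(|carrier:={x\<in>N. r x = 0_R}|))"
  "Z\<in>MC ==> h\<in>D.mh N (infl Z) ==> \<exists>k\<in>mh R Z. \<forall>x\<in>N. k (r x) = h x"
proof -
 show R: "R\<in>MC" and r: "r\<in>D.mh N (infl R)" and s: "r ` N = carrier R"
  and g: "D.gen {EE} (N(|carrier:={x\<in>N. r x = 0_R}|))"
  using assms(1) by (auto simp: reflects_def)
 let ?U = "{x\<in>N. r x = 0_R}" let ?k = "N(|carrier:=?U|)"
 have sU: "D.sbm ?U N" using D.sbm_kernel[OF r N infl_MC[OF R]] by simp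
 note U = D.sbmD[OF sU N]
 show "?k\<in>D.MC" by (rule U(6))
 show "\<exists>k\<in>mh R Z. \<forall>x\<in>N. k (r x) = h x" if Z: "Z\<in>MC" and h: "h\<in>D.mh N (infl Z)"
 proof -
  have hU: "h\<in>D.mh ?k (infl Z)" by (rule module_hom_dom[OF h]) (use U(1) in blast)
  let ?V = "{x\<in>carrier ?k. h x = 0_(infl Z)}"
  have sV: "D.sbm ?V ?k" by (rule D.sbm_kernel[OF hU U(6) infl_MC[OF Z]])
  have "\<forall>W\<in>{EE}. \<forall>g\<in>D.mh W ?k. g ` W <= ?V"
  proof (intro ballI subsetI)
   fix W g y assume W: "W\<in>{EE}" and g: "g\<in>D.mh W ?k" and "y\<in>g ` W"
   then obtain w where w: "w\<in>EE" "y = g w" by auto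
   have "h (g w) = 0_Z" using EE_infl_zero[OF hom_comp[OF _ hU] Z w(1)] g W by simp
   thus "y\<in>?V" using D.hom_closed[OF g] w W by simp
  qed
  hence kV: "carrier ?k <= ?V" using g sV unfolding D.gen_def by blast
  obtain k where k: "k\<in>D.mh (infl R) (infl Z)" "!!x. x\<in>N ==> k (r x) = h x"
   by (rule D.factor_surj[OF D.MC_rm[OF N] D.MC_rm[OF infl_MC[OF R]] D.MC_rm[OF infl_MC[OF Z]] r _ h])
    (use s kV in auto)
  thus ?thesis by auto
 qed
qed

text \<open>The trace of \<open>EE\<close> contains every \<open>e2 ._N x\<close>, so
  \<open>e2\<close> acts as zero on the quotient by it.\<close>

lemma reflects_exists:
 assumes N: "N\<in>D.MC"
 obtains R r where "reflects N R r"
proof -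
 interpret N: right_module dalg N by (rule D.MC_rm[OF N])
 have E: "{EE} <= D.MC" using EE(1) by simp
 obtain U where U: "D.sbm U N" "!!W h. W\<in>{EE} ==> h\<in>D.mh W N ==> h ` carrier W <= U" "D.gen {EE} (N(|carrier:=U|))"
  by (rule D.trace_exists[OF E N]) blast
 obtain w where w: "w\<in>EE" "!!N x. N\<in>D.MC ==> x\<in>N ==> e2 ._N x = x ==> \<exists>h\<in>D.mh EE N. h w = x"
  by (rule EE_generator) blast
 have eU: "e2 ._N x\<in>U" if x: "x\<in>N" for x
 proof -
  obtain h where h: "h\<in>D.mh EE N" "h w = e2 ._N x" using w(2)[OF N N.ract_closed[OF e_closed(2) x] e2_idem[OF N x]] by blast
  show ?thesis using subsetD[OF U(2)[OF singletonI h(1)] imageI[OF w(1)]] h(2) by simp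
 qed
 obtain Q q where Q: "Q\<in>D.MC" "q\<in>D.mh N Q" "q ` N = carrier Q" "!!x. x\<in>N ==> q x = 0_Q <-> x\<in>U"
  by (rule D.quotient_exists[OF N U(1)]) blast
 have "e2 ._Q y = 0_Q" if y: "y\<in>Q" for y
 proof -
  obtain x where x: "x\<in>N" "y = q x" using y Q(3) by auto
  thus ?thesis using homD(3)[OF Q(2) e_closed(2) x(1)] Q(4)[OF N.ract_closed[OF e_closed(2) x(1)]] eU[OF x(1)] by simp
 qed
 then obtain R where R: "R\<in>MC" "(%x. x)\<in>D.mh Q (infl R)" "carrier R = carrier Q" "0_R = 0_Q"
  by (rule infl_of_e2_zero[OF Q(1)]) blast+
 have ker: "{x\<in>N. q x = 0_R} = U" using Q(4) R(4) D.sbmD(1)[OF U(1) N] by auto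
 have "reflects N R q"
  unfolding reflects_def ker using R(1) Q(3) R(3) hom_comp[OF Q(2) R(2)] U(3) by simp
 thus ?thesis by (rule that)
qed

end

context fdalg begin

section \<open>Generation, and independence of the chosen presentation\<close>

lemma gen_trans:
 assumes "gen C N" "gen {N} L" "C <= MC" "N\<in>MC" "L\<in>MC"
 shows "gen C L"
 unfolding gen_def
proof (intro allI impI)
 fix V assume V: "sbm V L" and im: "\<forall>U\<in>C. \<forall>h\<in>mh U L. h ` U <= V"
 have "h ` N <= V" if h: "h\<in>mh N L" for h
 proof -
  have s: "sbm {x\<in>N. h x\<in>V} N" by (rule hom_more(6)[OF h MC_rm[OF assms(4)] MC_rm[OF assms(5)] V])
  have "k ` U <= {x\<in>N. h x\<in>V}" if U: "U\<in>C" "k\<in>mh U N" for U k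
   using bspec[OF bspec[OF im U(1)] hom_comp[OF U(2) h]] hom_closed[OF U(2)] by auto
  hence "carrier N <= {x\<in>N. h x\<in>V}" using assms(1) s unfolding gen_def by blast
  thus ?thesis by blast
 qed
 thus "carrier L <= V" using assms(2) V unfolding gen_def by blast
qed

lemma gen_sub:
 assumes "gen C (N(|carrier:=U|))" "sbm U N" "N\<in>MC" "sbm V N" "\<forall>W\<in>C. \<forall>h\<in>mh W N. h ` W <= V"
 shows "U <= V"
proof -
 note U = sbmD[OF assms(2,3)] and V = sbmD[OF assms(4,3)]
 have "sbm (V \<inter> U) (N(|carrier:=U|))"
  by (rule right_module.right_submoduleI[OF MC_rm[OF U(6)]]) (use U V in auto)
 moreover have "h ` W <= V \<inter> U" if "W\<in>C" "h\<in>mh W (N(|carrier:=U|))" for W h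
  using bspec[OF bspec[OF assms(5) that(1)] hom_comp[OF that(2) U(7)]] hom_closed[OF that(2)] by auto
 ultimately have "carrier (N(|carrier:=U|)) <= V \<inter> U" using assms(1) unfolding gen_def by blast
 thus ?thesis by simp
qed

lemma gen_sd: "sd U T ==> gen {T} U"
 unfolding gen_def sd_def
proof (intro allI impI subsetI)
 fix V x assume "\<exists>i\<in>mh U T. \<exists>p\<in>mh T U. \<forall>x\<in>U. p (i x) = x" "\<forall>W\<in>{T}. \<forall>h\<in>mh W U. h ` W <= V" "x\<in>U"
 then obtain i p where "i\<in>mh U T" "p ` T <= V" "p (i x) = x" by auto
 thus "x\<in>V" using hom_closed[of i U T x] \<open>x \<in> carrier U\<close> by (metis image_subset_iff)
qed

lemma gen_summands:
 assumes "N\<in>MC" "\<forall>U. ind U --> sd U N --> gen C U"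
 shows "gen C N"
 using assms
proof (induction rule: decomp_induct)
 case (zero Z)
 thus ?case unfolding gen_def zero_module_def by (auto dest: sbmD(2))
next
 case (sum M U N i1 i2 p1 p2)
 have h: "i1\<in>mh U M" "i2\<in>mh N M" "p1\<in>mh M U" "p2\<in>mh M N"
  "!!z. z\<in>M ==> i1 (p1 z) +_M i2 (p2 z) = z" using sum(4) by (auto simp: bip_def)
 have um: "U\<in>MC" using sum(3) by (rule indD(1))
 have g: "gen C U" "gen C N" using sum(3,5,6) bip_sd[OF sum(4)] sd_trans by blast+
 show ?case unfolding gen_def
 proof (intro allI impI subsetI)
  fix V z assume V: "sbm V M" and im: "\<forall>W\<in>C. \<forall>h\<in>mh W M. h ` W <= V" and z: "z\<in>M"
  have "i ` L <= V" if i: "i\<in>mh L M" and L: "L\<in>MC" "gen C L" for i L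
  proof -
   have "k ` W <= {x\<in>L. i x\<in>V}" if "W\<in>C" "k\<in>mh W L" for W k
    using bspec[OF bspec[OF im that(1)] hom_comp[OF that(2) i]] hom_closed[OF that(2)] by auto
   thus ?thesis
    using L(2) hom_more(6)[OF i MC_rm[OF L(1)] MC_rm[OF sum(1)] V] unfolding gen_def by blast
  qed
  from this[OF h(1) um g(1)] this[OF h(2) sum(2) g(2)]
  have "i1 (p1 z)\<in>V" "i2 (p2 z)\<in>V" using hom_closed[OF h(3) z] hom_closed[OF h(4) z] by auto
  thus "z\<in>V" using sbmD(3)[OF V sum(1)] h(5)[OF z] by metis
 qed
qed

lemma hd_sd: "sd V P ==> V\<in>MC ==> P\<in>MC ==> Z\<in>MC ==> hd V Z <= hd P Z"
proof -
 assume a: "sd V P" "V\<in>MC" "P\<in>MC" "Z\<in>MC"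
 obtain i p where ip: "i\<in>mh V P" "p\<in>mh P V" "!!x. x\<in>V ==> p (i x) = x" using a(1) unfolding sd_def by blast
 obtain N j q where "N\<in>MC" "bip P V N i j p q" by (rule sd_complement[OF a(2,3) ip]) blast+
 thus "hd V Z <= hd P Z" using hd_bip[OF _ a(3,2) _ a(4)] by fastforce
qed

text \<open>\<open>mp\<close> is chosen for each module separately, so isomorphic modules may
  receive different presentations. These are summands of each other, which forces equal
  dimensions.\<close>

lemma gv_iso:
 assumes "mod_iso A U V" "U\<in>MC" "V\<in>MC"
 shows "gv U = gv V"
proof -
 have half: "sd (mp0 U) (mp0 V) & sd (mp1 U) (mp1 V)" if uv: "U\<in>MC" "V\<in>MC" "sd U V" for U V
 proof -
  obtain e where p: "pres (mp1 V) (mp0 V) (mpf V) e V" using mp_pres[OF uv(2)] by blast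
  obtain d where m: "min_proj_presentation K A U (mp1 U) (mp0 U) (mpf U) d" using mp_min[OF uv(1)] by blast
  obtain i q where iq: "i\<in>mh U V" "q\<in>mh V U" "\<forall>x\<in>U. q (i x) = x" using uv(3) by (auto simp: sd_def)
  show ?thesis by (rule compare[OF p uv(1) iq m]) (auto intro: sdI)
 qed
 have s: "sd U V" "sd V U" using assms sd_iso iso_sym by blast+
 have m: "mp1 W\<in>MC & mp0 W\<in>MC" if W: "W\<in>MC" for W using mp_pres[OF W] presD(8,9) by blast
 have "hd (mp0 U) Z = hd (mp0 V) Z" "hd (mp1 U) Z = hd (mp1 V) Z" if "Z\<in>MC" for Z
  using half[OF assms(2,3) s(1)] half[OF assms(3,2) s(2)] hd_sd[of "mp0 U" "mp0 V" Z] hd_sd[of "mp0 V" "mp0 U" Z]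
   hd_sd[of "mp1 U" "mp1 V" Z] hd_sd[of "mp1 V" "mp1 U" Z] m assms that by (auto intro: antisym)
 thus ?thesis by (auto simp: gv_def vf_def hf_def fun_eq_iff)
qed

end

context dupl begin

section \<open>Reflection of projectives, presentations and \<open>Fac\<close>\<close>

lemma reflects_sd:
 assumes r: "reflects N R r" and s: "reflects V S s" and N: "N\<in>D.MC" and V: "V\<in>D.MC" and sd: "D.sd V N"
 shows "sd S R"
proof -
 note rD = reflectsD[OF r N] and sD = reflectsD[OF s V]
 obtain i p where ip: "i\<in>D.mh V N" "p\<in>D.mh N V" "!!x. x\<in>V ==> p (i x) = x" using sd unfolding D.sd_def by blast
 obtain a where a: "a\<in>mh S R" "\<forall>x\<in>V. a (s x) = r (i x)" using sD(6)[OF rD(1) hom_comp[OF ip(1) rD(2)]] by blast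
 obtain b where b: "b\<in>mh R S" "\<forall>x\<in>N. b (r x) = s (p x)" using rD(6)[OF sD(1) hom_comp[OF ip(2) sD(2)]] by blast
 show ?thesis by (rule sdI[OF a(1) b(1)]) (use a(2) b(2) ip(3) D.hom_closed[OF ip(1)] sD(3) in force)
qed

text \<open>Reflection is left adjoint to inflation, which preserves surjections.\<close>

lemma reflects_pj:
 assumes r: "reflects P R r" and P: "D.pj P" shows "pj R"
proof (rule pjI)
 note rD = reflectsD[OF r D.pj_MC[OF P]]
 show "R\<in>MC" by (rule rD(1))
 fix S T g f assume h: "S\<in>MC" "T\<in>MC" "g\<in>mh S T" "f\<in>mh R T" "g ` S = carrier T"
 have fr: "(%x. f (r x))\<in>D.mh P (infl T)" by (rule hom_comp[OF rD(2)]) (use h in simp)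
 obtain k where k: "k\<in>D.mh P (infl S)" "!!p. p\<in>P ==> g (k p) = f (r p)"
  by (rule D.pj_lift[OF P infl_MC[OF h(1)] infl_MC[OF h(2)] _ fr, of g]) (use h D.hom_closed[OF fr] in auto)
 obtain m where m: "m\<in>mh R S" "\<forall>x\<in>P. m (r x) = k x" using rD(6)[OF h(1) k(1)] by blast
 have "g (m y) = f y" if "y\<in>R" for y
  using that rD(3) m(2) k(2) by force
 thus "\<exists>h\<in>mh R S. \<forall>p\<in>R. g (h p) = f p" using m(1) by blast
qed

lemma reflects_hd:
 assumes r: "reflects P R r" and P: "P\<in>D.MC" and L: "L\<in>MC"
 shows "D.hd P (infl L) = hd R L"
proof -
 note rD = reflectsD[OF r P]
 define T where "T g = (\<lambda>x\<in>P. g (r x))" for g :: "(nat \<Rightarrow> 'k) \<Rightarrow> nat \<Rightarrow> 'k"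
 note rc = D.hom_closed[OF rD(2), simplified]
 have Tm: "T g\<in>Hom dalg P (infl L)" if "g\<in>Hom A R L" for g unfolding T_def
  by (rule D.restrict_Hom[OF hom_comp[OF rD(2)] D.MC_rm[OF P]]) (use that in \<open>simp add: Hom_iff\<close>)
 have lin: "T\<in>module_hom K (hs R L) (D.hs P (infl L))"
  by (rule homI) (use Tm in \<open>auto simp: T_def rc D_sc fun_eq_iff\<close>)
 have inj: "inj_on T (carrier (hs R L))"
 proof (rule inj_onI)
  fix g h assume g: "g\<in>carrier (hs R L)" "h\<in>carrier (hs R L)" "T g = T h"
  show "g = h"
  proof (rule Hom_ext[of g R L h])
   fix y assume "y\<in>R"
   then obtain x where "x\<in>P" "y = r x" using rD(3) by auto
   thus "g y = h y" using fun_cong[OF g(3), of x] by (simp add: T_def)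
  qed (use g in simp_all)
 qed
 have "T ` carrier (hs R L) = carrier (D.hs P (infl L))"
 proof (intro equalityI subsetI)
  fix g assume "g\<in>carrier (D.hs P (infl L))"
  hence g: "g\<in>D.mh P (infl L)" "g\<in>extensional P" by (simp_all add: D.Hom_iff)
  obtain k where k: "k\<in>mh R L" "\<forall>x\<in>P. k (r x) = g x" using rD(6)[OF L g(1)] by blast
  have "g = T (restrict k R)"
   by (rule extensionalityI[OF g(2)]) (use k(2) rc in \<open>auto simp: T_def\<close>)
  thus "g\<in>T ` carrier (hs R L)" using restrict_Hom[OF k(1) MC_rm[OF rD(1)]] by simp
 qed (use Tm in auto)
 thus ?thesis
  using fdvs_inj(3)[OF vs_hs[OF MC_rm[OF rD(1)] MC_rm[OF L]] D.fdvs_hs[OF P infl_MC[OF L]] lin inj] by (simp add: D.hd_def hd_def)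
qed

text \<open>A left adjoint is right exact. Exactness at \<open>R0\<close> is tested with the
  quotient \<open>Z\<close> of \<open>R0\<close> by the image of \<open>f'\<close>: the projection
  to \<open>Z\<close> descends to \<open>R\<close>.\<close>

lemma reflects_pres:
 assumes p: "D.pres P1 P0 f e U" and r1: "reflects P1 R1 r1" and r0: "reflects P0 R0 r0" and r: "reflects U R r"
 obtains f' e' where "pres R1 R0 f' e' R" "!!L. L\<in>MC ==> D.E0 P1 P0 f (infl L) ==> E0 R1 R0 f' L"
proof -
 note D = D.presD[OF p]
 note q1 = reflectsD[OF r1 D(8)] and q0 = reflectsD[OF r0 D(9)] and q = reflectsD[OF r D(3)]
 obtain f' where f': "f'\<in>mh R1 R0" "\<forall>x\<in>P1. f' (r1 x) = r0 (f x)" using q1(6)[OF q0(1) hom_comp[OF D(4) q0(2)]] by blast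
 obtain e' where e': "e'\<in>mh R0 R" "\<forall>x\<in>P0. e' (r0 x) = r (e x)" using q0(6)[OF q(1) hom_comp[OF D(5) q(2)]] by blast
 have "pres R1 R0 f' e' R" unfolding pres_def
 proof (intro conjI ballI)
  show "e' ` R0 = carrier R"
  proof (intro equalityI subsetI)
   fix y assume "y\<in>R"
   then obtain x where "x\<in>P0" "y = r (e x)" using q(3) D(6) by (metis (no_types, lifting) imageE)
   thus "y\<in>e' ` R0" using e'(2) q0(3) by (metis image_eqI)
  qed (use hom_closed[OF e'(1)] in auto)
  fix y assume y: "y\<in>R0"
  then obtain x where x: "x\<in>P0" "y = r0 x" using q0(3) by auto
  have s: "sbm (f' ` R1) R0" by (rule sbm_image[OF f'(1) q1(1) q0(1)])
  obtain Z z where Z: "Z\<in>MC" "z\<in>mh R0 Z" "!!y. y\<in>R0 ==> z y = 0_Z <-> y\<in>f' ` R1"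
   by (rule quotient_exists[OF q0(1) s]) blast
  have zr: "(%x. z (r0 x))\<in>D.mh P0 (infl Z)" by (rule hom_comp[OF q0(2)]) (use Z in simp)
  have "z (r0 (f x)) = 0_(infl Z)" if x: "x\<in>P1" for x
  proof -
   have "r1 x\<in>R1" using D.hom_closed[OF q1(2) x] by simp
   hence "z (f' (r1 x)) = 0_Z" using Z(3) hom_closed[OF f'(1)] by blast
   thus ?thesis using bspec[OF f'(2) x] by simp
  qed
  then obtain w where w: "w\<in>D.mh U (infl Z)" "!!y. y\<in>P0 ==> w (e y) = z (r0 y)"
   using D.pres_descend[OF p infl_MC[OF Z(1)] zr] by metis
  obtain k where k: "k\<in>mh R Z" "\<forall>x\<in>U. k (r x) = w x" using q(6)[OF Z(1) w(1)] by blast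
  have kz: "k (e' y) = z y" using x e'(2) k(2) w(2) D.hom_closed[OF D(5) x(1)] by simp
  show "e' y = 0_R <-> y\<in>f' ` R1"
  proof
   assume "e' y = 0_R"
   hence "z y = 0_Z" using kz hom_zero[OF k(1) q(1) Z(1)] by simp
   thus "y\<in>f' ` R1" using Z(3)[OF y] by simp
  next
   assume "y\<in>f' ` R1"
   then obtain u where u: "u\<in>P1" "y = f' (r1 u)" using q1(3) by (metis (no_types, lifting) imageE)
   thus "e' y = 0_R"
    using f'(2) e'(2) D(10)[OF u(1)] D.hom_closed[OF D(4) u(1)] D.hom_zero[OF q(2) D(3) infl_MC[OF q(1)]] by simp
  qed
 qed (use reflects_pj[OF r1 D(1)] reflects_pj[OF r0 D(2)] q(1) f' e' in auto)
 moreover have "E0 R1 R0 f' L" if L: "L\<in>MC" and E: "D.E0 P1 P0 f (infl L)" for L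
  unfolding E0_def
 proof
  fix g assume g: "g\<in>mh R1 L"
  have gr: "(%x. g (r1 x))\<in>D.mh P1 (infl L)" by (rule hom_comp[OF q1(2)]) (use g in simp)
  obtain h where h: "h\<in>D.mh P0 (infl L)" "\<forall>x\<in>P1. h (f x) = g (r1 x)" using bspec[OF E[unfolded D.E0_def] gr] by auto
  obtain k where k: "k\<in>mh R0 L" "\<forall>x\<in>P0. k (r0 x) = h x" using q0(6)[OF L h(1)] by blast
  have "k (f' y) = g y" if "y\<in>R1" for y
  proof -
   obtain x where "x\<in>P1" "y = r1 x" using \<open>y \<in> carrier R1\<close> q1(3) by auto
   thus ?thesis using f'(2) k(2) h(2) D.hom_closed[OF D(4)] by simp
  qed
  thus "\<exists>h\<in>mh R0 L. \<forall>x\<in>R1. h (f' x) = g x" using k(1) by blast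
 qed
 ultimately show ?thesis by (rule that)
qed

text \<open>The kernel of \<open>s\<close> is generated by \<open>EE\<close>, hence by
  \<open>T\<close>, so it lies in every submodule of \<open>N\<close> that contains all images of
  maps from \<open>T\<close>. Rigidity of \<open>T\<close> gives \<open>Ez\<close> for this kernel,
  and therefore maps from \<open>T\<close> to \<open>infl S\<close> lift to
  \<open>N\<close>.\<close>

lemma Fac_reflects:
 assumes T: "T\<in>D.MC" "D.Ez T T" "D.gen {T} EE" and N: "N\<in>D.MC" and r: "reflects T R r" and s: "reflects N S s"
 shows "D.gen {T} N <-> gen {R} S"
proof
 note rD = reflectsD[OF r T(1)] and sD = reflectsD[OF s N]
 assume g: "D.gen {T} N"
 show "gen {R} S" unfolding gen_def
 proof (intro allI impI)
  fix V assume V: "sbm V S" and im: "\<forall>U\<in>{R}. \<forall>h\<in>mh U S. h ` U <= V"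
  have "D.sbm V (infl S)"
   by (rule right_module.right_submoduleI[OF D.MC_rm[OF infl_MC[OF sD(1)]]]) (use sbmD[OF V sD(1)] in auto)
  from hom_more(6)[OF sD(2) D.MC_rm[OF N] D.MC_rm[OF infl_MC[OF sD(1)]] this]
  have W: "D.sbm {x\<in>N. s x\<in>V} N" .
  have "h ` T <= {x\<in>N. s x\<in>V}" if h: "h\<in>D.mh T N" for h
  proof -
   obtain k where k: "k\<in>mh R S" "\<forall>x\<in>T. k (r x) = s (h x)" using rD(6)[OF sD(1) hom_comp[OF h sD(2)]] by blast
   have "k (r x)\<in>V" if "x\<in>T" for x using im k(1) rD(3) that by blast
   thus ?thesis using k(2) D.hom_closed[OF h] by auto
  qed
  hence "carrier N <= {x\<in>N. s x\<in>V}" using g W unfolding D.gen_def by blast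
  hence "s ` N <= V" by auto
  thus "carrier S <= V" using sD(3) by simp
 qed
next
 note rD = reflectsD[OF r T(1)] and sD = reflectsD[OF s N]
 assume g: "gen {R} S"
 let ?k = "N(|carrier:={x\<in>N. s x = 0_S}|)"
 have gk: "D.gen {T} ?k" by (rule D.gen_trans[OF T(3) sD(5) _ EE(1) sD(4)]) (use T(1) in simp)
 have Ek: "D.Ez T ?k" by (rule D.Ez_gen[OF T(2) gk T(1,1) sD(4)])
 obtain e where p: "D.pres (D.mp1 T) (D.mp0 T) (D.mpf T) e T" using D.mp_pres[OF T(1)] by blast
 show "D.gen {T} N" unfolding D.gen_def
 proof (intro allI impI subsetI)
  fix V n assume V: "D.sbm V N" and im: "\<forall>U\<in>{T}. \<forall>h\<in>D.mh U N. h ` U <= V" and n: "n\<in>N"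
  note Vd = D.sbmD[OF V N]
  have kV: "{x\<in>N. s x = 0_S} <= V"
   by (rule D.gen_sub[OF gk _ N V im]) (use D.sbm_kernel[OF sD(2) N infl_MC[OF sD(1)]] in simp)
  have "D.sbm (s ` V) (infl S)" by (rule hom_more(5)[OF sD(2) D.MC_rm[OF N] D.MC_rm[OF infl_MC[OF sD(1)]] V])
  note sd = D.sbmD[OF this infl_MC[OF sD(1)]]
  have W: "sbm (s ` V) S"
  proof (rule right_module.right_submoduleI[OF MC_rm[OF sD(1)]])
   show "a ._S x\<in>s ` V" if "a\<in>A" "x\<in>s ` V" for a x using sd(5)[of "(a, z0, 0_A)" x] that by simp
  qed (use sd in auto)
  have "k ` R <= s ` V" if k: "k\<in>mh R S" for k
  proof -
   have u: "(%x. k (r x))\<in>D.mh T (infl S)" by (rule hom_comp[OF rD(2)]) (use k in simp)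
   obtain w where w: "w\<in>D.mh T N" "!!x. x\<in>T ==> s (w x) = k (r x)"
    by (rule D.lift_along[OF p N infl_MC[OF sD(1)] sD(2) _ _ u]) (use sD(3) Ek in \<open>auto simp: D.Ez_def\<close>)
   hence "w ` T <= V" using im by simp
   have "k (r x)\<in>s ` V" if "x\<in>T" for x using w(2)[OF that] \<open>w ` carrier T \<subseteq> V\<close> that by (metis image_eqI image_subset_iff)
   thus ?thesis using rD(3) by force
  qed
  hence "carrier S <= s ` V" using g W unfolding gen_def by blast
  then obtain v where v: "v\<in>V" "s n = s v" using sD(3) n by blast
  have vN: "v\<in>N" by (rule Vd(1)[OF v(1)])
  have "s (n -_N v) = 0_(infl S)"
   using D.hom_minus[OF sD(2) N infl_MC[OF sD(1)] n vN] v(2) D.hom_closed[OF sD(2) vN] D.MC_closed(6)[OF infl_MC[OF sD(1)]] by metis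
  hence "n -_N v\<in>V" using kV n vN N by auto
  hence "(n -_N v) +_N v\<in>V" using Vd(3) v(1) by blast
  thus "n\<in>V" using n vN N by simp
 qed
qed

end

context fdalg begin

lemma IS_facts:
 assumes "represents R (IS M)" "M\<in>MC"
 shows "U\<in>R ==> ind U" "U\<in>R ==> sd U M" "U\<in>R ==> U\<in>MC" "ind U ==> sd U M ==> \<exists>V\<in>R. mod_iso A U V" "noniso R" "finite R"
 using assms IS_iff[OF assms(2)] IS_MC finite_reps_IS[OF assms(2,1)] unfolding represents_def by auto

lemma represents_AA:
 assumes "represents PR (IS AA)"
 shows "Q\<in>PR ==> pj Q" "\<forall>c. (\<forall>z. (\<Sum>Q\<in>PR. c Q * hf Q z) = 0) --> (\<forall>Q\<in>PR. c Q = 0)"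
proof -
 note i = IS_facts[OF assms AA(1)]
 show pj: "Q\<in>PR ==> pj Q" for Q using pj_sd[OF pj_AA i(3) i(2)] .
 show "\<forall>c. (\<forall>z. (\<Sum>Q\<in>PR. c Q * hf Q z) = 0) --> (\<forall>Q\<in>PR. c Q = 0)"
  using vf_independent(2)[of "{}" _ _ _ _ PR] i(1,5,6) pj by (auto simp: noniso_def)
qed

lemma rigid_mrp:
 assumes r: "rigid R C" and n: "card R + card C = num_summands K A (regular_module A)"
 obtains M P where "mrp M P" "represents R (IS M)" "represents C (IS P)" "Sm R M"
proof -
 note d = r[unfolded rigid_def]
 obtain M where M: "M\<in>MC" "mfree M" "Sm R M" "represents R (IS M)" by (rule realize[of R]) (use d in auto)
 obtain P where P: "P\<in>MC" "mfree P" "Sm C P" "represents C (IS P)" by (rule realize[of C]) (use d in auto)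
 have c: "R <= MC" "C <= MC" using d indD(1) by blast+
 have E: "Ez V M" if "V\<in>R" for V using E0_Sm[OF M(3) c(1)] d that unfolding Ez_def by blast
 have z: "homz Q M" if "Q\<in>C" for Q using homz_Sm[OF M(3) c(1)] d that by blast
 have "Ez U M" if U: "ind U" "sd U M" for U
 proof -
  obtain V where "V\<in>R" "sd U V" using Sm_sd[OF M(3) c(1) U] by blast
  thus ?thesis using Ez_sd(1)[OF _ indD(1)[OF U(1)] _ E] c by blast
 qed
 hence "Ez M M" using Ez_summands(1)[OF M(1,1)] by blast
 moreover have "homz Q M" if Q: "ind Q" "sd Q P" for Q
  using Sm_sd[OF P(3) c(2) Q] homz_sd1 z by blast
 hence "homz P M" using homz_summands[OF M(1) P(1)] by blast
 moreover have "pj P" using Sm_pj[OF P(3)] d by blast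
 ultimately have "mrp M P" unfolding mrp_def using M P n by blast
 thus ?thesis using that M P by blast
qed

end

context dupl begin

lemma reflects_infl: "M\<in>MC ==> reflects (infl M) M (%x. x)"
proof -
 assume M: "M\<in>MC"
 have "D.sbm {x\<in>M. x = 0_M} (infl M)"
  using D.sbm_kernel[OF hom_id infl_MC[OF M] infl_MC[OF M]] by simp
 hence "D.gen {EE} (infl M(|carrier:={x\<in>M. x = 0_M}|))"
  unfolding D.gen_def using M D.sbmD[OF _ D.sbmD(6)[OF _ infl_MC[OF M]]] by fastforce
 thus ?thesis unfolding reflects_def using M hom_id[of A M] by simp
qed

lemma hd_infl: "R\<in>MC ==> L\<in>MC ==> D.hd (infl R) (infl L) = hd R L"
 using reflects_hd[OF reflects_infl infl_MC] by blast

text \<open>The elements fixed by \<open>e1\<close> form the largest inflated submodule, which makes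
  this construction right adjoint to inflation.\<close>

lemma corner:
 assumes N: "N\<in>D.MC"
 obtains R where "R\<in>MC" "carrier R = {x\<in>N. e1 ._N x = x}" "(%x. x)\<in>D.mh (infl R) N"
  "!!L k. L\<in>MC ==> k\<in>D.mh (infl L) N ==> k\<in>mh L R"
proof -
 interpret R: ring dalg by (rule ring_dalg)
 interpret N: right_module dalg N by (rule D.MC_rm[OF N])
 note ec = e_closed
 let ?W = "{x\<in>N. e1 ._N x = x}" let ?N = "N(|carrier:=?W|)"
 have W: "D.sbm ?W N"
 proof (rule N.right_submoduleI)
  fix v x assume v: "v\<in>dalg" and x: "x\<in>?W"
  have e: "(e1 *_dalg v) *_dalg e1 = e1 *_dalg v" using v by (auto simp: DA_D cong: restrict_cong)
  have *: "v ._N x = (e1 *_dalg v) ._N x" using N.ract_mult[OF ec(1) v] x by simp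
  hence "e1 ._N (v ._N x) = v ._N x"
   using N.ract_mult[OF R.m_closed[OF ec(1) v] ec(1), of x] x e by simp
  thus "v ._N x\<in>?W" using N.ract_closed[OF v] x by simp
 qed (use N.ract_zero[OF ec(1)] N.ract_add[OF ec(1)] N in auto)
 note Wd = D.sbmD[OF W N]
 have e21: "e1 *_dalg e2 = 0_dalg" by (auto simp: DA_D cong: restrict_cong)
 have e2: "e2 ._?N x = 0_?N" if "x\<in>carrier ?N" for x
  using N.ract_mult[OF ec, of x] N.ract_zero_ring[of x] that unfolding e21 by simp
 obtain R where R: "R\<in>MC" "(%x. x)\<in>D.mh ?N (infl R)" "carrier R = carrier ?N"
  by (rule infl_of_e2_zero[OF Wd(6) e2]) blast+
 have c: "carrier (infl R) = carrier ?N" using R(3) by simp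
 have "(%x. x)\<in>D.mh (infl R) ?N"
  by (rule homI, unfold c) (use homD[OF R(2)] in simp_all)
 hence i: "(%x. x)\<in>D.mh (infl R) N" using hom_comp[OF _ Wd(7)] by fast
 moreover have "k\<in>mh L R" if L: "L\<in>MC" and k: "k\<in>D.mh (infl L) N" for L k
 proof -
  interpret L: right_module A L by (rule MC_rm[OF L])
  have "k x\<in>?W" if "x\<in>(infl L)" for x
   using homD(3)[OF k ec(1) that] D.hom_closed[OF k that] L.ract_one[of x] that by simp
  from hom_comp[OF module_hom_codom[OF k this] R(2)] show ?thesis by simp
 qed
 ultimately show ?thesis using that[of R] R by simp
qed

text \<open>The right adjoint of \<open>corner\<close> preserves surjections: if \<open>g s\<close>
  is fixed by \<open>e1\<close>, then acting on \<open>s\<close> with \<open>e1\<close> gives a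
  fixed preimage.\<close>

lemma infl_pj:
 assumes P: "pj P" shows "D.pj (infl P)"
proof (rule D.pjI)
 show "infl P\<in>D.MC" using P by simp
 fix S T g f assume h: "S\<in>D.MC" "T\<in>D.MC" "g\<in>D.mh S T" "f\<in>D.mh (infl P) T" "g ` S = carrier T"
 interpret S: right_module dalg S by (rule D.MC_rm[OF h(1)])
 obtain R where R: "R\<in>MC" "carrier R = {x\<in>S. e1 ._S x = x}" "(%x. x)\<in>D.mh (infl R) S"
  by (rule corner[OF h(1)]) blast+
 obtain Q where Q: "Q\<in>MC" "carrier Q = {x\<in>T. e1 ._T x = x}" "!!L k. L\<in>MC ==> k\<in>D.mh (infl L) T ==> k\<in>mh L Q"
  by (rule corner[OF h(2)]) blast+
 have g: "g\<in>mh R Q" using Q(3)[OF R(1) hom_comp[OF R(3) h(3)]] by simp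
 have f: "f\<in>mh P Q" using Q(3)[OF pj_MC[OF P] h(4)] .
 have "f p\<in>g ` R" if p: "p\<in>P" for p
 proof -
  have fp: "f p\<in>Q" by (rule hom_closed[OF f p])
  then obtain s where s: "s\<in>S" "f p = g s" using Q(2) h(5) by auto
  have "g (e1 ._S s) = f p" using homD(3)[OF h(3) e_closed(1) s(1)] fp Q(2) s(2) by simp
  moreover have "e1 ._S s\<in>R"
  proof -
   have e: "e1 *_dalg e1 = e1" by (auto simp: DA_D cong: restrict_cong)
   show ?thesis unfolding R(2) using S.ract_mult[OF e_closed(1,1) s(1)] S.ract_closed[OF e_closed(1) s(1)] unfolding e by simp
  qed
  ultimately show ?thesis by (metis image_eqI)
 qed
 then obtain k where k: "k\<in>mh P R" "!!p. p\<in>P ==> g (k p) = f p" by (rule pj_lift[OF P R(1) Q(1) g f]) blast+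
 have "(%x. k x)\<in>D.mh (infl P) S" using hom_comp[OF _ R(3), of k "infl P"] k(1) by simp
 thus "\<exists>h\<in>D.mh (infl P) S. \<forall>p\<in>(infl P). g (h p) = f p" using k(2) by auto
qed

end

context fdalg begin

section \<open>Spans of indices, and the pair of a tilting module\<close>

lemma vf_hf_span: "pj P1 ==> pj P0 ==> represents PR (IS AA) ==> vf P1 P0\<in>fv.span (hf ` PR)"
proof -
 assume a: "pj P1" "pj P0" "represents PR (IS AA)"
 have "vf P1 P0 = hf P0 - hf P1" by (auto simp: vf_def fun_eq_iff)
 thus ?thesis using fv.span_diff hf_in_span[OF a(3)] a(1,2) by metis
qed

lemma vf_span_reps:
 assumes p: "pres P1 P0 f e S" and S: "sd S R" and R: "R\<in>MC" "E0 P1 P0 f R" "represents B (IS R)"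
  and C: "!!Q. ind Q ==> pj Q ==> homz Q R ==> \<exists>Q'\<in>C. mod_iso A Q Q'" "C <= MC"
 shows "vf P1 P0\<in>fv.span (gv ` B \<union> hf ` C)"
proof -
 have "gv ` {U. ind U & sd U S} \<union> hf ` {Q. ind Q & pj Q & (\<forall>L\<in>MC. E0 P1 P0 f L --> homz Q L) & ~ inj_on f P1}
   <= gv ` B \<union> hf ` C"
 proof (intro subsetI)
  fix y assume "y\<in>gv ` {U. ind U & sd U S} \<union> hf ` {Q. ind Q & pj Q & (\<forall>L\<in>MC. E0 P1 P0 f L --> homz Q L) & ~ inj_on f P1}"
  then consider U where "ind U" "sd U S" "y = gv U" | Q where "ind Q" "pj Q" "homz Q R" "y = hf Q" using R(1,2) by blast
  thus "y\<in>gv ` B \<union> hf ` C"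
  proof cases
   case 1
   obtain V where "V\<in>B" "mod_iso A U V" using IS_facts(4)[OF R(3,1) 1(1) sd_trans[OF 1(2) S]] by blast
   thus ?thesis using gv_iso[OF _ indD(1)[OF 1(1)] IS_facts(3)[OF R(3,1)]] 1(3) by auto
  next
   case 2
   obtain V where "V\<in>C" "mod_iso A Q V" using C(1)[OF 2(1-3)] by blast
   thus ?thesis using hf_iso[OF _ indD(1)[OF 2(1)]] C(2) 2(4) by blast
  qed
 qed
 thus ?thesis using vf_span[OF presD(3)[OF p] p] fv.span_mono by blast
qed

text \<open>There are as many independent indices as indecomposable projectives, so they span all
  the functionals \<open>hf Q\<close>.\<close>

lemma rigid_gv_spans:
 assumes r: "rigid R {}" and n: "card R = num_summands K A (regular_module A)" and P: "represents PR (IS AA)"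
 shows "hf ` PR <= fv.span (gv ` R)"
proof -
 note d = r[unfolded rigid_def] and nr = num_regular[OF P]
 define e where "e M = (SOME e. pres (mp1 M) (mp0 M) (mpf M) e M)" for M
 have p: "pres (mp1 U) (mp0 U) (mpf U) (e U) U" if "U\<in>R" for U
  unfolding e_def by (rule someI_ex[OF mp_pres]) (use d that indD(1) in auto)
 show ?thesis
 proof (rule family_spans)
  show "finite R" "finite (hf ` PR)" "card (hf ` PR) <= card R" using d n nr card_image_le by auto
  show "\<forall>c. (\<forall>z. (\<Sum>i\<in>R. c i * gv i z) = 0) --> (\<forall>i\<in>R. c i = 0)"
   using vf_independent(1)[of R mp1 mp0 mpf e "{}"] p d unfolding gv_def Ez_def by (auto simp: noniso_def)
  show "gv ` R <= fv.span (hf ` PR)" using vf_hf_span[OF presD(1,2)[OF p] P] unfolding gv_def by auto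
 qed
qed

end

context dupl begin

text \<open>Restriction of functionals to inflated modules. By adjunction it takes the index of a
  presentation to that of the reflected presentation, and it kills \<open>hf\<close> of the summands
  of \<open>EE\<close>.\<close>

definition "rs v = (%Z. if Z\<in>MC then v (infl Z) else (0 :: rat))"

lemma rs_span: "v\<in>fv.span S ==> rs v\<in>fv.span (rs ` S)"
proof (induction rule: fv.span_induct_alt)
 case base
 have "rs 0 = 0" by (auto simp: rs_def fun_eq_iff)
 thus ?case using fv.span_zero by metis
next
 case (step c x y)
 have "rs ((%z. c * x z) + y) = (%z. c * rs x z) + rs y" by (auto simp: rs_def fun_eq_iff)
 thus ?case using step fv.span_add fv.span_scale fv.span_base by (metis imageI)
qed

lemma rs_hf: "P\<in>MC ==> rs (D.hf (infl P)) = hf P"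
 by (auto simp: rs_def D.hf_def hf_def hd_infl fun_eq_iff)

lemma rs_vf:
 assumes "reflects P1 R1 r1" "reflects P0 R0 r0" "P1\<in>D.MC" "P0\<in>D.MC"
 shows "rs (D.vf P1 P0) = vf R1 R0"
 using reflects_hd[OF assms(1,3)] reflects_hd[OF assms(2,4)] by (auto simp: rs_def D.vf_def vf_def D.hf_def hf_def fun_eq_iff)

text \<open>Each indecomposable summand of \<open>EE\<close> is compatible with \<open>T\<close>: on
  one side because it is projective, on the other because \<open>EE\<close> is injective and the
  minimal presentation of \<open>T\<close> is an injection. By maximality it is a summand of
  \<open>T\<close>.\<close>

lemma tilting_gen:
 assumes m: "D.mrp T zmod" and pd: "D.pd1 T" shows "D.gen {T} EE"
proof (rule D.gen_summands[OF EE(1)], intro allI impI)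
 note d = m[unfolded D.mrp_def]
 fix U assume U: "D.ind U" "D.sd U EE"
 note um = D.indD(1)[OF U(1)]
 have pu: "D.pj U" by (rule D.pj_sd[OF EE_pj um U(2)])
 have T: "T\<in>D.MC" using d by blast
 obtain e where p: "D.pres (D.mp1 T) (D.mp0 T) (D.mpf T) e T" using D.mp_pres[OF T] by blast
 note pD = D.presD[OF p]
 have "D.Ez T EE" unfolding D.Ez_def by (rule EE_injective) (use pD pd in \<open>auto simp: D.pd1_def\<close>)
 hence "D.Ez T U" using D.E0_sd[OF _ U(2)] unfolding D.Ez_def by blast
 moreover have "D.homz (zmod :: ('k, 'a \<times> ('a \<Rightarrow> 'k) \<times> 'a) rmod) U" unfolding D.homz_def using D.hom_zero[OF _ D.MC_zmod um] by auto
 ultimately have "D.sd U T" using D.mrp_summand[OF m U(1)] D.Ez_pj(1)[OF pu] um T by blast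
 thus "D.gen {T} U" by (rule D.gen_sd)
qed

text \<open>\<open>B\<close> represents the summands of \<open>R\<close>, and \<open>C\<close> the
  indecomposable projectives without nonzero maps to \<open>R\<close>. The indices of the summands
  of \<open>T\<close> span \<open>hf\<close> of all projectives over the duplicated algebra.
  Restricted to inflated modules they lie in the span of \<open>gv\<close> on \<open>B\<close> and
  \<open>hf\<close> on \<open>C\<close>, so these are at least as many as the indecomposable
  projectives.\<close>

lemma tilting_pair:
 assumes m: "D.mrp T zmod" and r: "reflects T R r"
 obtains M P where "mrp M P" "!!U. ind U ==> sd U M <-> sd U R"
proof -
 note d = m[unfolded D.mrp_def]
 have T: "T\<in>D.MC" and ET: "D.Ez T T" using d by blast+
 note rD = reflectsD[OF r T]
 have ER: "D.E0 (D.mp1 U) (D.mp0 U) (D.mpf U) (infl R)" if U: "U\<in>D.MC" "D.sd U T" for U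
 proof -
  obtain e where p: "D.pres (D.mp1 U) (D.mp0 U) (D.mpf U) e U" using D.mp_pres[OF U(1)] by blast
  show ?thesis
   by (rule D.E0_quot[OF D.Ez_sd(1)[OF T U ET, unfolded D.Ez_def] D.presD(1)[OF p] T infl_MC[OF rD(1)] rD(2)]) (simp add: rD(3))
 qed
 \<comment> \<open>The reflection of a minimal presentation may fail to be minimal. The excess is
   accounted for by projectives without nonzero maps to \<open>R\<close>, that is, by
   \<open>C\<close>.\<close>
 have refl: "\<exists>R1 R0 f e. pres R1 R0 f e S & E0 R1 R0 f R & rs (D.gv U) = vf R1 R0"
  if U: "U\<in>D.MC" "D.sd U T" and s: "reflects U S s" for U S s
 proof -
  obtain e where p: "D.pres (D.mp1 U) (D.mp0 U) (D.mpf U) e U" using D.mp_pres[OF U(1)] by blast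
  note pD = D.presD[OF p]
  obtain R1 r1 where r1: "reflects (D.mp1 U) R1 r1" by (rule reflects_exists[OF pD(8)]) blast
  obtain R0 r0 where r0: "reflects (D.mp0 U) R0 r0" by (rule reflects_exists[OF pD(9)]) blast
  obtain f' e' where "pres R1 R0 f' e' S" "!!L. L\<in>MC ==> D.E0 (D.mp1 U) (D.mp0 U) (D.mpf U) (infl L) ==> E0 R1 R0 f' L"
   by (rule reflects_pres[OF p r1 r0 s]) blast
  thus ?thesis using ER[OF U] rD(1) rs_vf[OF r1 r0 pD(8,9)] unfolding D.gv_def by blast
 qed
 obtain R1 R0 f e where p: "pres R1 R0 f e R" "E0 R1 R0 f R" using refl[OF T D.sd_refl r] by blast
 obtain B where B: "represents B (IS R)" using reps_IS by blast
 note iR = IS_facts[OF B rD(1)]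
 obtain C where C: "C <= {Q. ind Q & pj Q & homz Q R}" "noniso C" "!!Q. Q\<in>{Q. ind Q & pj Q & homz Q R} ==> \<exists>V\<in>C. mod_iso A Q V"
  by (rule reps_exist[of "{Q. ind Q & pj Q & homz Q R}"]) (use indD(1) in auto)
 have cm: "C <= MC" using C(1) indD(1) by blast
 have "Ez U V" if "U\<in>B" "V\<in>B" for U V
  using E0_sd[OF compare_E0(1)[OF p(1) iR(3,2)[OF that(1)] p(2), unfolded Ez_def] iR(2)[OF that(2)]] unfolding Ez_def .
 moreover have "finite C" by (rule rank_bound(2)[of "{}" _ _ _ _ C]) (use C in \<open>auto simp: noniso_def\<close>)
 moreover have "homz Q U" if "U\<in>B" "Q\<in>C" for U Q
  using homz_sd2[OF _ iR(2,3)[OF that(1)] rD(1)] C(1) that(2) by blast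
 ultimately have rig: "rigid B C" unfolding rigid_def using iR(1,5,6) C(1,2) by blast
 obtain PR where PR: "represents PR (IS AA)" using reps_IS by blast
 obtain PD where PD: "D.represents PD (D.IS D.AA)" using D.reps_IS by blast
 obtain TB where TB: "D.represents TB (D.IS T)" using D.reps_IS by blast
 note iT = D.IS_facts[OF TB T]
 have sp: "D.hf ` PD <= fv.span (D.gv ` TB)"
  by (rule D.rigid_gv_spans[OF _ _ PD]) (use D.mrp_rigid[OF m TB D.reps_zmod] in auto)
 have "card PR <= card (gv ` B \<union> hf ` C)"
 proof (rule family_card_le[OF num_regular(2)[OF PR] represents_AA(2)[OF PR]])
  show "finite (gv ` B \<union> hf ` C)" using rig by (simp add: rigid_def)
  have "rs ` D.gv ` TB <= fv.span (gv ` B \<union> hf ` C)"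
  proof (intro subsetI)
   fix y assume "y\<in>rs ` D.gv ` TB"
   then obtain U where U: "U\<in>TB" "y = rs (D.gv U)" by auto
   note um = iT(3)[OF U(1)] and us = iT(2)[OF U(1)]
   obtain S s where s: "reflects U S s" by (rule reflects_exists[OF um]) blast
   obtain R1 R0 f e where q: "pres R1 R0 f e S" "E0 R1 R0 f R" "y = vf R1 R0" using refl[OF um us s] U(2) by blast
   show "y\<in>fv.span (gv ` B \<union> hf ` C)"
    unfolding q(3) by (rule vf_span_reps[OF q(1) reflects_sd[OF r s T um us] rD(1) q(2) B _ cm]) (use C(3) in blast)
  qed
  from fv.span_minimal[OF this fv.subspace_span]
  have sub: "fv.span (rs ` D.gv ` TB) <= fv.span (gv ` B \<union> hf ` C)" .
  show "hf ` PR <= fv.span (gv ` B \<union> hf ` C)"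
  proof (intro subsetI)
   fix y assume "y\<in>hf ` PR"
   then obtain Q where Q: "pj Q" "y = hf Q" using represents_AA(1)[OF PR] by auto
   have "D.hf (infl Q)\<in>fv.span (D.gv ` TB)"
    using D.hf_in_span[OF PD infl_pj[OF Q(1)]] fv.span_minimal[OF sp fv.subspace_span] by blast
   from rs_span[OF this] show "y\<in>fv.span (gv ` B \<union> hf ` C)" using rs_hf[OF pj_MC[OF Q(1)]] Q(2) sub by auto
  qed
 qed
 also have "\<dots> <= card B + card C"
  using card_Un_le[of "gv ` B" "hf ` C"] card_image_le[of B gv] card_image_le[of C hf] rig by (fastforce simp: rigid_def)
 finally have "card B + card C = num_summands K A (regular_module A)" using rigid_bound[OF rig] num_regular(1)[OF PR] by simp
 then obtain M P where M: "mrp M P" "represents B (IS M)" by (rule rigid_mrp[OF rig]) blast+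
 note iM = IS_facts[OF M(2)]
 have "sd U M <-> sd U R" if U: "ind U" for U
 proof -
  have Mm: "M\<in>MC" using M(1) by (simp add: mrp_def)
  show ?thesis using iM(4)[OF Mm U] iR(4)[OF U] iM(2)[OF Mm] iR(2) sd_trans[OF sd_iso[OF _ indD(1)[OF U]]] by blast
 qed
 thus ?thesis using that M(1) by blast
qed

text \<open>Here \<open>C\<close> is the cokernel of the completed injection \<open>F\<close>, and
  only the properties used in the count are recorded. A summand \<open>P1\<close> of the projective
  component enters with \<open>P0\<close> and \<open>V\<close> equal to \<open>zmod\<close>.\<close>

definition cone where
 "cone P1 P0 f V C v <-> (\<exists>B F c. D.pres (infl P1) B F c C & inj_on F P1 & v = D.vf (infl P1) B &
   (\<forall>R r. reflects C R r --> sd R V & sd V R) &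
   (\<forall>N R r. N\<in>D.MC --> reflects N R r --> E0 P1 P0 f R --> D.E0 (infl P1) B F N))"

lemma cone_exists:
 assumes p: "pres P1 P0 f e V"
 shows "\<exists>C v. cone P1 P0 f V C v & rs v = vf P1 P0"
proof -
 note pD = presD[OF p]
 obtain Q j where Q: "D.Sm {EE} Q" "j\<in>D.mh (infl P1) Q" "inj_on j P1" by (rule infl_embeds[OF pD(8)]) blast
 note Qp = Sm_EE(1,2)[OF Q(1)]
 have m: "infl P1\<in>D.MC" "infl P0\<in>D.MC" "Q\<in>D.MC" "infl V\<in>D.MC" using pD Qp by auto
 let ?B = "infl P0 [+] Q" let ?F = "%x. jn (f x) (j x)"
 have fj: "f\<in>D.mh (infl P1) (infl P0)" "e\<in>D.mh (infl P0) (infl V)" using pD by auto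
 have F: "?F\<in>D.mh (infl P1) ?B" by (rule bsum_pair[OF fj(1) Q(2)])
 have Bm: "?B\<in>D.MC" using m by simp
 note b = bsum_homs[OF D.MC_rm[OF m(2)] D.MC_rm[OF m(3)]]
 obtain C c where C: "C\<in>D.MC" "c\<in>D.mh ?B C" "c ` carrier ?B = carrier C"
  "!!x. x\<in>carrier ?B ==> c x = 0_C <-> x\<in>?F ` carrier (infl P1)"
  by (rule D.quotient_exists[OF Bm D.sbm_image[OF F m(1) Bm]]) blast
 have pr: "D.pres (infl P1) ?B ?F c C" unfolding D.pres_def
  using infl_pj[OF pD(1)] D.pj_bsum[OF infl_pj[OF pD(2)] Qp(1)] C F by auto
 have "inj_on ?F P1" using Q(3) by (auto simp: inj_on_def)
 moreover have "sd R V & sd V R" if r: "reflects C R r" for R r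
 proof -
  note rD = reflectsD[OF r C(1)]
  have wB: "(%z. e (pr1 z))\<in>D.mh ?B (infl V)" by (rule hom_comp[OF b(1) fj(2)])
  obtain w where w: "w\<in>D.mh C (infl V)" "!!z. z\<in>carrier ?B ==> w (c z) = e (pr1 z)"
   by (rule D.pres_descend[OF pr m(4) wB]) (use pD(10) in auto)
  obtain k where k: "k\<in>mh R V" "\<forall>x\<in>C. k (r x) = w x" using rD(6)[OF pD(3) w(1)] by blast
  have rc: "(%z. r (c z))\<in>D.mh ?B (infl R)" by (rule hom_comp[OF C(2) rD(2)])
  \<comment> \<open>\<open>Q\<close> has no nonzero map to an inflated module, so only the component
    in \<open>infl P0\<close> contributes.\<close>
  have rz: "r (c z) = r (c (jn (pr1 z) 0_Q))" if z: "z\<in>carrier ?B" for z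
  proof -
   have "z = jn (pr1 z) 0_Q +_?B jn 0_(infl P0) (pr2 z)" using z m pD(9) by simp
   moreover have "r (c (jn 0_(infl P0) (pr2 z))) = 0_(infl R)"
    by (rule D.homzD[OF Qp(2)[OF rD(1)] hom_comp[OF b(4) rc]]) (use z in simp)
   moreover have "jn (pr1 z) 0_Q\<in>carrier ?B" "jn 0_(infl P0) (pr2 z)\<in>carrier ?B" using z m pD(9) by auto
   ultimately show ?thesis using homD(1,2)[OF rc] D.MC_closed(4)[OF infl_MC[OF rD(1)]] by metis
  qed
  define g where "g p = r (c (jn p 0_Q))" for p
  have "g\<in>D.mh (infl P0) (infl R)" unfolding g_def by (rule hom_comp[OF b(3) rc])
  hence g: "g\<in>mh P0 R" by simp
  have gf: "g (f x) = 0_R" if x: "x\<in>P1" for x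
  proof -
   have "?F x\<in>carrier ?B" using D.hom_closed[OF F] x by auto
   from rz[OF this] have "g (f x) = r (c (?F x))" by (simp add: g_def)
   also have "\<dots> = 0_R" using D.presD(10)[OF pr] x D.hom_zero[OF rD(2) C(1) infl_MC[OF rD(1)]] by simp
   finally show ?thesis .
  qed
  obtain l where l: "l\<in>mh V R" "!!y. y\<in>P0 ==> l (e y) = g y" by (rule pres_descend[OF p rD(1) g gf]) blast+
  have cz: "jn y 0_Q\<in>carrier ?B" if "y\<in>P0" for y using that m by simp
  have kg: "k (g y) = e y" if y: "y\<in>P0" for y
   using k(2) D.hom_closed[OF C(2) cz[OF y]] w(2)[OF cz[OF y]] by (simp add: g_def)
  have "l (k y) = y" if y: "y\<in>R" for y
  proof -
   obtain x where x: "x\<in>c ` carrier ?B" "y = r x" using rD(3) y unfolding C(3) by auto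
   obtain z where z: "z\<in>carrier ?B" "y = r (c z)" by (rule imageE[OF x(1)]) (use x(2) in blast)
   hence "y = g (pr1 z)" "pr1 z\<in>P0" using rz[OF z(1)] by (auto simp: g_def)
   thus ?thesis using kg l(2) by simp
  qed
  moreover have "k (l x) = x" if x: "x\<in>V" for x
  proof -
   obtain y where "y\<in>P0" "x = e y" using pD(6) x by auto
   thus ?thesis using kg l(2) by simp
  qed
  ultimately show ?thesis using sdI[OF k(1) l(1)] sdI[OF l(1) k(1)] by blast
 qed
 moreover have "D.E0 (infl P1) ?B ?F N" if N: "N\<in>D.MC" and r: "reflects N R r" and E: "E0 P1 P0 f R" for N R r
  unfolding D.E0_def
 proof
  note rD = reflectsD[OF r N]
  fix g assume g: "g\<in>D.mh (infl P1) N"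
  have "(%x. r (g x))\<in>mh P1 R" using hom_comp[OF g rD(2)] by simp
  \<comment> \<open>The extension problem is solved after reflection and the solution lifted to
    \<open>N\<close>; the error is a map into the kernel of \<open>r\<close>.\<close>
  then obtain h where h: "h\<in>mh P0 R" "\<forall>x\<in>P1. h (f x) = r (g x)" using bspec[OF E[unfolded E0_def]] by blast
  obtain h' where h': "h'\<in>D.mh (infl P0) N" "!!y. y\<in>(infl P0) ==> r (h' y) = h y"
   by (rule D.pj_lift[OF infl_pj[OF pD(2)] N infl_MC[OF rD(1)] rD(2), of h]) (use h(1) hom_closed[OF h(1)] rD(3) in auto)
  let ?k = "N(|carrier:={x\<in>N. r x = 0_R}|)"
  have sk: "D.sbm {x\<in>N. r x = 0_R} N" using D.sbm_kernel[OF rD(2) N infl_MC[OF rD(1)]] by simp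
  note hf = hom_comp[OF fj(1) h'(1)]
  have d: "(%x. g x -_N h' (f x))\<in>D.mh (infl P1) ?k"
  proof (rule module_hom_codom[OF hom_diff[OF g hf D.MC_rm[OF N]]])
   fix x assume x: "x\<in>(infl P1)"
   note gx = D.hom_closed[OF g x] and hx = D.hom_closed[OF hf x]
   have "r (g x) = r (h' (f x))" using h(2) h'(2) hom_closed[OF pD(4)] x by simp
   thus "g x -_N h' (f x)\<in>{x\<in>N. r x = 0_R}"
    using D.hom_minus[OF rD(2) N infl_MC[OF rD(1)] gx hx] D.hom_closed[OF rD(2) hx] D.MC_closed(6)[OF infl_MC[OF rD(1)]] gx hx N
    by simp
  qed
  \<comment> \<open>This kernel is a quotient of a sum \<open>S\<close> of copies of
    \<open>EE\<close>. The error lifts to \<open>S\<close> because \<open>infl P1\<close> is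
    projective, and the lift extends along the injection \<open>j\<close> because \<open>S\<close>
    is injective.\<close>
  obtain S ro where S: "D.Sm {EE} S" "ro\<in>D.mh S ?k" "ro ` S = carrier ?k"
   by (rule D.gen_Sm[OF _ rD(4,5)]) (use EE(1) in auto)
  have Sm: "S\<in>D.MC" using Sm_EE(1)[OF S(1)] by simp
  obtain d' where d': "d'\<in>D.mh (infl P1) S" "!!x. x\<in>(infl P1) ==> ro (d' x) = g x -_N h' (f x)"
   by (rule D.pj_lift[OF infl_pj[OF pD(1)] Sm rD(4) S(2) d]) (use S(3) D.hom_closed[OF d] in auto)
  obtain t where t: "t\<in>D.mh Q S" "\<forall>x\<in>(infl P1). t (j x) = d' x"
   using Sm_EE(3)[OF S(1) m(1,3) Q(2)] Q(3) d'(1) unfolding D.E0_def by auto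
  have ro: "ro\<in>D.mh S N" using hom_comp[OF S(2) D.sbmD(7)[OF sk N]] .
  have H: "(%z. h' (pr1 z) +_N ro (t (pr2 z)))\<in>D.mh ?B N"
   by (rule hom_add[OF hom_comp[OF b(1) h'(1)] hom_comp[OF hom_comp[OF b(2) t(1)] ro] D.MC_rm[OF N]])
  show "\<exists>h\<in>D.mh ?B N. \<forall>x\<in>(infl P1). h (?F x) = g x"
  proof (rule bexI[OF _ H], intro ballI)
   fix x assume x: "x\<in>(infl P1)"
   show "h' (pr1 (?F x)) +_N ro (t (pr2 (?F x))) = g x"
    using t(2) d'(2)[OF x] x D.MC_closed(10)[OF N D.hom_closed[OF g x] D.hom_closed[OF hf x]] by simp
  qed
 qed
 moreover have "rs (D.vf (infl P1) ?B) = vf P1 P0"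
 proof -
  have "D.hd Q (infl Z) = 0" if Z: "Z\<in>MC" for Z
   by (rule D.hd_zero[OF m(3) infl_MC[OF Z]]) (rule D.homzD[OF Qp(2)[OF Z]])
  hence "D.hd ?B (infl Z) = hd P0 Z" "D.hd (infl P1) (infl Z) = hd P1 Z" if Z: "Z\<in>MC" for Z
   using D.hd_bsum[OF m(2,3) infl_MC[OF Z]] hd_infl[OF pD(9) Z] hd_infl[OF pD(8) Z] Z by auto
  thus ?thesis by (auto simp: rs_def D.vf_def vf_def D.hf_def hf_def fun_eq_iff)
 qed
 ultimately have "cone P1 P0 f V C (D.vf (infl P1) ?B)" unfolding cone_def using pr by blast
 thus ?thesis using \<open>rs (D.vf (infl P1) ?B) = vf P1 P0\<close> by blast
qed

text \<open>An indecomposable projective with zero reflection is generated by \<open>EE\<close>,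
  hence a summand of it. If the reflection is nonzero, it is projective and its inflation splits
  off. The two kinds are disjoint because \<open>EE\<close> has no nonzero map to an inflated
  module.\<close>

lemma dalg_count:
 assumes PR: "represents PR (IS AA)" and EL: "D.represents EL (D.IS EE)"
 shows "num_summands K dalg (regular_module dalg) = card PR + card EL"
proof -
 note iP = IS_facts[OF PR AA(1)] and iE = D.IS_facts[OF EL EE(1)] and pP = represents_AA(1)[OF PR]
 have pE: "D.pj U" if "U\<in>EL" for U using D.pj_sd[OF EE_pj iE(3,2)[OF that]] .
 have no: "~ mod_iso dalg U (infl Q)" "~ mod_iso dalg (infl Q) U" if "U\<in>EL" "Q\<in>PR" for U Q
 proof -
  have Q: "D.ind (infl Q)" using infl_ind[OF iP(3)[OF that(2)]] iP(1)[OF that(2)] by simp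
  show n: "~ mod_iso dalg (infl Q) U"
  proof
   assume "mod_iso dalg (infl Q) U"
   hence "D.sd (infl Q) EE" using D.sd_trans[OF D.sd_iso[OF _ D.indD(1)[OF Q]] iE(2)[OF that(1)]] by blast
   thus False using D.homz_sd1[OF EE_homz[OF iP(3)[OF that(2)]]] D.homz_self[OF Q] by blast
  qed
  thus "~ mod_iso dalg U (infl Q)" using D.iso_sym[OF _ iE(3)[OF that(1)]] by blast
 qed
 have "D.represents (infl ` PR \<union> EL) (D.IS D.AA)" unfolding D.represents_def
 proof (intro conjI ballI)
  show "infl ` PR \<union> EL <= D.IS D.AA"
  proof
   fix U assume "U\<in>infl ` PR \<union> EL"
   hence "D.ind U" "D.pj U" using iE(1) pE iP(1,3) infl_ind infl_pj pP by auto
   thus "U\<in>D.IS D.AA" using D.IS_iff[OF D.AA(1)] D.ind_pj_iff by blast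
  qed
  show "D.noniso (infl ` PR \<union> EL)" unfolding D.noniso_def
   using no iE(5)[unfolded D.noniso_def] iP(5)[unfolded noniso_def] infl_iso by blast
  fix U assume "U\<in>D.IS D.AA"
  hence U: "D.ind U" "D.pj U" using D.IS_iff[OF D.AA(1)] D.ind_pj_iff by auto
  note um = D.indD(1)[OF U(1)]
  obtain R r where r: "reflects U R r" by (rule reflects_exists[OF um]) blast
  note rD = reflectsD[OF r um]
  show "\<exists>V\<in>infl ` PR \<union> EL. mod_iso dalg U V"
  proof (cases "zero_module R")
   case True
   hence "r x = 0_R" if "x\<in>U" for x using rD(1,3) that zero_module_iff by blast
   hence "{x\<in>U. r x = 0_R} = carrier U" by auto
   hence "D.gen {EE} U" using rD(5) by simp
   then obtain S ro where S: "D.Sm {EE} S" "ro\<in>D.mh S U" "ro ` S = carrier U"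
    by (rule D.gen_Sm[OF _ um, rotated]) (use EE(1) in auto)
   have "D.sd U S" by (rule D.surj_onto_pj_splits[OF U(2) D.pj_MC[OF Sm_EE(1)[OF S(1)]] S(2,3)])
   hence "D.sd U EE" using D.Sm_sd[OF S(1) _ U(1)] EE(1) by auto
   thus ?thesis using iE(4)[OF U(1)] by blast
  next
   case False
   obtain V where V: "ind V" "sd V R" by (rule ind_summand_exists[OF rD(1) False]) blast
   have pR: "pj R" by (rule reflects_pj[OF r U(2)])
   have "D.sd (infl R) U" by (rule D.surj_onto_pj_splits[OF infl_pj[OF pR] um rD(2)]) (simp add: rD(3))
   hence s: "D.sd (infl V) U" using V(2) D.sd_trans[of "infl V" "infl R" U] by simp
   obtain Q where Q: "Q\<in>PR" "mod_iso A V Q" using ind_pj_represented[OF PR V(1) pj_sd[OF pR indD(1)[OF V(1)] V(2)]] by blast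
   have iV: "D.ind (infl V)" using infl_ind[OF indD(1)[OF V(1)]] V(1) by simp
   have "mod_iso dalg U (infl V)" using D.iso_sym[OF D.sd_ind_iso[OF iV U(1) s] D.indD(1)[OF iV]] .
   hence "mod_iso dalg U (infl Q)" using mod_iso_trans[of dalg U "infl V" "infl Q"] Q(2) by simp
   thus ?thesis using Q(1) by blast
  qed
 qed
 note n = D.num_regular[OF this]
 have "infl ` PR \<inter> EL = {}" using no(1) mod_iso_refl by blast
 moreover have "inj_on infl PR"
  by (rule inj_onI) (use iP(5) infl_iso mod_iso_refl in \<open>metis noniso_def\<close>)
 ultimately show ?thesis using n card_Un_disjoint[of "infl ` PR" EL] iE(6) iP(6) card_image by fastforce
qed

end

context fdalg begin

section \<open>The correspondence between tilting modules and pairs\<close>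

lemma gen_same_summands:
 assumes "M\<in>MC" "N\<in>MC" "!!U. ind U ==> sd U N ==> sd U M"
 shows "gen {M} N"
 by (rule gen_summands[OF assms(2)]) (use assms(3) gen_sd in blast)

lemma mrp_zmod:
 assumes m: "mrp T P" and P: "represents {} (IS P)"
 shows "mrp T (zmod :: ('k, 'a) rmod)"
proof -
 have T: "T\<in>MC" using m by (simp add: mrp_def)
 obtain R where R: "represents R (IS T)" using reps_IS by blast
 have "homz (zmod :: ('k, 'a) rmod) T" using hom_zero[OF _ MC_zmod T] unfolding homz_def by simp
 thus ?thesis
  unfolding mrp_def using m[unfolded mrp_def] pj_zero[OF MC_zmod zero_zmod] mfree_zmod R reps_zmod mrp_rigid(2)[OF m R P] by blast
qed

end

context dupl begin

text \<open>A relation instead of a function: \<open>M\<close> and the reflection of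
  \<open>T\<close> are only required to generate each other, which by \<open>mrp_antisym\<close>
  determines the pair up to isomorphism.\<close>

definition matches where
 "matches T M <-> (\<exists>R r. reflects T R r & gen {M} R & gen {R} M)"

lemma matches_order:
 assumes T: "D.mrp T zmod" "D.pd1 T" "D.mrp T' zmod" and M: "M\<in>MC" "M'\<in>MC" and m: "matches T M" "matches T' M'"
 shows "D.gen {T} T' <-> gen {M} M'"
proof -
 have t: "T\<in>D.MC" "T'\<in>D.MC" "D.Ez T T" using T unfolding D.mrp_def by blast+
 obtain R r R' r' where r: "reflects T R r" "gen {M} R" "gen {R} M" "reflects T' R' r'" "gen {M'} R'" "gen {R'} M'"
  using m unfolding matches_def by blast
 have "R\<in>MC" "R'\<in>MC" using reflectsD(1) r t by blast+
 hence "gen {R} R' <-> gen {M} M'" using r M gen_trans[of "{M}" R R'] gen_trans[of "{M}" R' M'] gen_trans[of "{R}" M M'] gen_trans[of "{R}" M' R'] by auto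
 thus ?thesis using Fac_reflects[OF t(1,3) tilting_gen[OF T(1,2)] t(2) r(1,4)] by simp
qed

lemma tilting_matches:
 assumes m: "D.mrp T zmod" obtains M P where "mrp M P" "matches T M"
proof -
 have T: "T\<in>D.MC" using m by (simp add: D.mrp_def)
 obtain R r where r: "reflects T R r" by (rule reflects_exists[OF T]) blast
 obtain M P where M: "mrp M P" "!!U. ind U ==> sd U M <-> sd U R" by (rule tilting_pair[OF m r]) blast
 hence "gen {M} R" "gen {R} M"
  using gen_same_summands reflectsD(1)[OF r T] unfolding mrp_def by blast+
 thus ?thesis using that M(1) r unfolding matches_def by blast
qed

text \<open>\<open>\<C>\<close> collects the cones of all suitable presentations of summands of
  \<open>M\<close>, and \<open>\<B>\<close> the indecomposable summands of these cones and of
  \<open>EE\<close>. Representatives \<open>B\<close> of \<open>\<B>\<close> form a rigid family,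
  and comparing spans shows that it has the size of a tilting module.\<close>

lemma pair_matches:
 assumes m: "mrp M P" obtains T where "D.mrp T zmod" "D.pd1 T" "matches T M"
proof -
 note d = m[unfolded mrp_def]
 have M: "M\<in>MC" and P: "P\<in>MC" and EM: "Ez M M" using d by auto
 obtain I J where IJ: "represents I (IS M)" "represents J (IS P)" using reps_IS by metis
 note iI = IS_facts[OF IJ(1) M] and iJ = IS_facts[OF IJ(2) P] and rij = mrp_rigid[OF m IJ]
 define \<C> where "\<C> = {(P1 :: ('k, 'a) rmod, P0 :: ('k, 'a) rmod, f :: (nat \<Rightarrow> 'k) \<Rightarrow> nat \<Rightarrow> 'k, V, C, v). cone P1 P0 f V C v & E0 P1 P0 f M & sd V M}"
 define \<B> where "\<B> = {U. D.ind U & (D.sd U EE \<or> (\<exists>P1 P0 f V C v. (P1, P0, f, V, C, v)\<in>\<C> & D.sd U C))}"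
 obtain B where B: "B <= \<B>" "D.noniso B" "!!U. U\<in>\<B> ==> \<exists>V\<in>B. mod_iso dalg U V"
  by (rule D.reps_exist[of \<B>]) (use D.indD(1) in \<open>auto simp: \<B>_def\<close>)
 have Bi: "D.ind U" if "U\<in>B" for U using B(1) that by (auto simp: \<B>_def)
 note Bm = D.indD(1)[OF Bi]
 \<comment> \<open>Summands of \<open>EE\<close> have zero reflection, and a summand of a cone
   reflects to a summand of the module \<open>V\<close> recorded with the cone.\<close>
 have refB: "sd S M" if U: "U\<in>B" and s: "reflects U S s" for U S s
 proof -
  consider "D.sd U EE" | P1 P0 f V C v where "(P1, P0, f, V, C, v)\<in>\<C>" "D.sd U C" using U B(1) unfolding \<B>_def by blast
  thus ?thesis
  proof cases
   case 1
   note sD = reflectsD[OF s Bm[OF U]]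
   have "D.homz U (infl S)" by (rule D.homz_sd1[OF EE_homz[OF sD(1)] 1])
   hence "\<forall>x\<in>S. x = 0_S" using D.homzD[OF _ sD(2)] sD(3) by fastforce
   hence "\<forall>x\<in>S. 0_S = x" by simp
   thus ?thesis using sdI[OF hom_0[OF MC_rm[OF M], of S] hom_0[OF MC_rm[OF sD(1)], of M]] by blast
  next
   case 2
   then obtain B0 F c where c: "D.pres (infl P1) B0 F c C" "!!R r. reflects C R r ==> sd R V" "sd V M"
    unfolding \<C>_def cone_def by blast
   have C: "C\<in>D.MC" by (rule D.presD(3)[OF c(1)])
   obtain R r where r: "reflects C R r" by (rule reflects_exists[OF C]) blast
   show ?thesis using sd_trans[OF sd_trans[OF reflects_sd[OF r s C Bm[OF U] 2(2)] c(2)[OF r]] c(3)] .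
  qed
 qed
 \<comment> \<open>For summands of cones, the last clause of \<open>cone\<close> reduces
   compatibility with \<open>V\<close> to \<open>E0\<close> over \<open>A\<close> at the reflection
   of \<open>V\<close>, a summand of \<open>M\<close>. Summands of \<open>EE\<close> are
   projective.\<close>
 have EB: "D.Ez U V & D.pd1 U" if U: "U\<in>B" and V: "V\<in>B" for U V
 proof -
  consider "D.sd U EE" | P1 P0 f N C v where "(P1, P0, f, N, C, v)\<in>\<C>" "D.sd U C" using U B(1) unfolding \<B>_def by blast
  thus ?thesis
  proof cases
   case 1
   thus ?thesis using D.Ez_pj[OF D.pj_sd[OF EE_pj Bm[OF U] 1]] Bm[OF V] by blast
  next
   case 2
   then obtain B0 F c where c: "D.pres (infl P1) B0 F c C" "inj_on F P1" "E0 P1 P0 f M"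
    "!!N R r. N\<in>D.MC ==> reflects N R r ==> E0 P1 P0 f R ==> D.E0 (infl P1) B0 F N"
    unfolding \<C>_def cone_def by blast
   obtain S s where s: "reflects V S s" by (rule reflects_exists[OF Bm[OF V]]) blast
   show ?thesis
    using D.compare_E0(1)[OF c(1) Bm[OF U] 2(2) c(4)[OF Bm[OF V] s E0_sd[OF c(3) refB[OF V s]]]]
     D.compare_E0(2)[OF c(1) Bm[OF U] 2(2)] c(2) by simp
  qed
 qed
 define e where "e N = (SOME e. D.pres (D.mp1 N) (D.mp0 N) (D.mpf N) e N)" for N
 have p: "D.pres (D.mp1 U) (D.mp0 U) (D.mpf U) (e U) U" if "U\<in>B" for U
  unfolding e_def by (rule someI_ex[OF D.mp_pres[OF Bm[OF that]]])
 have "finite B"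
  by (rule D.rank_bound(1)[of B D.mp1 D.mp0 D.mpf e "{}"]) (use Bi B(2) p EB in \<open>auto simp: D.noniso_def D.Ez_def\<close>)
 hence rig: "D.rigid B {}" unfolding D.rigid_def using Bi B(2) EB by (auto simp: D.noniso_def)
 have sp: "y\<in>fv.span (D.gv ` B)" if pr: "D.pres Q1 Q0 F c C" "inj_on F Q1" "y = D.vf Q1 Q0"
  and U: "!!U. D.ind U ==> D.sd U C ==> U\<in>\<B>" for Q1 Q0 F c C y
 proof -
  have "D.gv ` {U. D.ind U & D.sd U C} <= D.gv ` B"
  proof
   fix z assume "z\<in>D.gv ` {U. D.ind U & D.sd U C}"
   then obtain U where u: "D.ind U" "D.sd U C" "z = D.gv U" by auto
   obtain V where "V\<in>B" "mod_iso dalg U V" using B(3)[OF U[OF u(1,2)]] by blast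
   thus "z\<in>D.gv ` B" using D.gv_iso[OF _ D.indD(1)[OF u(1)] Bm] u(3) by blast
  qed
  from fv.span_mono[OF this] show ?thesis using D.vf_span[OF D.presD(3)[OF pr(1)] pr(1)] pr(2,3) by auto
 qed
 have lift: "\<exists>v. v\<in>fv.span (D.gv ` B) & rs v = vf P1 P0 & (\<exists>C. (P1, P0, f, V, C, v)\<in>\<C>)"
  if q: "pres P1 P0 f g V" "E0 P1 P0 f M" "sd V M" for P1 P0 f g V
 proof -
  obtain C v where C: "cone P1 P0 f V C v" "rs v = vf P1 P0" using cone_exists[OF q(1)] by blast
  then obtain B0 F c where c: "D.pres (infl P1) B0 F c C" "inj_on F P1" "v = D.vf (infl P1) B0"
   unfolding cone_def by blast
  have i: "(P1, P0, f, V, C, v)\<in>\<C>" using C(1) q(2,3) by (simp add: \<C>_def)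
  have "v\<in>fv.span (D.gv ` B)"
  proof (rule sp[OF c(1) _ c(3)])
   show "U\<in>\<B>" if "D.ind U" "D.sd U C" for U using that i unfolding \<B>_def by blast
  qed (use c(2) in simp)
  thus ?thesis using i C(2) by blast
 qed
 \<comment> \<open>The independent family of the pair over \<open>A\<close>. Every member is the
   restriction of a functional in the span of the indices of \<open>B\<close>. For the projective
   component the sign is changed, since a map from \<open>Q\<close> to zero has index
   \<open>- hf Q\<close>.\<close>
 define w where "w = case_sum (gv :: ('k, 'a) rmod \<Rightarrow> _) hf"
 have "\<exists>v. v\<in>fv.span (D.gv ` B) & rs v = w i" if i: "i\<in>I <+> J" for i
  using i
 proof (cases i)
  case (Inl U)
  hence U: "U\<in>I" using i by auto
  obtain g where g: "pres (mp1 U) (mp0 U) (mpf U) g U" using mp_pres[OF iI(3)[OF U]] by blast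
  have "Ez U M" by (rule Ez_sd(1)[OF M iI(3,2)[OF U] EM])
  thus ?thesis using lift[OF g _ iI(2)[OF U]] Inl by (auto simp: w_def gv_def Ez_def)
 next
  case (Inr Q)
  hence Q: "Q\<in>J" using i by auto
  note pQ = pj_sd[OF _ iJ(3,2)[OF Q]]
  have hz: "homz Q M" "pj Q" using homz_sd1[OF _ iJ(2)[OF Q]] pQ d by blast+
  let ?z = "zmod :: ('k, 'a) rmod"
  have zz: "y = 0_?z" if "y\<in>carrier ?z" for y using that zero_zmod zero_module_iff[OF MC_zmod] by metis
  have "pres Q ?z (%_. 0_?z) (%x. x) ?z" unfolding pres_def
  proof (intro conjI ballI)
   fix y assume y: "y\<in>carrier ?z"
   have "0_Q\<in>Q" using iJ(3)[OF Q] by simp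
   thus "y = 0_?z <-> y\<in>(%_. 0_?z) ` Q" using zz[OF y] by blast
  qed (use hz pj_zero[OF MC_zmod zero_zmod] MC_zmod hom_0[OF MC_rm[OF MC_zmod], of Q] hom_id[of A ?z] in auto)
  moreover have "E0 Q ?z (%_. 0_?z) M" unfolding E0_def
  proof
   fix g assume g: "g\<in>mh Q M"
   show "\<exists>h\<in>mh ?z M. \<forall>x\<in>Q. h 0_?z = g x"
    by (rule bexI[OF _ hom_0[OF MC_rm[OF M]]]) (use homzD[OF hz(1) g] in simp)
  qed
  moreover have "sd ?z M"
   by (rule sdI[OF hom_0[OF MC_rm[OF M]] hom_0[OF MC_rm[OF MC_zmod]]]) (use zz in simp)
  ultimately obtain v where v: "v\<in>fv.span (D.gv ` B)" "rs v = vf Q ?z" using lift by blast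
  have "vf Q ?z = - hf Q" using hf_zero[OF MC_zmod zero_zmod] by (auto simp: vf_def fun_eq_iff)
  hence "rs (- v) = hf Q" using v(2) by (auto simp: rs_def fun_eq_iff split: if_splits)
  thus ?thesis using fv.span_neg[OF v(1)] Inr by (auto simp: w_def)
 qed
 then obtain v where v: "!!i. i\<in>I <+> J ==> v i\<in>fv.span (D.gv ` B)" "!!i. i\<in>I <+> J ==> rs (v i) = w i" by metis
 obtain EL where EL: "D.represents EL (D.IS EE)" using D.reps_IS by blast
 note iE = D.IS_facts[OF EL EE(1)]
 have pE: "D.pj U" if "U\<in>EL" for U using D.pj_sd[OF EE_pj iE(3,2)[OF that]] .
 obtain PR where PR: "represents PR (IS AA)" using reps_IS by blast
 have fin: "finite I" "finite J" "finite EL" using iI(6) iJ(6) iE(6) by auto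
 have "card ((I <+> J) <+> EL) <= card (D.gv ` B)"
 proof (rule family_card_le[of _ "case_sum v D.hf"])
  show "finite ((I <+> J) <+> EL)" "finite (D.gv ` B)" using fin \<open>finite B\<close> by auto
  \<comment> \<open>On inflated modules the functionals of \<open>EL\<close> vanish and
    \<open>v\<close> becomes the independent family \<open>w\<close>, so the coefficients of
    \<open>v\<close> are zero. What remains is a relation between the functionals \<open>hf\<close>
    of nonisomorphic projectives.\<close>
  show "\<forall>c. (\<forall>z. (\<Sum>i\<in>(I <+> J) <+> EL. c i * case_sum v D.hf i z) = 0) --> (\<forall>i\<in>(I <+> J) <+> EL. c i = 0)"
  proof (intro allI impI)
   fix c assume "\<forall>z. (\<Sum>i\<in>(I <+> J) <+> EL. c i * case_sum v D.hf i z) = 0"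
   hence z: "(\<Sum>i\<in>I <+> J. c (Inl i) * v i z) + (\<Sum>U\<in>EL. c (Inr U) * D.hf U z) = 0" for z
    using fin by (subst (asm) sum.Plus) auto
   have "(\<Sum>i\<in>I <+> J. c (Inl i) * w i Z) = 0" for Z
   proof (cases "Z\<in>MC")
    case True
    have "D.hf U (infl Z) = 0" if "U\<in>EL" for U
     using D.hd_zero[OF iE(3)[OF that] infl_MC[OF True]] D.homzD[OF D.homz_sd1[OF EE_homz[OF True] iE(2)[OF that]]] by (simp add: D.hf_def)
    moreover have "v i (infl Z) = w i Z" if "i\<in>I <+> J" for i using fun_cong[OF v(2)[OF that], of Z] True by (simp add: rs_def)
    ultimately show ?thesis using z[of "infl Z"] by simp
   next
    case False
    have "w i Z = 0" if "i\<in>I <+> J" for i using fun_cong[OF v(2)[OF that], of Z] False by (simp add: rs_def)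
    thus ?thesis by simp
   qed
   moreover define g where "g N = (SOME e. pres (mp1 N) (mp0 N) (mpf N) e N)" for N
   moreover have "pres (mp1 U) (mp0 U) (mpf U) (g U) U" if "U\<in>I" for U
    unfolding g_def by (rule someI_ex[OF mp_pres[OF iI(3)[OF that]]])
   ultimately have ci: "\<forall>i\<in>I <+> J. c (Inl i) = 0"
    using vf_family[of I mp1 mp0 mpf g J "%i. c (Inl i)"] fin rij(1) unfolding rigid_def w_def gv_def Ez_def by simp
   hence "(\<Sum>U\<in>EL. c (Inr U) * D.hf U z) = 0" for z using z by simp
   hence "\<forall>U\<in>EL. c (Inr U) = 0"
    using D.vf_independent(2)[of "{}" _ _ _ _ EL _ "%U. c (Inr U)"] fin iE(1,5) pE by (auto simp: D.noniso_def)
   thus "\<forall>i\<in>(I <+> J) <+> EL. c i = 0" using ci by auto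
  qed
  show "case_sum v D.hf ` ((I <+> J) <+> EL) <= fv.span (D.gv ` B)"
  proof
   fix y assume "y\<in>case_sum v D.hf ` ((I <+> J) <+> EL)"
   then obtain i where i: "i\<in>(I <+> J) <+> EL" "y = case_sum v D.hf i" by blast
   show "y\<in>fv.span (D.gv ` B)"
   proof (cases i)
    case (Inl a)
    hence "a\<in>I <+> J" using i(1) by blast
    thus ?thesis using v(1) i(2) Inl by simp
   next
    case (Inr U)
    hence U: "U\<in>EL" using i(1) by blast
    have "inj_on (%_. 0_U) (carrier zmod)" using zero_zmod by (auto simp: zero_module_def inj_on_def)
    moreover have "y = D.vf zmod U" using i(2) Inr D.vf_projective by (metis sum.case(2))
    moreover have "W\<in>\<B>" if "D.ind W" "D.sd W U" for W using that D.sd_trans[OF that(2) iE(2)[OF U]] unfolding \<B>_def by blast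
    ultimately show ?thesis by (rule sp[OF D.pres_projective[OF pE[OF U]]])
   qed
  qed
 qed
 hence "card I + card J + card EL <= card B"
  using fin card_image_le[OF \<open>finite B\<close>, of D.gv] by (simp add: card_Plus)
 hence n: "card B + card {} = num_summands K dalg (regular_module dalg)"
  using D.rigid_bound[OF rig] dalg_count[OF PR EL] num_regular(1)[OF PR] rij(2) by simp
 obtain T P' where T: "D.mrp T P'" "D.represents B (D.IS T)" "D.represents {} (D.IS P')" "D.Sm B T"
  by (rule D.rigid_mrp[OF rig n]) blast
 have mT: "D.mrp T zmod" by (rule D.mrp_zmod[OF T(1,3)])
 hence Tm: "T\<in>D.MC" and ET: "D.Ez T T" unfolding D.mrp_def by blast+
 note iT = D.IS_facts[OF T(2) Tm]
 have pd: "D.pd1 T" unfolding D.Ez_summands(2)[OF Tm]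
 proof (intro allI impI)
  fix U assume U: "D.ind U" "D.sd U T"
  then obtain V where V: "V\<in>B" "mod_iso dalg U V" using iT(4) by blast
  thus "D.pd1 U" using D.Ez_sd(2)[OF iT(3)[OF V(1)] D.indD(1)[OF U(1)] D.sd_iso[OF V(2) D.indD(1)[OF U(1)]]] EB by blast
 qed
 obtain R r where r: "reflects T R r" by (rule reflects_exists[OF Tm]) blast
 note rD = reflectsD[OF r Tm]
 \<comment> \<open>\<open>T\<close> is generated by the members of \<open>B\<close>; after
   reflection, a map from such a member factors through a summand of \<open>M\<close>.\<close>
 have gR: "gen {M} R" unfolding gen_def
 proof (intro allI impI)
  fix V assume V: "sbm V R" and im: "\<forall>U\<in>{M}. \<forall>h\<in>mh U R. h ` U <= V"
  have "D.sbm V (infl R)"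
   by (rule right_module.right_submoduleI[OF D.MC_rm[OF infl_MC[OF rD(1)]]]) (use sbmD[OF V rD(1)] in auto)
  from hom_more(6)[OF rD(2) D.MC_rm[OF Tm] D.MC_rm[OF infl_MC[OF rD(1)]] this]
  have W: "D.sbm {x\<in>T. r x\<in>V} T" .
  have "h ` U <= {x\<in>T. r x\<in>V}" if U: "U\<in>B" and h: "h\<in>D.mh U T" for U h
  proof -
   obtain S s where s: "reflects U S s" by (rule reflects_exists[OF Bm[OF U]]) blast
   note sD = reflectsD[OF s Bm[OF U]]
   obtain k where k: "k\<in>mh S R" "\<forall>x\<in>U. k (s x) = r (h x)" using sD(6)[OF rD(1) hom_comp[OF h rD(2)]] by blast
   obtain i q where iq: "i\<in>mh S M" "q\<in>mh M S" "!!x. x\<in>S ==> q (i x) = x" using refB[OF U s] unfolding sd_def by blast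
   have kq: "(%x. k (q x)) ` M <= V" by (rule bspec[OF bspec[OF im singletonI] hom_comp[OF iq(2) k(1)]])
   have "k y\<in>V" if "y\<in>S" for y
    using subsetD[OF kq imageI[OF hom_closed[OF iq(1) that]]] iq(3)[OF that] by simp
   hence "r (h x)\<in>V" if "x\<in>U" for x using bspec[OF k(2) that] sD(3) imageI[OF that, of s] by metis
   thus ?thesis using D.hom_closed[OF h] by auto
  qed
  moreover have "D.gen B T" by (rule D.gen_of_surj[OF T(4) hom_id _ _ Tm]) (use Bm in auto)
  ultimately have "carrier T <= {x\<in>T. r x\<in>V}" using W unfolding D.gen_def by blast
  thus "carrier R <= V" unfolding rD(3)[symmetric] by blast
 qed
 \<comment> \<open>The cone of the minimal presentation of \<open>U\<close> is generated by
   \<open>T\<close>, so its reflection is generated by \<open>R\<close>; and \<open>U\<close> is a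
   summand of that reflection.\<close>
 have "gen {R} U" if U: "ind U" "sd U M" for U
 proof -
  note um = indD(1)[OF U(1)]
  obtain g where g: "pres (mp1 U) (mp0 U) (mpf U) g U" using mp_pres[OF um] by blast
  have "E0 (mp1 U) (mp0 U) (mpf U) M" using Ez_sd(1)[OF M um U(2) EM] unfolding Ez_def .
  then obtain C v where C: "(mp1 U, mp0 U, mpf U, U, C, v)\<in>\<C>" using lift[OF g _ U(2)] by blast
  then obtain B0 F c where c: "D.pres (infl (mp1 U)) B0 F c C" "!!R r. reflects C R r ==> sd U R"
   unfolding \<C>_def cone_def by blast
  have Cm: "C\<in>D.MC" by (rule D.presD(3)[OF c(1)])
  obtain S s where s: "reflects C S s" by (rule reflects_exists[OF Cm]) blast
  have "D.gen {T} C"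
  proof (rule D.gen_same_summands[OF Tm Cm])
   fix W assume W: "D.ind W" "D.sd W C"
   hence "W\<in>\<B>" using C unfolding \<B>_def by blast
   then obtain V where "V\<in>B" "mod_iso dalg W V" using B(3) by blast
   thus "D.sd W T" using iT(2) D.sd_trans[OF D.sd_iso[OF _ D.indD(1)[OF W(1)]]] by blast
  qed
  hence "gen {R} S" using Fac_reflects[OF Tm ET tilting_gen[OF mT pd] Cm r s] by simp
  thus ?thesis using gen_trans[OF _ gen_sd[OF c(2)[OF s]] _ reflectsD(1)[OF s Cm] um] rD(1) by simp
 qed
 hence "gen {R} M" using gen_summands[OF M] by blast
 hence "matches T M" using r gR unfolding matches_def by blast
 thus ?thesis using that mT pd by blast
qed

end

section \<open>Partially ordered sets of isomorphism classes\<close>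

definition quotient_order :: "'a set \<Rightarrow> ('a \<times> 'a) set \<Rightarrow> ('a \<Rightarrow> 'a \<Rightarrow> bool) \<Rightarrow> 'a set gorder" where
 "quotient_order C r l = (|carrier = C // r, eq = (=), le = (%S T. \<exists>x\<in>S. \<exists>y\<in>T. l x y)|)"

text \<open>A preorder \<open>l\<close> whose induced equivalence on \<open>C\<close> is
  \<open>r\<close>. Transitivity of \<open>l\<close> and its compatibility with \<open>r\<close> are
  required everywhere, so that the classes of \<open>r\<close> do not have to be shown to stay
  inside \<open>C\<close>.\<close>

definition order_kernel where
 "order_kernel C r l <-> (\<forall>x\<in>C. (x, x)\<in>r) & sym r & trans r & (\<forall>x y. (x, y)\<in>r --> l x y) &
   (\<forall>x y z. l x y --> l y z --> l x z) & (\<forall>x\<in>C. \<forall>y\<in>C. l x y --> l y x --> (x, y)\<in>r)"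

lemma order_kernel_le:
 assumes "order_kernel C r l" "x\<in>C" "y\<in>C"
 shows "r `` {x} \<sqsubseteq>\<^bsub>quotient_order C r l\<^esub> r `` {y} <-> l x y" "r `` {x} = r `` {y} <-> l x y & l y x"
proof -
 note a = assms(1)[unfolded order_kernel_def]
 show "r `` {x} \<sqsubseteq>\<^bsub>quotient_order C r l\<^esub> r `` {y} <-> l x y"
  unfolding quotient_order_def gorder.simps using a assms(2,3) by (meson Image_singleton_iff symD)
 show "r `` {x} = r `` {y} <-> l x y & l y x"
 proof
  assume "r `` {x} = r `` {y}"
  hence "(x, y)\<in>r" "(y, x)\<in>r" using a assms(2,3) by blast+
  thus "l x y & l y x" using a by blast
 next
  assume "l x y & l y x"
  hence "(x, y)\<in>r" "(y, x)\<in>r" using a assms(2,3) by blast+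
  thus "r `` {x} = r `` {y}" using a by (auto dest: transD)
 qed
qed

lemma quotient_order_poset:
 assumes "order_kernel C r l" shows "weak_partial_order (quotient_order C r l)"
proof -
 note a = order_kernel_le[OF assms]
 have c: "S\<in>carrier (quotient_order C r l) <-> (\<exists>x\<in>C. S = r `` {x})" for S
  by (auto simp: quotient_order_def quotient_def)
 have e: "S .=\<^bsub>quotient_order C r l\<^esub> T <-> S = T" for S T by (simp add: quotient_order_def)
 have t: "l x y ==> l y z ==> l x z" for x y z using assms unfolding order_kernel_def by blast
 have r: "x\<in>C ==> l x x" for x using assms unfolding order_kernel_def by blast
 show ?thesis
 proof unfold_locales
  fix S T U :: "'a set" let ?Q = "quotient_order C r l"
  show "S\<in>carrier ?Q ==> S \<sqsubseteq>\<^bsub>?Q\<^esub> S" using a(1) r unfolding c by blast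
  show "S \<sqsubseteq>\<^bsub>?Q\<^esub> T ==> T \<sqsubseteq>\<^bsub>?Q\<^esub> S ==> S\<in>carrier ?Q ==> T\<in>carrier ?Q ==> S .=\<^bsub>?Q\<^esub> T"
   unfolding c e using a by metis
  show "S \<sqsubseteq>\<^bsub>?Q\<^esub> T ==> T \<sqsubseteq>\<^bsub>?Q\<^esub> U ==> S\<in>carrier ?Q ==> T\<in>carrier ?Q ==> U\<in>carrier ?Q ==> S \<sqsubseteq>\<^bsub>?Q\<^esub> U"
   unfolding c using a(1) t by metis
 qed (auto simp: e)
qed

text \<open>A relation that is total on both sides and compatible with the orders in both directions
  is single valued and injective on classes, because the orders determine equality of
  classes.\<close>

lemma quotient_order_iso:
 assumes C: "order_kernel C r l" and D: "order_kernel D s m"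
  and t: "\<forall>x\<in>C. \<exists>y\<in>D. R x y" "\<forall>y\<in>D. \<exists>x\<in>C. R x y"
  and o: "!!x x' y y'. x\<in>C ==> x'\<in>C ==> y\<in>D ==> y'\<in>D ==> R x y ==> R x' y' ==> l x x' <-> m y y'"
 shows "poset_isomorphic (quotient_order C r l) (quotient_order D s m)"
proof -
 let ?L = "quotient_order C r l" and ?M = "quotient_order D s m"
 define f where "f S = s `` {SOME y. y\<in>D & (\<exists>x\<in>C. r `` {x} = S & R x y)}" for S
 note c = order_kernel_le[OF C] and d = order_kernel_le[OF D]
 have cl: "S\<in>carrier ?L <-> (\<exists>x\<in>C. S = r `` {x})" for S by (auto simp: quotient_order_def quotient_def)
 have cm: "S\<in>carrier ?M <-> (\<exists>x\<in>D. S = s `` {x})" for S by (auto simp: quotient_order_def quotient_def)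
 have f: "f (r `` {x}) = s `` {y}" if x: "x\<in>C" "y\<in>D" "R x y" for x y
 proof -
  have "\<exists>y. y\<in>D & (\<exists>x'\<in>C. r `` {x'} = r `` {x} & R x' y)" using x by blast
  from someI_ex[OF this] obtain x' where
   "(SOME y. y\<in>D & (\<exists>x'\<in>C. r `` {x'} = r `` {x} & R x' y))\<in>D" "x'\<in>C" "r `` {x'} = r `` {x}"
   "R x' (SOME y. y\<in>D & (\<exists>x'\<in>C. r `` {x'} = r `` {x} & R x' y))" by blast
  thus ?thesis unfolding f_def using c(2)[of x' x] d(2) o x by blast
 qed
 have ford: "S \<sqsubseteq>\<^bsub>?L\<^esub> T <-> f S \<sqsubseteq>\<^bsub>?M\<^esub> f T" "f S = f T <-> S = T" if S: "S\<in>carrier ?L" "T\<in>carrier ?L" for S T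
 proof -
  obtain x x' y y' where "x\<in>C" "S = r `` {x}" "x'\<in>C" "T = r `` {x'}" "y\<in>D" "R x y" "y'\<in>D" "R x' y'"
   using S t(1) unfolding cl by blast
  thus "S \<sqsubseteq>\<^bsub>?L\<^esub> T <-> f S \<sqsubseteq>\<^bsub>?M\<^esub> f T" "f S = f T <-> S = T" using f c d o by simp_all
 qed
 have "f ` carrier ?L = carrier ?M"
 proof (intro equalityI subsetI)
  fix T assume "T\<in>carrier ?M"
  then obtain y x where "y\<in>D" "T = s `` {y}" "x\<in>C" "R x y" using t(2) unfolding cm by blast
  thus "T\<in>f ` carrier ?L" using f cl by blast
 qed (use t(1) f in \<open>force simp: cl cm\<close>)
 hence bij: "bij_betw f (carrier ?L) (carrier ?M)" using ford(2) by (auto simp: bij_betw_def inj_on_def)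
 have i: "f (inv_into (carrier ?L) f T) = T" "inv_into (carrier ?L) f T\<in>carrier ?L" if "T\<in>carrier ?M" for T
  using bij_betw_inv_into_right[OF bij that] bij_betwE[OF bij_betw_inv_into[OF bij]] that by simp_all
 have "isotone ?M ?L (inv_into (carrier ?L) f)"
  by (rule isotoneI[OF quotient_order_poset[OF D] quotient_order_poset[OF C]]) (simp add: ford(1) i)
 moreover have "isotone ?L ?M f"
  by (rule isotoneI[OF quotient_order_poset[OF C] quotient_order_poset[OF D]]) (simp add: ford(1))
 ultimately show ?thesis unfolding poset_isomorphic_def using bij by blast
qed

context fdalg begin

lemma Fac_subset: "M\<in>MC ==> N\<in>MC ==> Fac K A M <= Fac K A N <-> gen {N} M"
 using Fac_iff gen_sd[OF sd_refl] gen_trans[of "{N}" M] by blast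

lemma iso_rel_props: "(M, N)\<in>iso_rel K A <-> M\<in>MC & N\<in>MC & mod_iso A M N" "sym (iso_rel K A)" "trans (iso_rel K A)"
 "(M, N)\<in>iso_rel K A ==> Fac K A M <= Fac K A N"
proof -
 show i: "(M, N)\<in>iso_rel K A <-> M\<in>MC & N\<in>MC & mod_iso A M N" for M N by (simp add: iso_rel_def)
 show "sym (iso_rel K A)" "trans (iso_rel K A)" using iso_sym mod_iso_trans[of A] by (fastforce simp: i sym_def trans_def)+
 show "(M, N)\<in>iso_rel K A ==> Fac K A M <= Fac K A N" using gen_sd[OF sd_iso] Fac_subset by (simp add: i)
qed

lemma order_kernel_tilting: "order_kernel {T. tilting K A T} (iso_rel K A) (%T T'. Fac K A T <= Fac K A T')"
 unfolding order_kernel_def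
proof (intro conjI ballI allI impI)
 fix T T' assume T: "T\<in>{T. tilting K A T}" "T'\<in>{T. tilting K A T}" and F: "Fac K A T <= Fac K A T'" "Fac K A T' <= Fac K A T"
 hence m: "mrp T zmod" "mrp T' zmod" by (auto simp: tilting_mrp)
 hence "T\<in>MC" "T'\<in>MC" by (auto simp: mrp_def)
 thus "(T, T')\<in>iso_rel K A" using F mrp_antisym(1)[OF m] by (simp add: Fac_subset iso_rel_props(1))
qed (use iso_rel_props mod_iso_refl in \<open>auto simp: tilting_mrp mrp_def\<close>)

lemma order_kernel_stau:
 "order_kernel {(M, P). support_tau_tilting K A M P} (pair_iso_rel K A) (%u v. Fac K A (fst u) <= Fac K A (fst v))"
 unfolding order_kernel_def
proof (intro conjI ballI allI impI)
 let ?r = "pair_iso_rel K A"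
 have p: "(u, v)\<in>?r <-> (fst u, fst v)\<in>iso_rel K A & (snd u, snd v)\<in>iso_rel K A" for u v
  by (auto simp: pair_iso_rel_def)
 show "sym ?r" "trans ?r" using iso_rel_props(2,3) unfolding sym_def trans_def p by blast+
 show "(u, v)\<in>?r ==> Fac K A (fst u) <= Fac K A (fst v)" for u v using iso_rel_props(4) p by blast
 fix u assume u: "u\<in>{(M, P). support_tau_tilting K A M P}"
 hence m: "mrp (fst u) (snd u)" by (auto simp: support_tau_tilting_mrp)
 hence mu: "fst u\<in>MC" "snd u\<in>MC" by (auto simp: mrp_def)
 thus "(u, u)\<in>?r" using mod_iso_refl by (auto simp: p iso_rel_props(1))
 fix v assume v: "v\<in>{(M, P). support_tau_tilting K A M P}" and F: "Fac K A (fst u) <= Fac K A (fst v)" "Fac K A (fst v) <= Fac K A (fst u)"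
 hence m': "mrp (fst v) (snd v)" by (auto simp: support_tau_tilting_mrp)
 hence "fst v\<in>MC" "snd v\<in>MC" by (auto simp: mrp_def)
 thus "(u, v)\<in>?r" using mrp_antisym[OF m m'] F mu by (auto simp: p iso_rel_props(1) Fac_subset)
qed auto

end

context dupl begin

lemma stau_iso_tilt: "poset_isomorphic (stau_tilt K A) (tilt K dalg)"
proof -
 have s: "stau_tilt K A = quotient_order {(M, P). support_tau_tilting K A M P} (pair_iso_rel K A) (%u v. Fac K A (fst u) <= Fac K A (fst v))"
  by (simp add: stau_tilt_def quotient_order_def split_beta)
 have t: "tilt K dalg = quotient_order {T. tilting K dalg T} (iso_rel K dalg) (%T T'. Fac K dalg T <= Fac K dalg T')"
  by (simp add: tilt_def quotient_order_def)
 show ?thesis unfolding s t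
 proof (rule quotient_order_iso[OF order_kernel_stau D.order_kernel_tilting])
  show "\<forall>x\<in>{(M, P). support_tau_tilting K A M P}. \<exists>T\<in>{T. tilting K dalg T}. matches T (fst x)"
   using pair_matches by (fastforce simp: support_tau_tilting_mrp D.tilting_mrp)
  show "\<forall>T\<in>{T. tilting K dalg T}. \<exists>x\<in>{(M, P). support_tau_tilting K A M P}. matches T (fst x)"
  proof
   fix T assume "T\<in>{T. tilting K dalg T}"
   then obtain M P where "mrp M P" "matches T M" using tilting_matches by (auto simp: D.tilting_mrp)
   thus "\<exists>x\<in>{(M, P). support_tau_tilting K A M P}. matches T (fst x)"
    by (intro bexI[of _ "(M, P)"]) (simp_all add: support_tau_tilting_mrp)
  qed
  fix x x' T T'
  assume "x\<in>{(M, P). support_tau_tilting K A M P}" "x'\<in>{(M, P). support_tau_tilting K A M P}"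
   and T: "T\<in>{T. tilting K dalg T}" "T'\<in>{T. tilting K dalg T}" and m: "matches T (fst x)" "matches T' (fst x')"
  hence M: "fst x\<in>MC" "fst x'\<in>MC" by (auto simp: support_tau_tilting_mrp mrp_def)
  have "D.mrp T zmod" "D.pd1 T" "D.mrp T' zmod" "D.pd1 T'" using T by (auto simp: D.tilting_mrp)
  moreover from this have "T\<in>D.MC" "T'\<in>D.MC" by (auto simp: D.mrp_def)
  ultimately show "Fac K A (fst x) <= Fac K A (fst x') <-> Fac K dalg T <= Fac K dalg T'"
   using matches_order[OF _ _ _ M(2,1) m(2,1)] M by (simp add: Fac_subset D.Fac_subset)
 qed
qed

end

theorem theorem1p1:
 fixes K :: "'k ring" and \<Lambda> :: "('k, 'a) module"
 assumes "algebraically_closed K"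
  and "fd_algebra K \<Lambda>"
 shows "poset_isomorphic (stau_tilt K \<Lambda>) (tilt K (duplicated_algebra K \<Lambda>))"
proof -
 have "field K" using assms(1) by (rule algebraically_closed.axioms(1))
 hence f: "fdalg K \<Lambda>" using assms(2) by (simp add: fdalg_def)
 interpret dupl K \<Lambda>
  by (intro dupl.intro f) (simp add: fdalg_def \<open>field K\<close> fdalg.fd_dalg[OF f])
 show ?thesis by (rule stau_iso_tilt)
qed

end
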